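(* Assume the setting described in the context (tail $V=V_{\mu(\delta)}$, functions $Q,Q_*,V_*,F,F_*$ with $\|Q-Q_*\|_{H^{2,h}(\Omega_h)}<\delta$, $\|F-F_*\|_{H_3^h}<\delta$, $\delta\in(0,\delta_0)\cap(0,\delta_1)$), let $R>0$ and let $\lambda\ge\lambda_1$, where $\lambda_1\ge\lambda_0$ is the number described in the context. Then there exists a unique minimizer $p_{\min,\lambda}\in\overline{B(R)}$ of $J_\lambda$ on $\overline{B(R)}$, and $$J'_\lambda(p_{\min,\lambda})(y-p_{\min,\lambda})\ge0\quad\text{for all }y\in\overline{B(R)}.$$ Moreover, there exists a sufficiently small number $\gamma_0=\gamma_0(\Omega_h,R,\|F_*\|_{H_3^h},\|V_*\|_{H^{2,h}(\Omega_h)},\underline{k},\overline{k},\lambda)\in(0,1)$ such that for every $\gamma\in(0,\gamma_0)$ and every starting point $p_0\in B(R)$, the sequence $p_n=P_{\overline{B}}\big(p_{n-1}-\gamma J'_\lambda(p_{n-1})\big)$, $n=1,2,\dots$, satisfies $$\|p_{\min,\lambda}-p_n\|_{H_2^h}\le\theta^n\|p_{\min,\lambda}-p_0\|_{H_2^h},\quad n=1,2,\dots,$$ for some $\theta=\theta(\Omega_h,R,\|F_*\|_{H_3^h},\|V_*\|_{H^{2,h}(\Omega_h)},\underline{k},\overline{k},\lambda,\gamma)\in(0,1)$ depending only on the listed parameters.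
   Context: Geometry and grid: $b,\xi,d>0$, $\Omega=\{|x|<b,|y|<b,-\xi<z<d\}$, $\Gamma=\{|x|<b,|y|<b,z=-\xi\}$; fixed grid step $h$, uniform grid $\{(x_j,y_s)\}_{j,s=1}^{N_h}\subset[-b,b]^2$; $\Omega_h=\{(x_j,y_s,z):z\in(-\xi,d)\}$. Semidiscrete functions are families $\{f(x_j,y_s,z)\}$ (possibly depending on $k\in[\underline{k},\overline{k}]\subset(0,\infty)$); complex valued functions are identified with pairs of real functions; Hilbert spaces are real. At interior grid points ($|x_j|,|y_s|<b$): $u^h_{xx}=(u(x_j-h,y_s,z)-2u(x_j,y_s,z)+u(x_j+h,y_s,z))/h^2$, $\partial^h_xu=(u(x_j+h,y_s,z)-u(x_j-h,y_s,z))/(2h)$, similarly in $y$; $\Delta^hu=u_{zz}+u^h_{xx}+u^h_{yy}$, $\nabla^hu=(\partial^h_xu,\partial^h_yu,u_z)$; difference operators are evaluated only at interior grid points, sums $\sum_{j,s}$ run over points where defined; $a\cdot b=\sum_ia_ib_i$ for complex vectors. Boundary conditions are imposed at grid points on $\partial\Omega$, $\Gamma$. Spaces: $\|f\|^2_{H^{n,h}(\Omega_h)}=\sum_{j,s}\sum_{r=0}^nh^2\int_{-\xi}^d|\partial_z^rf|^2dz$; $\|f\|^2_{H^h_n}=\int_{\underline{k}}^{\overline{k}}\|f(\cdot,k)\|^2_{H^{n,h}(\Omega_h)}dk$. $H_0^{2,h}(\Omega_h)$: $f\in H^{2,h}(\Omega_h)$, $f=0$ on $\partial\Omega$ (grid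 points on the boundary of $[-b,b]^2$ and $z=-\xi,d$), $f_z=0$ at $z=-\xi$; $H^h_{0,2}$: $f\in H^h_2$ with these conditions for each $k$. $B(R)=\{r\in H^h_{0,2}:\|r\|_{H_2^h}<R\}$; $P_{\overline{B}}:H^h_{0,2}\to\overline{B(R)}$ is the orthogonal projection onto the closed ball. $J'_\lambda$ is the Fréchet derivative (an element of $H^h_{0,2}$), $J'_\lambda(p)(r)$ its action on $r$. Weight $\varphi_\lambda(z)=e^{-2\lambda z}$; $\lambda_0>1$ is a number (depending only on $\xi,d,h$) such that $\sum_{j,s}h^2\int|\Delta^hu|^2\varphi_\lambda\ge C\sum_{j,s}h^2\int(|u_{zz}|^2+\lambda|u_z|^2+\lambda^3|u|^2)\varphi_\lambda$ for $\lambda\ge\lambda_0$, $u\in H_0^{2,h}(\Omega_h)$. Tail: $Q,Q_*\in H^{2,h}(\Omega_h)$ with $Q=\psi_0,Q_z=\psi_1$ on $\Gamma$, $Q=0$ on $\partial\Omega\setminus\Gamma$, and the same for $Q_*$ with noiseless $\psi_{0*},\psi_{1*}$; $V_*\in H^{2,h}(\Omega_h)$ solves $\Delta^hV_*=0$ with $V_*=\psi_{0*},\partial_zV_*=\psi_{1*}$ on $\Gamma$, $V_*=0$ on $\partial\Omega\setminus\Gamma$; $\delta_0\in(0,e^{-2(d+\xi)\lambda_0})$, $\mu(\delta)=\ln(\delta^{-1/(2(d+\xi))})$, $W_\mu$ the unique minimizer over $H_0^{2,h}(\Omega_h)$ of $e^{2\mu d}\sum_{j,s}h^2\int_{-\xi}^d|\Delta^hW+\Delta^hQ|^2\varphi_\mu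 dz$, and $V_{\mu(\delta)}=W_{\mu(\delta)}+Q$. Operator with tail $V$: $L^h(q)=\Delta^hq+2k(\nabla^hV-\int_k^{\overline{k}}\nabla^hq(\kappa)d\kappa)\cdot(k\nabla^h(q+V)-\int_k^{\overline{k}}\nabla^hq(\kappa)d\kappa)+2i(kq_z+V_z-\int_k^{\overline{k}}q_z(\kappa)d\kappa)$. $F,F_*\in H_3^h$ with $F=\phi_0,F_z=\phi_1$ on $\Gamma$, $F=0$ on $\partial\Omega\setminus\Gamma$, and likewise $F_*$ with noiseless $\phi_{0*},\phi_{1*}$, for all $k$. $J_\lambda(p)=e^{2\lambda d}\sum_{j,s}h^2\int_{\underline{k}}^{\overline{k}}\int_{-\xi}^d|L^h(p+F)|^2\varphi_\lambda dzd\kappa$ with $V=V_{\mu(\delta)}$. $\lambda_1=\lambda_1(\Omega_h,R,\|F_*\|_{H_3^h},\|V_*\|_{H^{2,h}},\underline{k},\overline{k})\ge\lambda_0$ is a number such that for all $\lambda\ge\lambda_1$ the functional $J_\lambda$ is strictly convex on $\overline{B(R)}$ in the sense $J_\lambda(p+r)-J_\lambda(p)-J'_\lambda(p)(r)\ge C_1\|r\|^2_{H_2^h}$ for all $p,p+r\in\overline{B(R)}$, with $C_1>0$ depending on the same parameters; $\delta_1\in(0,e^{-2(d+\xi)\lambda_1})$. *)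

theory Defs
  imports "HOL-Analysis.Analysis"
begin

text \<open>Grid indices j,s range over 0..N; x_j = -b + j*h with N*h = 2b, so the indices
 0 and N are the grid points on the boundary of [-b,b]^2.  Omega = (-xi,d) in z.
 The k-interval is [kl,ku].\<close>

record geom =
  gb  :: real
  gN  :: nat
  gh  :: real
  gxi :: real
  gd  :: real
  gkl :: real
  gku :: real

definition geom_ok :: "geom \<Rightarrow> bool" where
  "geom_ok G \<longleftrightarrow> 0 < gb G \<and> 0 < gxi G \<and> 0 < gd G \<and> 2 \<le> gN G \<and>
     gh G = 2 * gb G / real (gN G) \<and> 0 < gkl G \<and> gkl G < gku G"

definition in_grid :: "geom \<Rightarrow> nat \<Rightarrow> nat \<Rightarrow> bool" where
  "in_grid G j s \<longleftrightarrow> j \<le> gN G \<and> s \<le> gN G"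

definition interior_pt :: "geom \<Rightarrow> nat \<Rightarrow> nat \<Rightarrow> bool" where
  "interior_pt G j s \<longleftrightarrow> 0 < j \<and> j < gN G \<and> 0 < s \<and> s < gN G"

definition lateral_pt :: "geom \<Rightarrow> nat \<Rightarrow> nat \<Rightarrow> bool" where
  "lateral_pt G j s \<longleftrightarrow> in_grid G j s \<and> \<not> interior_pt G j s"

primrec zd :: "real \<Rightarrow> real \<Rightarrow> (real \<Rightarrow> complex) \<Rightarrow> nat \<Rightarrow> real \<Rightarrow> complex" where
  "zd a c g 0 = g"
| "zd a c g (Suc r) = (\<lambda>z. vector_derivative (zd a c g r) (at z within {a..c}))"

definition wd :: "real \<Rightarrow> real \<Rightarrow> (real \<Rightarrow> complex) \<Rightarrow> (real \<Rightarrow> complex) \<Rightarrow> bool" where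
  "wd a c g g' \<longleftrightarrow> set_integrable lborel {a..c} g' \<and>
     set_integrable lborel {a..c} (\<lambda>t. (cmod (g' t))\<^sup>2) \<and>
     (\<forall>z\<in>{a..c}. g z = g a + (LINT t:{a..z}|lborel. g' t))"

definition Hn1 :: "real \<Rightarrow> real \<Rightarrow> nat \<Rightarrow> (real \<Rightarrow> complex) \<Rightarrow> bool" where
  "Hn1 a c n g \<longleftrightarrow> set_integrable lborel {a..c} g \<and>
     set_integrable lborel {a..c} (\<lambda>t. (cmod (g t))\<^sup>2) \<and>
     (\<forall>r<n. wd a c (zd a c g r) (zd a c g (Suc r)))"

type_synonym sd = "nat \<Rightarrow> nat \<Rightarrow> real \<Rightarrow> complex"
type_synonym sdk = "real \<Rightarrow> nat \<Rightarrow> nat \<Rightarrow> real \<Rightarrow> complex"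

definition dz :: "geom \<Rightarrow> (real \<Rightarrow> complex) \<Rightarrow> nat \<Rightarrow> real \<Rightarrow> complex" where
  "dz G g r = zd (- gxi G) (gd G) g r"

definition Hsd :: "geom \<Rightarrow> nat \<Rightarrow> sd \<Rightarrow> bool" where
  "Hsd G n u \<longleftrightarrow> (\<forall>j\<le>gN G. \<forall>s\<le>gN G. Hn1 (- gxi G) (gd G) n (u j s))"

definition sd_nsq :: "geom \<Rightarrow> nat \<Rightarrow> sd \<Rightarrow> real" where
  "sd_nsq G n u = (\<Sum>j\<le>gN G. \<Sum>s\<le>gN G. \<Sum>r\<le>n.
      (gh G)\<^sup>2 * (LINT z:{- gxi G..gd G}|lborel. (cmod (dz G (u j s) r z))\<^sup>2))"

definition sd_norm :: "geom \<Rightarrow> nat \<Rightarrow> sd \<Rightarrow> real" where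
  "sd_norm G n u = sqrt (sd_nsq G n u)"

definition sd_sub :: "sd \<Rightarrow> sd \<Rightarrow> sd" where
  "sd_sub u v = (\<lambda>j s z. u j s z - v j s z)"

definition sd_add :: "sd \<Rightarrow> sd \<Rightarrow> sd" where
  "sd_add u v = (\<lambda>j s z. u j s z + v j s z)"

definition bc0 :: "geom \<Rightarrow> sd \<Rightarrow> bool" where
  "bc0 G u \<longleftrightarrow>
     (\<forall>j s. lateral_pt G j s \<longrightarrow> (\<forall>z\<in>{- gxi G..gd G}. u j s z = 0)) \<and>
     (\<forall>j\<le>gN G. \<forall>s\<le>gN G. u j s (- gxi G) = 0 \<and> u j s (gd G) = 0 \<and>
        dz G (u j s) 1 (- gxi G) = 0)"

definition H0sd :: "geom \<Rightarrow> sd \<Rightarrow> bool" where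
  "H0sd G u \<longleftrightarrow> Hsd G 2 u \<and> bc0 G u"

text \<open>H^h_n: k-dependent semidiscrete functions, L^2 in k with values in H^{n,h}(Omega_h)
  (jointly measurable z-derivatives).\<close>
definition Hk :: "geom \<Rightarrow> nat \<Rightarrow> sdk \<Rightarrow> bool" where
  "Hk G n f \<longleftrightarrow> (\<forall>k\<in>{gkl G..gku G}. Hsd G n (f k)) \<and>
     (\<forall>j\<le>gN G. \<forall>s\<le>gN G. \<forall>r\<le>n.
        (\<lambda>(k, z). indicator ({gkl G..gku G} \<times> {- gxi G..gd G}) (k, z) *\<^sub>R dz G (f k j s) r z)
          \<in> borel_measurable borel) \<and>
     set_integrable lborel {gkl G..gku G} (\<lambda>k. sd_nsq G n (f k))"

definition Hk0 :: "geom \<Rightarrow> sdk \<Rightarrow> bool" where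
  "Hk0 G f \<longleftrightarrow> Hk G 2 f \<and> (\<forall>k\<in>{gkl G..gku G}. bc0 G (f k))"

definition hk_norm :: "geom \<Rightarrow> nat \<Rightarrow> sdk \<Rightarrow> real" where
  "hk_norm G n f = sqrt (LINT k:{gkl G..gku G}|lborel. sd_nsq G n (f k))"

text \<open>inner product of the real Hilbert space H^h_2 (complex = pairs of reals)\<close>
definition hk_inner :: "geom \<Rightarrow> sdk \<Rightarrow> sdk \<Rightarrow> real" where
  "hk_inner G f g = (LINT k:{gkl G..gku G}|lborel. (\<Sum>j\<le>gN G. \<Sum>s\<le>gN G. \<Sum>r\<le>(2::nat).
      (gh G)\<^sup>2 * (LINT z:{- gxi G..gd G}|lborel.
          Re (dz G (f k j s) r z * cnj (dz G (g k j s) r z)))))"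

definition hk_sub :: "sdk \<Rightarrow> sdk \<Rightarrow> sdk" where
  "hk_sub f g = (\<lambda>k j s z. f k j s z - g k j s z)"

definition hk_add :: "sdk \<Rightarrow> sdk \<Rightarrow> sdk" where
  "hk_add f g = (\<lambda>k j s z. f k j s z + g k j s z)"

definition dxx :: "geom \<Rightarrow> sd \<Rightarrow> sd" where
  "dxx G u = (\<lambda>j s z. (u (j - 1) s z - 2 * u j s z + u (j + 1) s z) / complex_of_real ((gh G)\<^sup>2))"

definition dyy :: "geom \<Rightarrow> sd \<Rightarrow> sd" where
  "dyy G u = (\<lambda>j s z. (u j (s - 1) z - 2 * u j s z + u j (s + 1) z) / complex_of_real ((gh G)\<^sup>2))"

definition dx :: "geom \<Rightarrow> sd \<Rightarrow> sd" where
  "dx G u = (\<lambda>j s z. (u (j + 1) s z - u (j - 1) s z) / complex_of_real (2 * gh G))"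

definition dy :: "geom \<Rightarrow> sd \<Rightarrow> sd" where
  "dy G u = (\<lambda>j s z. (u j (s + 1) z - u j (s - 1) z) / complex_of_real (2 * gh G))"

definition lap :: "geom \<Rightarrow> sd \<Rightarrow> sd" where
  "lap G u = (\<lambda>j s z. dz G (u j s) 2 z + dxx G u j s z + dyy G u j s z)"

definition gradc :: "geom \<Rightarrow> sd \<Rightarrow> nat \<Rightarrow> sd" where
  "gradc G u i = (if i = 0 then dx G u else if i = 1 then dy G u else (\<lambda>j s z. dz G (u j s) 1 z))"

definition intgrad :: "geom \<Rightarrow> sdk \<Rightarrow> nat \<Rightarrow> real \<Rightarrow> sd" where
  "intgrad G q i k = (\<lambda>j s z. LINT \<kappa>:{k..gku G}|lborel. gradc G (q \<kappa>) i j s z)"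

definition Lop :: "geom \<Rightarrow> sd \<Rightarrow> sdk \<Rightarrow> real \<Rightarrow> sd" where
  "Lop G V q k = (\<lambda>j s z.
     lap G (q k) j s z
     + 2 * complex_of_real k *
         (\<Sum>i<3. (gradc G V i j s z - intgrad G q i k j s z) *
                  (complex_of_real k * gradc G (sd_add (q k) V) i j s z - intgrad G q i k j s z))
     + 2 * \<i> * (complex_of_real k * dz G (q k j s) 1 z + dz G (V j s) 1 z - intgrad G q 2 k j s z))"

definition Jfun :: "geom \<Rightarrow> real \<Rightarrow> sd \<Rightarrow> sdk \<Rightarrow> sdk \<Rightarrow> real" where
  "Jfun G lam V F p = exp (2 * lam * gd G) *
     (\<Sum>j\<in>{1..<gN G}. \<Sum>s\<in>{1..<gN G}. (gh G)\<^sup>2 *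
        (LINT \<kappa>:{gkl G..gku G}|lborel. LINT z:{- gxi G..gd G}|lborel.
            (cmod (Lop G V (hk_add p F) \<kappa> j s z))\<^sup>2 * exp (- 2 * lam * z)))"

text \<open>g is the Frechet derivative (Riesz representative in H^h_{0,2}) of J at p\<close>
definition is_frechet :: "geom \<Rightarrow> (sdk \<Rightarrow> real) \<Rightarrow> sdk \<Rightarrow> sdk \<Rightarrow> bool" where
  "is_frechet G J p g \<longleftrightarrow> Hk0 G g \<and>
     (\<forall>\<epsilon>>0. \<exists>\<eta>>0. \<forall>r. Hk0 G r \<and> hk_norm G 2 r < \<eta> \<longrightarrow>
        \<bar>J (hk_add p r) - J p - hk_inner G g r\<bar> \<le> \<epsilon> * hk_norm G 2 r)"

definition Jder :: "geom \<Rightarrow> (sdk \<Rightarrow> real) \<Rightarrow> sdk \<Rightarrow> sdk" where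
  "Jder G J p = (SOME g. is_frechet G J p g)"

definition cballH :: "geom \<Rightarrow> real \<Rightarrow> sdk set" where
  "cballH G R = {r. Hk0 G r \<and> hk_norm G 2 r \<le> R}"

definition ballH :: "geom \<Rightarrow> real \<Rightarrow> sdk set" where
  "ballH G R = {r. Hk0 G r \<and> hk_norm G 2 r < R}"

definition projB :: "geom \<Rightarrow> real \<Rightarrow> sdk \<Rightarrow> sdk" where
  "projB G R f = (SOME g. g \<in> cballH G R \<and>
      (\<forall>y\<in>cballH G R. hk_norm G 2 (hk_sub f g) \<le> hk_norm G 2 (hk_sub f y)))"

definition gd_iter :: "geom \<Rightarrow> real \<Rightarrow> (sdk \<Rightarrow> real) \<Rightarrow> real \<Rightarrow> sdk \<Rightarrow> nat \<Rightarrow> sdk" where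
  "gd_iter G R J \<gamma> p0 n =
     ((\<lambda>p. projB G R (\<lambda>k j s z. p k j s z - complex_of_real \<gamma> * Jder G J p k j s z)) ^^ n) p0"

definition Wfun :: "geom \<Rightarrow> real \<Rightarrow> sd \<Rightarrow> sd \<Rightarrow> real" where
  "Wfun G \<mu> Q W = exp (2 * \<mu> * gd G) *
     (\<Sum>j\<in>{1..<gN G}. \<Sum>s\<in>{1..<gN G}. (gh G)\<^sup>2 *
        (LINT z:{- gxi G..gd G}|lborel.
           (cmod (lap G W j s z + lap G Q j s z))\<^sup>2 * exp (- 2 * \<mu> * z)))"

definition Wmu :: "geom \<Rightarrow> sd \<Rightarrow> real \<Rightarrow> sd" where
  "Wmu G Q \<mu> = (SOME W. H0sd G W \<and> (\<forall>W'. H0sd G W' \<longrightarrow> Wfun G \<mu> Q W \<le> Wfun G \<mu> Q W'))"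

definition mu :: "geom \<Rightarrow> real \<Rightarrow> real" where
  "mu G \<delta> = ln (\<delta> powr (- 1 / (2 * (gd G + gxi G))))"

definition Vmu :: "geom \<Rightarrow> sd \<Rightarrow> real \<Rightarrow> sd" where
  "Vmu G Q \<delta> = sd_add (Wmu G Q (mu G \<delta>)) Q"

definition carleman :: "geom \<Rightarrow> real \<Rightarrow> bool" where
  "carleman G lamz \<longleftrightarrow> 1 < lamz \<and> (\<exists>C>0. \<forall>lam\<ge>lamz. \<forall>u. H0sd G u \<longrightarrow>
     (\<Sum>j\<in>{1..<gN G}. \<Sum>s\<in>{1..<gN G}. (gh G)\<^sup>2 *
        (LINT z:{- gxi G..gd G}|lborel. (cmod (lap G u j s z))\<^sup>2 * exp (- 2 * lam * z)))
     \<ge> C * (\<Sum>j\<in>{1..<gN G}. \<Sum>s\<in>{1..<gN G}. (gh G)\<^sup>2 *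
        (LINT z:{- gxi G..gd G}|lborel.
           ((cmod (dz G (u j s) 2 z))\<^sup>2 + lam * (cmod (dz G (u j s) 1 z))\<^sup>2
             + lam ^ 3 * (cmod (u j s z))\<^sup>2) * exp (- 2 * lam * z))))"

definition tail_bc :: "geom \<Rightarrow> sd \<Rightarrow> (nat \<Rightarrow> nat \<Rightarrow> complex) \<Rightarrow> (nat \<Rightarrow> nat \<Rightarrow> complex) \<Rightarrow> bool" where
  "tail_bc G u psi0 psi1 \<longleftrightarrow>
     (\<forall>j s. interior_pt G j s \<longrightarrow> u j s (- gxi G) = psi0 j s \<and> dz G (u j s) 1 (- gxi G) = psi1 j s) \<and>
     (\<forall>j s. lateral_pt G j s \<longrightarrow> (\<forall>z\<in>{- gxi G..gd G}. u j s z = 0)) \<and>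
     (\<forall>j\<le>gN G. \<forall>s\<le>gN G. u j s (gd G) = 0)"

record tdata =
  d_delta :: real
  d_psi0 :: "nat \<Rightarrow> nat \<Rightarrow> complex"
  d_psi1 :: "nat \<Rightarrow> nat \<Rightarrow> complex"
  d_psi0s :: "nat \<Rightarrow> nat \<Rightarrow> complex"
  d_psi1s :: "nat \<Rightarrow> nat \<Rightarrow> complex"
  d_Q :: sd
  d_Qs :: sd
  d_Vs :: sd
  d_phi0 :: "real \<Rightarrow> nat \<Rightarrow> nat \<Rightarrow> complex"
  d_phi1 :: "real \<Rightarrow> nat \<Rightarrow> nat \<Rightarrow> complex"
  d_phi0s :: "real \<Rightarrow> nat \<Rightarrow> nat \<Rightarrow> complex"
  d_phi1s :: "real \<Rightarrow> nat \<Rightarrow> nat \<Rightarrow> complex"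
  d_F :: sdk
  d_Fs :: sdk

definition admissible :: "geom \<Rightarrow> real \<Rightarrow> real \<Rightarrow> real \<Rightarrow> real \<Rightarrow> tdata \<Rightarrow> bool" where
  "admissible G dz0 dz1 nF nV D \<longleftrightarrow>
     0 < d_delta D \<and> d_delta D < dz0 \<and> d_delta D < dz1 \<and>
     Hsd G 2 (d_Q D) \<and> tail_bc G (d_Q D) (d_psi0 D) (d_psi1 D) \<and>
     Hsd G 2 (d_Qs D) \<and> tail_bc G (d_Qs D) (d_psi0s D) (d_psi1s D) \<and>
     Hsd G 2 (d_Vs D) \<and> tail_bc G (d_Vs D) (d_psi0s D) (d_psi1s D) \<and>
     (\<forall>j s. interior_pt G j s \<longrightarrow>
        (AE z in lborel. z \<in> {- gxi G<..<gd G} \<longrightarrow> lap G (d_Vs D) j s z = 0)) \<and>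
     Hk G 3 (d_F D) \<and> (\<forall>k\<in>{gkl G..gku G}. tail_bc G (d_F D k) (d_phi0 D k) (d_phi1 D k)) \<and>
     Hk G 3 (d_Fs D) \<and> (\<forall>k\<in>{gkl G..gku G}. tail_bc G (d_Fs D k) (d_phi0s D k) (d_phi1s D k)) \<and>
     sd_norm G 2 (sd_sub (d_Q D) (d_Qs D)) < d_delta D \<and>
     hk_norm G 3 (hk_sub (d_F D) (d_Fs D)) < d_delta D \<and>
     hk_norm G 3 (d_Fs D) = nF \<and> sd_norm G 2 (d_Vs D) = nV"

definition Jd :: "geom \<Rightarrow> real \<Rightarrow> tdata \<Rightarrow> sdk \<Rightarrow> real" where
  "Jd G lam D = Jfun G lam (Vmu G (d_Q D) (d_delta D)) (d_F D)"

end

theory Submission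
  imports Defs "HOL-Library.Function_Algebras"
begin

text \<open>The operator $L^h$ is quadratic in $q$ and bounded into a weighted $L^2$ space, so $J_\<lambda>$
is a quartic polynomial: it is Frechet differentiable, and its gradient is Lipschitz on every ball with a constant
depending only on bounds for the tail $V$ and for $F$. The tail is bounded uniformly in $\<delta>$ by comparing
$W_\<mu>$ with $V_* - Q_*$ and applying the Carleman estimate. Strong convexity with constant $C_1$ then makes
minimizing sequences Cauchy, which gives the minimizer, and makes the projected gradient step
a contraction: the squared distance to the minimizer is multiplied by at most
$1 - 4\<gamma>C_1 + \<gamma>^2M^2$, where $M$ is the Lipschitz constant.

Two analytic facts are needed on the way. By the Lebesgue differentiation theorem $\<partial>_z^2 f$, which is a pointwise classical
derivative, represents the weak derivative almost everywhere. The space $H^h_{0,2}$ is complete because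
$f$ is recovered from $f_{zz}$ by integrating twice from $z=-\<xi>$, so that completeness reduces to that of $L^2$.\<close>

section \<open>Differentiation of indefinite integrals\<close>

text \<open>What keeps the operator bounded is that no product of two gradients of q occurs. One
  factor of its nonlinear term is grad V minus the integral of grad q over
  [k, \<open>gku G\<close>], so every quadratic term contains such an integral. The slices q(k) are
  only square integrable in k, and grad q has no bound uniform in k; its k-integral has one, by the
  Sobolev inequality in z and Cauchy-Schwarz in k. The gradient of V is bounded because V does not
  depend on k. The rate \<theta> is fixed before the data are known, so V needs a bound uniform in
  \<delta>, although the functional defining it changes with \<delta>. The gradient, the projection
  and the tail minimizer are given by choice operators, and functions are not identified. Existence
  must therefore precede every use of them, and equality of points becomes vanishing norm of the
  difference. The factor 4 in the contraction constant arises as follows: the convexity inequality,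
  added for (p, q) and (q, p), makes the gradient monotone with constant 2 C_1, and the expansion of
  the square doubles this again.\<close>

text \<open>Where the increments of the indefinite integral stay away from $f$, Vitali's theorem selects disjoint tagged
intervals on which they do; by Henstock's lemma these have arbitrarily small total length.\<close>

lemma negligible_increment_defect:
  fixes f :: "real \<Rightarrow> 'b::euclidean_space"
  assumes f: "f integrable_on {a..b}" and e: "0 < e"
  shows "negligible {z\<in>{a..b}. \<forall>d>0. \<exists>u v. a \<le> u \<and> u < v \<and> v \<le> b \<and> (z = u \<or> z = v) \<and> v - u < d
           \<and> norm ((v - u) *\<^sub>R f z - integral {u..v} f) \<ge> e * (v - u)}" (is "negligible ?S")
  unfolding negligible_outer_le
proof (intro allI impI)
  fix \<epsilon> :: real assume \<epsilon>: "0 < \<epsilon>"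
  have fc: "f integrable_on cbox a b" using f by simp
  \<comment> \<open>The tolerance is e * \<epsilon> because each offending interval has a defect of
    at least e times its length; a total defect below e * \<epsilon> then bounds the total length by
    \<epsilon>.\<close>
  obtain \<gamma> where \<gamma>: "gauge \<gamma>"
    and H: "\<And>p. \<lbrakk>p tagged_partial_division_of (cbox a b); \<gamma> fine p\<rbrakk> \<Longrightarrow>
             sum (\<lambda>(x,k). norm(measure lborel k *\<^sub>R f x - integral k f)) p < e * \<epsilon>"
    by (rule Henstock_lemma[OF fc mult_pos_pos[OF e \<epsilon>]]) (rule that)
  \<comment> \<open>Tagged intervals that are fine for the gauge and have a large defect. They are
    rewritten as balls with centre \<open>m\<close> and radius \<open>r\<close>, the form in which
    Vitali's covering theorem is applied.\<close>
  define K where "K = {(z,u,v). a \<le> u \<and> u < v \<and> v \<le> b \<and> (z = u \<or> z = v) \<and> {u..v} \<subseteq> \<gamma> z \<and>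
      norm ((v - u) *\<^sub>R f z - integral {u..v} f) \<ge> e * (v - u)}"
  define m where "m = (\<lambda>(z::real,u::real,v::real). (u+v)/2)"
  define r where "r = (\<lambda>(z::real,u::real,v::real). (v-u)/2)"
  have cb: "cball (m i) (r i) = {fst (snd i)..snd (snd i)}" if "i \<in> K" for i
    using that unfolding K_def m_def r_def by (auto simp: cball_eq_atLeastAtMost field_simps)
  have r0: "0 < r i" if "i \<in> K" for i using that unfolding K_def r_def by auto
  have cover: "\<exists>i. i \<in> K \<and> x \<in> cball (m i) (r i) \<and> r i < d" if x: "x \<in> ?S" and d: "0 < d" for x d
  proof -
    have "open (\<gamma> x)" "x \<in> \<gamma> x" using \<gamma> by (auto simp: gauge_def)
    then obtain d' where d': "d' > 0" "ball x d' \<subseteq> \<gamma> x" using open_contains_ball by blast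
    obtain u v where uv: "a \<le> u" "u < v" "v \<le> b" "x = u \<or> x = v" "v - u < min d d'"
       "norm ((v - u) *\<^sub>R f x - integral {u..v} f) \<ge> e * (v - u)"
      using x d d'(1) by (auto dest!: spec[of _ "min d d'"])
    have "{u..v} \<subseteq> ball x d'" using uv by (auto simp: dist_real_def)
    then have "(x,u,v) \<in> K" using uv d' unfolding K_def by auto
    moreover have "x \<in> cball (m (x,u,v)) (r (x,u,v))" using cb[OF calculation] uv by auto
    moreover have "r (x,u,v) < d" using uv unfolding r_def by auto
    ultimately show ?thesis by blast
  qed
  obtain C where C: "countable C" "C \<subseteq> K"
     "pairwise (\<lambda>i j. disjnt (cball (m i) (r i)) (cball (m j) (r j))) C"
     "negligible(?S - (\<Union>i \<in> C. cball (m i) (r i)))"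
    by (rule Vitali_covering_theorem_cballs[of K r ?S m, OF r0 cover])
  let ?U = "\<Union>i \<in> C. cball (m i) (r i)"
  have fin: "measure lebesgue (\<Union>i \<in> C'. cball (m i) (r i)) \<le> \<epsilon>" if C': "C' \<subseteq> C" "finite C'" for C'
  proof -
    define J where "J = (\<lambda>i::real\<times>real\<times>real. {fst (snd i)..snd (snd i)})"
    have J: "cball (m i) (r i) = J i" if "i \<in> C" for i using cb that C(2) unfolding J_def by blast
    have disj: "J i \<inter> J j = {}" if "i \<in> C'" "j \<in> C'" "i \<noteq> j" for i j
      using C(3) that C'(1) J unfolding pairwise_def disjnt_def by (metis subsetD)
    \<comment> \<open>Distinct indices in \<open>C'\<close> have disjoint nonempty intervals, hence
      different tagged intervals, so that the sum over indices is Henstock's sum over the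
      division.\<close>
    have inj: "inj_on (\<lambda>i. (fst i, J i)) C'"
    proof (rule inj_onI)
      fix i j assume ij: "i \<in> C'" "j \<in> C'" "(fst i, J i) = (fst j, J j)"
      have "m i \<in> J i" using J[of i] r0[of i] C(2) C'(1) ij(1) by (metis centre_in_cball less_imp_le subsetD)
      then show "i = j" using disj[OF ij(1,2)] ij(3) by auto
    qed
    let ?p = "(\<lambda>i. (fst i, J i)) ` C'"
    have K': "i \<in> K" if "i \<in> C'" for i using that C C' by blast
    have p: "?p tagged_partial_division_of cbox a b"
      unfolding tagged_partial_division_of_def
    proof (intro conjI allI impI)
      show "finite ?p" using C' by auto
    next
      fix x k assume "(x,k) \<in> ?p"
      then obtain u v where uv: "(x,u,v) \<in> C'" "k = {u..v}" unfolding J_def by force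
      with K'[OF uv(1)] show "x \<in> k" "k \<subseteq> cbox a b" "\<exists>a b. k = cbox a b"
        unfolding K_def by (auto simp flip: interval_cbox)
    next
      fix x k x' k' assume "(x,k) \<in> ?p \<and> (x',k') \<in> ?p \<and> (x,k) \<noteq> (x',k')"
      then obtain i j where i: "i \<in> C'" "x = fst i" "k = J i" and j: "j \<in> C'" "x' = fst j" "k' = J j"
        and ne: "(x,k) \<noteq> (x',k')" by blast
      then have "i \<noteq> j" by auto
      from disj[OF i(1) j(1) this] show "interior k \<inter> interior k' = {}"
        using interior_subset[of k] interior_subset[of k'] unfolding i j by blast
    qed
    have fine: "\<gamma> fine ?p"
      unfolding fine_def
    proof (intro ballI, clarsimp)
      fix x u v w assume "(x, u, v) \<in> C'" and w: "w \<in> J (x, u, v)"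
      then have "{u..v} \<subseteq> \<gamma> x" using K'[of "(x,u,v)"] unfolding K_def by simp
      then show "w \<in> \<gamma> x" using w unfolding J_def by auto
    qed
    have Kd: "fst (snd i) \<le> snd (snd i)"
        "e * (snd (snd i) - fst (snd i)) \<le> norm ((snd (snd i) - fst (snd i)) *\<^sub>R f (fst i) - integral (J i) f)"
      if "i \<in> C'" for i
      using K'[OF that] unfolding K_def J_def by auto
    have lm: "J i \<in> lmeasurable" for i unfolding J_def by simp
    have "e * measure lebesgue (\<Union>i \<in> C'. J i) \<le> e * (\<Sum>i\<in>C'. measure lebesgue (J i))"
      using lm e by (intro mult_left_mono measure_UNION_le[OF C'(2)]) (auto intro: fmeasurableD)
    also have "\<dots> = (\<Sum>i\<in>C'. e * (snd (snd i) - fst (snd i)))"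
      unfolding sum_distrib_left J_def
      by (intro sum.cong refl) (use Kd in \<open>auto\<close>)
    also have "\<dots> \<le> (\<Sum>i\<in>C'. norm(measure lborel (J i) *\<^sub>R f (fst i) - integral (J i) f))"
      by (intro sum_mono) (use Kd in \<open>auto simp: J_def\<close>)
    also have "\<dots> = sum (\<lambda>(x,k). norm(measure lborel k *\<^sub>R f x - integral k f)) ?p"
      by (subst sum.reindex[OF inj]) simp
    also have "\<dots> < e * \<epsilon>" using H[OF p fine] .
    finally have "measure lebesgue (\<Union>i \<in> C'. J i) \<le> \<epsilon>" using e by simp
    moreover have "(\<Union>i \<in> C'. J i) = (\<Union>i \<in> C'. cball (m i) (r i))" using J C'(1) by (intro SUP_cong) auto
    ultimately show ?thesis by simp
  qed
  have U: "?U \<in> lmeasurable \<and> measure lebesgue ?U \<le> \<epsilon>"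
    using fmeasurable_UN_bound[OF C(1), of "\<lambda>i. cball (m i) (r i)" lebesgue \<epsilon>]
      measure_UN_bound[OF C(1), of "\<lambda>i. cball (m i) (r i)" lebesgue \<epsilon>] fin
    by (simp add: lmeasurable_cball)
  have N: "?S - ?U \<in> lmeasurable" "measure lebesgue (?S - ?U) = 0"
    using C(4) negligible_iff_measure by auto
  show "\<exists>T. ?S \<subseteq> T \<and> T \<in> lmeasurable \<and> measure lebesgue T \<le> \<epsilon>"
  proof (intro exI conjI)
    show "?S \<subseteq> ?U \<union> (?S - ?U)" by blast
    show "?U \<union> (?S - ?U) \<in> lmeasurable" using U N by (intro fmeasurable.Un) auto
    have "measure lebesgue (?U \<union> (?S - ?U)) \<le> measure lebesgue ?U + measure lebesgue (?S - ?U)"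
      using U N by (intro measure_Un_le) auto
    then show "measure lebesgue (?U \<union> (?S - ?U)) \<le> \<epsilon>" using U N by simp
  qed
qed

text \<open>The exceptional set is the union of the defect sets for the thresholds 1/(n+1). Since a
  tag may be either endpoint, increments to the left and to the right of z are both controlled off
  this set.\<close>

theorem indefinite_integral_has_vector_derivative_ae:
  fixes f :: "real \<Rightarrow> 'b::euclidean_space"
  assumes f: "f integrable_on {a..b}"
  shows "\<exists>N. negligible N \<and> (\<forall>z\<in>{a..b} - N.
           ((\<lambda>x. integral {a..x} f) has_vector_derivative f z) (at z within {a..b}))"
proof -
  define S where "S = (\<lambda>e::real. {z\<in>{a..b}. \<forall>d>0. \<exists>u v. a \<le> u \<and> u < v \<and> v \<le> b \<and> (z = u \<or> z = v) \<and> v - u < d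
           \<and> norm ((v - u) *\<^sub>R f z - integral {u..v} f) \<ge> e * (v - u)})"
  define N where "N = (\<Union>n. S (inverse (real (Suc n))))"
  have "negligible N"
    unfolding N_def S_def by (rule negligible_Union_nat, rule negligible_increment_defect[OF f]) simp
  moreover have "((\<lambda>x. integral {a..x} f) has_vector_derivative f z) (at z within {a..b})"
    if z: "z \<in> {a..b} - N" for z
    unfolding has_vector_derivative_def has_derivative_within_alt
  proof (intro conjI allI impI)
    show "bounded_linear (\<lambda>x. x *\<^sub>R f z)" by (rule bounded_linear_scaleR_left)
    fix e :: real assume e: "0 < e"
    then obtain n where n: "inverse (real (Suc n)) < e" using reals_Archimedean by blast
    from z have "z \<notin> S (inverse (real (Suc n)))" unfolding N_def by blast
    then obtain d where d: "0 < d" and D: "\<And>u v. a \<le> u \<Longrightarrow> u < v \<Longrightarrow> v \<le> b \<Longrightarrow> z = u \<or> z = v \<Longrightarrow> v - u < d \<Longrightarrow>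
        norm ((v - u) *\<^sub>R f z - integral {u..v} f) < inverse (real (Suc n)) * (v - u)"
      using z unfolding S_def mem_Collect_eq by (simp add: not_le) (metis not_less)
    have i: "integral {a..v} f - integral {a..u} f = integral {u..v} f" if "a \<le> u" "u \<le> v" "v \<le> b" for u v
      using Henstock_Kurzweil_Integration.integral_combine[OF that(1,2) integrable_subinterval_real[OF f]] that
      by (auto simp: algebra_simps)
    have B: "norm ((v - u) *\<^sub>R f z - integral {u..v} f) \<le> e * (v - u)"
      if "a \<le> u" "u < v" "v \<le> b" "z = u \<or> z = v" "v - u < d" for u v
      using D[OF that] mult_right_mono[of "inverse (real (Suc n))" e "v - u"] n that by linarith
    show "\<exists>d>0. \<forall>y\<in>{a..b}. norm (y - z) < d \<longrightarrow>
      norm (integral {a..y} f - integral {a..z} f - (y - z) *\<^sub>R f z) \<le> e * norm (y - z)"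
    proof (intro exI[of _ d] conjI ballI impI d)
      fix y assume y: "y \<in> {a..b}" "norm (y - z) < d"
      consider "y = z" | "y < z" | "z < y" by linarith
      then show "norm (integral {a..y} f - integral {a..z} f - (y - z) *\<^sub>R f z) \<le> e * norm (y - z)"
      proof cases
        case 2
        have "integral {a..y} f - integral {a..z} f - (y - z) *\<^sub>R f z = (z - y) *\<^sub>R f z - integral {y..z} f"
          using i[of y z] y z 2 by (auto simp: algebra_simps)
        then show ?thesis using B[of y z] y z 2 by auto
      next
        case 3
        have "integral {a..y} f - integral {a..z} f - (y - z) *\<^sub>R f z = - ((y - z) *\<^sub>R f z - integral {z..y} f)"
          using i[of z y] y z 3 by (auto simp: algebra_simps)
        then show ?thesis using B[of z y] y z 3 by (simp add: norm_minus_commute)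
      qed simp
    qed
  qed
  ultimately show ?thesis by blast
qed

section \<open>Semi-inner product spaces\<close>

text \<open>With pointwise operations all functions of a given type form one vector space, and the
  spaces below become subspaces of it in the sense of \<open>subspace\<close>.\<close>

instantiation "fun" :: (type, real_vector) real_vector
begin
definition scaleR_fun_def: "scaleR c f = (\<lambda>x. c *\<^sub>R f x)"
instance
  by standard (auto simp: scaleR_fun_def fun_eq_iff algebra_simps)
end

text \<open>Discriminant criterion: evaluate at the vertex t = -u/w. For w = 0 the polynomial is
  affine and takes the value -1 at t = -(a+1)/(2u) unless u = 0; this degenerate case occurs, as the
  form may vanish on nonzero vectors.\<close>

lemma quadratic_nonneg_imp:
  fixes a u w :: real
  assumes q: "\<And>t. 0 \<le> a + 2 * t * u + t\<^sup>2 * w" and w: "0 \<le> w"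
  shows "u\<^sup>2 \<le> a * w"
proof (cases "w = 0")
  case True
  have "u = 0"
  proof (rule ccontr)
    assume n: "u \<noteq> 0"
    have "2 * (- (a + 1) / (2 * u)) * u = - (a + 1)" using n by simp
    then show False using q[of "- (a + 1) / (2 * u)"] True by simp
  qed
  then show ?thesis using True by simp
next
  case False
  then have p: "0 < w" using w by simp
  have "0 \<le> w * (a + 2 * (- u / w) * u + (- u / w)\<^sup>2 * w)" 
    using q[of "- u / w"] w by (intro mult_nonneg_nonneg)
  also have "\<dots> = a * w - u\<^sup>2"
    using p by (simp add: field_simps power2_eq_square)
  finally show ?thesis by simp
qed

text \<open>The form is only semidefinite, since functions are not identified up to null sets.\<close>

locale semi_inner =
  fixes S :: "'a::real_vector set" and ip :: "'a \<Rightarrow> 'a \<Rightarrow> real"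
  assumes sub: "subspace S"
    and ip_add: "\<And>x y z. x \<in> S \<Longrightarrow> y \<in> S \<Longrightarrow> z \<in> S \<Longrightarrow> ip (x + y) z = ip x z + ip y z"
    and ip_scale: "\<And>c x z. x \<in> S \<Longrightarrow> z \<in> S \<Longrightarrow> ip (c *\<^sub>R x) z = c * ip x z"
    and ip_sym: "\<And>x y. x \<in> S \<Longrightarrow> y \<in> S \<Longrightarrow> ip x y = ip y x"
    and ip_nonneg: "\<And>x. x \<in> S \<Longrightarrow> 0 \<le> ip x x"
begin

definition nrm :: "'a \<Rightarrow> real" where "nrm x = sqrt (ip x x)"

lemma S_add: "x \<in> S \<Longrightarrow> y \<in> S \<Longrightarrow> x + y \<in> S"
  and S_scale: "x \<in> S \<Longrightarrow> c *\<^sub>R x \<in> S"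
  and S_diff: "x \<in> S \<Longrightarrow> y \<in> S \<Longrightarrow> x - y \<in> S"
  and S_zero: "0 \<in> S"
  using sub by (auto intro: subspace_add subspace_scale subspace_diff subspace_0)

lemmas S_intros = S_add S_scale S_diff S_zero

lemma ip_add': "x \<in> S \<Longrightarrow> y \<in> S \<Longrightarrow> z \<in> S \<Longrightarrow> ip z (x + y) = ip z x + ip z y"
  using ip_add[of x y z] ip_sym S_add by metis

lemma ip_scale': "x \<in> S \<Longrightarrow> z \<in> S \<Longrightarrow> ip z (c *\<^sub>R x) = c * ip z x"
  using ip_scale[of x z c] ip_sym S_scale by metis

lemma ip_diff: "x \<in> S \<Longrightarrow> y \<in> S \<Longrightarrow> z \<in> S \<Longrightarrow> ip (x - y) z = ip x z - ip y z"
  using ip_add[of x "(-1) *\<^sub>R y" z] ip_scale[of y z "-1"] S_scale[of y "-1"] by simp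

lemma ip_diff': "x \<in> S \<Longrightarrow> y \<in> S \<Longrightarrow> z \<in> S \<Longrightarrow> ip z (x - y) = ip z x - ip z y"
  using ip_diff[of x y z] ip_sym S_diff by metis

lemmas ip_simps = ip_add ip_add' ip_scale ip_scale' ip_diff ip_diff'

lemma nrm_sq: "x \<in> S \<Longrightarrow> (nrm x)\<^sup>2 = ip x x"
  unfolding nrm_def using ip_nonneg by simp

lemma nrm_ge0: "x \<in> S \<Longrightarrow> 0 \<le> nrm x"
  unfolding nrm_def using ip_nonneg by simp

lemma nrm_sq_add:
  assumes x: "x \<in> S" and y: "y \<in> S"
  shows "(nrm (x + y))\<^sup>2 = (nrm x)\<^sup>2 + 2 * ip x y + (nrm y)\<^sup>2"
  using x y by (simp add: nrm_sq S_add ip_add ip_add' ip_sym[OF y x])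

lemma nrm_scale: "x \<in> S \<Longrightarrow> nrm (c *\<^sub>R x) = \<bar>c\<bar> * nrm x"
  unfolding nrm_def by (simp add: ip_simps S_intros real_sqrt_mult flip: mult.assoc power2_eq_square)

lemma nrm_zero: "nrm 0 = 0"
  using nrm_scale[OF S_zero, of 0] by simp

lemma nrm_minus: "x \<in> S \<Longrightarrow> y \<in> S \<Longrightarrow> nrm (x - y) = nrm (y - x)"
  using nrm_scale[OF S_diff, of x y "-1"] by simp

lemma cauchy_schwarz:
  assumes x: "x \<in> S" and y: "y \<in> S"
  shows "\<bar>ip x y\<bar> \<le> nrm x * nrm y"
proof -
  have q: "0 \<le> ip x x + 2 * t * ip x y + t\<^sup>2 * ip y y" for t
  proof -
    have ty: "t *\<^sub>R y \<in> S" using y by (rule S_scale)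
    have "0 \<le> ip (x + t *\<^sub>R y) (x + t *\<^sub>R y)" using S_add[OF x ty] by (rule ip_nonneg)
    also have "\<dots> = ip x x + 2 * t * ip x y + t\<^sup>2 * ip y y"
      using x y ty by (simp add: ip_simps S_add power2_eq_square ip_sym[OF y x] distrib_left distrib_right)
    finally show ?thesis .
  qed
  have "(ip x y)\<^sup>2 \<le> ip x x * ip y y"
    using quadratic_nonneg_imp[OF q ip_nonneg[OF y]] by simp
  then have "\<bar>ip x y\<bar>\<^sup>2 \<le> (nrm x * nrm y)\<^sup>2"
    using x y by (simp add: power_mult_distrib nrm_sq)
  then show ?thesis using x y nrm_ge0 by (meson mult_nonneg_nonneg power2_le_imp_le)
qed

lemma ip_le: "x \<in> S \<Longrightarrow> y \<in> S \<Longrightarrow> ip x y \<le> nrm x * nrm y"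
  using cauchy_schwarz[of x y] by simp

lemma nrm_add: assumes x: "x \<in> S" and y: "y \<in> S" shows "nrm (x + y) \<le> nrm x + nrm y"
proof -
  have "(nrm (x + y))\<^sup>2 = ip x x + 2 * ip x y + ip y y"
    using x y ip_sym[of x y] by (simp add: nrm_sq ip_simps S_intros)
  also have "\<dots> \<le> (nrm x + nrm y)\<^sup>2"
    using ip_le[OF x y] x y by (simp add: power2_sum nrm_sq)
  finally show ?thesis using x y nrm_ge0 by (meson add_nonneg_nonneg power2_le_imp_le)
qed

lemma nrm_diff: "x \<in> S \<Longrightarrow> y \<in> S \<Longrightarrow> nrm (x - y) \<le> nrm x + nrm y"
  using nrm_add[of x "(-1) *\<^sub>R y"] nrm_scale[of y "-1"] S_scale[of y "-1"] by simp

lemma nrm_tri: "x \<in> S \<Longrightarrow> y \<in> S \<Longrightarrow> z \<in> S \<Longrightarrow> nrm (x - z) \<le> nrm (x - y) + nrm (y - z)"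
  using nrm_add[of "x - y" "y - z"] S_diff by simp

lemma parallelogram:
  assumes "x \<in> S" "y \<in> S"
  shows "(nrm ((1/2) *\<^sub>R (x + y)))\<^sup>2 = (nrm x)\<^sup>2 / 2 + (nrm y)\<^sup>2 / 2 - (nrm (x - y))\<^sup>2 / 4"
  using assms ip_sym[of x y] by (simp add: nrm_sq ip_simps S_intros field_simps)

lemma nrm_close: "x \<in> S \<Longrightarrow> y \<in> S \<Longrightarrow> \<bar>nrm x - nrm y\<bar> \<le> nrm (x - y)"
  using nrm_tri[of x y 0] nrm_tri[of y x 0] nrm_minus[of x y] S_zero by simp

text \<open>Equality in the quotient by the vectors of norm zero, without forming the quotient.
  Almost-everywhere identities enter the abstract theory in this form.\<close>

definition eqv :: "'a \<Rightarrow> 'a \<Rightarrow> bool" where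
  "eqv x y \<longleftrightarrow> x \<in> S \<and> y \<in> S \<and> nrm (x - y) = 0"

lemma eqv_refl: "x \<in> S \<Longrightarrow> eqv x x"
  unfolding eqv_def by (simp add: nrm_zero)

lemma eqv_sym: "eqv x y \<Longrightarrow> eqv y x"
  unfolding eqv_def using nrm_minus by metis

lemma eqv_trans [trans]: "eqv x y \<Longrightarrow> eqv y z \<Longrightarrow> eqv x z"
  unfolding eqv_def using nrm_tri[of x y z] nrm_ge0[of "x - z"] S_diff by force

lemma eqv_add: assumes "eqv x y" "eqv x' y'" shows "eqv (x + x') (y + y')"
proof -
  have "nrm ((x + x') - (y + y')) \<le> nrm (x - y) + nrm (x' - y')"
    using nrm_add[of "x - y" "x' - y'"] assms S_diff unfolding eqv_def by (simp add: algebra_simps)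
  then show ?thesis using assms nrm_ge0[of "(x + x') - (y + y')"] unfolding eqv_def by (simp add: S_intros)
qed

lemma eqv_scale: "eqv x y \<Longrightarrow> eqv (c *\<^sub>R x) (c *\<^sub>R y)"
  unfolding eqv_def using nrm_scale[of "x - y" c] by (auto simp: S_intros algebra_simps)

lemma ip_eqv: assumes "eqv x y" "z \<in> S" shows "ip x z = ip y z" "ip z x = ip z y"
proof -
  have "\<bar>ip (x - y) z\<bar> \<le> 0" using cauchy_schwarz[of "x - y" z] assms unfolding eqv_def by (simp add: S_intros)
  then show 1: "ip x z = ip y z" using assms unfolding eqv_def by (simp add: ip_simps)
  then show "ip z x = ip z y" using assms ip_sym unfolding eqv_def by metis
qed

lemma nrm_eqv: "eqv x y \<Longrightarrow> nrm x = nrm y"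
  unfolding eqv_def using nrm_close[of x y] by simp

lemma eqv_diff_nrm: "eqv x (y + z) \<Longrightarrow> y \<in> S \<Longrightarrow> z \<in> S \<Longrightarrow> nrm (x - y) = nrm z"
  using nrm_eqv[of "x - y" "z"] unfolding eqv_def by (simp add: S_intros algebra_simps)

lemma convergent_nrm:
  assumes "\<And>n. f n \<in> S" "l \<in> S" "(\<lambda>n. nrm (f n - l)) \<longlonglongrightarrow> 0"
  shows "(\<lambda>n. nrm (f n)) \<longlonglongrightarrow> nrm l"
proof -
  have "\<forall>\<^sub>F n in sequentially. norm (nrm (f n) - nrm l) \<le> nrm (f n - l)"
    using nrm_close[OF assms(1,2)] by simp
  then have "(\<lambda>n. nrm (f n) - nrm l) \<longlonglongrightarrow> 0"
    using assms(3) by (rule Lim_null_comparison)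
  then show ?thesis by (rule LIM_zero_cancel)
qed

end

section \<open>Complete spaces: minimizers and Riesz representation\<close>

locale semi_hilbert = semi_inner +
  assumes complete: "\<And>f. (\<And>n::nat. f n \<in> S) \<Longrightarrow>
      (\<And>e::real. 0 < e \<Longrightarrow> \<exists>N. \<forall>m\<ge>N. \<forall>n\<ge>N. nrm (f m - f n) < e) \<Longrightarrow>
      \<exists>l\<in>S. (\<lambda>n. nrm (f n - l)) \<longlonglongrightarrow> 0"
begin

text \<open>The common source of the Riesz representation, the projection onto a ball, the tail
  minimizer and the minimizer of J. Closedness and continuity are sequential, and convexity is asked
  only at midpoints, which is what the parallelogram law delivers.\<close>

lemma exists_minimizer:
  fixes J :: "'a \<Rightarrow> real"
  assumes C: "C \<subseteq> S" "C \<noteq> {}"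
    and cl: "\<And>f l. (\<And>n::nat. f n \<in> C) \<Longrightarrow> l \<in> S \<Longrightarrow> (\<lambda>n. nrm (f n - l)) \<longlonglongrightarrow> 0 \<Longrightarrow> l \<in> C"
    and mid: "\<And>x y. x \<in> C \<Longrightarrow> y \<in> C \<Longrightarrow> (1/2) *\<^sub>R (x + y) \<in> C"
    and c: "0 < c"
    and conv: "\<And>x y. x \<in> C \<Longrightarrow> y \<in> C \<Longrightarrow> J ((1/2) *\<^sub>R (x + y)) \<le> J x / 2 + J y / 2 - c * (nrm (x - y))\<^sup>2"
    and bd: "\<And>x. x \<in> C \<Longrightarrow> B \<le> J x"
    and cont: "\<And>f l. (\<And>n::nat. f n \<in> C) \<Longrightarrow> l \<in> C \<Longrightarrow> (\<lambda>n. nrm (f n - l)) \<longlonglongrightarrow> 0 \<Longrightarrow> (\<lambda>n. J (f n)) \<longlonglongrightarrow> J l"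
  shows "\<exists>x\<in>C. \<forall>y\<in>C. J x \<le> J y"
proof -
  define I where "I = Inf (J ` C)"
  have bb: "bdd_below (J ` C)" using bd by (auto intro!: bdd_belowI)
  have I: "I \<le> J x" if "x \<in> C" for x unfolding I_def using bb that by (simp add: cInf_lower)
  have "\<exists>x\<in>C. J x < I + inverse (real (Suc n))" for n
    using cInf_lessD[of "J ` C" "I + inverse (real (Suc n))"] C(2) unfolding I_def by auto
  then obtain f where f: "\<And>n. f n \<in> C" "\<And>n. J (f n) < I + inverse (real (Suc n))" by metis
  have fS: "f n \<in> S" for n using f C by auto
  \<comment> \<open>The midpoint of f m and f n has value at least the infimum I, while both ends
    lie below I + 1/(N+1); the convexity gap bounds their distance.\<close>
  have d: "c * (nrm (f m - f n))\<^sup>2 \<le> inverse (real (Suc N))" if "m \<ge> N" "n \<ge> N" for m n N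
  proof -
    have "inverse (real (Suc m)) \<le> inverse (real (Suc N))" "inverse (real (Suc n)) \<le> inverse (real (Suc N))"
      using that by (auto intro!: le_imp_inverse_le)
    then show ?thesis
      using conv[OF f(1)[of m] f(1)[of n]] I[OF mid[OF f(1)[of m] f(1)[of n]]] f(2)[of m] f(2)[of n]
      by linarith
  qed
  have "\<exists>l\<in>S. (\<lambda>n. nrm (f n - l)) \<longlonglongrightarrow> 0"
  proof (rule complete[OF fS])
    fix e :: real assume e: "0 < e"
    then have "0 < c * e\<^sup>2" using c by simp
    then obtain N where N: "inverse (real (Suc N)) < c * e\<^sup>2" using reals_Archimedean by blast
    have "nrm (f m - f n) < e" if "m \<ge> N" "n \<ge> N" for m n
    proof -
      have "c * (nrm (f m - f n))\<^sup>2 < c * e\<^sup>2" using d[OF that] N by simp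
      then show ?thesis using c e by (simp add: power2_less_imp_less)
    qed
    then show "\<exists>N. \<forall>m\<ge>N. \<forall>n\<ge>N. nrm (f m - f n) < e" by blast
  qed
  then obtain l where l: "l \<in> S" "(\<lambda>n. nrm (f n - l)) \<longlonglongrightarrow> 0" by blast
  have lC: "l \<in> C" using cl[OF f(1) l] .
  have "J l \<le> I"
  proof (rule LIMSEQ_le[OF cont[OF f(1) lC l(2)]])
    show "(\<lambda>n. I + inverse (real (Suc n))) \<longlonglongrightarrow> I"
      using tendsto_add[OF tendsto_const LIMSEQ_inverse_real_of_nat, of I] by simp
    show "\<exists>N. \<forall>n\<ge>N. J (f n) \<le> I + inverse (real (Suc n))" using f(2) by (auto intro: less_imp_le)
  qed
  then show ?thesis using I lC by (meson order_trans)
qed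

text \<open>The representing vector minimizes (nrm x)^2/2 - \<phi> x. Half of the parallelogram law
  gives the convexity constant 1/8, and completing the square with the bound on \<phi> gives the
  lower bound -K^2/2.\<close>

lemma riesz:
  assumes add: "\<And>x y. x \<in> S \<Longrightarrow> y \<in> S \<Longrightarrow> \<phi> (x + y) = \<phi> x + \<phi> y"
    and scale: "\<And>a x. x \<in> S \<Longrightarrow> \<phi> (a *\<^sub>R x) = a * \<phi> x"
    and bd: "\<And>x. x \<in> S \<Longrightarrow> \<bar>\<phi> x\<bar> \<le> K * nrm x"
  shows "\<exists>g\<in>S. \<forall>x\<in>S. ip g x = \<phi> x"
proof -
  have df: "\<phi> (x - y) = \<phi> x - \<phi> y" if "x \<in> S" "y \<in> S" for x y
    using add[of x "(-1) *\<^sub>R y"] scale[of y "-1"] that S_scale[of y "-1"] by simp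
  define J where "J x = (nrm x)\<^sup>2 / 2 - \<phi> x" for x
  have "\<exists>x\<in>S. \<forall>y\<in>S. J x \<le> J y"
  proof (rule exists_minimizer[where c = "1/8" and B = "- K\<^sup>2/2"])
    fix x y assume xy: "x \<in> S" "y \<in> S"
    show "J ((1/2) *\<^sub>R (x + y)) \<le> J x / 2 + J y / 2 - 1/8 * (nrm (x - y))\<^sup>2"
      unfolding J_def using xy parallelogram[OF xy] by (simp add: scale add S_intros field_simps)
  next
    fix x assume x: "x \<in> S"
    have "0 \<le> (nrm x - K)\<^sup>2" by simp
    then show "- K\<^sup>2/2 \<le> J x"
      unfolding J_def using bd[OF x] by (simp add: power2_diff field_simps)
  next
    fix f l assume f: "\<And>n::nat. f n \<in> S" "l \<in> S" "(\<lambda>n. nrm (f n - l)) \<longlonglongrightarrow> 0"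
    have "\<forall>\<^sub>F n in sequentially. norm (\<phi> (f n) - \<phi> l) \<le> K * nrm (f n - l)"
      using bd[OF S_diff[OF f(1) f(2)]] df[OF f(1) f(2)] by simp
    moreover have "(\<lambda>n. K * nrm (f n - l)) \<longlonglongrightarrow> 0"
      using tendsto_mult_left[OF f(3), of K] by simp
    ultimately have "(\<lambda>n. \<phi> (f n) - \<phi> l) \<longlonglongrightarrow> 0"
      by (rule Lim_null_comparison)
    then have "(\<lambda>n. \<phi> (f n)) \<longlonglongrightarrow> \<phi> l" by (rule LIM_zero_cancel)
    then show "(\<lambda>n. J (f n)) \<longlonglongrightarrow> J l"
      unfolding J_def by (intro tendsto_intros convergent_nrm f) auto
  qed (use S_intros in auto)
  then obtain g where g: "g \<in> S" "\<And>y. y \<in> S \<Longrightarrow> J g \<le> J y" by blast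
  have "ip g x = \<phi> x" if x: "x \<in> S" for x
  proof (rule ccontr)
    assume ne: "ip g x \<noteq> \<phi> x"
    have q: "0 \<le> t * (ip g x - \<phi> x) + t\<^sup>2 * (ip x x / 2)" for t
    proof -
      have "J (g + t *\<^sub>R x) = J g + t * (ip g x - \<phi> x) + t\<^sup>2 * (ip x x / 2)"
        unfolding J_def using nrm_sq_add[OF g(1) S_scale[OF x], of t] g(1) x
        by (simp add: add scale S_scale ip_scale' nrm_scale nrm_sq power_mult_distrib field_simps)
      then show ?thesis using g(2)[of "g + t *\<^sub>R x"] g(1) x by (simp add: S_intros)
    qed
    \<comment> \<open>A polynomial in t without constant term that is nonnegative for all t has
      vanishing linear coefficient; this is the discriminant criterion with a = 0.\<close>
    have "((ip g x - \<phi> x) / 2)\<^sup>2 \<le> 0 * (ip x x / 2)"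
      using q ip_nonneg[OF x] by (intro quadratic_nonneg_imp) auto
    then show False using ne by simp
  qed
  then show ?thesis using g(1) by blast
qed

section \<open>Closed balls and nearest-point projection\<close>

definition cb :: "real \<Rightarrow> 'a set" where "cb R = {x \<in> S. nrm x \<le> R}"

lemma cb_closed:
  assumes f: "\<And>n::nat. f n \<in> cb R" and l: "l \<in> S" "(\<lambda>n. nrm (f n - l)) \<longlonglongrightarrow> 0"
  shows "l \<in> cb R"
proof -
  have "(\<lambda>n. nrm (f n)) \<longlonglongrightarrow> nrm l" using f l unfolding cb_def by (intro convergent_nrm) auto
  then have "nrm l \<le> R" by (rule LIMSEQ_le_const2) (use f in \<open>auto simp: cb_def\<close>)
  then show ?thesis using l unfolding cb_def by simp
qed

lemma cb_convex:
  assumes x: "x \<in> cb R" and y: "y \<in> cb R" and t: "0 \<le> t" "t \<le> 1"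
  shows "x + t *\<^sub>R (y - x) \<in> cb R"
proof -
  have S: "x \<in> S" "y \<in> S" and n: "nrm x \<le> R" "nrm y \<le> R" using x y unfolding cb_def by auto
  have "nrm (x + t *\<^sub>R (y - x)) = nrm ((1 - t) *\<^sub>R x + t *\<^sub>R y)" by (simp add: algebra_simps)
  also have "\<dots> \<le> (1 - t) * nrm x + t * nrm y"
    using nrm_add[of "(1 - t) *\<^sub>R x" "t *\<^sub>R y"] S t by (simp add: S_intros nrm_scale)
  also have "\<dots> \<le> (1 - t) * R + t * R" using n t by (intro add_mono mult_left_mono) auto
  finally have "nrm (x + t *\<^sub>R (y - x)) \<le> R" by (simp add: algebra_simps)
  then show ?thesis using S unfolding cb_def by (simp add: S_intros)
qed

lemma cb_mid: "x \<in> cb R \<Longrightarrow> y \<in> cb R \<Longrightarrow> (1/2) *\<^sub>R (x + y) \<in> cb R"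
proof -
  have "x + (1/2) *\<^sub>R (y - x) = (1/2) *\<^sub>R (x + y)"
  proof -
    have "x + y = (x + x) + (y - x)" by simp
    then show ?thesis by (simp only: scaleR_right_distrib[of _ "x + x"] scaleR_half_double)
  qed
  then show "x \<in> cb R \<Longrightarrow> y \<in> cb R \<Longrightarrow> (1/2) *\<^sub>R (x + y) \<in> cb R"
    using cb_convex[of x R y "1/2"] by simp
qed

text \<open>A relation rather than a function, because nearest points are determined only up to
  \<open>eqv\<close>; any selection made by a choice operator satisfies it.\<close>

definition is_proj :: "real \<Rightarrow> 'a \<Rightarrow> 'a \<Rightarrow> bool" where
  "is_proj R f g \<longleftrightarrow> g \<in> cb R \<and> (\<forall>y\<in>cb R. nrm (f - g) \<le> nrm (f - y))"

text \<open>For the squared distance to f, the parallelogram law is strong midpoint convexity with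
  constant exactly 1/4.\<close>

lemma exists_proj:
  assumes R: "0 \<le> R" and f: "f \<in> S"
  shows "\<exists>g. is_proj R f g"
proof -
  have "\<exists>x\<in>cb R. \<forall>y\<in>cb R. (nrm (f - x))\<^sup>2 \<le> (nrm (f - y))\<^sup>2"
  proof (rule exists_minimizer[where c = "1/4" and B = 0])
    show "cb R \<noteq> {}" using R S_zero nrm_zero unfolding cb_def by auto
    fix x y assume "x \<in> cb R" "y \<in> cb R"
    then have xy: "x \<in> S" "y \<in> S" unfolding cb_def by auto
    have e: "(1/2) *\<^sub>R ((f - x) + (f - y)) = f - (1/2) *\<^sub>R (x + y)"
    proof -
      have "(f - x) + (f - y) = (f + f) - (x + y)" by (simp add: algebra_simps)
      then show ?thesis by (simp only: scaleR_right_diff_distrib scaleR_half_double)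
    qed
    show "(nrm (f - (1/2) *\<^sub>R (x + y)))\<^sup>2 \<le> (nrm (f - x))\<^sup>2 / 2 + (nrm (f - y))\<^sup>2 / 2 - 1/4 * (nrm (x - y))\<^sup>2"
      using parallelogram[of "f - x" "f - y"] xy f nrm_minus[of x y] unfolding e by (simp add: S_intros)
  next
    fix h l assume h: "\<And>n::nat. h n \<in> cb R" "l \<in> cb R" "(\<lambda>n. nrm (h n - l)) \<longlonglongrightarrow> 0"
    then have hS: "h n \<in> S" "l \<in> S" for n unfolding cb_def by auto
    have "(\<lambda>n. nrm (f - h n)) \<longlonglongrightarrow> nrm (f - l)"
    proof (rule convergent_nrm)
      show "(\<lambda>n. nrm (f - h n - (f - l))) \<longlonglongrightarrow> 0"
        using h(3) nrm_minus[OF hS] by simp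
    qed (use f hS S_intros in auto)
    then show "(\<lambda>n. (nrm (f - h n))\<^sup>2) \<longlonglongrightarrow> (nrm (f - l))\<^sup>2" by (intro tendsto_intros)
  next
    show "cb R \<subseteq> S" unfolding cb_def by auto
    show "l \<in> cb R" if "\<And>n::nat. h n \<in> cb R" "l \<in> S" "(\<lambda>n. nrm (h n - l)) \<longlonglongrightarrow> 0" for h l
      using cb_closed[OF that] .
  qed (simp_all add: cb_mid)
  then obtain g where g: "g \<in> cb R" "\<And>y. y \<in> cb R \<Longrightarrow> (nrm (f - g))\<^sup>2 \<le> (nrm (f - y))\<^sup>2" by blast
  have "is_proj R f g"
    unfolding is_proj_def
  proof (intro conjI ballI g)
    fix y assume y: "y \<in> cb R"
    then have "0 \<le> nrm (f - y)" using f unfolding cb_def by (auto intro!: nrm_ge0 S_intros)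
    then show "nrm (f - g) \<le> nrm (f - y)" using g(2)[OF y] power2_le_imp_le by blast
  qed
  then show ?thesis by blast
qed

text \<open>Obtuse-angle property: if the angle at g were acute, a short move from g towards y would
  stay in the ball and come closer to f.\<close>

lemma proj_var:
  assumes f: "f \<in> S" and g: "is_proj R f g" and y: "y \<in> cb R"
  shows "ip (f - g) (y - g) \<le> 0"
proof (rule ccontr)
  assume "\<not> ip (f - g) (y - g) \<le> 0"
  then have u: "0 < ip (f - g) (y - g)" by simp
  define u where "u = ip (f - g) (y - g)"
  define w where "w = ip (y - g) (y - g)"
  have S: "g \<in> S" "y \<in> S" using g y unfolding is_proj_def cb_def by auto
  have w: "0 \<le> w" unfolding w_def using ip_nonneg S by (simp add: S_intros)
  \<comment> \<open>The step is so short that the quadratic term t*t*w is less than the linear gain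
    2*t*u; the summand 1 guards against w = 0.\<close>
  define t where "t = min 1 (u / (1 + w))"
  have t: "0 < t" "t \<le> 1" using u w unfolding t_def u_def[symmetric] by auto
  have "g + t *\<^sub>R (y - g) \<in> cb R" using cb_convex[of g R y t] g y t unfolding is_proj_def by auto
  then have "nrm (f - g) \<le> nrm (f - (g + t *\<^sub>R (y - g)))" using g unfolding is_proj_def by blast
  then have "(nrm (f - g))\<^sup>2 \<le> (nrm ((f - g) - t *\<^sub>R (y - g)))\<^sup>2"
    using nrm_ge0[of "f - g"] f S by (intro power_mono) (auto simp: S_intros algebra_simps)
  also have "\<dots> = (nrm (f - g))\<^sup>2 - 2 * t * u + t * t * w"
    unfolding u_def w_def using f S ip_sym[of "f - g" "y - g"]
    by (simp only: nrm_sq ip_diff[of "f - g"] ip_diff'[of "f - g"] ip_scale ip_scale' S_intros) (simp add: algebra_simps)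
  finally have "2 * u \<le> t * w" using t by (simp add: mult.assoc)
  also have "\<dots> \<le> u / (1 + w) * w" using w unfolding t_def by (intro mult_right_mono) auto
  also have "\<dots> \<le> u" using w u unfolding u_def[symmetric] by (simp add: field_simps)
  finally show False using u unfolding u_def by simp
qed

text \<open>The obtuse-angle inequalities for the two projections, each tested with the other
  projection, add up to (nrm (g - g'))^2 \<le> ip (f - f') (g - g'); Cauchy-Schwarz
  finishes.\<close>

lemma proj_nonexpansive:
  assumes f: "f \<in> S" "f' \<in> S" and g: "is_proj R f g" "is_proj R f' g'"
  shows "nrm (g - g') \<le> nrm (f - f')"
proof -
  have S: "g \<in> S" "g' \<in> S" "g \<in> cb R" "g' \<in> cb R" using g unfolding is_proj_def cb_def by auto
  have "ip (f - g) (g' - g) \<le> 0" "ip (f' - g') (g - g') \<le> 0"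
    using proj_var[OF f(1) g(1) S(4)] proj_var[OF f(2) g(2) S(3)] by auto
  then have "(nrm (g - g'))\<^sup>2 \<le> ip (f - f') (g - g')"
    using f S by (simp add: nrm_sq ip_simps S_intros algebra_simps)
  also have "\<dots> \<le> nrm (f - f') * nrm (g - g')" using f S by (intro ip_le S_intros)
  finally show ?thesis
    using nrm_ge0[of "g - g'"] nrm_ge0[of "f - f'"] S f
    by (cases "nrm (g - g') = 0") (auto simp: S_intros power2_eq_square)
qed

text \<open>Converse of \<open>proj_var\<close>: the two variational inequalities, for p and for g,
  are tested against each other. The conclusion is distance zero because g is an arbitrary nearest
  point.\<close>

lemma proj_fixed:
  assumes p: "p \<in> cb R" and f: "f \<in> S" and v: "\<And>y. y \<in> cb R \<Longrightarrow> ip (f - p) (y - p) \<le> 0" and g: "is_proj R f g"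
  shows "nrm (p - g) = 0"
proof -
  have S: "g \<in> S" "p \<in> S" "g \<in> cb R" using g p unfolding is_proj_def cb_def by auto
  have "ip (f - g) (p - g) \<le> 0" "ip (f - p) (g - p) \<le> 0"
    using proj_var[OF f g p] v[OF S(3)] by auto
  then have "(nrm (p - g))\<^sup>2 \<le> 0"
    using f S by (simp add: nrm_sq ip_simps S_intros algebra_simps)
  then show ?thesis by simp
qed

section \<open>Gradients and strongly convex functionals\<close>

definition has_grad :: "('a \<Rightarrow> real) \<Rightarrow> 'a \<Rightarrow> 'a \<Rightarrow> bool" where
  "has_grad J p g \<longleftrightarrow> g \<in> S \<and>
     (\<forall>\<epsilon>>0. \<exists>\<eta>>0. \<forall>r. r \<in> S \<and> nrm r < \<eta> \<longrightarrow> \<bar>J (p + r) - J p - ip g r\<bar> \<le> \<epsilon> * nrm r)"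

text \<open>Gradients may differ as functions, so only their pairings are compared. This frees the
  later estimates from the particular gradient picked by \<open>Jder\<close>. The increments of J
  along t x cancel, leaving the two remainders.\<close>

lemma has_grad_unique:
  assumes g: "has_grad J p g" and h: "has_grad J p h" and x: "x \<in> S"
  shows "ip g x = ip h x"
proof -
  have S: "g \<in> S" "h \<in> S" using g h unfolding has_grad_def by auto
  have "\<bar>ip (g - h) x\<bar> \<le> 0"
  proof (rule field_le_epsilon)
    fix e :: real assume e: "0 < e"
    define \<epsilon> where "\<epsilon> = e / (2 * (nrm x + 1))"
    have nx: "0 \<le> nrm x" using nrm_ge0 x .
    then have \<epsilon>: "0 < \<epsilon>" unfolding \<epsilon>_def using e by simp
    obtain \<eta> where \<eta>: "0 < \<eta>" "\<And>r. r \<in> S \<Longrightarrow> nrm r < \<eta> \<Longrightarrow> \<bar>J (p + r) - J p - ip g r\<bar> \<le> \<epsilon> * nrm r"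
      using g \<epsilon> unfolding has_grad_def by metis
    obtain \<eta>' where \<eta>': "0 < \<eta>'" "\<And>r. r \<in> S \<Longrightarrow> nrm r < \<eta>' \<Longrightarrow> \<bar>J (p + r) - J p - ip h r\<bar> \<le> \<epsilon> * nrm r"
      using h \<epsilon> unfolding has_grad_def by metis
    define t where "t = min \<eta> \<eta>' / (2 * (nrm x + 1))"
    have t: "0 < t" unfolding t_def using \<eta> \<eta>' nx by simp
    have tx: "t *\<^sub>R x \<in> S" using x by (rule S_scale)
    have tn: "nrm (t *\<^sub>R x) = t * nrm x" using t nrm_scale[OF x] by simp
    also have "\<dots> = min \<eta> \<eta>' * (nrm x / (2 * (nrm x + 1)))" unfolding t_def by simp
    also have "\<dots> < min \<eta> \<eta>' * 1" using \<eta> \<eta>' nx by (intro mult_strict_left_mono) (auto simp: field_simps)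
    finally have small: "nrm (t *\<^sub>R x) < \<eta>" "nrm (t *\<^sub>R x) < \<eta>'" by auto
    have "t * \<bar>ip (g - h) x\<bar> = \<bar>ip g (t *\<^sub>R x) - ip h (t *\<^sub>R x)\<bar>"
      using S x t by (simp add: ip_diff ip_scale' abs_mult flip: right_diff_distrib)
    also have "\<dots> \<le> 2 * (\<epsilon> * nrm (t *\<^sub>R x))"
      using \<eta>(2)[OF tx small(1)] \<eta>'(2)[OF tx small(2)] by linarith
    also have "\<dots> = t * (2 * \<epsilon> * nrm x)" using t x by (simp add: nrm_scale)
    finally have "\<bar>ip (g - h) x\<bar> \<le> 2 * \<epsilon> * nrm x" using t by simp
    also have "\<dots> \<le> e" unfolding \<epsilon>_def using nx e by (simp add: field_simps)
    finally show "\<bar>ip (g - h) x\<bar> \<le> 0 + e" by simp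
  qed
  then show ?thesis using S x by (simp add: ip_diff)
qed

text \<open>With tolerance 1 the expansion at l gives the local bound 1 + nrm g for the difference
  quotient. This provides the continuity that \<open>exists_minimizer\<close> asks for.\<close>

lemma has_grad_tendsto:
  assumes g: "has_grad J l g" and f: "\<And>n::nat. f n \<in> S" and l: "l \<in> S" and lim: "(\<lambda>n. nrm (f n - l)) \<longlonglongrightarrow> 0"
  shows "(\<lambda>n. J (f n)) \<longlonglongrightarrow> J l"
proof -
  have gS: "g \<in> S" using g unfolding has_grad_def by simp
  obtain \<eta> where \<eta>: "0 < \<eta>" "\<And>r. r \<in> S \<Longrightarrow> nrm r < \<eta> \<Longrightarrow> \<bar>J (l + r) - J l - ip g r\<bar> \<le> 1 * nrm r"
    using g zero_less_one unfolding has_grad_def by metis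
  have "\<forall>\<^sub>F n in sequentially. nrm (f n - l) < \<eta>" using order_tendstoD(2)[OF lim \<eta>(1)] .
  then have "\<forall>\<^sub>F n in sequentially. norm (J (f n) - J l) \<le> (1 + nrm g) * nrm (f n - l)"
  proof eventually_elim
    case (elim n)
    have r: "f n - l \<in> S" using f l by (rule S_diff)
    have "\<bar>J (f n) - J l - ip g (f n - l)\<bar> \<le> nrm (f n - l)" using \<eta>(2)[OF r elim] by simp
    then show ?case using cauchy_schwarz[OF gS r] by (simp add: distrib_right)
  qed
  moreover have "(\<lambda>n. (1 + nrm g) * nrm (f n - l)) \<longlonglongrightarrow> 0"
    using tendsto_mult_left[OF lim, of "1 + nrm g"] by simp
  ultimately have "(\<lambda>n. J (f n) - J l) \<longlonglongrightarrow> 0" by (rule Lim_null_comparison)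
  then show ?thesis by (rule LIM_zero_cancel)
qed

text \<open>The gradient inequality is applied at the midpoint towards both ends: the linear terms
  are opposite and cancel in the average, and each distance is half of nrm (x - y), hence the
  constant c/4.\<close>

lemma strongly_convex_midpoint:
  assumes D: "\<And>p. p \<in> cb R \<Longrightarrow> D p \<in> S"
    and conv: "\<And>p q. p \<in> cb R \<Longrightarrow> q \<in> cb R \<Longrightarrow> J q - J p - ip (D p) (q - p) \<ge> c * (nrm (q - p))\<^sup>2"
    and x: "x \<in> cb R" and y: "y \<in> cb R"
  shows "J ((1/2) *\<^sub>R (x + y)) \<le> J x / 2 + J y / 2 - c / 4 * (nrm (x - y))\<^sup>2"
proof -
  define m where "m = (1/2) *\<^sub>R (x + y)"
  have S: "x \<in> S" "y \<in> S" "x - y \<in> S" using x y S_diff unfolding cb_def by auto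
  have m: "m \<in> cb R" unfolding m_def using cb_mid[OF x y] .
  have xm: "x - m = (1/2) *\<^sub>R (x - y)" "y - m = (-1/2) *\<^sub>R (x - y)"
  proof -
    have "m + (1/2) *\<^sub>R (x - y) = x" "m + (-1/2) *\<^sub>R (x - y) = y"
      unfolding m_def by (simp_all add: algebra_simps flip: scaleR_add_left)
    then show "x - m = (1/2) *\<^sub>R (x - y)" "y - m = (-1/2) *\<^sub>R (x - y)" by (metis add_diff_cancel_left')+
  qed
  have n: "nrm (x - m) = nrm (x - y) / 2" "nrm (y - m) = nrm (x - y) / 2"
    unfolding xm nrm_scale[OF S(3)] by simp_all
  have i: "ip (D m) (x - m) = ip (D m) (x - y) / 2" "ip (D m) (y - m) = - ip (D m) (x - y) / 2"
    unfolding xm ip_scale'[OF S(3) D[OF m]] by simp_all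
  have "J x - J m - ip (D m) (x - y) / 2 \<ge> c * (nrm (x - y))\<^sup>2 / 4" "J y - J m + ip (D m) (x - y) / 2 \<ge> c * (nrm (x - y))\<^sup>2 / 4"
    using conv[OF m x] conv[OF m y] unfolding n i by (simp_all add: power_divide)
  then show ?thesis unfolding m_def[symmetric] by simp
qed

lemma strongly_convex_minimizer:
  assumes R: "0 \<le> R" and c: "0 < c"
    and D: "\<And>p. p \<in> cb R \<Longrightarrow> has_grad J p (D p)"
    and conv: "\<And>p q. p \<in> cb R \<Longrightarrow> q \<in> cb R \<Longrightarrow> J q - J p - ip (D p) (q - p) \<ge> c * (nrm (q - p))\<^sup>2"
    and bd: "\<And>x. x \<in> cb R \<Longrightarrow> 0 \<le> J x"
  shows "\<exists>x\<in>cb R. \<forall>y\<in>cb R. J x \<le> J y"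
proof (rule exists_minimizer[where c = "c/4" and B = 0])
  have DS: "\<And>p. p \<in> cb R \<Longrightarrow> D p \<in> S" using D unfolding has_grad_def by auto
  show "cb R \<noteq> {}" using R S_zero nrm_zero unfolding cb_def by auto
  show "cb R \<subseteq> S" unfolding cb_def by auto
  show "J ((1/2) *\<^sub>R (x + y)) \<le> J x / 2 + J y / 2 - c / 4 * (nrm (x - y))\<^sup>2" if "x \<in> cb R" "y \<in> cb R" for x y
    using strongly_convex_midpoint[OF DS conv that] .
  show "l \<in> cb R" if "\<And>n::nat. f n \<in> cb R" "l \<in> S" "(\<lambda>n. nrm (f n - l)) \<longlonglongrightarrow> 0" for f l
    using cb_closed[OF that] .
  show "(\<lambda>n. J (f n)) \<longlonglongrightarrow> J l" if "\<And>n::nat. f n \<in> cb R" "l \<in> cb R" "(\<lambda>n. nrm (f n - l)) \<longlonglongrightarrow> 0" for f l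
    using has_grad_tendsto[OF D[OF that(2)] _ _ that(3)] that(1,2) unfolding cb_def by auto
qed (use c bd cb_mid in simp_all)

lemma strongly_convex_unique:
  assumes c: "0 < c"
    and D: "\<And>p. p \<in> cb R \<Longrightarrow> D p \<in> S"
    and conv: "\<And>p q. p \<in> cb R \<Longrightarrow> q \<in> cb R \<Longrightarrow> J q - J p - ip (D p) (q - p) \<ge> c * (nrm (q - p))\<^sup>2"
    and x: "x \<in> cb R" "\<And>y. y \<in> cb R \<Longrightarrow> J x \<le> J y"
    and y: "y \<in> cb R" "\<And>z. z \<in> cb R \<Longrightarrow> J y \<le> J z"
  shows "nrm (x - y) = 0"
proof -
  have "c / 4 * (nrm (x - y))\<^sup>2 \<le> 0"
    using strongly_convex_midpoint[OF D conv x(1) y(1)] x(2)[OF cb_mid[OF x(1) y(1)]] x(2)[OF y(1)] y(2)[OF x(1)]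
    by linarith
  then show ?thesis using c by (simp add: mult_le_0_iff)
qed

text \<open>A negative derivative -u in the direction y - x would make J decrease inside the ball:
  \<epsilon> is taken so small that the remainder along t (y - x) stays below t*u.\<close>

lemma variational_inequality:
  assumes x: "x \<in> cb R" "\<And>y. y \<in> cb R \<Longrightarrow> J x \<le> J y"
    and g: "has_grad J x g" and y: "y \<in> cb R"
  shows "0 \<le> ip g (y - x)"
proof (rule ccontr)
  assume n: "\<not> 0 \<le> ip g (y - x)"
  have S: "x \<in> S" "y \<in> S" "g \<in> S" using x y g unfolding cb_def has_grad_def by auto
  have r: "y - x \<in> S" using S by (simp add: S_diff)
  define u where "u = - ip g (y - x)"
  have u: "0 < u" using n unfolding u_def by simp
  define \<epsilon> where "\<epsilon> = u / (2 * (nrm (y - x) + 1))"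
  have nr: "0 \<le> nrm (y - x)" using nrm_ge0[OF r] .
  have \<epsilon>: "0 < \<epsilon>" unfolding \<epsilon>_def using u nr by simp
  have \<epsilon>': "\<epsilon> * nrm (y - x) < u" unfolding \<epsilon>_def using u nr by (simp add: field_simps) (smt (verit) mult_nonneg_nonneg)
  obtain \<eta> where \<eta>: "0 < \<eta>" "\<And>r. r \<in> S \<Longrightarrow> nrm r < \<eta> \<Longrightarrow> \<bar>J (x + r) - J x - ip g r\<bar> \<le> \<epsilon> * nrm r"
    using g \<epsilon> unfolding has_grad_def by metis
  define t where "t = min 1 (\<eta> / (2 * (nrm (y - x) + 1)))"
  have t: "0 < t" "t \<le> 1" unfolding t_def using \<eta> nr by auto
  have "nrm (t *\<^sub>R (y - x)) = t * nrm (y - x)" using nrm_scale[OF r] t by simp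
  also have "\<dots> \<le> \<eta> / (2 * (nrm (y - x) + 1)) * nrm (y - x)" unfolding t_def using nr by (intro mult_right_mono) auto
  also have "\<dots> < \<eta>" using \<eta>(1) nr by (simp add: field_simps) (smt (verit) mult_nonneg_nonneg)
  finally have small: "nrm (t *\<^sub>R (y - x)) < \<eta>" .
  have "J x \<le> J (x + t *\<^sub>R (y - x))" using cb_convex[OF x(1) y, of t] t x(2) by auto
  moreover have "\<bar>J (x + t *\<^sub>R (y - x)) - J x - ip g (t *\<^sub>R (y - x))\<bar> \<le> \<epsilon> * nrm (t *\<^sub>R (y - x))"
    using \<eta>(2)[OF S_scale[OF r] small] .
  moreover have "ip g (t *\<^sub>R (y - x)) = - (t * u)" unfolding u_def using ip_scale'[OF r S(3)] by simp
  moreover have "\<epsilon> * nrm (t *\<^sub>R (y - x)) = t * (\<epsilon> * nrm (y - x))" using nrm_scale[OF r] t by simp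
  ultimately have "t * u \<le> t * (\<epsilon> * nrm (y - x))" by linarith
  then show False using t \<epsilon>' by simp
qed

text \<open>The minimizer is, up to distance zero, the projection of its own gradient step. Hence
  nonexpansiveness reduces the claim to the vectors before projection, whose difference is d -
  \<gamma> e with d = pm - p and e the difference of gradients.\<close>

lemma projected_gradient_contraction:
  assumes c: "0 < c"
    and DS: "\<And>p. p \<in> cb R \<Longrightarrow> D p \<in> S"
    and conv: "\<And>p q. p \<in> cb R \<Longrightarrow> q \<in> cb R \<Longrightarrow> J q - J p - ip (D p) (q - p) \<ge> c * (nrm (q - p))\<^sup>2"
    and lip: "\<And>p q r. p \<in> cb R \<Longrightarrow> q \<in> cb R \<Longrightarrow> r \<in> S \<Longrightarrow> \<bar>ip (D p) r - ip (D q) r\<bar> \<le> M * nrm (p - q) * nrm r"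
    and var: "\<And>y. y \<in> cb R \<Longrightarrow> 0 \<le> ip (D pm) (y - pm)"
    and pm: "pm \<in> cb R" and p: "p \<in> cb R"
    and g: "is_proj R (p - \<gamma> *\<^sub>R D p) g" and \<gamma>: "0 < \<gamma>" and M: "0 \<le> M"
    and \<theta>: "0 \<le> \<theta>" "1 - 4 * \<gamma> * c + \<gamma>\<^sup>2 * M\<^sup>2 \<le> \<theta>\<^sup>2"
  shows "nrm (pm - g) \<le> \<theta> * nrm (pm - p)"
proof -
  have S: "pm \<in> S" "p \<in> S" using pm p unfolding cb_def by auto
  have gS: "g \<in> S" using g unfolding is_proj_def cb_def by auto
  have R: "0 \<le> R" using pm nrm_ge0 unfolding cb_def by force
  define f where "f = pm - \<gamma> *\<^sub>R D pm"
  have fS: "f \<in> S" "p - \<gamma> *\<^sub>R D p \<in> S" unfolding f_def using S DS pm p by (auto intro!: S_diff S_scale)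
  obtain h where h: "is_proj R f h" using exists_proj[OF R fS(1)] by blast
  have hS: "h \<in> S" using h unfolding is_proj_def cb_def by auto
  have "nrm (pm - h) = 0"
  proof (rule proj_fixed[OF pm fS(1) _ h])
    fix y assume y: "y \<in> cb R"
    have yS: "y - pm \<in> S" using y S unfolding cb_def by (simp add: S_diff)
    have "f - pm = (-\<gamma>) *\<^sub>R D pm" unfolding f_def by simp
    then show "ip (f - pm) (y - pm) \<le> 0"
      using var[OF y] DS[OF pm] \<gamma> yS by (simp only: ip_scale) simp
  qed
  then have 1: "nrm (pm - g) \<le> nrm (h - g)"
    using nrm_tri[OF S(1) hS gS] by simp
  also have "\<dots> \<le> nrm (f - (p - \<gamma> *\<^sub>R D p))" using proj_nonexpansive[OF fS h g] .
  finally have 2: "nrm (pm - g) \<le> nrm (f - (p - \<gamma> *\<^sub>R D p))" .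
  define d where "d = pm - p"
  define e where "e = D pm - D p"
  have dS: "d \<in> S" "e \<in> S" unfolding d_def e_def using S DS pm p by (auto intro!: S_diff)
  have fe: "f - (p - \<gamma> *\<^sub>R D p) = d + (-\<gamma>) *\<^sub>R e" unfolding f_def d_def e_def by (simp add: algebra_simps)
  have ipe: "ip e r = ip (D pm) r - ip (D p) r" if "r \<in> S" for r
    unfolding e_def using DS pm p that by (simp add: ip_diff)
  have pmd: "nrm (p - pm) = nrm d" "p - pm = (-1) *\<^sub>R d" using nrm_minus[OF S(2,1)] unfolding d_def by auto
  \<comment> \<open>Sum of the convexity inequalities from pm to p and from p to pm; the values of J
    cancel.\<close>
  have mono: "2 * c * (nrm d)\<^sup>2 \<le> ip e d"
    using conv[OF pm p, unfolded pmd(1)] conv[OF p pm] ipe[OF dS(1)] ip_scale'[OF dS(1) DS[OF pm], of "-1"] unfolding pmd(2) d_def[symmetric]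
    by simp
  \<comment> \<open>The Lipschitz hypothesis concerns pairings only; testing it with e itself turns
    it into a bound for the norm of e.\<close>
  have "(nrm e)\<^sup>2 \<le> M * nrm d * nrm e"
    using lip[OF pm p dS(2)] ipe[OF dS(2)] nrm_sq[OF dS(2)] unfolding d_def[symmetric] by simp
  then have ne: "nrm e \<le> M * nrm d"
    using nrm_ge0[OF dS(2)] nrm_ge0[OF dS(1)] M by (cases "nrm e = 0") (auto simp: power2_eq_square)
  have "(nrm (d + (-\<gamma>) *\<^sub>R e))\<^sup>2 = (nrm d)\<^sup>2 - 2 * \<gamma> * ip e d + \<gamma>\<^sup>2 * (nrm e)\<^sup>2"
    using nrm_sq_add[OF dS(1) S_scale[OF dS(2)], of "-\<gamma>"] ip_scale'[OF dS(2,1), of "-\<gamma>"] nrm_scale[OF dS(2), of "-\<gamma>"]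
      ip_sym[OF dS] by (simp add: power_mult_distrib)
  also have "\<dots> \<le> (nrm d)\<^sup>2 - 2 * \<gamma> * (2 * c * (nrm d)\<^sup>2) + \<gamma>\<^sup>2 * (M * nrm d)\<^sup>2"
    using mono ne nrm_ge0[OF dS(2)] nrm_ge0[OF dS(1)] \<gamma>
    by (intro add_mono diff_mono mult_left_mono power_mono) auto
  also have "\<dots> = (1 - 4 * \<gamma> * c + \<gamma>\<^sup>2 * M\<^sup>2) * (nrm d)\<^sup>2" by (simp add: algebra_simps power_mult_distrib)
  also have "\<dots> \<le> \<theta>\<^sup>2 * (nrm d)\<^sup>2" using \<theta>(2) by (intro mult_right_mono) auto
  finally have "(nrm (d + (-\<gamma>) *\<^sub>R e))\<^sup>2 \<le> (\<theta> * nrm d)\<^sup>2" by (simp add: power_mult_distrib)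
  then have "nrm (d + (-\<gamma>) *\<^sub>R e) \<le> \<theta> * nrm d"
    using \<theta>(1) nrm_ge0[OF dS(1)] by (meson mult_nonneg_nonneg power2_le_imp_le)
  then show ?thesis using 2 unfolding fe d_def[symmetric] by simp
qed

text \<open>Membership in the ball is carried through the induction, because convexity and the
  Lipschitz bound are available only there. \<open>T\<close> is any selection of
  projections.\<close>

lemma projected_gradient_iterates:
  assumes c: "0 < c"
    and DS: "\<And>p. p \<in> cb R \<Longrightarrow> D p \<in> S"
    and conv: "\<And>p q. p \<in> cb R \<Longrightarrow> q \<in> cb R \<Longrightarrow> J q - J p - ip (D p) (q - p) \<ge> c * (nrm (q - p))\<^sup>2"
    and lip: "\<And>p q r. p \<in> cb R \<Longrightarrow> q \<in> cb R \<Longrightarrow> r \<in> S \<Longrightarrow> \<bar>ip (D p) r - ip (D q) r\<bar> \<le> M * nrm (p - q) * nrm r"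
    and var: "\<And>y. y \<in> cb R \<Longrightarrow> 0 \<le> ip (D pm) (y - pm)"
    and pm: "pm \<in> cb R" and p: "p \<in> cb R"
    and T: "\<And>p. p \<in> cb R \<Longrightarrow> is_proj R (p - \<gamma> *\<^sub>R D p) (T p)" and \<gamma>: "0 < \<gamma>" and M: "0 \<le> M"
    and \<theta>: "0 \<le> \<theta>" "1 - 4 * \<gamma> * c + \<gamma>\<^sup>2 * M\<^sup>2 \<le> \<theta>\<^sup>2"
  shows "(T ^^ n) p \<in> cb R \<and> nrm (pm - (T ^^ n) p) \<le> \<theta> ^ n * nrm (pm - p)"
proof (induction n)
  case 0
  show ?case using p by simp
next
  case (Suc n)
  then have q: "(T ^^ n) p \<in> cb R" and b: "nrm (pm - (T ^^ n) p) \<le> \<theta> ^ n * nrm (pm - p)" by auto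
  have "nrm (pm - T ((T ^^ n) p)) \<le> \<theta> * nrm (pm - (T ^^ n) p)"
    using projected_gradient_contraction[OF c DS conv lip var pm q T[OF q] \<gamma> M \<theta>] by blast
  also have "\<dots> \<le> \<theta> * (\<theta> ^ n * nrm (pm - p))" using b \<theta>(1) by (rule mult_left_mono)
  finally show ?case using T[OF q] unfolding is_proj_def by (simp add: mult.assoc)
qed

end

text \<open>Linearity is required only up to \<open>eqv\<close>: the classical second derivative of a sum is the sum of the
second derivatives only almost everywhere.\<close>

locale quadratic_map = X: semi_inner SX ipX + Y: semi_inner SY ipY
  for SX :: "'a::real_vector set" and ipX and SY :: "'b::real_vector set" and ipY +
  fixes c :: 'b and l :: "'a \<Rightarrow> 'b" and B :: "'a \<Rightarrow> 'a \<Rightarrow> 'b" and K :: real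
  assumes cS: "c \<in> SY" and lS: "\<And>x. x \<in> SX \<Longrightarrow> l x \<in> SY" and BS: "\<And>x y. x \<in> SX \<Longrightarrow> y \<in> SX \<Longrightarrow> B x y \<in> SY"
    and l_add: "\<And>x y. x \<in> SX \<Longrightarrow> y \<in> SX \<Longrightarrow> Y.eqv (l (x + y)) (l x + l y)"
    and l_scale: "\<And>a x. x \<in> SX \<Longrightarrow> Y.eqv (l (a *\<^sub>R x)) (a *\<^sub>R l x)"
    and B_add1: "\<And>x y z. x \<in> SX \<Longrightarrow> y \<in> SX \<Longrightarrow> z \<in> SX \<Longrightarrow> Y.eqv (B (x + y) z) (B x z + B y z)"
    and B_add2: "\<And>x y z. x \<in> SX \<Longrightarrow> y \<in> SX \<Longrightarrow> z \<in> SX \<Longrightarrow> Y.eqv (B z (x + y)) (B z x + B z y)"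
    and B_scale1: "\<And>a x z. x \<in> SX \<Longrightarrow> z \<in> SX \<Longrightarrow> Y.eqv (B (a *\<^sub>R x) z) (a *\<^sub>R B x z)"
    and B_scale2: "\<And>a x z. x \<in> SX \<Longrightarrow> z \<in> SX \<Longrightarrow> Y.eqv (B z (a *\<^sub>R x)) (a *\<^sub>R B z x)"
    and K0: "0 \<le> K"
    and c_bd: "Y.nrm c \<le> K"
    and l_bd: "\<And>x. x \<in> SX \<Longrightarrow> Y.nrm (l x) \<le> K * X.nrm x"
    and B_bd: "\<And>x y. x \<in> SX \<Longrightarrow> y \<in> SX \<Longrightarrow> Y.nrm (B x y) \<le> K * X.nrm x * X.nrm y"
begin

definition L where "L x = c + l x + B x x"
text \<open>The derivative of \<open>L\<close> at x. The bilinear map is not symmetric, so both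
  slots contribute.\<close>

definition A where "A x r = l r + (B x r + B r x)"
definition dJ where "dJ x r = 2 * ipY (L x) (A x r)"
definition a0 where "a0 \<rho> = K * (1 + \<rho> + \<rho>\<^sup>2)"
text \<open>The two summands come from the product rule for the pairing of \<open>L\<close> and
  \<open>A\<close>: the increment of \<open>L\<close> against \<open>A\<close>, and \<open>L\<close>
  against the increment of \<open>A\<close>. The factor 1 + 4*\<rho> uses that two points of the
  ball have distance at most 2*\<rho>.\<close>

definition lipc where "lipc \<rho> = 2 * K\<^sup>2 * (1 + 4 * \<rho>) * (1 + 2 * \<rho>) + 4 * a0 \<rho> * K"

lemma L_S: "x \<in> SX \<Longrightarrow> L x \<in> SY" and A_S: "x \<in> SX \<Longrightarrow> r \<in> SX \<Longrightarrow> A x r \<in> SY"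
  unfolding L_def A_def using cS lS BS by (auto intro!: Y.S_add)

lemma L_add:
  assumes x: "x \<in> SX" and r: "r \<in> SX"
  shows "Y.eqv (L (x + r)) (L x + (A x r + B r r))"
proof -
  have xr: "x + r \<in> SX" using x r by (rule X.S_add)
  have "Y.eqv (B (x + r) (x + r)) (B x (x + r) + B r (x + r))" using B_add1 x r xr by blast
  also have "Y.eqv \<dots> ((B x x + B x r) + (B r x + B r r))" using B_add2 x r by (intro Y.eqv_add) auto
  finally have "Y.eqv (L (x + r)) ((c + (l x + l r)) + ((B x x + B x r) + (B r x + B r r)))"
    unfolding L_def using l_add x r cS by (intro Y.eqv_add Y.eqv_refl) auto
  moreover have "(c + (l x + l r)) + ((B x x + B x r) + (B r x + B r r)) = L x + (A x r + B r r)"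
    unfolding L_def A_def by (simp add: algebra_simps)
  ultimately show ?thesis by simp
qed

lemma A_add2:
  assumes x: "x \<in> SX" and r: "r \<in> SX" "s \<in> SX"
  shows "Y.eqv (A x (r + s)) (A x r + A x s)"
proof -
  have "Y.eqv (A x (r + s)) ((l r + l s) + ((B x r + B x s) + (B r x + B s x)))"
    unfolding A_def using l_add B_add1 B_add2 x r by (intro Y.eqv_add) auto
  moreover have "(l r + l s) + ((B x r + B x s) + (B r x + B s x)) = A x r + A x s"
    unfolding A_def by (simp add: algebra_simps)
  ultimately show ?thesis by simp
qed

lemma A_scale2:
  assumes x: "x \<in> SX" and r: "r \<in> SX"
  shows "Y.eqv (A x (a *\<^sub>R r)) (a *\<^sub>R A x r)"
  unfolding A_def scaleR_add_right using l_scale B_scale1 B_scale2 x r by (intro Y.eqv_add) auto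

lemma A_add1:
  assumes x: "x \<in> SX" "y \<in> SX" and r: "r \<in> SX"
  shows "Y.eqv (A (x + y) r) (A x r + (B y r + B r y))"
proof -
  have "Y.eqv (A (x + y) r) (l r + ((B x r + B y r) + (B r x + B r y)))"
    unfolding A_def using lS[OF r] B_add1 B_add2 x r by (intro Y.eqv_add Y.eqv_refl) auto
  moreover have "l r + ((B x r + B y r) + (B r x + B r y)) = A x r + (B y r + B r y)"
    unfolding A_def by (simp add: algebra_simps)
  ultimately show ?thesis by simp
qed

lemma BB_bd:
  assumes "x \<in> SX" "r \<in> SX" shows "Y.nrm (B x r + B r x) \<le> 2 * K * X.nrm x * X.nrm r"
  using Y.nrm_add[OF BS BS, of x r r x] B_bd[of x r] B_bd[of r x] assms by (simp add: algebra_simps)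

lemma A_bd:
  assumes x: "x \<in> SX" "X.nrm x \<le> \<rho>" and r: "r \<in> SX"
  shows "Y.nrm (A x r) \<le> K * (1 + 2 * \<rho>) * X.nrm r"
proof -
  have "Y.nrm (A x r) \<le> K * X.nrm r + 2 * K * X.nrm x * X.nrm r"
    unfolding A_def using Y.nrm_add[OF lS[OF r] Y.S_add[OF BS[OF x(1) r] BS[OF r x(1)]]] l_bd[OF r] BB_bd[OF x(1) r] by linarith
  also have "\<dots> \<le> K * X.nrm r + 2 * K * \<rho> * X.nrm r"
    using x K0 X.nrm_ge0[OF r] by (intro add_mono order_refl mult_right_mono mult_left_mono) auto
  finally show ?thesis by (simp add: algebra_simps)
qed

lemma L_bd:
  assumes x: "x \<in> SX" "X.nrm x \<le> \<rho>"
  shows "Y.nrm (L x) \<le> a0 \<rho>"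
proof -
  have n: "0 \<le> X.nrm x" using X.nrm_ge0 x by auto
  have "Y.nrm (L x) \<le> Y.nrm c + Y.nrm (l x) + Y.nrm (B x x)"
    unfolding L_def using Y.nrm_add[of "c + l x" "B x x"] Y.nrm_add[of c "l x"] cS lS[OF x(1)] BS[OF x(1) x(1)] Y.S_add[of c "l x"]
    by linarith
  also have "\<dots> \<le> K + K * X.nrm x + K * X.nrm x * X.nrm x"
    using c_bd l_bd[OF x(1)] B_bd[OF x(1) x(1)] by linarith
  also have "\<dots> \<le> K + K * \<rho> + K * \<rho> * \<rho>"
    using x n K0 by (intro add_mono order_refl mult_mono mult_nonneg_nonneg) auto
  finally show ?thesis unfolding a0_def by (simp add: algebra_simps power2_eq_square)
qed

lemma dJ_add: "x \<in> SX \<Longrightarrow> r \<in> SX \<Longrightarrow> s \<in> SX \<Longrightarrow> dJ x (r + s) = dJ x r + dJ x s"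
  unfolding dJ_def using Y.ip_eqv(2)[OF A_add2 L_S] by (simp add: Y.ip_add' A_S L_S)

lemma dJ_scale: "x \<in> SX \<Longrightarrow> r \<in> SX \<Longrightarrow> dJ x (a *\<^sub>R r) = a * dJ x r"
  unfolding dJ_def using Y.ip_eqv(2)[OF A_scale2 L_S] by (simp add: Y.ip_scale' A_S L_S)

lemma dJ_bd:
  assumes x: "x \<in> SX" and r: "r \<in> SX"
  shows "\<bar>dJ x r\<bar> \<le> (2 * Y.nrm (L x) * (K * (1 + 2 * X.nrm x))) * X.nrm r"
proof -
  have "\<bar>dJ x r\<bar> \<le> 2 * (Y.nrm (L x) * Y.nrm (A x r))"
    unfolding dJ_def using Y.cauchy_schwarz[OF L_S[OF x] A_S[OF x r]] by simp
  also have "\<dots> \<le> 2 * (Y.nrm (L x) * (K * (1 + 2 * X.nrm x) * X.nrm r))"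
    using A_bd[OF x order_refl r] Y.nrm_ge0[OF L_S[OF x]] by (intro mult_left_mono) auto
  finally show ?thesis by (simp add: algebra_simps)
qed

text \<open>The exact remainder consists of the pairing of \<open>L x\<close> with
  \<open>B r r\<close> and the square of the increment of \<open>L\<close>. For r of norm at most 1
  its cubic and quartic parts are absorbed into a multiple of (X.nrm r)^2.\<close>

lemma expansion:
  assumes x: "x \<in> SX" and r: "r \<in> SX" "X.nrm r \<le> 1"
  shows "\<bar>(Y.nrm (L (x + r)))\<^sup>2 - (Y.nrm (L x))\<^sup>2 - dJ x r\<bar>
     \<le> (2 * Y.nrm (L x) * K + (K * (1 + 2 * X.nrm x) + K)\<^sup>2) * (X.nrm r)\<^sup>2"
proof -
  have n: "0 \<le> X.nrm r" "0 \<le> X.nrm x" using X.nrm_ge0 x r by auto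
  have S: "L x \<in> SY" "A x r \<in> SY" "B r r \<in> SY" "A x r + B r r \<in> SY"
    using L_S A_S BS Y.S_add x r by auto
  have "(Y.nrm (L (x + r)))\<^sup>2 = (Y.nrm (L x + (A x r + B r r)))\<^sup>2"
    using Y.nrm_eqv[OF L_add[OF x r(1)]] by simp
  also have "\<dots> = (Y.nrm (L x))\<^sup>2 + 2 * ipY (L x) (A x r + B r r) + (Y.nrm (A x r + B r r))\<^sup>2"
    using Y.nrm_sq_add[OF S(1,4)] .
  also have "\<dots> = (Y.nrm (L x))\<^sup>2 + dJ x r + 2 * ipY (L x) (B r r) + (Y.nrm (A x r + B r r))\<^sup>2"
    unfolding dJ_def using Y.ip_add'[OF S(2,3,1)] by simp
  finally have 1: "(Y.nrm (L (x + r)))\<^sup>2 - (Y.nrm (L x))\<^sup>2 - dJ x r = 2 * ipY (L x) (B r r) + (Y.nrm (A x r + B r r))\<^sup>2" by simp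
  have "\<bar>ipY (L x) (B r r)\<bar> \<le> Y.nrm (L x) * (K * X.nrm r * X.nrm r)"
    using Y.cauchy_schwarz[OF S(1,3)] mult_left_mono[OF B_bd[OF r(1) r(1)] Y.nrm_ge0[OF S(1)]] by linarith
  moreover have "Y.nrm (A x r + B r r) \<le> (K * (1 + 2 * X.nrm x) + K) * X.nrm r"
  proof -
    have "K * X.nrm r * X.nrm r \<le> K * X.nrm r * 1" using r n K0 by (intro mult_left_mono) auto
    then show ?thesis
      using Y.nrm_add[OF S(2,3)] A_bd[OF x order_refl r(1)] B_bd[OF r(1) r(1)] by (simp add: algebra_simps)
  qed
  then have "(Y.nrm (A x r + B r r))\<^sup>2 \<le> ((K * (1 + 2 * X.nrm x) + K) * X.nrm r)\<^sup>2"
    using Y.nrm_ge0[OF S(4)] by (intro power_mono) auto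
  moreover have "\<bar>2 * ipY (L x) (B r r) + (Y.nrm (A x r + B r r))\<^sup>2\<bar> \<le> 2 * \<bar>ipY (L x) (B r r)\<bar> + (Y.nrm (A x r + B r r))\<^sup>2"
    using abs_triangle_ineq[of "2 * ipY (L x) (B r r)" "(Y.nrm (A x r + B r r))\<^sup>2"] by (simp add: abs_mult)
  ultimately have "\<bar>2 * ipY (L x) (B r r) + (Y.nrm (A x r + B r r))\<^sup>2\<bar>
      \<le> 2 * (Y.nrm (L x) * (K * X.nrm r * X.nrm r)) + ((K * (1 + 2 * X.nrm x) + K) * X.nrm r)\<^sup>2" by linarith
  then show ?thesis unfolding 1 by (simp add: power_mult_distrib algebra_simps power2_eq_square)
qed

lemma dJ_lipschitz:
  assumes x: "x \<in> SX" "X.nrm x \<le> \<rho>" and y: "y \<in> SX" "X.nrm y \<le> \<rho>" and r: "r \<in> SX"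
  shows "\<bar>dJ x r - dJ y r\<bar> \<le> lipc \<rho> * X.nrm (x - y) * X.nrm r"
proof -
  define d where "d = x - y"
  have dS: "d \<in> SX" unfolding d_def using x y by (simp add: X.S_diff)
  have xe: "x = y + d" unfolding d_def by simp
  have n: "0 \<le> X.nrm r" "0 \<le> X.nrm d" "0 \<le> \<rho>" using X.nrm_ge0 x r dS by (auto intro: order_trans)
  have nd: "X.nrm d \<le> 2 * \<rho>" unfolding d_def using X.nrm_diff[OF x(1) y(1)] x y by linarith
  have S: "L x \<in> SY" "L y \<in> SY" "A x r \<in> SY" "A y r \<in> SY" "A y d \<in> SY" "B d d \<in> SY" "B d r + B r d \<in> SY" "A y d + B d d \<in> SY"
    using L_S A_S BS Y.S_add x y r dS by auto
  have "Y.nrm (L x - L y) = Y.nrm (A y d + B d d)"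
    using Y.eqv_diff_nrm[OF L_add[OF y(1) dS] S(2,8)] unfolding xe[symmetric] .
  also have "\<dots> \<le> K * (1 + 2 * \<rho>) * X.nrm d + K * X.nrm d * X.nrm d"
    using Y.nrm_add[OF S(5,6)] A_bd[OF y dS] B_bd[OF dS dS] by linarith
  also have "\<dots> \<le> K * (1 + 2 * \<rho>) * X.nrm d + K * X.nrm d * (2 * \<rho>)"
    using nd n K0 by (intro add_mono order_refl mult_left_mono) auto
  finally have 1: "Y.nrm (L x - L y) \<le> K * (1 + 4 * \<rho>) * X.nrm d" by (simp add: algebra_simps)
  have "Y.nrm (A x r - A y r) = Y.nrm (B d r + B r d)"
    using Y.eqv_diff_nrm[OF A_add1[OF y(1) dS r] S(4,7)] unfolding xe[symmetric] .
  then have 2: "Y.nrm (A x r - A y r) \<le> 2 * K * X.nrm d * X.nrm r" using BB_bd[OF dS r] by simp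
  have e: "dJ x r - dJ y r = 2 * ipY (L x - L y) (A x r) + 2 * ipY (L y) (A x r - A y r)"
    unfolding dJ_def using S by (simp add: Y.ip_diff Y.ip_diff')
  have "\<bar>dJ x r - dJ y r\<bar> \<le> 2 * (Y.nrm (L x - L y) * Y.nrm (A x r)) + 2 * (Y.nrm (L y) * Y.nrm (A x r - A y r))"
    unfolding e using Y.cauchy_schwarz[OF Y.S_diff[OF S(1,2)] S(3)] Y.cauchy_schwarz[OF S(2) Y.S_diff[OF S(3,4)]] by linarith
  also have "\<dots> \<le> 2 * ((K * (1 + 4 * \<rho>) * X.nrm d) * (K * (1 + 2 * \<rho>) * X.nrm r)) + 2 * (a0 \<rho> * (2 * K * X.nrm d * X.nrm r))"
  proof -
    have "Y.nrm (L x - L y) * Y.nrm (A x r) \<le> (K * (1 + 4 * \<rho>) * X.nrm d) * (K * (1 + 2 * \<rho>) * X.nrm r)"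
    proof (rule mult_mono[OF 1 A_bd[OF x r]])
      show "0 \<le> K * (1 + 4 * \<rho>) * X.nrm d" using n K0 by simp
    qed (rule Y.nrm_ge0[OF S(3)])
    moreover have "Y.nrm (L y) * Y.nrm (A x r - A y r) \<le> a0 \<rho> * (2 * K * X.nrm d * X.nrm r)"
    proof (rule mult_mono[OF L_bd[OF y] 2])
      show "0 \<le> a0 \<rho>" unfolding a0_def using n K0 by simp
    qed (rule Y.nrm_ge0[OF Y.S_diff[OF S(3,4)]])
    ultimately show ?thesis by linarith
  qed
  also have "\<dots> = lipc \<rho> * X.nrm d * X.nrm r"
  proof -
    have "2 * ((K * a * d) * (K * b * r)) + 2 * (e * (2 * K * d * r)) = (2 * K\<^sup>2 * a * b + 4 * e * K) * d * r" for a b d e r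
      by (simp add: power2_eq_square distrib_right)
    then show ?thesis unfolding lipc_def .
  qed
  finally show ?thesis unfolding d_def .
qed

end

section \<open>Square integrable functions\<close>

definition L2 :: "'m measure \<Rightarrow> ('m \<Rightarrow> complex) set" where
  "L2 M = {f. f \<in> borel_measurable M \<and> integrable M (\<lambda>x. (cmod (f x))\<^sup>2)}"

definition ip2 :: "'m measure \<Rightarrow> ('m \<Rightarrow> complex) \<Rightarrow> ('m \<Rightarrow> complex) \<Rightarrow> real" where
  "ip2 M f g = (\<integral>x. Re (f x * cnj (g x)) \<partial>M)"

lemma L2_measurable: "f \<in> L2 M \<Longrightarrow> f \<in> borel_measurable M"
  and L2_sq: "f \<in> L2 M \<Longrightarrow> integrable M (\<lambda>x. (cmod (f x))\<^sup>2)"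
  by (auto simp: L2_def)

lemma L2_dominated:
  assumes f: "f \<in> L2 M" and g: "g \<in> borel_measurable M" and b: "AE x in M. cmod (g x) \<le> C * cmod (f x)"
  shows "g \<in> L2 M"
proof -
  have "integrable M (\<lambda>x. C\<^sup>2 * (cmod (f x))\<^sup>2)" using L2_sq[OF f] by simp
  then have "integrable M (\<lambda>x. (cmod (g x))\<^sup>2)"
  proof (rule Bochner_Integration.integrable_bound)
    show "AE x in M. norm ((cmod (g x))\<^sup>2) \<le> norm (C\<^sup>2 * (cmod (f x))\<^sup>2)"
      using b
    proof eventually_elim
      case (elim x)
      then have "(cmod (g x))\<^sup>2 \<le> (C * cmod (f x))\<^sup>2" by (intro power_mono) auto
      then show ?case by (simp add: power_mult_distrib abs_mult)
    qed
  qed (use g in measurable)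
  then show ?thesis using g by (simp add: L2_def)
qed

lemma L2_add: assumes f: "f \<in> L2 M" and g: "g \<in> L2 M" shows "(\<lambda>x. f x + g x) \<in> L2 M"
proof -
  have m: "f \<in> borel_measurable M" "g \<in> borel_measurable M" using f g by (auto simp: L2_def)
  have "integrable M (\<lambda>x. 2 * (cmod (f x))\<^sup>2 + 2 * (cmod (g x))\<^sup>2)"
    using f g by (intro Bochner_Integration.integrable_add integrable_mult_right) (auto simp: L2_def)
  then have "integrable M (\<lambda>x. (cmod (f x + g x))\<^sup>2)"
  proof (rule Bochner_Integration.integrable_bound)
    show "AE x in M. norm ((cmod (f x + g x))\<^sup>2) \<le> norm (2 * (cmod (f x))\<^sup>2 + 2 * (cmod (g x))\<^sup>2)"
    proof (rule AE_I2)
      fix x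
      have "(cmod (f x + g x))\<^sup>2 \<le> (cmod (f x) + cmod (g x))\<^sup>2" by (intro power_mono norm_triangle_ineq) auto
      also have "\<dots> \<le> 2 * (cmod (f x))\<^sup>2 + 2 * (cmod (g x))\<^sup>2"
        using sum_squares_bound[of "cmod (f x)" "cmod (g x)"] by (simp add: power2_sum)
      finally show "norm ((cmod (f x + g x))\<^sup>2) \<le> norm (2 * (cmod (f x))\<^sup>2 + 2 * (cmod (g x))\<^sup>2)" by simp
    qed
  qed (use m in measurable)
  then show ?thesis using m by (simp add: L2_def)
qed

lemma L2_scale: "f \<in> L2 M \<Longrightarrow> (\<lambda>x. c *\<^sub>R f x) \<in> L2 M"
  by (auto simp: L2_def power_mult_distrib)

lemma L2_diff: "f \<in> L2 M \<Longrightarrow> g \<in> L2 M \<Longrightarrow> (\<lambda>x. f x - g x) \<in> L2 M"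
  using L2_add[of f M "\<lambda>x. (-1) *\<^sub>R g x"] L2_scale[of g M "-1"] by simp

lemma L2_zero: "(\<lambda>x. 0) \<in> L2 M" by (simp add: L2_def)

lemma L2_AE_cong: "f \<in> L2 M \<Longrightarrow> g \<in> borel_measurable M \<Longrightarrow> AE x in M. f x = g x \<Longrightarrow> g \<in> L2 M"
  by (rule L2_dominated[where C = 1]) auto

lemma integrable_ip2:
  assumes f: "f \<in> L2 M" and g: "g \<in> L2 M"
  shows "integrable M (\<lambda>x. Re (f x * cnj (g x)))"
proof -
  have "integrable M (\<lambda>x. (cmod (f x))\<^sup>2 + (cmod (g x))\<^sup>2)"
    using f g by (auto simp: L2_def)
  then show ?thesis
  proof (rule Bochner_Integration.integrable_bound)
    show "AE x in M. norm (Re (f x * cnj (g x))) \<le> norm ((cmod (f x))\<^sup>2 + (cmod (g x))\<^sup>2)"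
    proof (rule AE_I2)
      fix x
      have "\<bar>Re (f x * cnj (g x))\<bar> \<le> cmod (f x) * cmod (g x)"
        using abs_Re_le_cmod[of "f x * cnj (g x)"] by (simp add: norm_mult)
      also have "\<dots> \<le> 2 * cmod (f x) * cmod (g x)" by simp
      also have "\<dots> \<le> (cmod (f x))\<^sup>2 + (cmod (g x))\<^sup>2" by (rule sum_squares_bound)
      finally show "norm (Re (f x * cnj (g x))) \<le> norm ((cmod (f x))\<^sup>2 + (cmod (g x))\<^sup>2)" by simp
    qed
    show "(\<lambda>x. Re (f x * cnj (g x))) \<in> borel_measurable M"
      using f g unfolding L2_def by (auto simp: borel_measurable_complex_iff)
  qed
qed

lemma semi_inner_L2: "semi_inner (L2 M) (ip2 M)"
proof
  show "subspace (L2 M)"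
    unfolding subspace_def plus_fun_def scaleR_fun_def zero_fun_def using L2_add L2_scale L2_zero by blast
  fix x y z :: "'a \<Rightarrow> complex" and c :: real
  assume x: "x \<in> L2 M"
  { assume y: "y \<in> L2 M" and z: "z \<in> L2 M"
    show "ip2 M (x + y) z = ip2 M x z + ip2 M y z"
      unfolding ip2_def
      by (subst Bochner_Integration.integral_add[OF integrable_ip2[OF x z] integrable_ip2[OF y z], symmetric])
         (simp add: plus_fun_def algebra_simps) }
  { assume z: "z \<in> L2 M"
    show "ip2 M (c *\<^sub>R x) z = c * ip2 M x z"
      unfolding ip2_def
      by (subst integral_mult_right_zero[symmetric]) (simp add: scaleR_fun_def algebra_simps) }
  { assume y: "y \<in> L2 M"
    show "ip2 M x y = ip2 M y x" unfolding ip2_def by (simp add: algebra_simps) }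
  show "0 \<le> ip2 M x x" unfolding ip2_def by (rule Bochner_Integration.integral_nonneg) simp
qed

interpretation L2: semi_inner "L2 M" "ip2 M" for M by (rule semi_inner_L2)

lemma ip2_self: "ip2 M f f = (\<integral>x. (cmod (f x))\<^sup>2 \<partial>M)"
  unfolding ip2_def by (simp add: complex_norm_square[symmetric] flip: of_real_power)

lemma L2_nrm: "L2.nrm M f = sqrt (\<integral>x. (cmod (f x))\<^sup>2 \<partial>M)"
  unfolding L2.nrm_def ip2_self ..

lemma nn_integral_L2:
  assumes f: "f \<in> L2 M" shows "(\<integral>\<^sup>+x. ennreal ((cmod (f x))\<^sup>2) \<partial>M) = ennreal ((L2.nrm M f)\<^sup>2)"
  using L2.nrm_sq[OF f] nn_integral_eq_integral[OF L2_sq[OF f]] by (simp add: ip2_self)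

text \<open>Bounds obtained from Tonelli or Fatou are bounds for nonnegative integrals; here they
  yield membership in \<open>L2\<close> and the norm bound at once.\<close>

lemma L2_I_nn:
  assumes f: "f \<in> borel_measurable M" and b: "(\<integral>\<^sup>+x. ennreal ((cmod (f x))\<^sup>2) \<partial>M) \<le> ennreal B" and B: "0 \<le> B"
  shows "f \<in> L2 M" "(L2.nrm M f)\<^sup>2 \<le> B"
proof -
  have "(\<integral>\<^sup>+x. ennreal (norm ((cmod (f x))\<^sup>2)) \<partial>M) < \<infinity>" using b by (simp add: order_le_less_trans)
  then have "integrable M (\<lambda>x. (cmod (f x))\<^sup>2)" using f by (intro integrableI_bounded) auto
  then show 1: "f \<in> L2 M" using f by (simp add: L2_def)
  show "(L2.nrm M f)\<^sup>2 \<le> B" using b B unfolding nn_integral_L2[OF 1] by simp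
qed

lemma L2_nrm_mono:
  assumes f: "f \<in> L2 M" and g: "g \<in> L2 M" and b: "AE x in M. cmod (g x) \<le> cmod (f x)"
  shows "L2.nrm M g \<le> L2.nrm M f"
  unfolding L2_nrm
  by (intro real_sqrt_le_mono integral_mono_AE L2_sq f g) (use b in \<open>auto elim!: eventually_mono intro!: power_mono\<close>)

lemma L2_nrm_cong_AE:
  assumes f: "f \<in> L2 M" and g: "g \<in> L2 M" and b: "AE x in M. g x = f x"
  shows "L2.nrm M g = L2.nrm M f"
  by (rule antisym; rule L2_nrm_mono) (use f g b in \<open>auto elim!: eventually_mono\<close>)

lemma L2_eqv_AE:
  assumes f: "f \<in> L2 M" and g: "g \<in> L2 M" and b: "AE x in M. f x = g x"
  shows "L2.eqv M f g"
proof -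
  have "(\<lambda>x. f x - g x) \<in> L2 M" using f g by (rule L2_diff)
  then have "L2.nrm M (\<lambda>x. f x - g x) = L2.nrm M (\<lambda>x. 0)"
    by (intro L2_nrm_cong_AE) (use b L2_zero in \<open>auto elim!: eventually_mono\<close>)
  then show ?thesis using f g unfolding L2.eqv_def by (simp add: L2_nrm fun_diff_def)
qed

text \<open>Riesz-Fischer: a rapidly converging subsequence converges almost everywhere, and Fatou's
  lemma identifies its pointwise limit as the limit in norm.\<close>

lemma L2_complete:
  assumes f: "\<And>n::nat. f n \<in> L2 M"
    and C: "\<And>e::real. 0 < e \<Longrightarrow> \<exists>N. \<forall>m\<ge>N. \<forall>n\<ge>N. L2.nrm M (f m - f n) < e"
  shows "\<exists>l\<in>L2 M. (\<lambda>n. L2.nrm M (f n - l)) \<longlonglongrightarrow> 0"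
proof -
  have [measurable]: "f n \<in> borel_measurable M" for n using f by (rule L2_measurable)
  have "\<exists>N. \<forall>m\<ge>N. \<forall>n\<ge>N. L2.nrm M (f m - f n) < (1/2)^k" for k
    using C[of "(1/2)^k"] by simp
  then obtain N where N: "\<And>k m n. m \<ge> N k \<Longrightarrow> n \<ge> N k \<Longrightarrow> L2.nrm M (f m - f n) < (1/2)^k" by metis
  \<comment> \<open>The partial sums make \<open>r\<close> monotone and at least \<open>N k\<close>;
    the added k makes it unbounded.\<close>
  define r where "r k = (\<Sum>i\<le>k. N i) + k" for k
  have rN: "N k \<le> r k" for k unfolding r_def by (simp add: sum.atMost_Suc trans_le_add1 member_le_sum)
  have rS: "r k \<le> r (Suc k)" for k unfolding r_def by simp
  have rk: "k \<le> r k" for k unfolding r_def by simp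
  define d where "d k x = f (r (Suc k)) x - f (r k) x" for k x
  have dm[measurable]: "d k \<in> borel_measurable M" for k unfolding d_def by measurable
  have dL: "d k \<in> L2 M" for k unfolding d_def using L2_diff[OF f f] .
  have dn: "L2.nrm M (d k) < (1/2)^k" for k
    using N[of k "r (Suc k)" "r k"] rN[of k] rS[of k] unfolding d_def fun_diff_def by auto
  \<comment> \<open>The weight 2^k still leaves a convergent sum of integrals, since the squared
    norms are below 4^-k; it is what later gives absolute summability of the increments.\<close>
  have "(\<integral>\<^sup>+x. (\<Sum>k. ennreal (2^k * (cmod (d k x))\<^sup>2)) \<partial>M) = (\<Sum>k. \<integral>\<^sup>+x. ennreal (2^k * (cmod (d k x))\<^sup>2) \<partial>M)"
    by (rule nn_integral_suminf) measurable
  also have "\<dots> \<le> (\<Sum>k. ennreal ((1/2)^k))"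
  proof (rule suminf_le)
    fix k
    have "(\<integral>\<^sup>+x. ennreal (2^k * (cmod (d k x))\<^sup>2) \<partial>M) = ennreal (2^k) * (\<integral>\<^sup>+x. ennreal ((cmod (d k x))\<^sup>2) \<partial>M)"
      by (subst nn_integral_cmult[symmetric]) (auto simp: ennreal_mult)
    also have "\<dots> = ennreal (2^k * (L2.nrm M (d k))\<^sup>2)" by (simp add: nn_integral_L2[OF dL] ennreal_mult)
    also have "\<dots> \<le> ennreal (2^k * ((1/2)^k)\<^sup>2)"
      using dn[of k] L2.nrm_ge0[OF dL[of k]] by (intro ennreal_leI mult_left_mono power_mono) auto
    also have "2^k * ((1/2)^k)\<^sup>2 = (1/2::real)^k" by (simp add: power2_eq_square power_one_over)
    finally show "(\<integral>\<^sup>+x. ennreal (2^k * (cmod (d k x))\<^sup>2) \<partial>M) \<le> ennreal ((1/2)^k)" .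
  qed auto
  also have "\<dots> = ennreal (\<Sum>k. (1/2)^k)" by (rule suminf_ennreal2) (auto intro: summable_geometric)
  finally have "(\<integral>\<^sup>+x. (\<Sum>k. ennreal (2^k * (cmod (d k x))\<^sup>2)) \<partial>M) \<noteq> \<infinity>"
    by (auto simp: top_unique)
  then have "AE x in M. (\<Sum>k. ennreal (2^k * (cmod (d k x))\<^sup>2)) \<noteq> \<infinity>"
    by (rule nn_integral_noteq_infinite[rotated]) measurable
  then have cv: "AE x in M. convergent (\<lambda>k. f (r k) x)"
  proof eventually_elim
    case (elim x)
    then have s: "summable (\<lambda>k. 2^k * (cmod (d k x))\<^sup>2)"
      by (intro summable_suminf_not_top) auto
    have "summable (\<lambda>k. (2^k * (cmod (d k x))\<^sup>2 + (1/2)^k))" 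
      using s by (intro summable_add summable_geometric) auto
    then have "summable (\<lambda>k. d k x)"
    proof (rule summable_comparison_test'[where N = 0])
      fix k :: nat
      have p: "(0::real) < 2^k" by simp
      have h: "(1/2::real)^k = inverse (2^k)" by (simp add: power_one_over inverse_eq_divide)
      \<comment> \<open>Arithmetic-geometric mean: the norm of an increment is dominated by its
        weighted square plus 2^-k, and both are summable.\<close>
      have "0 \<le> 2^k * (cmod (d k x) - inverse (2^k))\<^sup>2" by simp
      also have "\<dots> = 2^k * (cmod (d k x))\<^sup>2 - 2 * cmod (d k x) + inverse (2^k)"
        using p by (simp add: power2_eq_square field_simps)
      finally show "norm (d k x) \<le> 2^k * (cmod (d k x))\<^sup>2 + (1/2)^k"
        unfolding h using norm_ge_zero[of "d k x"] by linarith
    qed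
    then have "(\<lambda>n. \<Sum>k<n. d k x) \<longlonglongrightarrow> (\<Sum>k. d k x)" by (rule summable_LIMSEQ)
    then have "(\<lambda>n. f (r 0) x + (\<Sum>k<n. d k x)) \<longlonglongrightarrow> f (r 0) x + (\<Sum>k. d k x)"
      by (intro tendsto_add tendsto_const)
    moreover have "f (r 0) x + (\<Sum>k<n. d k x) = f (r n) x" for n
      unfolding d_def by (subst sum_lessThan_telescope) simp
    ultimately show ?case unfolding convergent_def by auto
  qed
  define l where "l x = lim (\<lambda>k. f (r k) x)" for x
  have lm[measurable]: "l \<in> borel_measurable M" unfolding l_def by (rule borel_measurable_lim_metric) measurable
  have tl: "AE x in M. (\<lambda>k. f (r k) x) \<longlonglongrightarrow> l x"
    using cv by eventually_elim (simp add: l_def convergent_LIMSEQ_iff)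
  \<comment> \<open>Fatou's lemma along the subsequence, with the other index m fixed: the Cauchy
    bound passes to the limit function.\<close>
  have key: "(\<lambda>x. l x - f m x) \<in> L2 M \<and> (L2.nrm M (\<lambda>x. l x - f m x))\<^sup>2 \<le> e\<^sup>2"
    if m: "\<And>n n'. n \<ge> N' \<Longrightarrow> n' \<ge> N' \<Longrightarrow> L2.nrm M (f n - f n') < e" "m \<ge> N'" and e: "0 < e" for m e N'
  proof -
    have "(\<integral>\<^sup>+x. ennreal ((cmod (l x - f m x))\<^sup>2) \<partial>M) = (\<integral>\<^sup>+x. liminf (\<lambda>k. ennreal ((cmod (f (r k) x - f m x))\<^sup>2)) \<partial>M)"
    proof (rule nn_integral_cong_AE)
      show "AE x in M. ennreal ((cmod (l x - f m x))\<^sup>2) = liminf (\<lambda>k. ennreal ((cmod (f (r k) x - f m x))\<^sup>2))"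
        using tl
      proof eventually_elim
        case (elim x)
        have "(\<lambda>k. ennreal ((cmod (f (r k) x - f m x))\<^sup>2)) \<longlonglongrightarrow> ennreal ((cmod (l x - f m x))\<^sup>2)"
          by (intro tendsto_ennrealI tendsto_intros elim)
        then show ?case by (rule lim_imp_Liminf[OF sequentially_bot, symmetric])
      qed
    qed
    also have "\<dots> \<le> liminf (\<lambda>k. \<integral>\<^sup>+x. ennreal ((cmod (f (r k) x - f m x))\<^sup>2) \<partial>M)"
      by (rule nn_integral_liminf) measurable
    also have "\<dots> \<le> liminf (\<lambda>k. ennreal (e\<^sup>2))"
    proof (rule Liminf_mono)
      show "\<forall>\<^sub>F k in sequentially. (\<integral>\<^sup>+x. ennreal ((cmod (f (r k) x - f m x))\<^sup>2) \<partial>M) \<le> ennreal (e\<^sup>2)"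
        using eventually_ge_at_top[of N']
      proof eventually_elim
        case (elim k)
        then have "L2.nrm M (f (r k) - f m) < e" using m rk[of k] by simp
        then have "(L2.nrm M (f (r k) - f m))\<^sup>2 \<le> e\<^sup>2"
          using L2.nrm_ge0[OF L2.S_diff[OF f f]] by (intro power_mono) auto
        then show ?case using nn_integral_L2[OF L2_diff[OF f f]] by (simp add: fun_diff_def)
      qed
    qed
    also have "\<dots> = ennreal (e\<^sup>2)" by (simp add: Liminf_const)
    finally show ?thesis using L2_I_nn[of "\<lambda>x. l x - f m x" M "e\<^sup>2"] by simp
  qed
  obtain N1 where N1: "\<And>n n'. n \<ge> N1 \<Longrightarrow> n' \<ge> N1 \<Longrightarrow> L2.nrm M (f n - f n') < 1" using C[OF zero_less_one] by blast
  have lL: "l \<in> L2 M"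
    using L2_add[OF conjunct1[OF key[where m = N1 and N' = N1, OF N1 order_refl zero_less_one]] f[of N1]] by simp
  have "(\<lambda>n. L2.nrm M (f n - l)) \<longlonglongrightarrow> 0"
  proof (rule LIMSEQ_I)
    fix e :: real assume e: "0 < e"
    then have e2: "0 < e/2" by simp
    obtain N2 where N2: "\<And>n n'. n \<ge> N2 \<Longrightarrow> n' \<ge> N2 \<Longrightarrow> L2.nrm M (f n - f n') < e/2" using C[OF e2] by blast
    have "norm (L2.nrm M (f n - l) - 0) < e" if n: "n \<ge> N2" for n
    proof -
      have "(L2.nrm M (l - f n))\<^sup>2 \<le> (e/2)\<^sup>2" using key[OF N2 n e2] by (simp add: fun_diff_def)
      then have "L2.nrm M (l - f n) \<le> e/2" using e2 by (meson less_imp_le power2_le_imp_le)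
      then show ?thesis using L2.nrm_minus[OF lL f[of n]] L2.nrm_ge0[OF L2.S_diff[OF f lL]] e by simp
    qed
    then show "\<exists>N. \<forall>n\<ge>N. norm (L2.nrm M (f n - l) - 0) < e" by blast
  qed
  then show ?thesis using lL by blast
qed

section \<open>Sobolev functions of one variable\<close>

text \<open>The interval as a finite measure space of its own, so that the \<open>L2\<close> theory,
  products and Fubini's theorem apply directly; set integrals over {a..c} become plain
  integrals.\<close>

definition mI :: "real \<Rightarrow> real \<Rightarrow> real measure" where
  "mI a c = restrict_space lborel {a..c}"

lemma space_mI [simp]: "space (mI a c) = {a..c}"
  by (simp add: mI_def space_restrict_space)

lemma sets_mI: "sets (mI a c) = sets (restrict_space borel {a..c})"
  by (simp add: mI_def sets_restrict_space)

lemma finite_measure_mI: "finite_measure (mI a c)"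
proof (rule finite_measureI)
  show "emeasure (mI a c) (space (mI a c)) \<noteq> \<infinity>"
    unfolding mI_def by (subst emeasure_restrict_space) (auto simp: space_restrict_space emeasure_lborel_Icc_eq)
qed

interpretation mI: finite_measure "mI a c" for a c by (rule finite_measure_mI)
interpretation mI2: pair_sigma_finite "mI k l" "mI a c" for k l a c by standard

lemma finite_measure_mI2: "finite_measure (mI k l \<Otimes>\<^sub>M mI a c)"
  by (intro finite_measure_pair_measure finite_measure_mI)

lemma integral_mI:
  fixes f :: "real \<Rightarrow> 'b::{banach,second_countable_topology}"
  shows "(LINT t:{a..c}|lborel. f t) = integral\<^sup>L (mI a c) f"
  unfolding mI_def set_lebesgue_integral_def by (subst integral_restrict_space) auto

lemma integrable_mI:
  fixes f :: "real \<Rightarrow> 'b::{banach,second_countable_topology}"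
  shows "set_integrable lborel {a..c} f \<longleftrightarrow> integrable (mI a c) f"
  unfolding mI_def set_integrable_def by (subst integrable_restrict_space) auto

lemma AE_mI: "(AE t in mI a c. P t) \<longleftrightarrow> (AE t in lborel. t \<in> {a..c} \<longrightarrow> P t)"
  unfolding mI_def by (subst AE_restrict_space_iff) auto

lemma measurable_mI_continuous: "continuous_on {a..c} f \<Longrightarrow> f \<in> borel_measurable (mI a c)"
  unfolding measurable_cong_sets[OF sets_mI refl] by (rule borel_measurable_continuous_on_restrict)

lemma measurable_ident_mI [measurable]: "(\<lambda>x. x) \<in> borel_measurable (mI a c)"
  by (rule measurable_mI_continuous) (rule continuous_on_id)

lemma measurable_into_mI:
  assumes "f \<in> borel_measurable M" "\<And>x. x \<in> space M \<Longrightarrow> f x \<in> {a..c}"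
  shows "f \<in> measurable M (mI a c)"
  unfolding measurable_cong_sets[OF refl sets_mI] using assms by (intro measurable_restrict_space2) auto

lemma measure_mI [simp]: "a \<le> c \<Longrightarrow> measure (mI a c) {a..c} = c - a"
  unfolding mI_def by (subst measure_restrict_space) auto

lemma integral_mI_const: "a \<le> c \<Longrightarrow> (\<integral>x. (k::real) \<partial>mI a c) = (c - a) * k"
  by simp

section \<open>Indefinite integrals of square integrable functions\<close>

definition indef :: "real \<Rightarrow> (real \<Rightarrow> complex) \<Rightarrow> real \<Rightarrow> complex" where
  "indef a f z = (LINT t:{a..z}|lborel. f t)"

lemma indef_mI: "z \<in> {a..c} \<Longrightarrow> indef a f z = (\<integral>t. indicator {..z} t *\<^sub>R f t \<partial>mI a c)"
  unfolding indef_def integral_mI[symmetric] set_lebesgue_integral_def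
  by (intro Bochner_Integration.integral_cong) (auto simp: indicator_def)

lemma L2_const: "(\<lambda>x. k) \<in> L2 (mI a c)"
  unfolding L2_def by simp

lemma L2_bounded:
  assumes "f \<in> borel_measurable (mI a c)" "\<And>x. x \<in> {a..c} \<Longrightarrow> cmod (f x) \<le> B"
  shows "f \<in> L2 (mI a c)"
  using assms(2) by (intro L2_dominated[OF L2_const[of 1 a c] assms(1), of B] AE_I2) simp

lemma L2_nrm_const: "a \<le> c \<Longrightarrow> 0 \<le> B \<Longrightarrow> L2.nrm (mI a c) (\<lambda>x. complex_of_real B) = sqrt (c - a) * B"
  by (simp add: L2_nrm integral_mI_const real_sqrt_mult)

lemma L2_nrm_bounded:
  assumes "f \<in> L2 (mI a c)" "\<And>x. x \<in> {a..c} \<Longrightarrow> cmod (f x) \<le> B" "a \<le> c" "0 \<le> B"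
  shows "L2.nrm (mI a c) f \<le> sqrt (c - a) * B"
proof -
  have "L2.nrm (mI a c) f \<le> L2.nrm (mI a c) (\<lambda>x. complex_of_real B)"
    by (intro L2_nrm_mono L2_const assms(1) AE_I2) (use assms(2,4) in simp)
  then show ?thesis by (simp only: L2_nrm_const[OF assms(3,4)])
qed

lemma L2_integrable: assumes f: "f \<in> L2 (mI a c)" shows "integrable (mI a c) f"
proof -
  have "integrable (mI a c) (\<lambda>x. cmod (f x))"
    by (rule mI.square_integrable_imp_integrable) (use f in \<open>auto simp: L2_def\<close>)
  then show ?thesis using f by (simp add: L2_def integrable_norm_iff)
qed

lemma L1_le_L2:
  assumes f: "f \<in> L2 (mI a c)" and ac: "a \<le> c"
  shows "(\<integral>x. cmod (f x) \<partial>mI a c) \<le> sqrt (c - a) * L2.nrm (mI a c) f"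
proof -
  let ?g = "\<lambda>x. complex_of_real (cmod (f x))"
  have g: "?g \<in> L2 (mI a c)" using f by (auto simp: L2_def)
  have "ip2 (mI a c) (\<lambda>x. complex_of_real 1) ?g \<le> L2.nrm (mI a c) (\<lambda>x. complex_of_real 1) * L2.nrm (mI a c) ?g"
    by (rule L2.ip_le[OF L2_const g])
  then show ?thesis unfolding L2_nrm_const[OF ac zero_le_one] by (simp add: ip2_def L2_nrm)
qed

text \<open>Both integrals are written over the whole interval with indicator cut-offs. The
  difference of the integrands is then dominated by the norm of f, whatever the order of y and
  z.\<close>

lemma indef_diff_bound:
  assumes f: "f \<in> L2 (mI a c)" and y: "y \<in> {a..c}" and z: "z \<in> {a..c}"
  shows "cmod (indef a f z - indef a f y) \<le> sqrt (c - a) * L2.nrm (mI a c) f"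
proof -
  have i: "integrable (mI a c) f" using L2_integrable[OF f] .
  have ii: "integrable (mI a c) (\<lambda>t. indicator {..w} t *\<^sub>R f t)" for w
    by (rule Bochner_Integration.integrable_bound[OF i])
       (use f in \<open>auto simp: L2_def indicator_def intro!: borel_measurable_scaleR\<close>)
  have "indef a f z - indef a f y = (\<integral>t. indicator {..z} t *\<^sub>R f t - indicator {..y} t *\<^sub>R f t \<partial>mI a c)"
    unfolding indef_mI[OF z] indef_mI[OF y] by (rule Bochner_Integration.integral_diff[OF ii ii, symmetric])
  then have "cmod (indef a f z - indef a f y) \<le> (\<integral>t. cmod (indicator {..z} t *\<^sub>R f t - indicator {..y} t *\<^sub>R f t) \<partial>mI a c)"
    using integral_norm_bound by metis
  also have "\<dots> \<le> (\<integral>x. cmod (f x) \<partial>mI a c)"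
    by (intro integral_mono integrable_norm Bochner_Integration.integrable_diff i ii) (auto simp: indicator_def)
  also have "\<dots> \<le> sqrt (c - a) * L2.nrm (mI a c) f" using L1_le_L2[OF f] y by force
  finally show ?thesis .
qed

lemma indef_start [simp]: "indef a f a = 0"
proof -
  have "indef a f a = (\<integral>t. indicator {a} t *\<^sub>R f a \<partial>lborel)"
    unfolding indef_def set_lebesgue_integral_def
    by (intro Bochner_Integration.integral_cong) (auto simp: indicator_def)
  then show ?thesis by simp
qed

lemma indef_bound:
  assumes f: "f \<in> L2 (mI a c)" and z: "z \<in> {a..c}"
  shows "cmod (indef a f z) \<le> sqrt (c - a) * L2.nrm (mI a c) f"
  using indef_diff_bound[OF f _ z, of a] z by auto

lemma indef_add:
  assumes f: "f \<in> L2 (mI a c)" and g: "g \<in> L2 (mI a c)" and z: "z \<in> {a..c}"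
  shows "indef a (\<lambda>t. f t + s *\<^sub>R g t) z = indef a f z + s *\<^sub>R indef a g z"
proof -
  have ii: "integrable (mI a c) (\<lambda>t. indicator {..z} t *\<^sub>R h t)" if "h \<in> L2 (mI a c)" for h :: "real \<Rightarrow> complex"
    by (rule Bochner_Integration.integrable_bound[OF L2_integrable[OF that]])
       (use that in \<open>auto simp: L2_def indicator_def intro!: borel_measurable_scaleR\<close>)
  have "(\<integral>t. indicator {..z} t *\<^sub>R f t + s *\<^sub>R (indicator {..z} t *\<^sub>R g t) \<partial>mI a c) = indef a f z + s *\<^sub>R indef a g z"
    unfolding indef_mI[OF z] integral_scaleR_right[symmetric]
    by (intro Bochner_Integration.integral_add ii[OF f] integrable_scaleR_right ii[OF g])
  moreover have "indef a (\<lambda>t. f t + s *\<^sub>R g t) z = (\<integral>t. indicator {..z} t *\<^sub>R f t + s *\<^sub>R (indicator {..z} t *\<^sub>R g t) \<partial>mI a c)"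
    unfolding indef_mI[OF z] by (intro Bochner_Integration.integral_cong) (auto simp: scaleR_add_right scaleR_left_commute)
  ultimately show ?thesis by simp
qed

lemma indef_cong_AE:
  assumes "AE t in mI a c. f t = g t" "f \<in> borel_measurable (mI a c)" "g \<in> borel_measurable (mI a c)" "z \<in> {a..c}"
  shows "indef a f z = indef a g z"
  unfolding indef_mI[OF assms(4)]
  by (rule integral_cong_AE) (use assms in \<open>auto intro!: borel_measurable_scaleR elim!: eventually_mono\<close>)

text \<open>Passage to the gauge integral, in terms of which the differentiation theorem above is
  stated.\<close>

lemma indef_HK:
  assumes f: "f \<in> L2 (mI a c)"
  shows "f integrable_on {a..c}" "z \<in> {a..c} \<Longrightarrow> indef a f z = integral {a..z} f"
proof -
  have s: "set_integrable lborel {a..c} f" unfolding integrable_mI using L2_integrable[OF f] .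
  then show "f integrable_on {a..c}" by (rule set_borel_integral_eq_integral)
  assume z: "z \<in> {a..c}"
  have "set_integrable lborel {a..z} f" by (rule set_integrable_subset[OF s]) (use z in auto)
  then show "indef a f z = integral {a..z} f" unfolding indef_def by (rule set_borel_integral_eq_integral)
qed

lemma indef_continuous: assumes f: "f \<in> L2 (mI a c)" shows "continuous_on {a..c} (indef a f)"
  using indefinite_integral_continuous_1[OF indef_HK(1)[OF f]]
  by (rule continuous_on_eq) (simp add: indef_HK(2)[OF f])

text \<open>\<open>negligible\<close> refers to completed Lebesgue measure, and the exceptional set
  need not be Borel; the property is transferred to the uncompleted measure.\<close>

lemma AE_mI_negligible:
  assumes "negligible N" "\<And>z. z \<in> {a..c} - N \<Longrightarrow> P z" shows "AE z in mI a c. P z"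
proof -
  have "AE z in lebesgue. z \<in> {a..c} \<longrightarrow> P z"
    using AE_not_in[of N lebesgue] assms by (auto simp: negligible_iff_null_sets elim!: eventually_mono)
  then show ?thesis unfolding AE_mI by (simp add: AE_completion_iff)
qed

lemma indef_has_derivative_AE:
  assumes f: "f \<in> L2 (mI a c)"
  shows "AE z in mI a c. (indef a f has_vector_derivative f z) (at z within {a..c})"
proof -
  obtain N where N: "negligible N" "\<And>z. z \<in> {a..c} - N \<Longrightarrow> ((\<lambda>x. integral {a..x} f) has_vector_derivative f z) (at z within {a..c})"
    using indefinite_integral_has_vector_derivative_ae[OF indef_HK(1)[OF f]] by blast
  show ?thesis
  proof (rule AE_mI_negligible[OF N(1)])
    fix z assume z: "z \<in> {a..c} - N"
    then show "(indef a f has_vector_derivative f z) (at z within {a..c})"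
      by (intro has_vector_derivative_transform[OF _ _ N(2)]) (auto simp: indef_HK(2)[OF f])
  qed
qed

lemma indef_has_derivative_continuous:
  assumes f: "continuous_on {a..c} f" and z: "z \<in> {a..c}" and L: "f \<in> L2 (mI a c)"
  shows "(indef a f has_vector_derivative f z) (at z within {a..c})"
  using z by (intro has_vector_derivative_transform[OF _ _ integral_has_vector_derivative[OF f z]])
     (auto simp: indef_HK(2)[OF L])

lemma L2_continuous: assumes "continuous_on {a..c} f" shows "f \<in> L2 (mI a c)"
proof -
  have "bounded (f ` {a..c})" using assms by (intro compact_imp_bounded compact_continuous_image) auto
  then obtain B where "\<forall>x\<in>f ` {a..c}. cmod x \<le> B" unfolding bounded_iff by blast
  then have "cmod (f x) \<le> B" if "x \<in> {a..c}" for x using that by blast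
  then show ?thesis using measurable_mI_continuous[OF assms] by (rule L2_bounded[rotated])
qed

lemma L2_mI_iff: "f \<in> L2 (mI a c) \<longleftrightarrow> set_integrable lborel {a..c} f \<and> set_integrable lborel {a..c} (\<lambda>t. (cmod (f t))\<^sup>2)"
  unfolding integrable_mI using L2_integrable L2_sq borel_measurable_integrable unfolding L2_def by blast

section \<open>Weak and classical derivatives\<close>

lemma wd_iff: "wd a c g g' \<longleftrightarrow> g' \<in> L2 (mI a c) \<and> (\<forall>z\<in>{a..c}. g z = g a + indef a g' z)"
  unfolding wd_def L2_mI_iff indef_def by blast

lemma Hn1_iff: "Hn1 a c n g \<longleftrightarrow> g \<in> L2 (mI a c) \<and> (\<forall>r<n. wd a c (zd a c g r) (zd a c g (Suc r)))"
  unfolding Hn1_def L2_mI_iff by simp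

lemma wd_eq: "wd a c g g' \<Longrightarrow> z \<in> {a..c} \<Longrightarrow> g a + indef a g' z = g z"
  unfolding wd_iff by metis

lemma wd_continuous: assumes "wd a c g g'" shows "continuous_on {a..c} g"
proof -
  have "continuous_on {a..c} (\<lambda>z. g a + indef a g' z)"
    using assms unfolding wd_iff by (intro continuous_intros indef_continuous) auto
  then show ?thesis by (rule continuous_on_eq) (rule wd_eq[OF assms])
qed

lemma wd_derivative:
  assumes w: "wd a c g g'" and d: "(indef a g' has_vector_derivative D) (at z within {a..c})" and z: "z \<in> {a..c}"
  shows "(g has_vector_derivative D) (at z within {a..c})"
proof (rule has_vector_derivative_transform[OF z])
  show "((\<lambda>z. g a + indef a g' z) has_vector_derivative D) (at z within {a..c})"
    using has_vector_derivative_add[OF has_vector_derivative_const d, of "g a"] by simp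
qed (rule wd_eq[OF w, symmetric])

text \<open>Here the two notions of derivative meet: \<open>wd\<close> prescribes only the integrals
  of g', whereas \<open>zd\<close> takes classical derivatives point by point. Lebesgue
  differentiation makes them agree off a null set.\<close>

lemma wd_derivative_AE:
  assumes w: "wd a c g g'"
  shows "AE z in mI a c. (g has_vector_derivative g' z) (at z within {a..c})"
proof -
  have "g' \<in> L2 (mI a c)" using w by (simp add: wd_iff)
  from indef_has_derivative_AE[OF this] have "AE z in mI a c. z \<in> {a..c} \<longrightarrow> (indef a g' has_vector_derivative g' z) (at z within {a..c})"
    by eventually_elim simp
  then have "AE z in mI a c. z \<in> {a..c} \<longrightarrow> (g has_vector_derivative g' z) (at z within {a..c})"
    by eventually_elim (blast intro: wd_derivative[OF w])
  then show ?thesis unfolding AE_mI by simp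
qed

lemma wd_derivative_cont: "wd a c g g' \<Longrightarrow> continuous_on {a..c} g' \<Longrightarrow> z \<in> {a..c} \<Longrightarrow> (g has_vector_derivative g' z) (at z within {a..c})"
  using wd_derivative[of a c g g'] indef_has_derivative_continuous L2_continuous by blast

lemma Hn1_L2: "Hn1 a c n g \<Longrightarrow> r \<le> n \<Longrightarrow> zd a c g r \<in> L2 (mI a c)"
  by (cases r) (auto simp: Hn1_iff wd_iff)

lemma Hn1_wd: "Hn1 a c n g \<Longrightarrow> r < n \<Longrightarrow> wd a c (zd a c g r) (zd a c g (Suc r))"
  by (auto simp: Hn1_iff)

lemma Hn1_cont: "Hn1 a c n g \<Longrightarrow> r < n \<Longrightarrow> continuous_on {a..c} (zd a c g r)"
  using Hn1_wd wd_continuous by blast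

lemma Hn1_mono: "Hn1 a c n g \<Longrightarrow> m \<le> n \<Longrightarrow> Hn1 a c m g"
  by (auto simp: Hn1_iff)

text \<open>The derivatives are taken within {a..c}, so the values outside do not matter. This
  allows a condition u = 0 on the interval, as at lateral grid points, to be differentiated.\<close>

lemma zd_cong:
  assumes "\<And>z. z \<in> {a..c} \<Longrightarrow> f z = g z" "z \<in> {a..c}"
  shows "zd a c f r z = zd a c g r z"
  using assms(2)
proof (induction r arbitrary: z)
  case (Suc r)
  have "(zd a c f r has_vector_derivative D) (at z within {a..c}) \<longleftrightarrow> (zd a c g r has_vector_derivative D) (at z within {a..c})" for D
    using has_vector_derivative_transform[OF Suc.prems, of "zd a c g r" "zd a c f r" D]
      has_vector_derivative_transform[OF Suc.prems, of "zd a c f r" "zd a c g r" D] Suc.IH by metis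
  then show ?case by (simp add: vector_derivative_def)
qed (use assms in auto)

definition sobolev_const :: "real \<Rightarrow> real \<Rightarrow> real" where "sobolev_const a c = 1 / sqrt (c - a) + sqrt (c - a)"

lemma sobolev_const_nonneg: "a < c \<Longrightarrow> 0 \<le> sobolev_const a c"
  unfolding sobolev_const_def by simp

text \<open>The value at z is compared with the value at y through the indefinite integral of g',
  and the bound is averaged over y. \<open>sobolev_const\<close> is the sum of the two factors that
  arise.\<close>

lemma sobolev:
  assumes ac: "a < c" and w: "wd a c g g'" and g: "g \<in> L2 (mI a c)" and z: "z \<in> {a..c}"
  shows "cmod (g z) \<le> sobolev_const a c * (L2.nrm (mI a c) g + L2.nrm (mI a c) g')"
proof -
  have g': "g' \<in> L2 (mI a c)" using w by (simp add: wd_iff)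
  let ?n = "L2.nrm (mI a c) g" and ?n' = "L2.nrm (mI a c) g'"
  have n: "0 \<le> ?n" "0 \<le> ?n'" using L2.nrm_ge0 g g' by auto
  have "cmod (g z) \<le> cmod (g y) + sqrt (c - a) * ?n'" if y: "y \<in> {a..c}" for y
  proof -
    have "g z - g y = indef a g' z - indef a g' y" using w y z unfolding wd_iff by (metis add_diff_cancel_left)
    then show ?thesis using indef_diff_bound[OF g' y z] norm_triangle_sub[of "g z" "g y"] by simp
  qed
  then have "(\<integral>y. cmod (g z) \<partial>mI a c) \<le> (\<integral>y. cmod (g y) + sqrt (c - a) * ?n' \<partial>mI a c)"
    using L2_integrable[OF g] by (intro integral_mono) auto
  also have "\<dots> = (\<integral>y. cmod (g y) \<partial>mI a c) + (c - a) * (sqrt (c - a) * ?n')"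
    using L2_integrable[OF g] integral_mI_const[of a c] ac by (subst Bochner_Integration.integral_add) auto
  also have "\<dots> \<le> sqrt (c - a) * ?n + (c - a) * (sqrt (c - a) * ?n')"
    using L1_le_L2[OF g] ac by simp
  also have "(\<integral>y. cmod (g z) \<partial>mI a c) = (c - a) * cmod (g z)" using integral_mI_const ac by simp
  finally have b: "(c - a) * cmod (g z) \<le> sqrt (c - a) * ?n + (c - a) * (sqrt (c - a) * ?n')" .
  define s where "s = sqrt (c - a)"
  have s: "0 < s" "c - a = s * s" using ac by (auto simp: s_def)
  have "s * s * cmod (g z) \<le> s * s * (1 / s * ?n + s * ?n')"
    using b s(1) unfolding s_def[symmetric] s(2) by (simp add: algebra_simps)
  then have "cmod (g z) \<le> 1 / sqrt (c - a) * ?n + sqrt (c - a) * ?n'"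
    using s(1) unfolding s_def[symmetric] by (subst (asm) mult_le_cancel_left_pos) auto
  also have "\<dots> \<le> sobolev_const a c * (?n + ?n')"
  proof -
    have "0 \<le> t * ?n'" "0 \<le> sqrt (c - a) * ?n" if "t \<ge> 0" for t using n ac that by auto
    from this[of "1 / sqrt (c - a)"] show ?thesis
      using ac unfolding sobolev_const_def distrib_left distrib_right by simp
  qed
  finally show ?thesis .
qed

context
  fixes a c :: real
  assumes ac: "a < c"
begin

lemma zd_Suc_eq:
  "(zd a c g r has_vector_derivative D) (at z within {a..c}) \<Longrightarrow> z \<in> {a..c} \<Longrightarrow> zd a c g (Suc r) z = D"
  using vector_derivative_within_closed_interval[OF ac] by simp

text \<open>Below the top order the next derivative is continuous, so a classical derivative exists
  at every point. At the top order this holds only almost everywhere, which is why many facts below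
  come in a pointwise and an almost-everywhere version.\<close>

lemma zd_has_derivative:
  assumes "Hn1 a c n g" "Suc r < n" "z \<in> {a..c}"
  shows "(zd a c g r has_vector_derivative zd a c g (Suc r) z) (at z within {a..c})"
  using wd_derivative_cont[OF Hn1_wd[OF assms(1)] Hn1_cont[OF assms(1,2)] assms(3)] assms(2) by simp

lemma zd_lin_comb:
  assumes f: "Hn1 a c n f" and g: "Hn1 a c n g" and r: "r < n" and z: "z \<in> {a..c}"
  shows "zd a c (\<lambda>z. f z + s *\<^sub>R g z) r z = zd a c f r z + s *\<^sub>R zd a c g r z"
  using r z
proof (induction r arbitrary: z)
  case (Suc r)
  have "((\<lambda>z. zd a c f r z + s *\<^sub>R zd a c g r z) has_vector_derivative zd a c f (Suc r) z + s *\<^sub>R zd a c g (Suc r) z) (at z within {a..c})"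
    using has_vector_derivative_scaleR[OF DERIV_const zd_has_derivative[OF g Suc.prems], of s]
    by (intro has_vector_derivative_add zd_has_derivative[OF f Suc.prems]) simp
  then have "(zd a c (\<lambda>z. f z + s *\<^sub>R g z) r has_vector_derivative zd a c f (Suc r) z + s *\<^sub>R zd a c g (Suc r) z) (at z within {a..c})"
    by (rule has_vector_derivative_transform[rotated -1]) (use Suc in auto)
  then show ?case by (rule zd_Suc_eq) (rule Suc.prems)
qed simp

text \<open>At the top order linearity can fail where the lower derivative of f or g is not
  differentiable, since \<open>vector_derivative\<close> then returns a default value.\<close>

lemma zd_lin_comb_AE:
  assumes f: "Hn1 a c n f" and g: "Hn1 a c n g" and r: "r \<le> n"
  shows "AE z in mI a c. zd a c (\<lambda>z. f z + s *\<^sub>R g z) r z = zd a c f r z + s *\<^sub>R zd a c g r z"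
proof (cases r)
  case (Suc q)
  then have q: "q < n" using r by simp
  have "AE z in mI a c. z \<in> {a..c}" by (rule AE_I2) simp
  with wd_derivative_AE[OF Hn1_wd[OF f q]] wd_derivative_AE[OF Hn1_wd[OF g q]] show ?thesis
    unfolding Suc
  proof eventually_elim
    case (elim z)
    have "((\<lambda>z. zd a c f q z + s *\<^sub>R zd a c g q z) has_vector_derivative zd a c f (Suc q) z + s *\<^sub>R zd a c g (Suc q) z) (at z within {a..c})"
      using has_vector_derivative_scaleR[OF DERIV_const elim(2), of s]
      by (intro has_vector_derivative_add elim(1)) simp
    then have "(zd a c (\<lambda>z. f z + s *\<^sub>R g z) q has_vector_derivative zd a c f (Suc q) z + s *\<^sub>R zd a c g (Suc q) z) (at z within {a..c})"
      by (rule has_vector_derivative_transform[rotated -1]) (use elim zd_lin_comb[OF f g q] in auto)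
    then show ?case by (rule zd_Suc_eq) (rule elim)
  qed
qed simp

section \<open>Measurability of pointwise derivatives\<close>

lemma rational_seq:
  assumes y: "y \<in> {a..c}"
  obtains q where "\<And>n::nat. q n \<in> \<rat> \<inter> {a..c}" "q \<longlonglongrightarrow> y"
proof -
  have "\<exists>q\<in>\<rat>. max a (y - inverse (real (Suc n))) < q \<and> q < min c (y + inverse (real (Suc n)))" for n
  proof (rule Rats_dense_in_real)
    define e where "e = inverse (real (Suc n))"
    have "0 < e" unfolding e_def by simp
    then show "max a (y - inverse (real (Suc n))) < min c (y + inverse (real (Suc n)))"
      using y ac unfolding e_def[symmetric] by auto
  qed
  then obtain q where q: "\<And>n. q n \<in> \<rat>" "\<And>n. max a (y - inverse (real (Suc n))) < q n" "\<And>n. q n < min c (y + inverse (real (Suc n)))"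
    by metis
  have "\<bar>q n - y\<bar> \<le> inverse (real (Suc n))" for n using q(2)[of n] q(3)[of n] by linarith
  then have "(\<lambda>n. q n - y) \<longlonglongrightarrow> 0"
    by (intro Lim_null_comparison[OF _ LIMSEQ_inverse_real_of_nat] always_eventually) auto
  then have "q \<longlonglongrightarrow> y" by (rule LIM_zero_cancel)
  moreover have "q n \<in> \<rat> \<inter> {a..c}" for n using q(1)[of n] q(2)[of n] q(3)[of n] by auto
  ultimately show ?thesis using that by blast
qed

text \<open>Tolerance and radius are restricted to reciprocals of integers and the comparison points
  to rationals; continuity of g extends the estimate from rational y to all y. The condition is
  thereby a countable combination of measurable ones.\<close>

lemma has_vector_derivative_rational_iff:
  fixes g :: "real \<Rightarrow> complex"
  assumes g: "continuous_on {a..c} g" and z: "z \<in> {a..c}"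
  shows "(g has_vector_derivative D) (at z within {a..c}) \<longleftrightarrow>
    (\<forall>i::nat. \<exists>m::nat. \<forall>y\<in>\<rat> \<inter> {a..c}. \<bar>y - z\<bar> < inverse (real (Suc m)) \<longrightarrow>
       norm (g y - g z - (y - z) *\<^sub>R D) \<le> inverse (real (Suc i)) * \<bar>y - z\<bar>)" (is "_ \<longleftrightarrow> ?R")
proof
  assume "(g has_vector_derivative D) (at z within {a..c})"
  then have h: "\<And>e. e > 0 \<Longrightarrow> \<exists>d>0. \<forall>y\<in>{a..c}. norm (y - z) < d \<longrightarrow> norm (g y - g z - (y - z) *\<^sub>R D) \<le> e * norm (y - z)"
    unfolding has_vector_derivative_def has_derivative_within_alt by blast
  show ?R
  proof
    fix i :: nat
    obtain d where d: "d > 0" "\<And>y. y \<in> {a..c} \<Longrightarrow> norm (y - z) < d \<Longrightarrow> norm (g y - g z - (y - z) *\<^sub>R D) \<le> inverse (real (Suc i)) * norm (y - z)"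
      using h[of "inverse (real (Suc i))"] by auto
    obtain m where "inverse (real (Suc m)) < d" using reals_Archimedean[OF d(1)] by blast
    then show "\<exists>m::nat. \<forall>y\<in>\<rat> \<inter> {a..c}. \<bar>y - z\<bar> < inverse (real (Suc m)) \<longrightarrow>
       norm (g y - g z - (y - z) *\<^sub>R D) \<le> inverse (real (Suc i)) * \<bar>y - z\<bar>"
      using d(2) by (intro exI[of _ m]) force
  qed
next
  assume R: ?R
  show "(g has_vector_derivative D) (at z within {a..c})"
    unfolding has_vector_derivative_def has_derivative_within_alt
  proof (intro conjI allI impI)
    show "bounded_linear (\<lambda>x. x *\<^sub>R D)" by (rule bounded_linear_scaleR_left)
    fix e :: real assume e: "0 < e"
    obtain i where i: "inverse (real (Suc i)) < e" using reals_Archimedean[OF e] by blast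
    obtain m where m: "\<And>y. y \<in> \<rat> \<inter> {a..c} \<Longrightarrow> \<bar>y - z\<bar> < inverse (real (Suc m)) \<Longrightarrow>
       norm (g y - g z - (y - z) *\<^sub>R D) \<le> inverse (real (Suc i)) * \<bar>y - z\<bar>" using R by blast
    show "\<exists>d>0. \<forall>y\<in>{a..c}. norm (y - z) < d \<longrightarrow> norm (g y - g z - (y - z) *\<^sub>R D) \<le> e * norm (y - z)"
    proof (intro exI[of _ "inverse (real (Suc m))"] conjI ballI impI)
      fix y assume y: "y \<in> {a..c}" "norm (y - z) < inverse (real (Suc m))"
      obtain q where q: "\<And>n::nat. q n \<in> \<rat> \<inter> {a..c}" "q \<longlonglongrightarrow> y" using rational_seq[OF y(1)] by blast
      have gq: "(\<lambda>n. g (q n)) \<longlonglongrightarrow> g y"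
        using continuous_on_tendsto_compose[OF g q(2) y(1)] q(1) by simp
      have "(\<lambda>n. \<bar>q n - z\<bar>) \<longlonglongrightarrow> \<bar>y - z\<bar>" by (intro tendsto_intros q)
      then have "\<forall>\<^sub>F n in sequentially. \<bar>q n - z\<bar> < inverse (real (Suc m))"
        by (rule order_tendstoD(2)) (use y in simp)
      then have "\<forall>\<^sub>F n in sequentially. norm (g (q n) - g z - (q n - z) *\<^sub>R D) \<le> inverse (real (Suc i)) * \<bar>q n - z\<bar>"
        by eventually_elim (rule m[OF q(1)])
      then have "norm (g y - g z - (y - z) *\<^sub>R D) \<le> inverse (real (Suc i)) * \<bar>y - z\<bar>"
        by (rule tendsto_le[OF sequentially_bot, rotated 2]) (intro tendsto_intros q gq)+
      also have "\<dots> \<le> e * \<bar>y - z\<bar>" using i by (intro mult_right_mono) auto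
      finally show "norm (g y - g z - (y - z) *\<^sub>R D) \<le> e * norm (y - z)" by simp
    qed simp
  qed
qed

text \<open>A measurable choice of points of the interval that tend to z and differ from it: to the
  right of z in the left half, to the left of z in the right half.\<close>

definition step :: "nat \<Rightarrow> real \<Rightarrow> real" where
  "step n z = z + (if z < (a + c) / 2 then 1 else -1) * ((c - a) / 2 * inverse (real (Suc n)))"

lemma step_mem: assumes z: "z \<in> {a..c}" shows "step n z \<in> {a..c}" "step n z \<noteq> z"
proof -
  define w where "w = (c - a) / 2 * inverse (real (Suc n))"
  have "w \<le> (c - a) / 2 * 1"
    unfolding w_def using ac by (intro mult_left_mono) (auto simp: inverse_le_1_iff)
  moreover have "0 < w" unfolding w_def using ac by simp
  ultimately show "step n z \<in> {a..c}" "step n z \<noteq> z" using z unfolding step_def w_def[symmetric] by auto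
qed

lemma step_tendsto: "(\<lambda>n. step n z) \<longlonglongrightarrow> z"
  unfolding step_def by (rule tendsto_eq_intros LIMSEQ_inverse_real_of_nat refl)+ simp

lemma measurable_step: "step n \<in> borel_measurable (mI a c)"
  unfolding step_def by measurable

lemma derivative_eq_lim:
  fixes g :: "real \<Rightarrow> complex"
  assumes d: "(g has_vector_derivative D) (at z within {a..c})" and z: "z \<in> {a..c}"
  shows "lim (\<lambda>n. (g (step n z) - g z) /\<^sub>R (step n z - z)) = D"
proof -
  have "(\<lambda>n. (g (step n z) - g z) /\<^sub>R (step n z - z)) \<longlonglongrightarrow> D"
  proof (rule LIMSEQ_I)
    fix e :: real assume "0 < e"
    then have e: "0 < e/2" by simp
    obtain \<eta> where \<eta>: "\<eta> > 0" "\<And>y. y \<in> {a..c} \<Longrightarrow> norm (y - z) < \<eta> \<Longrightarrow> norm (g y - g z - (y - z) *\<^sub>R D) \<le> e/2 * norm (y - z)"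
      using d e unfolding has_vector_derivative_def has_derivative_within_alt by blast
    obtain N where N: "\<And>n. n \<ge> N \<Longrightarrow> norm (step n z - z) < \<eta>"
      using LIMSEQ_D[OF step_tendsto \<eta>(1)] by blast
    have "norm ((g (step n z) - g z) /\<^sub>R (step n z - z) - D) < e" if n: "n \<ge> N" for n
    proof -
      define t where "t = step n z - z"
      have t: "t \<noteq> 0" using step_mem(2)[OF z] unfolding t_def by simp
      have "(g (step n z) - g z) /\<^sub>R t - D = (g (step n z) - g z - t *\<^sub>R D) /\<^sub>R t"
        using t by (simp add: scaleR_diff_right)
      then have "norm ((g (step n z) - g z) /\<^sub>R t - D) = norm (g (step n z) - g z - t *\<^sub>R D) / \<bar>t\<bar>"
        by (simp add: divide_inverse_commute)
      also have "\<dots> \<le> e/2" using \<eta>(2)[OF step_mem(1)[OF z] N[OF n]] t unfolding t_def[symmetric] by (simp add: field_simps)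
      finally show ?thesis using e unfolding t_def by simp
    qed
    then show "\<exists>N. \<forall>n\<ge>N. norm ((g (step n z) - g z) /\<^sub>R (step n z - z) - D) < e" by blast
  qed
  then show ?thesis by (rule limI)
qed

text \<open>Where no derivative exists, \<^const>\<open>vector_derivative\<close> is the fixed value \<open>SOME D. False\<close>, so it
suffices to show that the set of differentiability is measurable; by continuity this can be tested with countably
many increments.\<close>

lemma measurable_vector_derivative:
  fixes g :: "'k \<Rightarrow> real \<Rightarrow> complex"
  assumes gm: "(\<lambda>x. g (fst x) (snd x)) \<in> borel_measurable (M \<Otimes>\<^sub>M mI a c)"
    and gc: "\<And>k. k \<in> space M \<Longrightarrow> continuous_on {a..c} (g k)"
  shows "(\<lambda>x. vector_derivative (g (fst x)) (at (snd x) within {a..c})) \<in> borel_measurable (M \<Otimes>\<^sub>M mI a c)"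
proof -
  let ?M = "M \<Otimes>\<^sub>M mI a c"
  note [measurable] = gm
  have snd_m[measurable]: "snd \<in> borel_measurable ?M"
    using measurable_compose[OF measurable_snd measurable_ident_mI] by (simp add: comp_def)
  have gs[measurable]: "(\<lambda>x. g (fst x) (step n (snd x))) \<in> borel_measurable ?M" for n
  proof -
    have "(\<lambda>x. step n (snd x)) \<in> measurable ?M (mI a c)"
      by (rule measurable_into_mI[OF measurable_compose[OF measurable_snd measurable_step]])
         (use step_mem in \<open>auto simp: space_pair_measure simp del: atLeastAtMost_iff\<close>)
    then have "(\<lambda>x. (fst x, step n (snd x))) \<in> measurable ?M ?M"
      by (intro measurable_Pair measurable_fst)
    from measurable_compose[OF this gm] show ?thesis by simp
  qed
  have gy[measurable]: "(\<lambda>x. g (fst x) y) \<in> borel_measurable ?M" if y: "y \<in> {a..c}" for y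
  proof -
    have "(\<lambda>x. (fst x, y)) \<in> measurable ?M ?M"
      by (intro measurable_Pair measurable_fst measurable_into_mI) (use y in auto)
    from measurable_compose[OF this gm] show ?thesis by simp
  qed
  have sm[measurable]: "(\<lambda>x. step n (snd x)) \<in> borel_measurable ?M" for n by (rule measurable_compose[OF measurable_snd measurable_step])
  \<comment> \<open>The only candidate for the derivative, measurable as a limit of difference
    quotients along \<open>step\<close>. Where the quotients diverge, \<open>lim\<close> still has
    some value; \<open>E\<close> decides whether the candidate really is a derivative.\<close>
  define Lm where "Lm x = lim (\<lambda>n. (g (fst x) (step n (snd x)) - g (fst x) (snd x)) /\<^sub>R (step n (snd x) - snd x))" for x
  have Lm_m[measurable]: "Lm \<in> borel_measurable ?M"
    unfolding Lm_def by (rule borel_measurable_lim_metric) measurable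
  define E where "E x \<longleftrightarrow> (\<forall>i::nat. \<exists>m::nat. \<forall>y\<in>\<rat> \<inter> {a..c}. \<bar>y - snd x\<bar> < inverse (real (Suc m)) \<longrightarrow>
       norm (g (fst x) y - g (fst x) (snd x) - (y - snd x) *\<^sub>R Lm x) \<le> inverse (real (Suc i)) * \<bar>y - snd x\<bar>)" for x
  have E_m[measurable]: "Measurable.pred ?M E"
    unfolding E_def
  proof (intro pred_intros_countable(1,2))
    fix i m :: nat
    show "Measurable.pred ?M (\<lambda>x. \<forall>y\<in>\<rat> \<inter> {a..c}. \<bar>y - snd x\<bar> < inverse (real (Suc m)) \<longrightarrow>
         norm (g (fst x) y - g (fst x) (snd x) - (y - snd x) *\<^sub>R Lm x) \<le> inverse (real (Suc i)) * \<bar>y - snd x\<bar>)"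
      (is "Measurable.pred ?M (\<lambda>x. \<forall>y\<in>\<rat> \<inter> {a..c}. ?P y x)")
    proof -
      have "Measurable.pred ?M (\<lambda>x. real_of_rat q \<in> {a..c} \<longrightarrow> ?P (real_of_rat q) x)" for q
      proof (cases "real_of_rat q \<in> {a..c}")
        case True
        note [measurable] = gy[OF True]
        show ?thesis using True by simp
      qed simp
      then have "Measurable.pred ?M (\<lambda>x. \<forall>q. real_of_rat q \<in> {a..c} \<longrightarrow> ?P (real_of_rat q) x)"
        by (rule pred_intros_countable(1))
      moreover have "(\<forall>y\<in>\<rat> \<inter> {a..c}. ?P y x) \<longleftrightarrow> (\<forall>q. real_of_rat q \<in> {a..c} \<longrightarrow> ?P (real_of_rat q) x)" for x
        unfolding Rats_def by blast
      ultimately show ?thesis by presburger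
    qed
  qed
  have eq: "vector_derivative (g (fst x)) (at (snd x) within {a..c}) = (if E x then Lm x else (SOME D. False))"
    if x: "x \<in> space ?M" for x
  proof -
    have k: "fst x \<in> space M" and z: "snd x \<in> {a..c}" using x by (auto simp: space_pair_measure)
    note iff = has_vector_derivative_rational_iff[OF gc[OF k] z]
    show ?thesis
    proof (cases "E x")
      case True
      then have "(g (fst x) has_vector_derivative Lm x) (at (snd x) within {a..c})" unfolding iff E_def by simp
      then show ?thesis using vector_derivative_within_closed_interval[OF ac z] True by simp
    next
      case False
      have "\<not> (g (fst x) has_vector_derivative D) (at (snd x) within {a..c})" for D
      proof
        assume D: "(g (fst x) has_vector_derivative D) (at (snd x) within {a..c})"
        then have "Lm x = D" unfolding Lm_def using derivative_eq_lim[OF D z] by simp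
        then show False using D False unfolding iff E_def by simp
      qed
      then show ?thesis using False by (simp add: vector_derivative_def)
    qed
  qed
  have "(\<lambda>x. if E x then Lm x else (SOME D. False)) \<in> borel_measurable ?M" by measurable
  moreover have "(\<lambda>x. vector_derivative (g (fst x)) (at (snd x) within {a..c})) \<in> borel_measurable ?M
      \<longleftrightarrow> (\<lambda>x. if E x then Lm x else (SOME D. False)) \<in> borel_measurable ?M"
    by (rule measurable_cong) (rule eq)
  ultimately show ?thesis by blast
qed

text \<open>The case without parameter, with \<open>mI 0 0\<close> as a dummy parameter
  space.\<close>

lemma measurable_vector_derivative1:
  fixes g :: "real \<Rightarrow> complex"
  assumes "continuous_on {a..c} g"
  shows "(\<lambda>z. vector_derivative g (at z within {a..c})) \<in> borel_measurable (mI a c)"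
proof -
  have "(\<lambda>x. g (snd x)) \<in> borel_measurable (mI 0 0 \<Otimes>\<^sub>M mI a c)"
    using measurable_mI_continuous[OF assms] by measurable
  from measurable_vector_derivative[of "\<lambda>k. g", OF this assms]
  have m: "(\<lambda>x. vector_derivative g (at (snd x) within {a..c})) \<in> borel_measurable (mI 0 0 \<Otimes>\<^sub>M mI a c)" by simp
  have "(\<lambda>z. (0::real, z)) \<in> measurable (mI a c) (mI 0 0 \<Otimes>\<^sub>M mI a c)"
    by (intro measurable_Pair measurable_ident measurable_const) auto
  from measurable_compose[OF this m] show ?thesis by simp
qed

text \<open>The top derivative of the combination agrees with the combination of top derivatives
  only off a null set, and equality almost everywhere does not transfer Borel measurability. Hence
  measurability is taken from \<open>measurable_vector_derivative1\<close>.\<close>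

lemma Hn1_lin_comb:
  assumes f: "Hn1 a c n f" and g: "Hn1 a c n g"
  shows "Hn1 a c n (\<lambda>z. f z + s *\<^sub>R g z)" (is "Hn1 a c n ?h")
proof -
  have m: "zd a c ?h (Suc r) \<in> borel_measurable (mI a c)" if r: "r < n" for r
  proof -
    have "continuous_on {a..c} (zd a c ?h r)"
      using continuous_on_add[OF Hn1_cont[OF f r] continuous_on_scaleR[OF continuous_on_const Hn1_cont[OF g r]], of s]
      by (rule continuous_on_eq) (simp add: zd_lin_comb[OF f g r])
    then show ?thesis using measurable_vector_derivative1 by simp
  qed
  have "wd a c (zd a c ?h r) (zd a c ?h (Suc r))" if r: "r < n" for r
  proof -
    have lc: "(\<lambda>z. zd a c f (Suc r) z + s *\<^sub>R zd a c g (Suc r) z) \<in> L2 (mI a c)"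
      using r by (intro L2_add L2_scale Hn1_L2[OF f] Hn1_L2[OF g]) auto
    have ae: "AE z in mI a c. zd a c ?h (Suc r) z = zd a c f (Suc r) z + s *\<^sub>R zd a c g (Suc r) z"
      using r by (intro zd_lin_comb_AE[OF f g]) auto
    have L: "zd a c ?h (Suc r) \<in> L2 (mI a c)"
      by (rule L2_AE_cong[OF lc m[OF r]]) (use ae in eventually_elim, simp)
    have "zd a c ?h r z = zd a c ?h r a + indef a (zd a c ?h (Suc r)) z" if z: "z \<in> {a..c}" for z
    proof -
      have a: "a \<in> {a..c}" using z by auto
      have "indef a (zd a c ?h (Suc r)) z = indef a (\<lambda>z. zd a c f (Suc r) z + s *\<^sub>R zd a c g (Suc r) z) z"
        by (rule indef_cong_AE[OF ae m[OF r] L2_measurable[OF lc] z])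
      also have "\<dots> = indef a (zd a c f (Suc r)) z + s *\<^sub>R indef a (zd a c g (Suc r)) z"
        using r by (intro indef_add[OF Hn1_L2[OF f] Hn1_L2[OF g] z]) auto
      finally have I: "indef a (zd a c ?h (Suc r)) z = indef a (zd a c f (Suc r)) z + s *\<^sub>R indef a (zd a c g (Suc r)) z" .
      show ?thesis
        unfolding zd_lin_comb[OF f g r z] zd_lin_comb[OF f g r a] I
          wd_eq[OF Hn1_wd[OF f r] z, symmetric] wd_eq[OF Hn1_wd[OF g r] z, symmetric]
        by (simp only: scaleR_add_right add_ac)
    qed
    then show ?thesis using L unfolding wd_iff by blast
  qed
  then show ?thesis unfolding Hn1_iff using L2_add[OF Hn1_L2[OF f, of 0] L2_scale[OF Hn1_L2[OF g, of 0]], of s] by simp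
qed

lemma zd_zero: "z \<in> {a..c} \<Longrightarrow> zd a c (\<lambda>z. 0) r z = 0"
proof (induction r arbitrary: z)
  case (Suc r)
  have "(zd a c (\<lambda>z. 0) r has_vector_derivative 0) (at z within {a..c})"
    by (rule has_vector_derivative_transform[OF Suc.prems _ has_vector_derivative_const]) (use Suc in simp)
  then show ?case using zd_Suc_eq Suc.prems by blast
qed simp

lemma Hn1_zero: "Hn1 a c n (\<lambda>z. 0)"
proof -
  have L: "zd a c (\<lambda>z. 0) r \<in> L2 (mI a c)" for r
    by (rule L2_continuous) (rule continuous_on_eq[OF continuous_on_const[of _ 0]], simp add: zd_zero)
  have "indef a (zd a c (\<lambda>z. 0) r) z = 0" if z: "z \<in> {a..c}" for r z
  proof -
    have "AE t in mI a c. zd a c (\<lambda>z. 0) r t = 0" by (rule AE_I2) (simp add: zd_zero)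
    then have "indef a (zd a c (\<lambda>z. 0) r) z = indef a (\<lambda>z. 0) z"
      using L by (intro indef_cong_AE[OF _ _ _ z]) (auto simp: L2_def)
    then show ?thesis by (simp add: indef_def)
  qed
  then show ?thesis using L L[of 0] ac unfolding Hn1_iff wd_iff by (auto simp: zd_zero simp del: zd.simps(2))
qed

section \<open>Twice integrated functions\<close>

lemma indef_L2: "f \<in> L2 (mI a c) \<Longrightarrow> indef a f \<in> L2 (mI a c)"
  by (rule L2_continuous[OF indef_continuous])

lemma indef_nrm: assumes f: "f \<in> L2 (mI a c)" shows "L2.nrm (mI a c) (indef a f) \<le> (c - a) * L2.nrm (mI a c) f"
proof -
  have "L2.nrm (mI a c) (indef a f) \<le> sqrt (c - a) * (sqrt (c - a) * L2.nrm (mI a c) f)"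
    using L2.nrm_ge0[OF f] ac by (intro L2_nrm_bounded indef_L2 f indef_bound) auto
  also have "\<dots> = (c - a) * L2.nrm (mI a c) f" using ac by (simp flip: mult.assoc)
  finally show ?thesis .
qed

text \<open>Constructs the function with prescribed second derivative u and zero Cauchy data at the
  left end; limits in the completeness proof are built this way. The first derivative is classical
  everywhere, the second agrees with u almost everywhere.\<close>

lemma double_indef:
  assumes u: "u \<in> L2 (mI a c)"
  defines "f \<equiv> indef a (indef a u)"
  shows "z \<in> {a..c} \<Longrightarrow> zd a c f 1 z = indef a u z" "AE z in mI a c. zd a c f 2 z = u z" "Hn1 a c 2 f"
proof -
  have d1: "zd a c f 1 z = indef a u z" if z: "z \<in> {a..c}" for z
    using zd_Suc_eq[of f 0] indef_has_derivative_continuous[OF indef_continuous[OF u] z indef_L2[OF u]] z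
    unfolding f_def by simp
  then show "z \<in> {a..c} \<Longrightarrow> zd a c f 1 z = indef a u z" .
  have "AE z in mI a c. z \<in> {a..c}" by (rule AE_I2) simp
  with indef_has_derivative_AE[OF u] show ae: "AE z in mI a c. zd a c f 2 z = u z"
  proof eventually_elim
    case (elim z)
    have "(zd a c f 1 has_vector_derivative u z) (at z within {a..c})"
      by (rule has_vector_derivative_transform[OF elim(2) _ elim(1)]) (rule d1)
    then show ?case using zd_Suc_eq[OF _ elim(2), of f 1] by (simp add: numeral_2_eq_2)
  qed
  have c1: "continuous_on {a..c} (zd a c f 1)"
    using indef_continuous[OF u] by (rule continuous_on_eq) (simp only: d1)
  have m2: "zd a c f 2 \<in> borel_measurable (mI a c)"
    using measurable_vector_derivative1[OF c1] by (simp add: numeral_2_eq_2)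
  have L1: "zd a c f 1 \<in> L2 (mI a c)" using L2_continuous[OF c1] .
  have L2': "zd a c f 2 \<in> L2 (mI a c)"
    by (rule L2_AE_cong[OF u m2]) (use ae in eventually_elim, simp)
  have "wd a c f (zd a c f 1)"
    unfolding wd_iff
  proof (intro conjI ballI L1)
    fix z assume z: "z \<in> {a..c}"
    have "indef a (zd a c f 1) z = indef a (indef a u) z"
      by (rule indef_cong_AE[OF AE_I2 L2_measurable[OF L1] L2_measurable[OF indef_L2[OF u]] z]) (simp only: space_mI d1)
    then show "f z = f a + indef a (zd a c f 1) z" by (simp add: f_def)
  qed
  moreover have "wd a c (zd a c f 1) (zd a c f 2)"
    unfolding wd_iff
  proof (intro conjI ballI L2')
    fix z assume z: "z \<in> {a..c}"
    have a: "a \<in> {a..c}" using ac by simp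
    have "indef a (zd a c f 2) z = indef a u z"
      by (rule indef_cong_AE[OF ae m2 L2_measurable[OF u] z])
    then show "zd a c f 1 z = zd a c f 1 a + indef a (zd a c f 2) z" unfolding d1[OF z] d1[OF a] by simp
  qed
  moreover have "f \<in> L2 (mI a c)" unfolding f_def by (intro indef_L2 u)
  ultimately show "Hn1 a c 2 f"
    unfolding Hn1_iff by (auto simp: numeral_2_eq_2 less_Suc_eq simp del: zd.simps(2))
qed

text \<open>Converse of \<open>double_indef\<close>: zero Cauchy data at the left end make a
  function recoverable from its second derivative.\<close>

lemma Hn1_eq_indef:
  assumes f: "Hn1 a c 2 f" and 0: "f a = 0" "zd a c f 1 a = 0" and z: "z \<in> {a..c}"
  shows "zd a c f 1 z = indef a (zd a c f 2) z" "f z = indef a (indef a (zd a c f 2)) z"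
proof -
  have 1: "zd a c f 1 z = indef a (zd a c f 2) z" if "z \<in> {a..c}" for z
    using wd_eq[OF Hn1_wd[OF f, of 1] that] 0 by (simp add: numeral_2_eq_2 del: zd.simps(2))
  then show "zd a c f 1 z = indef a (zd a c f 2) z" using z .
  have "f z = indef a (zd a c f 1) z"
    using wd_eq[OF Hn1_wd[OF f, of 0] z] 0 by simp
  also have "\<dots> = indef a (indef a (zd a c f 2)) z"
    using Hn1_L2[OF f, of 1] Hn1_L2[OF f, of 2] indef_L2 1
    by (intro indef_cong_AE[OF AE_I2 _ _ z]) (auto simp: L2_def simp del: zd.simps(2))
  finally show "f z = indef a (indef a (zd a c f 2)) z" .
qed

end

section \<open>The semidiscrete spaces\<close>

text \<open>Weighted L^2 products pulled back along maps that are linear almost everywhere. With the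
  derivatives at the grid points this gives the semidiscrete Sobolev spaces, with multiplication by
  the Carleman weight the target space of the operator.\<close>

lemma semi_inner_family:
  fixes S :: "'a::real_vector set" and T :: "'i \<Rightarrow> 'a \<Rightarrow> 'm \<Rightarrow> complex"
  assumes S: "subspace S" and w: "0 \<le> w"
    and T: "\<And>i f. i \<in> I \<Longrightarrow> f \<in> S \<Longrightarrow> T i f \<in> L2 M"
    and add: "\<And>i f g. i \<in> I \<Longrightarrow> f \<in> S \<Longrightarrow> g \<in> S \<Longrightarrow> AE x in M. T i (f + g) x = T i f x + T i g x"
    and scale: "\<And>i a f. i \<in> I \<Longrightarrow> f \<in> S \<Longrightarrow> AE x in M. T i (a *\<^sub>R f) x = a *\<^sub>R T i f x"
  shows "semi_inner S (\<lambda>f g. \<Sum>i\<in>I. w * ip2 M (T i f) (T i g))"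
proof
  show "subspace S" by fact
  fix x y z :: 'a and c :: real
  assume x: "x \<in> S"
  { assume y: "y \<in> S" and z: "z \<in> S"
    have "ip2 M (T i (x + y)) (T i z) = ip2 M (T i x) (T i z) + ip2 M (T i y) (T i z)" if i: "i \<in> I" for i
    proof -
      have "L2.eqv M (T i (x + y)) (T i x + T i y)"
        using T[OF i] x y subspace_add[OF S x y] add[OF i x y]
        by (intro L2_eqv_AE L2.S_add) auto
      from L2.ip_eqv(1)[OF this T[OF i z]] show ?thesis
        using T[OF i] x y z by (simp add: L2.ip_add)
    qed
    then show "(\<Sum>i\<in>I. w * ip2 M (T i (x + y)) (T i z)) = (\<Sum>i\<in>I. w * ip2 M (T i x) (T i z)) + (\<Sum>i\<in>I. w * ip2 M (T i y) (T i z))"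
      by (simp add: sum.distrib distrib_left) }
  { assume z: "z \<in> S"
    have "ip2 M (T i (c *\<^sub>R x)) (T i z) = c * ip2 M (T i x) (T i z)" if i: "i \<in> I" for i
    proof -
      have "L2.eqv M (T i (c *\<^sub>R x)) (c *\<^sub>R T i x)"
        using T[OF i] x subspace_scale[OF S x] scale[OF i x]
        by (intro L2_eqv_AE L2.S_scale) (auto simp: scaleR_fun_def)
      from L2.ip_eqv(1)[OF this T[OF i z]] show ?thesis
        using T[OF i] x z by (simp add: L2.ip_scale)
    qed
    then show "(\<Sum>i\<in>I. w * ip2 M (T i (c *\<^sub>R x)) (T i z)) = c * (\<Sum>i\<in>I. w * ip2 M (T i x) (T i z))"
      by (simp add: sum_distrib_left mult.left_commute) }
  { assume y: "y \<in> S"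
    show "(\<Sum>i\<in>I. w * ip2 M (T i x) (T i y)) = (\<Sum>i\<in>I. w * ip2 M (T i y) (T i x))"
      using L2.ip_sym[OF T T] x y by (intro sum.cong) auto }
  show "0 \<le> (\<Sum>i\<in>I. w * ip2 M (T i x) (T i x))"
    using w L2.ip_nonneg[OF T[OF _ x]] by (intro sum_nonneg mult_nonneg_nonneg) auto
qed

section \<open>Functions of k and z on a rectangle\<close>

locale geometry =
  fixes G :: geom
  assumes ok: "geom_ok G"
begin

abbreviation "a \<equiv> - gxi G"
abbreviation "c \<equiv> gd G"
abbreviation "kl \<equiv> gkl G"
abbreviation "ku \<equiv> gku G"
abbreviation "MK \<equiv> mI kl ku"
abbreviation "MZ \<equiv> mI a c"
abbreviation "M2 \<equiv> MK \<Otimes>\<^sub>M MZ"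

lemma ac: "a < c" and kk: "kl < ku" and kl: "0 < kl" and h: "0 < gh G" and N2: "2 \<le> gN G"
  using ok unfolding geom_ok_def by auto

definition D :: "sdk \<Rightarrow> nat \<Rightarrow> nat \<Rightarrow> nat \<Rightarrow> real \<times> real \<Rightarrow> complex" where
  "D f j s r = (\<lambda>x. dz G (f (fst x) j s) r (snd x))"

definition idx :: "nat \<Rightarrow> (nat \<times> nat \<times> nat) set" where
  "idx n = {..gN G} \<times> {..gN G} \<times> {..n}"

definition Dt :: "nat \<times> nat \<times> nat \<Rightarrow> sdk \<Rightarrow> real \<times> real \<Rightarrow> complex" where
  "Dt = (\<lambda>(j,s,r) f. D f j s r)"

text \<open>The same product as \<open>hk_inner\<close>, but with integrals over the rectangle
  instead of iterated ones; Fubini's theorem identifies the two. In this form it is an instance of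
  \<open>semi_inner_family\<close>.\<close>

definition hkip :: "nat \<Rightarrow> sdk \<Rightarrow> sdk \<Rightarrow> real" where
  "hkip n f g = (\<Sum>i\<in>idx n. (gh G)\<^sup>2 * ip2 M2 (Dt i f) (Dt i g))"

lemma sum_idx: "(\<Sum>j\<le>gN G. \<Sum>s\<le>gN G. \<Sum>r\<le>n. F j s r) = (\<Sum>(j,s,r)\<in>idx n. F j s r)"
  unfolding idx_def by (simp add: sum.cartesian_product)

lemma space_M2: "space M2 = {kl..ku} \<times> {a..c}"
  by (simp add: space_pair_measure)

text \<open>Translates between two encodings of joint measurability: extension by zero to the plane,
  as in \<open>Hk\<close>, and measurability on the product of the two interval measures.\<close>

lemma measurable_M2_iff:
  fixes g :: "real \<Rightarrow> real \<Rightarrow> complex"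
  shows "(\<lambda>(k, z). indicator ({kl..ku} \<times> {a..c}) (k, z) *\<^sub>R g k z) \<in> borel_measurable borel
    \<longleftrightarrow> (\<lambda>x. g (fst x) (snd x)) \<in> borel_measurable M2"
proof -
  let ?B = "restrict_space borel ({kl..ku} \<times> {a..c}) :: (real \<times> real) measure"
  have KZ: "{kl..ku} \<times> {a..c} \<in> sets (borel :: (real \<times> real) measure)"
    by (intro borel_closed closed_Times) auto
  have "(\<lambda>x. (fst x, snd x)) \<in> borel_measurable M2"
    by (intro borel_measurable_Pair measurable_compose[OF measurable_fst measurable_ident_mI] measurable_compose[OF measurable_snd measurable_ident_mI])
  then have 1: "(\<lambda>x. x) \<in> measurable M2 ?B"
    by (intro measurable_restrict_space2) (auto simp: space_M2)
  have b: "fst \<in> borel_measurable ?B" "snd \<in> borel_measurable ?B"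
    by (intro measurable_restrict_space1 borel_measurable_continuous_onI continuous_intros)+
  have "(\<lambda>x. (fst x, snd x)) \<in> measurable ?B M2"
    by (intro measurable_Pair measurable_into_mI b) (auto simp: space_restrict_space)
  then have 2: "(\<lambda>x. x) \<in> measurable ?B M2" by simp
  have "(\<lambda>(k, z). indicator ({kl..ku} \<times> {a..c}) (k, z) *\<^sub>R g k z) \<in> borel_measurable borel
     \<longleftrightarrow> (\<lambda>x. g (fst x) (snd x)) \<in> borel_measurable ?B"
    using KZ by (subst borel_measurable_restrict_space_iff) (auto simp: case_prod_unfold)
  also have "\<dots> \<longleftrightarrow> (\<lambda>x. g (fst x) (snd x)) \<in> borel_measurable M2"
    using measurable_compose[OF 1] measurable_compose[OF 2] by blast
  finally show ?thesis .
qed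

lemma Hsd_L2: "Hsd G n u \<Longrightarrow> j \<le> gN G \<Longrightarrow> s \<le> gN G \<Longrightarrow> r \<le> n \<Longrightarrow> dz G (u j s) r \<in> L2 MZ"
  unfolding Hsd_def dz_def by (blast intro: Hn1_L2)

lemma Hk_Hsd: "Hk G n f \<Longrightarrow> k \<in> {kl..ku} \<Longrightarrow> Hsd G n (f k)"
  by (simp add: Hk_def)

lemma Hk_Hn1: "Hk G n f \<Longrightarrow> k \<in> {kl..ku} \<Longrightarrow> j \<le> gN G \<Longrightarrow> s \<le> gN G \<Longrightarrow> Hn1 a c n (f k j s)"
  by (simp add: Hk_def Hsd_def)

lemma sd_nsq_eq: "sd_nsq G n u = (\<Sum>(j,s,r)\<in>idx n. (gh G)\<^sup>2 * (\<integral>z. (cmod (dz G (u j s) r z))\<^sup>2 \<partial>MZ))"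
  unfolding sd_nsq_def sum_idx integral_mI ..

lemma nn_integral_slices:
  assumes m: "g \<in> borel_measurable M2" and s: "\<And>k. k \<in> {kl..ku} \<Longrightarrow> (\<lambda>z. g (k, z)) \<in> L2 MZ"
  shows "(\<integral>\<^sup>+x. ennreal ((cmod (g x))\<^sup>2) \<partial>M2) = (\<integral>\<^sup>+k. ennreal (\<integral>z. (cmod (g (k, z)))\<^sup>2 \<partial>MZ) \<partial>MK)"
proof -
  have "(\<integral>\<^sup>+x. ennreal ((cmod (g x))\<^sup>2) \<partial>M2) = (\<integral>\<^sup>+k. \<integral>\<^sup>+z. ennreal ((cmod (g (k, z)))\<^sup>2) \<partial>MZ \<partial>MK)"
    using m by (subst mI.nn_integral_fst[symmetric]) auto
  also have "\<dots> = (\<integral>\<^sup>+k. ennreal (\<integral>z. (cmod (g (k, z)))\<^sup>2 \<partial>MZ) \<partial>MK)"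
    using L2_sq[OF s] by (intro nn_integral_cong nn_integral_eq_integral) auto
  finally show ?thesis .
qed

text \<open>By Tonelli the integral over the rectangle is the k-integral of slice integrals, and
  each slice is bounded by \<open>sd_nsq\<close> divided by the mesh weight, which is integrable in
  k.\<close>

lemma Hk_D:
  assumes f: "Hk G n f" and j: "j \<le> gN G" and s: "s \<le> gN G" and r: "r \<le> n"
  shows "D f j s r \<in> L2 M2"
proof -
  have m: "D f j s r \<in> borel_measurable M2"
    using f j s r unfolding Hk_def D_def measurable_M2_iff by blast
  have sl: "(\<lambda>z. D f j s r (k, z)) \<in> L2 MZ" if "k \<in> {kl..ku}" for k
    using Hsd_L2[OF Hk_Hsd[OF f that] j s r] by (simp add: D_def)
  have int: "integrable MK (\<lambda>k. sd_nsq G n (f k))"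
    using f unfolding Hk_def integrable_mI by blast
  have le: "(\<integral>z. (cmod (D f j s r (k, z)))\<^sup>2 \<partial>MZ) \<le> sd_nsq G n (f k) / (gh G)\<^sup>2" for k
  proof -
    have "(case (j,s,r) of (j,s,r) \<Rightarrow> (gh G)\<^sup>2 * (\<integral>z. (cmod (dz G (f k j s) r z))\<^sup>2 \<partial>MZ)) \<le> sd_nsq G n (f k)"
      unfolding sd_nsq_eq using j s r
      by (intro member_le_sum) (auto simp: idx_def intro!: mult_nonneg_nonneg Bochner_Integration.integral_nonneg)
    then have "(gh G)\<^sup>2 * (\<integral>z. (cmod (D f j s r (k, z)))\<^sup>2 \<partial>MZ) \<le> sd_nsq G n (f k)" by (simp add: D_def)
    then show ?thesis using h by (simp add: field_simps)
  qed
  have nn: "0 \<le> sd_nsq G n (f k)" for k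
    unfolding sd_nsq_eq by (intro sum_nonneg) (auto intro!: mult_nonneg_nonneg Bochner_Integration.integral_nonneg)
  have "(\<integral>\<^sup>+x. ennreal ((cmod (D f j s r x))\<^sup>2) \<partial>M2) \<le> (\<integral>\<^sup>+k. ennreal (sd_nsq G n (f k) / (gh G)\<^sup>2) \<partial>MK)"
    by (subst nn_integral_slices[OF m]) (rule sl, use le in \<open>auto intro!: nn_integral_mono ennreal_leI\<close>)
  also have "\<dots> = ennreal (\<integral>k. sd_nsq G n (f k) / (gh G)\<^sup>2 \<partial>MK)"
    using int nn by (intro nn_integral_eq_integral) auto
  finally show ?thesis using nn by (intro L2_I_nn(1)[OF m]) (auto intro!: Bochner_Integration.integral_nonneg)
qed

lemma Hk_measurable:
  assumes f: "Hk G n f" and j: "j \<le> gN G" and s: "s \<le> gN G" and r: "r \<le> n"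
  shows "D f j s r \<in> borel_measurable M2"
  using Hk_D[OF assms] by (rule L2_measurable)

lemma integrable_slices:
  assumes g: "g \<in> L2 M2"
  shows "integrable MK (\<lambda>k. \<integral>z. (cmod (g (k, z)))\<^sup>2 \<partial>MZ)"
    "(\<integral>k. \<integral>z. (cmod (g (k, z)))\<^sup>2 \<partial>MZ \<partial>MK) = (L2.nrm M2 g)\<^sup>2"
proof -
  have i: "integrable M2 (\<lambda>(k,z). (cmod (g (k, z)))\<^sup>2)" using L2_sq[OF g] by (simp add: case_prod_unfold)
  show "integrable MK (\<lambda>k. \<integral>z. (cmod (g (k, z)))\<^sup>2 \<partial>MZ)" using mI2.integrable_fst[OF i] .
  show "(\<integral>k. \<integral>z. (cmod (g (k, z)))\<^sup>2 \<partial>MZ \<partial>MK) = (L2.nrm M2 g)\<^sup>2"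
    using mI2.integral_fst[OF i] L2.nrm_sq[OF g] by (simp add: ip2_self case_prod_unfold)
qed

lemma HkI:
  assumes f: "\<And>k. k \<in> {kl..ku} \<Longrightarrow> Hsd G n (f k)"
    and D: "\<And>j s r. j \<le> gN G \<Longrightarrow> s \<le> gN G \<Longrightarrow> r \<le> n \<Longrightarrow> D f j s r \<in> L2 M2"
  shows "Hk G n f"
proof -
  have "(\<lambda>(k, z). indicator ({kl..ku} \<times> {a..c}) (k, z) *\<^sub>R dz G (f k j s) r z) \<in> borel_measurable borel"
    if "j \<le> gN G" "s \<le> gN G" "r \<le> n" for j s r
    unfolding measurable_M2_iff using L2_measurable[OF D[OF that]] by (simp add: D_def)
  moreover have "integrable MK (\<lambda>k. sd_nsq G n (f k))"
    unfolding sd_nsq_eq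
  proof (intro Bochner_Integration.integrable_sum)
    fix i assume "i \<in> idx n"
    then show "integrable MK (\<lambda>k. case i of (j,s,r) \<Rightarrow> (gh G)\<^sup>2 * (\<integral>z. (cmod (dz G (f k j s) r z))\<^sup>2 \<partial>MZ))"
      using integrable_slices(1)[OF D] unfolding idx_def D_def by (auto split: prod.split)
  qed
  ultimately show ?thesis using f unfolding Hk_def integrable_mI by blast
qed

lemma Hk_mono: assumes "Hk G n f" "m \<le> n" shows "Hk G m f"
proof (rule HkI)
  show "Hsd G m (f k)" if "k \<in> {kl..ku}" for k
    using Hk_Hsd[OF assms(1) that] Hn1_mono assms(2) unfolding Hsd_def by blast
qed (use Hk_D[OF assms(1)] assms(2) in auto)

lemma hk_norm_eq: assumes f: "Hk G n f" shows "hk_norm G n f = sqrt (hkip n f f)"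
proof -
  have "(LINT k:{kl..ku}|lborel. sd_nsq G n (f k)) = (\<integral>k. (\<Sum>(j,s,r)\<in>idx n. (gh G)\<^sup>2 * (\<integral>z. (cmod (D f j s r (k, z)))\<^sup>2 \<partial>MZ)) \<partial>MK)"
    unfolding integral_mI sd_nsq_eq D_def by simp
  also have "\<dots> = (\<Sum>(j,s,r)\<in>idx n. (gh G)\<^sup>2 * (\<integral>k. \<integral>z. (cmod (D f j s r (k, z)))\<^sup>2 \<partial>MZ \<partial>MK))"
    using integrable_slices(1)[OF Hk_D[OF f]]
    by (subst Bochner_Integration.integral_sum) (auto simp: idx_def case_prod_unfold)
  also have "\<dots> = hkip n f f"
    unfolding hkip_def Dt_def using integrable_slices(2)[OF Hk_D[OF f]] L2.nrm_sq[OF Hk_D[OF f]]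
    by (intro sum.cong) (auto simp: idx_def)
  finally show ?thesis by (simp add: hk_norm_def)
qed

lemma hk_inner_eq:
  assumes f: "Hk G 2 f" and g: "Hk G 2 g" shows "hk_inner G f g = hkip 2 f g"
proof -
  define F where "F i k = (gh G)\<^sup>2 * (\<integral>z. Re (Dt i f (k, z) * cnj (Dt i g (k, z))) \<partial>MZ)" for i k
  have i: "integrable M2 (\<lambda>(k,z). Re (Dt i f (k, z) * cnj (Dt i g (k, z))))" if "i \<in> idx 2" for i
    using that integrable_ip2[OF Hk_D[OF f] Hk_D[OF g]] unfolding idx_def Dt_def by (auto simp: case_prod_unfold)
  have "hk_inner G f g = (\<integral>k. (\<Sum>i\<in>idx 2. F i k) \<partial>MK)"
    unfolding hk_inner_def integral_mI sum_idx F_def Dt_def D_def by (simp add: case_prod_unfold)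
  also have "\<dots> = (\<Sum>i\<in>idx 2. \<integral>k. F i k \<partial>MK)"
    unfolding F_def using mI2.integrable_fst[OF i] by (intro Bochner_Integration.integral_sum) auto
  also have "\<dots> = hkip 2 f g"
    unfolding hkip_def F_def ip2_def using mI2.integral_fst[OF i]
    by (intro sum.cong refl) (simp add: case_prod_unfold)
  finally show ?thesis .
qed

lemma hk_norm_inner: "hk_norm G 2 f = sqrt (hk_inner G f f)"
  unfolding hk_norm_def hk_inner_def sd_nsq_def
  by (simp add: complex_norm_square[symmetric] flip: of_real_power)

section \<open>Linear combinations of k-dependent functions\<close>

lemma D_lin_comb:
  assumes f: "Hk G n f" and g: "Hk G n g" and j: "j \<le> gN G" "s \<le> gN G" and r: "r < n"
    and x: "x \<in> space M2"
  shows "D (f + t *\<^sub>R g) j s r x = D f j s r x + t *\<^sub>R D g j s r x"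
  using zd_lin_comb[OF ac Hk_Hn1[OF f _ j] Hk_Hn1[OF g _ j] r, where s = t] x
  unfolding D_def dz_def space_M2 by (auto simp: plus_fun_def scaleR_fun_def)

lemma D_lin_comb_measurable:
  assumes f: "Hk G n f" and g: "Hk G n g" and j: "j \<le> gN G" "s \<le> gN G" and r: "r \<le> n"
  shows "D (f + t *\<^sub>R g) j s r \<in> borel_measurable M2"
proof -
  have m: "D (f + t *\<^sub>R g) j s r \<in> borel_measurable M2" if r: "r < n" for r
  proof -
    have "(\<lambda>x. D f j s r x + t *\<^sub>R D g j s r x) \<in> borel_measurable M2"
      using Hk_measurable[OF f j] Hk_measurable[OF g j] r
      by (intro borel_measurable_add borel_measurable_scaleR measurable_const) auto
    moreover have "D (f + t *\<^sub>R g) j s r \<in> borel_measurable M2 \<longleftrightarrow> (\<lambda>x. D f j s r x + t *\<^sub>R D g j s r x) \<in> borel_measurable M2"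
      by (rule measurable_cong) (rule D_lin_comb[OF f g j r])
    ultimately show ?thesis by blast
  qed
  show ?thesis
  proof (cases r)
    case 0
    have "(\<lambda>x. D f j s 0 x + t *\<^sub>R D g j s 0 x) \<in> borel_measurable M2"
      using Hk_measurable[OF f j, of 0] Hk_measurable[OF g j, of 0]
      by (intro borel_measurable_add borel_measurable_scaleR measurable_const) auto
    then show ?thesis unfolding 0 by (simp add: D_def dz_def plus_fun_def scaleR_fun_def)
  next
    case (Suc q)
    then have q: "q < n" using r by simp
    have hn: "Hn1 a c n ((f + t *\<^sub>R g) k j s)" if "k \<in> {kl..ku}" for k
      using Hn1_lin_comb[OF ac Hk_Hn1[OF f that j] Hk_Hn1[OF g that j], of t] by (simp add: plus_fun_def scaleR_fun_def)
    have "(\<lambda>x. vector_derivative (zd a c ((f + t *\<^sub>R g) (fst x) j s) q) (at (snd x) within {a..c})) \<in> borel_measurable M2"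
    proof (rule measurable_vector_derivative[OF ac])
      show "(\<lambda>x. zd a c ((f + t *\<^sub>R g) (fst x) j s) q (snd x)) \<in> borel_measurable M2"
        using m[OF q] by (simp add: D_def dz_def)
      show "continuous_on {a..c} (zd a c ((f + t *\<^sub>R g) k j s) q)" if "k \<in> space MK" for k
        using Hn1_cont[OF hn q] that by simp
    qed
    then show ?thesis unfolding Suc D_def dz_def by simp
  qed
qed

text \<open>Exceptional sets that are null in every slice combine to a null set because the whole
  set is measurable. For this the joint measurability of the top derivative of a combination was
  established.\<close>

lemma AE_M2:
  assumes "Measurable.pred M2 P" "\<And>k. k \<in> {kl..ku} \<Longrightarrow> AE z in MZ. P (k, z)"
  shows "AE x in M2. P x"
proof (rule mI2.AE_pair_measure)
  show "{x \<in> space M2. P x} \<in> sets M2" using assms(1) by (simp add: pred_def)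
  show "AE k in MK. AE z in MZ. P (k, z)" by (rule AE_I2, rule assms(2)) simp
qed

lemma D_lin_comb_AE:
  assumes f: "Hk G n f" and g: "Hk G n g" and j: "j \<le> gN G" "s \<le> gN G" and r: "r \<le> n"
  shows "AE x in M2. D (f + t *\<^sub>R g) j s r x = D f j s r x + t *\<^sub>R D g j s r x"
proof (rule AE_M2)
  note [measurable] = D_lin_comb_measurable[OF assms] Hk_measurable[OF f j r] Hk_measurable[OF g j r]
  show "Measurable.pred M2 (\<lambda>x. D (f + t *\<^sub>R g) j s r x = D f j s r x + t *\<^sub>R D g j s r x)" by measurable
  show "AE z in MZ. D (f + t *\<^sub>R g) j s r (k, z) = D f j s r (k, z) + t *\<^sub>R D g j s r (k, z)" if "k \<in> {kl..ku}" for k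
    using zd_lin_comb_AE[OF ac Hk_Hn1[OF f that j] Hk_Hn1[OF g that j] r, of t]
    unfolding D_def dz_def by (simp add: plus_fun_def scaleR_fun_def)
qed

lemma Hk_lin_comb:
  assumes f: "Hk G n f" and g: "Hk G n g"
  shows "Hk G n (f + t *\<^sub>R g)"
proof (rule HkI)
  show "Hsd G n ((f + t *\<^sub>R g) k)" if "k \<in> {kl..ku}" for k
    using Hn1_lin_comb[OF ac Hk_Hn1[OF f that] Hk_Hn1[OF g that], of _ _ _ _ t] unfolding Hsd_def by (simp add: plus_fun_def scaleR_fun_def)
  fix j s r assume j: "j \<le> gN G" "s \<le> gN G" "r \<le> n"
  show "D (f + t *\<^sub>R g) j s r \<in> L2 M2"
    by (rule L2_AE_cong[OF L2_add[OF Hk_D[OF f j] L2_scale[OF Hk_D[OF g j], of t]] D_lin_comb_measurable[OF f g j]])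
       (use D_lin_comb_AE[OF f g j, of t] in eventually_elim, simp)
qed

lemma D_zero: "x \<in> space M2 \<Longrightarrow> D 0 j s r x = 0"
  unfolding D_def dz_def space_M2 using zd_zero[OF ac] by (auto simp: zero_fun_def)

lemma Hk_zero: "Hk G n 0"
proof (rule HkI)
  show "Hsd G n (0 k)" for k unfolding Hsd_def using Hn1_zero[OF ac] by (simp add: zero_fun_def)
  show "D 0 j s r \<in> L2 M2" for j s r
  proof -
    have "D 0 j s r \<in> borel_measurable M2 \<longleftrightarrow> (\<lambda>x. 0::complex) \<in> borel_measurable M2" by (rule measurable_cong) (rule D_zero)
    then have m: "D 0 j s r \<in> borel_measurable M2" by simp
    have "AE x in M2. 0 = D 0 j s r x" by (rule AE_I2) (rule D_zero[symmetric])
    then show ?thesis by (rule L2_AE_cong[OF L2_zero m])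
  qed
qed

lemma subspace_Hk: "subspace {f. Hk G n f}"
  unfolding subspace_def
proof (intro conjI ballI allI, simp_all add: Hk_zero)
  show "Hk G n (x + y)" if "Hk G n x" "Hk G n y" for x y using Hk_lin_comb[OF that, of 1] by simp
  show "Hk G n (t *\<^sub>R x)" if "Hk G n x" for t x using Hk_lin_comb[OF Hk_zero that, of t] by simp
qed

lemma semi_inner_hkip: "semi_inner {f. Hk G n f} (hkip n)"
  unfolding hkip_def
proof (rule semi_inner_family[OF subspace_Hk])
  fix i f g and t :: real assume i: "i \<in> idx n" and f: "f \<in> {f. Hk G n f}"
  obtain j s r where e: "i = (j,s,r)" and j: "j \<le> gN G" "s \<le> gN G" "r \<le> n" using i unfolding idx_def by auto
  show "Dt i f \<in> L2 M2" using Hk_D[of n f] f j unfolding e Dt_def by simp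
  show "AE x in M2. Dt i (f + g) x = Dt i f x + Dt i g x" if "g \<in> {f. Hk G n f}"
    using D_lin_comb_AE[of n f g, OF _ _ j, of 1] f that unfolding e Dt_def by simp
  have "AE x in M2. D (0 + t *\<^sub>R f) j s r x = D 0 j s r x + t *\<^sub>R D f j s r x"
    using D_lin_comb_AE[OF Hk_zero _ j, of f t] f by simp
  moreover have "AE x in M2. D 0 j s r x = 0" by (rule AE_I2) (rule D_zero)
  ultimately have "AE x in M2. D (t *\<^sub>R f) j s r x = t *\<^sub>R D f j s r x" by eventually_elim simp
  then show "AE x in M2. Dt i (t *\<^sub>R f) x = t *\<^sub>R Dt i f x" unfolding e Dt_def by simp
qed simp

lemma Hk_add: "Hk G n x \<Longrightarrow> Hk G n y \<Longrightarrow> Hk G n (x + y)"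
  and Hk_diff: "Hk G n x \<Longrightarrow> Hk G n y \<Longrightarrow> Hk G n (x - y)"
  and Hk_scale: "Hk G n x \<Longrightarrow> Hk G n (t *\<^sub>R x)"
  using subspace_add[OF subspace_Hk, of x n y] subspace_diff[OF subspace_Hk, of x n y] subspace_scale[OF subspace_Hk, of x n t] by simp_all

lemma hk_norm_triangle:
  assumes "Hk G n f" "Hk G n g" shows "hk_norm G n f \<le> hk_norm G n (f - g) + hk_norm G n g"
proof -
  interpret X: semi_inner "{f. Hk G n f}" "hkip n" by (rule semi_inner_hkip)
  show ?thesis
    using X.nrm_add[of "f - g" g] assms Hk_diff[OF assms] by (simp add: hk_norm_eq X.nrm_def)
qed

lemma hk_norm_mono: assumes "Hk G n f" "m \<le> n" shows "hk_norm G m f \<le> hk_norm G n f"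
proof -
  have "hkip m f f \<le> hkip n f f"
    unfolding hkip_def
  proof (rule sum_mono2)
    fix i assume "i \<in> idx n - idx m"
    then have "Dt i f \<in> L2 M2" using Hk_D[OF assms(1)] unfolding idx_def Dt_def by auto
    then show "0 \<le> (gh G)\<^sup>2 * ip2 M2 (Dt i f) (Dt i f)" by (intro mult_nonneg_nonneg L2.ip_nonneg) auto
  qed (use assms(2) in \<open>auto simp: idx_def\<close>)
  then show ?thesis using assms Hk_mono by (simp add: hk_norm_eq)
qed

lemma semi_inner_Hk: "semi_inner {f. Hk G 2 f} (hk_inner G)"
proof -
  interpret X: semi_inner "{f. Hk G 2 f}" "hkip 2" by (rule semi_inner_hkip)
  show ?thesis
    by standard (use X.sub X.ip_add X.ip_scale X.ip_sym X.ip_nonneg in \<open>simp_all add: hk_inner_eq Hk_add Hk_scale\<close>)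
qed

text \<open>The space without boundary conditions, to which p + F belongs; \<open>X0\<close> below
  is the complete space of the p themselves, with the same inner product.\<close>

sublocale X: semi_inner "{f. Hk G 2 f}" "hk_inner G" by (rule semi_inner_Hk)

lemma X_nrm: "X.nrm = hk_norm G 2"
  by (simp add: fun_eq_iff X.nrm_def hk_norm_inner)

lemma nrm_D_le:
  assumes f: "Hk G 2 f" and j: "j \<le> gN G" "s \<le> gN G" "r \<le> 2"
  shows "L2.nrm M2 (D f j s r) \<le> hk_norm G 2 f / gh G"
proof -
  have nn: "0 \<le> (gh G)\<^sup>2 * ip2 M2 (Dt i f) (Dt i f)" if "i \<in> idx 2" for i
    using that Hk_D[OF f] unfolding idx_def Dt_def by (intro mult_nonneg_nonneg L2.ip_nonneg) auto
  have "(gh G)\<^sup>2 * ip2 M2 (Dt (j,s,r) f) (Dt (j,s,r) f) \<le> hkip 2 f f"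
    unfolding hkip_def by (rule member_le_sum) (use nn j in \<open>auto simp: idx_def\<close>)
  then have "(gh G * L2.nrm M2 (D f j s r))\<^sup>2 \<le> hkip 2 f f"
    using L2.nrm_sq[OF Hk_D[OF f j]] by (simp add: power_mult_distrib Dt_def)
  then have "gh G * L2.nrm M2 (D f j s r) \<le> hk_norm G 2 f"
    unfolding hk_norm_eq[OF f] using real_le_rsqrt by blast
  then show ?thesis using h by (simp add: field_simps)
qed

end

section \<open>Poincare inequalities and completeness\<close>

context geometry
begin

text \<open>The variable upper limit is moved into the integrand as a cut-off, which makes this the
  measurability of an integral depending on a parameter.\<close>

lemma measurable_indef:
  assumes v: "v \<in> borel_measurable M2"
  shows "(\<lambda>x. indef a (\<lambda>t. v (fst x, t)) (snd x)) \<in> borel_measurable M2"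
proof -
  have [measurable]: "(\<lambda>x. snd (fst x)) \<in> borel_measurable (M2 \<Otimes>\<^sub>M MZ)" "snd \<in> borel_measurable (M2 \<Otimes>\<^sub>M MZ)"
    using measurable_compose[OF measurable_fst measurable_compose[OF measurable_snd measurable_ident_mI]]
      measurable_compose[OF measurable_snd measurable_ident_mI] by simp_all
  have "(\<lambda>y. (fst (fst y), snd y)) \<in> measurable (M2 \<Otimes>\<^sub>M MZ) M2"
    by (intro measurable_Pair measurable_compose[OF measurable_fst measurable_fst] measurable_snd)
  from measurable_compose[OF this v] have [measurable]: "(\<lambda>y. v (fst (fst y), snd y)) \<in> borel_measurable (M2 \<Otimes>\<^sub>M MZ)" .
  have "(\<lambda>(x, t). (if t \<le> snd x then 1 else 0) *\<^sub>R v (fst x, t)) \<in> borel_measurable (M2 \<Otimes>\<^sub>M MZ)"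
    unfolding case_prod_unfold by measurable
  then have m: "(\<lambda>x. \<integral>t. (if t \<le> snd x then 1 else 0) *\<^sub>R v (fst x, t) \<partial>MZ) \<in> borel_measurable M2"
    by (rule mI.borel_measurable_lebesgue_integral)
  have "(\<lambda>x. indef a (\<lambda>t. v (fst x, t)) (snd x)) \<in> borel_measurable M2
      \<longleftrightarrow> (\<lambda>x. \<integral>t. (if t \<le> snd x then 1 else 0) *\<^sub>R v (fst x, t) \<partial>MZ) \<in> borel_measurable M2"
  proof (rule measurable_cong)
    fix x assume "x \<in> space M2"
    then have z: "snd x \<in> {a..c}" by (auto simp: space_M2)
    show "indef a (\<lambda>t. v (fst x, t)) (snd x) = (\<integral>t. (if t \<le> snd x then 1 else 0) *\<^sub>R v (fst x, t) \<partial>MZ)"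
      unfolding indef_mI[OF z] by (intro Bochner_Integration.integral_cong) (auto simp: indicator_def)
  qed
  then show ?thesis using m by blast
qed

text \<open>One constant for all orders: it dominates 1, c - a and (c - a)^2, the costs of
  integrating zero, one and two times.\<close>

definition poin :: real where "poin = 1 + (c - a)\<^sup>2"

lemma poin: "1 \<le> poin" "c - a \<le> poin" "(c - a) * (c - a) \<le> poin"
proof -
  define d where "d = c - a"
  have "0 < d" "2 * 1 * d \<le> 1\<^sup>2 + d\<^sup>2" using ac sum_squares_bound[of 1 d] unfolding d_def by auto
  then show "1 \<le> poin" "c - a \<le> poin" "(c - a) * (c - a) \<le> poin"
    unfolding poin_def d_def[symmetric] by (auto simp: power2_eq_square)
qed

lemma poincare_slice:
  assumes f: "Hn1 a c 2 g" and 0: "g a = 0" "zd a c g 1 a = 0" and r: "r \<le> 2"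
  shows "L2.nrm MZ (zd a c g r) \<le> poin * L2.nrm MZ (zd a c g 2)"
proof -
  let ?u = "zd a c g 2"
  have u: "?u \<in> L2 MZ" using Hn1_L2[OF f, of 2] by simp
  have n: "0 \<le> L2.nrm MZ ?u" using L2.nrm_ge0[OF u] .
  note e = Hn1_eq_indef[OF ac f 0]
  have 1: "L2.nrm MZ (zd a c g 1) = L2.nrm MZ (indef a ?u)"
    by (rule L2_nrm_cong_AE[OF indef_L2[OF ac u] Hn1_L2[OF f]]) (auto intro!: AE_I2 e(1) simp del: zd.simps(2) One_nat_def)
  have 2: "L2.nrm MZ (zd a c g 0) = L2.nrm MZ (indef a (indef a ?u))"
    by (rule L2_nrm_cong_AE[OF indef_L2[OF ac indef_L2[OF ac u]] Hn1_L2[OF f]]) (auto intro!: AE_I2 e(2))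
  have b1: "L2.nrm MZ (indef a ?u) \<le> (c - a) * L2.nrm MZ ?u" using indef_nrm[OF ac u] .
  have "L2.nrm MZ (indef a (indef a ?u)) \<le> (c - a) * ((c - a) * L2.nrm MZ ?u)"
    using indef_nrm[OF ac indef_L2[OF ac u]] b1 ac mult_left_mono[OF b1, of "c - a"] by linarith
  then have b2: "L2.nrm MZ (indef a (indef a ?u)) \<le> ((c - a) * (c - a)) * L2.nrm MZ ?u" by (simp only: mult.assoc)
  consider "r = 0" | "r = 1" | "r = 2" using r by linarith
  then show ?thesis
  proof cases
    case 1
    then show ?thesis using order_trans[OF b2 mult_right_mono[OF poin(3) n]] 2 by simp
  next
    case 2
    then show ?thesis using order_trans[OF b1 mult_right_mono[OF poin(2) n]] 1 by simp
  next
    case 3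
    then show ?thesis using mult_right_mono[OF poin(1) n] by simp
  qed
qed

text \<open>Square integrability of the lower derivatives is part of the conclusion: for the limit
  built in the completeness proof only the second derivative is known to be square
  integrable.\<close>

lemma poincare:
  assumes h: "\<And>k. k \<in> {kl..ku} \<Longrightarrow> Hn1 a c 2 (f k j s)"
    and 0: "\<And>k. k \<in> {kl..ku} \<Longrightarrow> f k j s a = 0" "\<And>k. k \<in> {kl..ku} \<Longrightarrow> zd a c (f k j s) 1 a = 0"
    and m: "D f j s r \<in> borel_measurable M2" and L: "D f j s 2 \<in> L2 M2" and r: "r \<le> 2"
  shows "D f j s r \<in> L2 M2" "L2.nrm M2 (D f j s r) \<le> poin * L2.nrm M2 (D f j s 2)"
proof -
  have sl: "(\<lambda>z. D f j s q (k, z)) \<in> L2 MZ" if "k \<in> {kl..ku}" "q \<le> 2" for k q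
    using Hn1_L2[OF h[OF that(1)] that(2)] by (simp add: D_def dz_def)
  have "(\<integral>\<^sup>+x. ennreal ((cmod (D f j s r x))\<^sup>2) \<partial>M2) = (\<integral>\<^sup>+k. ennreal (\<integral>z. (cmod (D f j s r (k, z)))\<^sup>2 \<partial>MZ) \<partial>MK)"
    using m sl[OF _ r] by (rule nn_integral_slices)
  also have "\<dots> \<le> (\<integral>\<^sup>+k. ennreal (poin\<^sup>2 * (\<integral>z. (cmod (D f j s 2 (k, z)))\<^sup>2 \<partial>MZ)) \<partial>MK)"
  proof (intro nn_integral_mono ennreal_leI)
    fix k assume "k \<in> space MK"
    then have k: "k \<in> {kl..ku}" by simp
    have "L2.nrm MZ (\<lambda>z. D f j s r (k, z)) \<le> poin * L2.nrm MZ (\<lambda>z. D f j s 2 (k, z))"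
      using poincare_slice[OF h[OF k] 0(1)[OF k] 0(2)[OF k] r] by (simp add: D_def dz_def)
    then have "(L2.nrm MZ (\<lambda>z. D f j s r (k, z)))\<^sup>2 \<le> (poin * L2.nrm MZ (\<lambda>z. D f j s 2 (k, z)))\<^sup>2"
      using L2.nrm_ge0[OF sl[OF k r]] by (intro power_mono) auto
    then show "(\<integral>z. (cmod (D f j s r (k, z)))\<^sup>2 \<partial>MZ) \<le> poin\<^sup>2 * (\<integral>z. (cmod (D f j s 2 (k, z)))\<^sup>2 \<partial>MZ)"
      unfolding power_mult_distrib L2.nrm_sq[OF sl[OF k r]] L2.nrm_sq[OF sl[OF k order_refl]] ip2_self .
  qed
  also have "\<dots> = ennreal (\<integral>k. poin\<^sup>2 * (\<integral>z. (cmod (D f j s 2 (k, z)))\<^sup>2 \<partial>MZ) \<partial>MK)"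
    using integrable_slices(1)[OF L] by (intro nn_integral_eq_integral) (auto intro!: mult_nonneg_nonneg Bochner_Integration.integral_nonneg)
  also have "(\<integral>k. poin\<^sup>2 * (\<integral>z. (cmod (D f j s 2 (k, z)))\<^sup>2 \<partial>MZ) \<partial>MK) = (poin * L2.nrm M2 (D f j s 2))\<^sup>2"
    using integrable_slices[OF L] by (simp add: power_mult_distrib)
  finally have b: "(\<integral>\<^sup>+x. ennreal ((cmod (D f j s r x))\<^sup>2) \<partial>M2) \<le> ennreal ((poin * L2.nrm M2 (D f j s 2))\<^sup>2)" .
  show "D f j s r \<in> L2 M2" using L2_I_nn(1)[OF m b] by simp
  have "0 \<le> poin * L2.nrm M2 (D f j s 2)" using poin(1) L2.nrm_ge0[OF L] by (intro mult_nonneg_nonneg) auto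
  then show "L2.nrm M2 (D f j s r) \<le> poin * L2.nrm M2 (D f j s 2)"
    using L2_I_nn(2)[OF m b] power2_le_imp_le by auto
qed

lemma hk_norm_L2_set: assumes f: "Hk G n f" shows "hk_norm G n f = L2_set (\<lambda>i. gh G * L2.nrm M2 (Dt i f)) (idx n)"
proof -
  have "hkip n f f = (\<Sum>i\<in>idx n. (gh G * L2.nrm M2 (Dt i f))\<^sup>2)"
    unfolding hkip_def
  proof (rule sum.cong[OF refl])
    fix i assume "i \<in> idx n"
    then have "Dt i f \<in> L2 M2" using Hk_D[OF f] unfolding idx_def Dt_def by auto
    then show "(gh G)\<^sup>2 * ip2 M2 (Dt i f) (Dt i f) = (gh G * L2.nrm M2 (Dt i f))\<^sup>2"
      by (simp add: power_mult_distrib L2.nrm_sq)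
  qed
  then show ?thesis unfolding hk_norm_eq[OF f] L2_set_def by simp
qed

lemma Hk0_Hk: "Hk0 G f \<Longrightarrow> Hk G 2 f" and Hk0_bc: "Hk0 G f \<Longrightarrow> k \<in> {kl..ku} \<Longrightarrow> bc0 G (f k)"
  by (auto simp: Hk0_def)

lemma bc0_zd:
  assumes "bc0 G u" "j \<le> gN G" "s \<le> gN G"
  shows "u j s a = 0" "u j s c = 0" "zd a c (u j s) 1 a = 0"
  using assms unfolding bc0_def dz_def by auto

lemma Hk0_poincare:
  assumes f: "Hk0 G f" and j: "j \<le> gN G" "s \<le> gN G" and r: "r \<le> 2"
  shows "L2.nrm M2 (D f j s r) \<le> poin * L2.nrm M2 (D f j s 2)"
proof (rule poincare(2))
  show "D f j s r \<in> borel_measurable M2" "D f j s 2 \<in> L2 M2"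
    using Hk_measurable[OF Hk0_Hk[OF f] j r] Hk_D[OF Hk0_Hk[OF f] j] by auto
qed (use Hk_Hn1[OF Hk0_Hk[OF f]] bc0_zd[OF Hk0_bc[OF f]] j r in auto)

text \<open>Second derivatives alone control the norm, so convergence in \<open>Hk0\<close> reduces
  to L^2 convergence of f_zz at each grid point.\<close>

lemma Hk0_norm_le:
  assumes f: "Hk0 G f"
  shows "hk_norm G 2 f \<le> (\<Sum>(j,s,r)\<in>idx 2. gh G * (poin * L2.nrm M2 (D f j s 2)))"
proof -
  have L: "Dt i f \<in> L2 M2" if "i \<in> idx 2" for i using Hk_D[OF Hk0_Hk[OF f]] that unfolding idx_def Dt_def by auto
  have "hk_norm G 2 f \<le> (\<Sum>i\<in>idx 2. gh G * L2.nrm M2 (Dt i f))"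
    unfolding hk_norm_L2_set[OF Hk0_Hk[OF f]] using h L by (intro L2_set_le_sum mult_nonneg_nonneg L2.nrm_ge0) auto
  also have "\<dots> \<le> (\<Sum>(j,s,r)\<in>idx 2. gh G * (poin * L2.nrm M2 (D f j s 2)))"
    using Hk0_poincare[OF f] h by (intro sum_mono) (auto simp: idx_def Dt_def)
  finally show ?thesis .
qed

lemma bc0_lin_comb:
  assumes u: "Hsd G 2 u" "bc0 G u" and v: "Hsd G 2 v" "bc0 G v"
  shows "bc0 G (u + t *\<^sub>R v)"
proof -
  have "dz G ((u + t *\<^sub>R v) j s) 1 a = 0" if j: "j \<le> gN G" "s \<le> gN G" for j s
    using zd_lin_comb[OF ac, of 2 "u j s" "v j s" 1 a t] u v j bc0_zd[OF u(2) j] bc0_zd[OF v(2) j] ac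
    unfolding Hsd_def dz_def by (simp add: plus_fun_def scaleR_fun_def)
  then show ?thesis using u(2) v(2) unfolding bc0_def by (auto simp: plus_fun_def scaleR_fun_def)
qed

lemma Hk0_lin_comb: assumes f: "Hk0 G f" and g: "Hk0 G g" shows "Hk0 G (f + t *\<^sub>R g)"
proof -
  have "bc0 G ((f + t *\<^sub>R g) k)" if k: "k \<in> {kl..ku}" for k
    using bc0_lin_comb[OF Hk_Hsd[OF Hk0_Hk[OF f] k] Hk0_bc[OF f k] Hk_Hsd[OF Hk0_Hk[OF g] k] Hk0_bc[OF g k], of t]
    by (simp add: plus_fun_def scaleR_fun_def)
  then show ?thesis using Hk_lin_comb[OF Hk0_Hk[OF f] Hk0_Hk[OF g]] unfolding Hk0_def by blast
qed

lemma Hk0_zero: "Hk0 G 0"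
proof -
  have "bc0 G 0" unfolding bc0_def dz_def using zd_zero[OF ac, of a 1] ac by (auto simp: zero_fun_def simp del: zd.simps One_nat_def)
  then show ?thesis using Hk_zero unfolding Hk0_def by (simp add: zero_fun_def)
qed

lemma subspace_Hk0: "subspace {f. Hk0 G f}"
  unfolding subspace_def
proof (intro conjI ballI allI, simp_all add: Hk0_zero)
  show "Hk0 G (x + y)" if "Hk0 G x" "Hk0 G y" for x y using Hk0_lin_comb[OF that, of 1] by simp
  show "Hk0 G (t *\<^sub>R x)" if "Hk0 G x" for t x using Hk0_lin_comb[OF Hk0_zero that, of t] by simp
qed

lemma D_diff_AE:
  assumes f: "Hk G n f" and g: "Hk G n g" and j: "j \<le> gN G" "s \<le> gN G" and r: "r \<le> n"
  shows "AE x in M2. D (f - g) j s r x = D f j s r x - D g j s r x"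
  using D_lin_comb_AE[OF assms, of "-1"] by simp

text \<open>The condition at \<open>z = d\<close> survives the limit for almost every \<open>k\<close> only; on the remaining null set the limit is
replaced by 0 in \<open>Hk0_complete\<close>.\<close>

lemma Hk0_limit_component:
  assumes f: "\<And>n::nat. Hk0 G (f n)" and j: "j \<le> gN G" "s \<le> gN G"
    and v: "v \<in> L2 M2" and lim: "(\<lambda>n. L2.nrm M2 (D (f n) j s 2 - v)) \<longlonglongrightarrow> 0"
  shows "AE k in MK. (\<lambda>z. v (k, z)) \<in> L2 MZ \<and> indef a (indef a (\<lambda>z. v (k, z))) c = 0"
proof -
  let ?w = "\<lambda>n x. D (f n) j s 2 x - v x"
  have DL: "D (f n) j s 2 \<in> L2 M2" for n using Hk_D[OF Hk0_Hk[OF f] j] by simp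
  have wL: "?w n \<in> L2 M2" for n using L2_diff[OF DL v] .
  have "AE k in MK. integrable MZ (\<lambda>z. (cmod (v (k, z)))\<^sup>2)"
    by (rule mI2.AE_integrable_fst'[OF L2_sq[OF v]])
  moreover have "(\<lambda>z. v (k, z)) \<in> borel_measurable MZ" if "k \<in> {kl..ku}" for k
    using measurable_compose[OF measurable_Pair1' L2_measurable[OF v]] that by simp
  ultimately have A: "AE k in MK. (\<lambda>z. v (k, z)) \<in> L2 MZ"
    by (auto simp: L2_def AE_mI elim!: eventually_mono)
  define \<phi> where "\<phi> n k = (\<integral>z. (cmod (?w n (k, z)))\<^sup>2 \<partial>MZ)" for n k
  have i\<phi>: "integrable MK (\<phi> n)" "(\<integral>k. \<phi> n k \<partial>MK) = (L2.nrm M2 (?w n))\<^sup>2" for n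
    unfolding \<phi>_def using integrable_slices[OF wL] by auto
  have \<phi>0: "0 \<le> \<phi> n k" for n k unfolding \<phi>_def by (intro Bochner_Integration.integral_nonneg) auto
  have "(\<lambda>n. (L2.nrm M2 (?w n))\<^sup>2) \<longlonglongrightarrow> 0" using tendsto_power[OF lim, of 2] by (simp add: fun_diff_def)
  then have "(\<lambda>n. \<integral>k. norm (\<phi> n k) \<partial>MK) \<longlonglongrightarrow> 0" using i\<phi> \<phi>0 by simp
  \<comment> \<open>Convergence on the rectangle is L^1 convergence in k of the squared slice norms;
    a subsequence of these tends to zero for almost every k.\<close>
  from tendsto_L1_AE_subseq[OF i\<phi>(1) this] obtain q where q: "strict_mono q" "AE k in MK. (\<lambda>n. \<phi> (q n) k) \<longlonglongrightarrow> 0" by blast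
  have "AE k in MK. k \<in> {kl..ku}" by (rule AE_I2) simp
  with A q(2) show ?thesis
  proof eventually_elim
    case (elim k)
    let ?vk = "\<lambda>z. v (k, z)" and ?fk = "\<lambda>n z. D (f n) j s 2 (k, z)"
    have fk: "?fk n \<in> L2 MZ" for n using Hsd_L2[OF Hk_Hsd[OF Hk0_Hk[OF f] elim(3)] j, of 2] by (simp add: D_def)
    have c: "c \<in> {a..c}" using ac by simp
    have b: "cmod (indef a (indef a ?vk) c) \<le> sqrt (c - a) * ((c - a) * sqrt (\<phi> n k))" for n
    proof -
      have z: "f n k j s a = 0" "f n k j s c = 0" "zd a c (f n k j s) 1 a = 0" using bc0_zd[OF Hk0_bc[OF f elim(3)] j] .
      \<comment> \<open>The condition f = 0 at z = d, rewritten as a condition on the second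
        derivative, where it is continuous under L^2 convergence.\<close>
      have 0: "indef a (indef a (?fk n)) c = 0"
        using Hn1_eq_indef(2)[OF ac Hk_Hn1[OF Hk0_Hk[OF f] elim(3) j] z(1,3) c] z(2) by (simp add: D_def dz_def)
      have d: "(\<lambda>z. ?fk n z + (-1) *\<^sub>R ?vk z) \<in> L2 MZ" using L2_diff[OF fk elim(1)] by simp
      have i1: "indef a (\<lambda>z. ?fk n z + (-1) *\<^sub>R ?vk z) z = indef a (?fk n) z + (-1) *\<^sub>R indef a ?vk z" if "z \<in> {a..c}" for z
        using indef_add[OF fk elim(1) that] .
      have "indef a (indef a (\<lambda>z. ?fk n z + (-1) *\<^sub>R ?vk z)) c = indef a (\<lambda>z. indef a (?fk n) z + (-1) *\<^sub>R indef a ?vk z) c"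
        by (rule indef_cong_AE[OF _ L2_measurable[OF indef_L2[OF ac d]] L2_measurable[OF L2_add[OF indef_L2[OF ac fk] L2_scale[OF indef_L2[OF ac elim(1)]]]] c])
           (rule AE_I2, rule i1, simp)
      also have "\<dots> = indef a (indef a (?fk n)) c + (-1) *\<^sub>R indef a (indef a ?vk) c"
        by (rule indef_add[OF indef_L2[OF ac fk] indef_L2[OF ac elim(1)] c])
      finally have "cmod (indef a (indef a ?vk) c) = cmod (indef a (indef a (\<lambda>z. ?fk n z + (-1) *\<^sub>R ?vk z)) c)" using 0 by simp
      also have "\<dots> \<le> sqrt (c - a) * L2.nrm MZ (indef a (\<lambda>z. ?fk n z + (-1) *\<^sub>R ?vk z))"
        by (rule indef_bound[OF indef_L2[OF ac d] c])
      also have "\<dots> \<le> sqrt (c - a) * ((c - a) * L2.nrm MZ (\<lambda>z. ?fk n z + (-1) *\<^sub>R ?vk z))"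
        using indef_nrm[OF ac d] ac by (intro mult_left_mono) auto
      also have "L2.nrm MZ (\<lambda>z. ?fk n z + (-1) *\<^sub>R ?vk z) = sqrt (\<phi> n k)" unfolding \<phi>_def L2_nrm by simp
      finally show ?thesis .
    qed
    have "(\<lambda>n. sqrt (c - a) * ((c - a) * sqrt (\<phi> (q n) k))) \<longlonglongrightarrow> sqrt (c - a) * ((c - a) * sqrt 0)"
      by (intro tendsto_intros elim)
    then have "cmod (indef a (indef a ?vk) c) \<le> sqrt (c - a) * ((c - a) * sqrt 0)"
      by (rule LIMSEQ_le_const) (use b in blast)
    then show ?case using elim(1) by simp
  qed
qed

lemma AE_mI_null_set: "AE k in mI l u. P k \<Longrightarrow> \<exists>N. N \<in> null_sets (mI l u) \<and> (\<forall>k\<in>{l..u} - N. P k)"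
  unfolding eventually_ae_filter space_mI by blast

text \<open>The limit is the double integral of the limits of the second derivatives. This form
  enforces both conditions at z = -\<xi>; the condition at z = d comes from
  \<open>Hk0_limit_component\<close>.\<close>

lemma Hk0_complete:
  assumes f: "\<And>n::nat. Hk0 G (f n)"
    and C: "\<And>e::real. 0 < e \<Longrightarrow> \<exists>N. \<forall>m\<ge>N. \<forall>n\<ge>N. hk_norm G 2 (f m - f n) < e"
  shows "\<exists>l. Hk0 G l \<and> (\<lambda>n. hk_norm G 2 (f n - l)) \<longlonglongrightarrow> 0"
proof -
  have fH: "Hk G 2 (f n)" for n using Hk0_Hk[OF f] .
  have DL: "D (f n) j s 2 \<in> L2 M2" if "j \<le> gN G" "s \<le> gN G" for n j s using Hk_D[OF fH that] by simp
  \<comment> \<open>At lateral points the limit is taken to be the zero function itself and not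
    merely a null function; its double integral then vanishes for every k and z, as
    \<open>bc0\<close> demands.\<close>
  have "\<exists>v. v \<in> L2 M2 \<and> (\<lambda>n. L2.nrm M2 (D (f n) j s 2 - v)) \<longlonglongrightarrow> 0 \<and> (lateral_pt G j s \<longrightarrow> v = (\<lambda>_. 0))"
    if j: "j \<le> gN G" "s \<le> gN G" for j s
  proof (cases "lateral_pt G j s")
    case True
    have "D (f n) j s 2 x = 0" if "x \<in> space M2" for n x
    proof -
      have k: "fst x \<in> {kl..ku}" and z: "snd x \<in> {a..c}" using that by (auto simp: space_M2)
      have "zd a c (f n (fst x) j s) 2 (snd x) = zd a c (\<lambda>z. 0) 2 (snd x)"
        using Hk0_bc[OF f k] True by (intro zd_cong[OF _ z]) (auto simp: bc0_def)
      then show ?thesis unfolding D_def dz_def using zd_zero[OF ac z] by simp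
    qed
    then have "L2.nrm M2 (D (f n) j s 2 - (\<lambda>_. 0)) = 0" for n
      unfolding L2_nrm fun_diff_def by (subst Bochner_Integration.integral_cong[OF refl, where g = "\<lambda>_. 0"]) auto
    then show ?thesis using L2_zero by (intro exI[of _ "\<lambda>_. 0"]) simp
  next
    case False
    have "\<exists>N. \<forall>m\<ge>N. \<forall>n\<ge>N. L2.nrm M2 (D (f m) j s 2 - D (f n) j s 2) < e" if e: "0 < e" for e
    proof -
      have "0 < e * gh G" using e h by simp
      then obtain N where N: "\<And>m n. m \<ge> N \<Longrightarrow> n \<ge> N \<Longrightarrow> hk_norm G 2 (f m - f n) < e * gh G" using C by meson
      have "L2.nrm M2 (D (f m) j s 2 - D (f n) j s 2) < e" if "m \<ge> N" "n \<ge> N" for m n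
      proof -
        have "L2.nrm M2 (D (f m) j s 2 - D (f n) j s 2) = L2.nrm M2 (D (f m - f n) j s 2)"
          using D_diff_AE[OF fH fH j, of 2 m n] Hk_D[OF Hk_diff[OF fH fH] j, of 2] L2.S_diff[OF DL[OF j] DL[OF j]]
          by (intro L2_nrm_cong_AE) (auto elim!: eventually_mono)
        also have "\<dots> \<le> hk_norm G 2 (f m - f n) / gh G" using nrm_D_le[OF Hk_diff[OF fH fH] j] by simp
        also have "\<dots> < e" using N[OF that] h by (simp add: field_simps)
        finally show ?thesis .
      qed
      then show ?thesis by blast
    qed
    from L2_complete[OF DL[OF j] this] show ?thesis using False by blast
  qed
  note ex_v = this
  define v where "v j s = (SOME v. v \<in> L2 M2 \<and> (\<lambda>n. L2.nrm M2 (D (f n) j s 2 - v)) \<longlonglongrightarrow> 0 \<and> (lateral_pt G j s \<longrightarrow> v = (\<lambda>_. 0)))" for j s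
  have v: "v j s \<in> L2 M2" "(\<lambda>n. L2.nrm M2 (D (f n) j s 2 - v j s)) \<longlonglongrightarrow> 0" "lateral_pt G j s \<Longrightarrow> v j s = (\<lambda>_. 0)"
    if j: "j \<le> gN G" "s \<le> gN G" for j s
    using someI_ex[OF ex_v[OF j]] unfolding v_def[symmetric] by auto
  define N where "N j s = (SOME N. N \<in> null_sets MK \<and> (\<forall>k\<in>{kl..ku} - N. (\<lambda>z. v j s (k, z)) \<in> L2 MZ \<and> indef a (indef a (\<lambda>z. v j s (k, z))) c = 0))" for j s
  have N: "N j s \<in> null_sets MK" "\<And>k. k \<in> {kl..ku} - N j s \<Longrightarrow> (\<lambda>z. v j s (k, z)) \<in> L2 MZ"
    "\<And>k. k \<in> {kl..ku} - N j s \<Longrightarrow> indef a (indef a (\<lambda>z. v j s (k, z))) c = 0"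
    if j: "j \<le> gN G" "s \<le> gN G" for j s
    using someI_ex[OF AE_mI_null_set[OF Hk0_limit_component[OF f j v(1,2)[OF j]]]] unfolding N_def[symmetric] by auto
  define u where "u j s x = (if fst x \<in> N j s then 0 else v j s x)" for j s x
  define l :: sdk where "l k j s = indef a (indef a (\<lambda>z. u j s (k, z)))" for k j s
  have i0: "indef a (\<lambda>z. 0) = (\<lambda>z. 0)" unfolding indef_def by (simp add: set_lebesgue_integral_def)
  have uL: "(\<lambda>z. u j s (k, z)) \<in> L2 MZ" and uc: "l k j s c = 0" if j: "j \<le> gN G" "s \<le> gN G" and k: "k \<in> {kl..ku}" for j s k
    using N(2,3)[OF j, of k] k L2_zero[of MZ] unfolding u_def l_def by (cases "k \<in> N j s"; simp add: i0)+
  have um: "u j s \<in> borel_measurable M2" if j: "j \<le> gN G" "s \<le> gN G" for j s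
  proof -
    have [measurable]: "N j s \<in> sets MK" "v j s \<in> borel_measurable M2" using N(1)[OF j] L2_measurable[OF v(1)[OF j]] by auto
    show ?thesis unfolding u_def by measurable
  qed
  have zd1: "zd a c (l k j s) 1 z = indef a (\<lambda>z. u j s (k, z)) z" and Hl: "Hn1 a c 2 (l k j s)"
    and zd2: "AE z in MZ. zd a c (l k j s) 2 z = u j s (k, z)"
    if j: "j \<le> gN G" "s \<le> gN G" and k: "k \<in> {kl..ku}" and z: "z \<in> {a..c}" for j s k z
    using double_indef[OF ac uL[OF j k]] z unfolding l_def by auto
  have a': "a \<in> {a..c}" using ac by simp
  have la: "l k j s a = 0" "zd a c (l k j s) 1 a = 0" if j: "j \<le> gN G" "s \<le> gN G" and k: "k \<in> {kl..ku}" for j s k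
    using zd1[OF that a'] by (auto simp: l_def)
  have D1: "D l j s 1 \<in> borel_measurable M2" if j: "j \<le> gN G" "s \<le> gN G" for j s
  proof -
    have "D l j s 1 \<in> borel_measurable M2 \<longleftrightarrow> (\<lambda>x. indef a (\<lambda>t. u j s (fst x, t)) (snd x)) \<in> borel_measurable M2"
      by (rule measurable_cong) (use zd1[OF j] in \<open>auto simp: D_def dz_def space_M2 simp del: zd.simps One_nat_def\<close>)
    then show ?thesis using measurable_indef[OF um[OF j]] by blast
  qed
  have D0: "D l j s 0 \<in> borel_measurable M2" if j: "j \<le> gN G" "s \<le> gN G" for j s
    using measurable_indef[OF measurable_indef[OF um[OF j]]] by (simp add: D_def dz_def l_def)
  have D2: "D l j s 2 \<in> borel_measurable M2" if j: "j \<le> gN G" "s \<le> gN G" for j s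
  proof -
    have "(\<lambda>x. vector_derivative (zd a c (l (fst x) j s) 1) (at (snd x) within {a..c})) \<in> borel_measurable M2"
    proof (rule measurable_vector_derivative[OF ac])
      show "(\<lambda>x. zd a c (l (fst x) j s) 1 (snd x)) \<in> borel_measurable M2" using D1[OF j] by (simp add: D_def dz_def)
      show "continuous_on {a..c} (zd a c (l k j s) 1)" if "k \<in> space MK" for k
        using Hn1_cont[OF Hl[OF j _ a'], of k 1] that by simp
    qed
    then show ?thesis unfolding D_def dz_def by (simp add: numeral_2_eq_2)
  qed
  have D2v: "AE x in M2. v j s x = D l j s 2 x" if j: "j \<le> gN G" "s \<le> gN G" for j s
  proof (rule mI2.AE_pair_measure)
    note [measurable] = D2[OF j] L2_measurable[OF v(1)[OF j]]
    show "{x \<in> space M2. v j s x = D l j s 2 x} \<in> sets M2" by measurable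
    have "AE k in MK. k \<notin> N j s" using AE_not_in[OF N(1)[OF j]] .
    moreover have "AE k in MK. k \<in> {kl..ku}" by (rule AE_I2) simp
    ultimately show "AE k in MK. AE z in MZ. v j s (k, z) = D l j s 2 (k, z)"
    proof eventually_elim
      case (elim k)
      show ?case using zd2[OF j elim(2) a'] elim(1) by (auto simp: u_def D_def dz_def elim!: eventually_mono)
    qed
  qed
  have D2L: "D l j s 2 \<in> L2 M2" if j: "j \<le> gN G" "s \<le> gN G" for j s
    by (rule L2_AE_cong[OF v(1)[OF j] D2[OF j] D2v[OF j]])
  have lH: "Hk G 2 l"
  proof (rule HkI)
    show "Hsd G 2 (l k)" if "k \<in> {kl..ku}" for k unfolding Hsd_def using Hl[OF _ _ that a'] by blast
    fix j s r :: nat assume j: "j \<le> gN G" "s \<le> gN G" and r: "r \<le> 2"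
    have "D l j s r \<in> borel_measurable M2"
      using D0[OF j] D1[OF j] D2[OF j] r by (cases r; cases "r - 1"; auto simp: numeral_2_eq_2 le_Suc_eq)
    then show "D l j s r \<in> L2 M2"
      using poincare(1)[of l j s r] Hl[OF j _ a'] la[OF j] D2L[OF j] r by blast
  qed
  have l0: "Hk0 G l"
  proof -
    have "bc0 G (l k)" if k: "k \<in> {kl..ku}" for k
      unfolding bc0_def
    proof (intro conjI allI impI ballI)
      fix j s z assume p: "lateral_pt G j s" and z: "z \<in> {a..c}"
      then have j: "j \<le> gN G" "s \<le> gN G" unfolding lateral_pt_def in_grid_def by auto
      have "(\<lambda>z. u j s (k, z)) = (\<lambda>z. 0)" unfolding u_def using v(3)[OF j p] by auto
      then show "l k j s z = 0" unfolding l_def by (simp add: i0)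
    qed (use la[OF _ _ k] uc[OF _ _ k] in \<open>auto simp: dz_def\<close>)
    then show ?thesis using lH unfolding Hk0_def by blast
  qed
  have "(\<lambda>n. hk_norm G 2 (f n - l)) \<longlonglongrightarrow> 0"
  proof (rule tendsto_sandwich[OF _ _ tendsto_const])
    have d0: "Hk0 G (f n - l)" for n using subspace_diff[OF subspace_Hk0, of "f n" l] f l0 by simp
    show "\<forall>\<^sub>F n in sequentially. 0 \<le> hk_norm G 2 (f n - l)"
      using X.nrm_ge0[of "f n - l" for n] Hk0_Hk[OF d0] unfolding X_nrm by simp
    have e: "L2.nrm M2 (D (f n - l) j s 2) = L2.nrm M2 (D (f n) j s 2 - v j s)" if j: "j \<le> gN G" "s \<le> gN G" for n j s
    proof (rule L2_nrm_cong_AE[OF L2.S_diff[OF DL[OF j] v(1)[OF j]] Hk_D[OF Hk0_Hk[OF d0] j order_refl]])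
      show "AE x in M2. D (f n - l) j s 2 x = (D (f n) j s 2 - v j s) x"
        using D_diff_AE[OF fH lH j order_refl, of n] D2v[OF j] by eventually_elim simp
    qed
    show "\<forall>\<^sub>F n in sequentially. hk_norm G 2 (f n - l) \<le> (\<Sum>(j,s,r)\<in>idx 2. gh G * (poin * L2.nrm M2 (D (f n) j s 2 - v j s)))"
    proof (rule always_eventually, rule allI)
      fix n
      have "(\<Sum>(j,s,r)\<in>idx 2. gh G * (poin * L2.nrm M2 (D (f n - l) j s 2))) = (\<Sum>(j,s,r)\<in>idx 2. gh G * (poin * L2.nrm M2 (D (f n) j s 2 - v j s)))"
        by (intro sum.cong refl) (auto simp: idx_def e)
      then show "hk_norm G 2 (f n - l) \<le> (\<Sum>(j,s,r)\<in>idx 2. gh G * (poin * L2.nrm M2 (D (f n) j s 2 - v j s)))"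
        using Hk0_norm_le[OF d0, of n] by simp
    qed
    have "(\<lambda>n. (\<Sum>(j,s,r)\<in>idx 2. gh G * (poin * L2.nrm M2 (D (f n) j s 2 - v j s)))) \<longlonglongrightarrow> (\<Sum>(j,s,r::nat)\<in>idx 2. gh G * (poin * 0))"
      unfolding case_prod_unfold
      by (intro tendsto_sum tendsto_mult tendsto_const v(2)) (auto simp: idx_def)
    then show "(\<lambda>n. (\<Sum>(j,s,r)\<in>idx 2. gh G * (poin * L2.nrm M2 (D (f n) j s 2 - v j s)))) \<longlonglongrightarrow> 0" by simp
  qed
  then show ?thesis using l0 by blast
qed

lemma semi_hilbert_Hk0: "semi_hilbert {f. Hk0 G f} (hk_inner G)"
proof -
  have si: "semi_inner {f. Hk0 G f} (hk_inner G)"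
    by standard (use subspace_Hk0 X.ip_add X.ip_scale X.ip_sym X.ip_nonneg Hk0_Hk in \<open>auto\<close>)
  interpret X0: semi_inner "{f. Hk0 G f}" "hk_inner G" by (rule si)
  have n: "X0.nrm = hk_norm G 2" by (simp add: fun_eq_iff X0.nrm_def hk_norm_inner)
  show ?thesis
    by standard (use Hk0_complete in \<open>auto simp: n\<close>)
qed

sublocale X0: semi_hilbert "{f. Hk0 G f}" "hk_inner G" by (rule semi_hilbert_Hk0)

lemma X0_nrm: "X0.nrm = hk_norm G 2"
  by (simp add: fun_eq_iff X0.nrm_def hk_norm_inner)

end

section \<open>Spaces of functions independent of k\<close>

context geometry
begin

text \<open>Functions without \<open>k\<close>, such as the tail, are treated as constant in \<open>k\<close>; this makes the
estimates and the completeness of \<open>Hk0\<close> available for them.\<close>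

definition cst :: "sd \<Rightarrow> sdk" where "cst u = (\<lambda>k. u)"

lemma cst_add: "cst (u + v) = cst u + cst v" and cst_scale: "cst (t *\<^sub>R u) = t *\<^sub>R cst u" and cst_diff: "cst (u - v) = cst u - cst v"
  by (auto simp: cst_def plus_fun_def scaleR_fun_def fun_diff_def)

lemma D_cst: "D (cst u) j s r x = dz G (u j s) r (snd x)"
  by (simp add: D_def cst_def)

lemma Hk_cst: assumes u: "Hsd G n u" shows "Hk G n (cst u)"
proof (rule HkI)
  show "Hsd G n (cst u k)" for k using u by (simp add: cst_def)
  fix j s r assume j: "j \<le> gN G" "s \<le> gN G" "r \<le> n"
  have L: "dz G (u j s) r \<in> L2 MZ" using Hsd_L2[OF u j] .
  have m: "D (cst u) j s r \<in> borel_measurable M2"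
    using measurable_compose[OF measurable_snd L2_measurable[OF L]] by (simp add: D_cst[abs_def])
  have "(\<integral>\<^sup>+x. ennreal ((cmod (D (cst u) j s r x))\<^sup>2) \<partial>M2) = (\<integral>\<^sup>+k. ennreal (\<integral>z. (cmod (dz G (u j s) r z))\<^sup>2 \<partial>MZ) \<partial>MK)"
    using nn_integral_slices[OF m] L by (simp add: D_cst)
  also have "\<dots> = ennreal (\<integral>k. (\<integral>z. (cmod (dz G (u j s) r z))\<^sup>2 \<partial>MZ) \<partial>MK)"
    by (intro nn_integral_eq_integral) (auto intro!: Bochner_Integration.integral_nonneg)
  finally show "D (cst u) j s r \<in> L2 M2"
    by (intro L2_I_nn(1)[OF m]) (auto intro!: Bochner_Integration.integral_nonneg)
qed

lemma Hk0_cst: assumes u: "H0sd G u" shows "Hk0 G (cst u)"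
  using u Hk_cst unfolding H0sd_def Hk0_def by (simp add: cst_def)

lemma Hsd_cst: assumes "Hk G n (cst u)" shows "Hsd G n u"
  using Hk_Hsd[OF assms, of kl] kk by (simp add: cst_def)

lemma hk_norm_cst: "hk_norm G n (cst u) = sqrt (ku - kl) * sd_norm G n u"
  using kk by (simp add: hk_norm_def sd_norm_def cst_def integral_mI real_sqrt_mult)

definition H0ip :: "sd \<Rightarrow> sd \<Rightarrow> real" where "H0ip u v = hk_inner G (cst u) (cst v)"

lemma subspace_H0sd: "subspace {u. H0sd G u}"
proof -
  have lc: "H0sd G (u + t *\<^sub>R v)" if "H0sd G u" "H0sd G v" for u v t
    using Hk_lin_comb[OF Hk_cst Hk_cst, of 2 u v t] bc0_lin_comb[of u v t] that Hsd_cst[of 2 "u + t *\<^sub>R v"]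
    unfolding H0sd_def by (simp add: cst_add cst_scale)
  have z: "H0sd G 0"
  proof -
    have "Hsd G 2 0" unfolding Hsd_def using Hn1_zero[OF ac] by (simp add: zero_fun_def)
    moreover have "bc0 G 0" using Hk0_bc[OF Hk0_zero, of kl] kk by (simp add: zero_fun_def)
    ultimately show ?thesis unfolding H0sd_def by simp
  qed
  show ?thesis
    unfolding subspace_def
  proof (intro conjI ballI allI, simp_all add: z)
    show "H0sd G (x + y)" if "H0sd G x" "H0sd G y" for x y using lc[OF that, of 1] by simp
    show "H0sd G (t *\<^sub>R x)" if "H0sd G x" for t x using lc[OF z that, of t] by simp
  qed
qed

lemma semi_inner_H0sd: "semi_inner {u. H0sd G u} H0ip"
  by standard (use subspace_H0sd X0.ip_add X0.ip_scale X0.ip_sym X0.ip_nonneg Hk0_cst in \<open>auto simp: H0ip_def cst_add cst_scale\<close>)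

text \<open>The limit found in \<open>Hk0\<close> need not be constant in k. A subsequence converges
  at some single k, and the slice of the limit there is the k-independent limit; the Cauchy property
  extends this to the whole sequence.\<close>

lemma H0sd_complete:
  assumes f: "\<And>n::nat. H0sd G (f n)"
    and C: "\<And>e::real. 0 < e \<Longrightarrow> \<exists>N. \<forall>m\<ge>N. \<forall>n\<ge>N. hk_norm G 2 (cst (f m - f n)) < e"
  shows "\<exists>l. H0sd G l \<and> (\<lambda>n. hk_norm G 2 (cst (f n - l))) \<longlonglongrightarrow> 0"
proof -
  have f0: "Hk0 G (cst (f n))" for n using Hk0_cst[OF f] .
  have "\<exists>l. Hk0 G l \<and> (\<lambda>n. hk_norm G 2 (cst (f n) - l)) \<longlonglongrightarrow> 0"
    by (rule Hk0_complete[OF f0]) (rule C[unfolded cst_diff])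
  then obtain l where l: "Hk0 G l" "(\<lambda>n. hk_norm G 2 (cst (f n) - l)) \<longlonglongrightarrow> 0" by blast
  have d: "Hk G 2 (cst (f n) - l)" for n using Hk_diff[OF Hk0_Hk[OF f0] Hk0_Hk[OF l(1)]] .
  define \<phi> where "\<phi> n k = sd_nsq G 2 ((cst (f n) - l) k)" for n k
  have \<phi>0: "0 \<le> \<phi> n k" for n k
    unfolding \<phi>_def sd_nsq_eq by (intro sum_nonneg) (auto intro!: mult_nonneg_nonneg Bochner_Integration.integral_nonneg)
  have i: "integrable MK (\<phi> n)" for n using d[of n] unfolding Hk_def integrable_mI \<phi>_def by blast
  have "(hk_norm G 2 (cst (f n) - l))\<^sup>2 = (\<integral>k. \<phi> n k \<partial>MK)" for n
    unfolding hk_norm_def integral_mI \<phi>_def[symmetric] using \<phi>0 by (simp add: Bochner_Integration.integral_nonneg)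
  then have "(\<lambda>n. \<integral>k. norm (\<phi> n k) \<partial>MK) \<longlonglongrightarrow> 0" using tendsto_power[OF l(2), of 2] \<phi>0 by simp
  from tendsto_L1_AE_subseq[OF i this] obtain q where q: "strict_mono q" "AE k in MK. (\<lambda>n. \<phi> (q n) k) \<longlonglongrightarrow> 0" by blast
  \<comment> \<open>Almost every k has the property, and the k-interval has positive length.\<close>
  have "\<exists>k\<in>{kl..ku}. (\<lambda>n. \<phi> (q n) k) \<longlonglongrightarrow> 0"
  proof (rule ccontr)
    assume "\<not> ?thesis"
    then have "AE k in MK. False" using q(2) unfolding AE_mI by (auto elim!: eventually_mono)
    moreover have "{x. kl \<le> x \<and> x \<le> ku} = {kl..ku}" by auto
    ultimately have "emeasure MK {kl..ku} = 0" using AE_iff_measurable[of "{kl..ku}" MK "\<lambda>_. False"] by (simp add: sets.top[of MK, simplified])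
    then have "measure MK {kl..ku} = 0" by (simp add: measure_def)
    then show False using kk by simp
  qed
  then obtain k where k: "k \<in> {kl..ku}" "(\<lambda>n. \<phi> (q n) k) \<longlonglongrightarrow> 0" by blast
  define u where "u = l k"
  have u: "H0sd G u" unfolding u_def H0sd_def using Hk_Hsd[OF Hk0_Hk[OF l(1)] k(1)] Hk0_bc[OF l(1) k(1)] by simp
  have dq: "Hk0 G (cst (f m - u))" for m using subspace_diff[OF subspace_H0sd, of "f m" u] f u Hk0_cst by simp
  have sub: "(\<lambda>n. hk_norm G 2 (cst (f (q n) - u))) \<longlonglongrightarrow> 0"
  proof -
    have "hk_norm G 2 (cst (f (q n) - u)) = sqrt (ku - kl) * sqrt (\<phi> (q n) k)" for n
      unfolding hk_norm_cst sd_norm_def \<phi>_def u_def by (simp add: cst_def)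
    moreover have "(\<lambda>n. sqrt (ku - kl) * sqrt (\<phi> (q n) k)) \<longlonglongrightarrow> sqrt (ku - kl) * sqrt 0" by (intro tendsto_intros k)
    ultimately show ?thesis by simp
  qed
  have "(\<lambda>n. hk_norm G 2 (cst (f n - u))) \<longlonglongrightarrow> 0"
  proof (rule LIMSEQ_I)
    fix e :: real assume e: "0 < e"
    then have e2: "0 < e/2" by simp
    obtain N where N: "\<And>m n. m \<ge> N \<Longrightarrow> n \<ge> N \<Longrightarrow> hk_norm G 2 (cst (f m - f n)) < e/2" using C[OF e2] by blast
    obtain N' where N': "\<And>n. n \<ge> N' \<Longrightarrow> \<bar>hk_norm G 2 (cst (f (q n) - u))\<bar> < e/2" using LIMSEQ_D[OF sub e2] by auto
    have "norm (hk_norm G 2 (cst (f n - u)) - 0) < e" if n: "n \<ge> N" for n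
    proof -
      define m where "m = max N N'"
      have qm: "q m \<ge> N" using seq_suble[OF q(1), of m] unfolding m_def by linarith
      have "hk_norm G 2 (cst (f n - u)) \<le> hk_norm G 2 (cst (f n - f (q m))) + hk_norm G 2 (cst (f (q m) - u))"
        using X0.nrm_tri[of "cst (f n)" "cst (f (q m))" "cst u"] f0 Hk0_cst[OF u] unfolding X0_nrm cst_diff by simp
      moreover have "0 \<le> hk_norm G 2 (cst (f n - u))" using X0.nrm_ge0[of "cst (f n - u)"] dq unfolding X0_nrm by simp
      ultimately show ?thesis using N[OF n qm] N'[of m] unfolding m_def by auto
    qed
    then show "\<exists>N. \<forall>n\<ge>N. norm (hk_norm G 2 (cst (f n - u)) - 0) < e" by blast
  qed
  then show ?thesis using u by blast
qed

lemma semi_hilbert_H0sd: "semi_hilbert {u. H0sd G u} H0ip"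
proof -
  interpret Z: semi_inner "{u. H0sd G u}" H0ip by (rule semi_inner_H0sd)
  have n: "Z.nrm u = hk_norm G 2 (cst u)" for u by (simp add: Z.nrm_def hk_norm_inner H0ip_def)
  show ?thesis by standard (use H0sd_complete in \<open>auto simp: n\<close>)
qed

sublocale Z: semi_hilbert "{u. H0sd G u}" H0ip by (rule semi_hilbert_H0sd)

lemma Z_nrm: "Z.nrm u = hk_norm G 2 (cst u)"
  by (simp add: Z.nrm_def hk_norm_inner H0ip_def)

text \<open>\<open>pbd\<close> and \<open>bd\<close> carry explicit sup and $L^2$ bounds; the constants of the estimates for the operator are
composed by their closure rules.\<close>

definition pbd :: "(real \<times> real \<Rightarrow> complex) \<Rightarrow> real \<Rightarrow> bool" where
  "pbd m \<beta> \<longleftrightarrow> m \<in> borel_measurable M2 \<and> 0 \<le> \<beta> \<and> (\<forall>x\<in>space M2. cmod (m x) \<le> \<beta>)"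

definition bd :: "(real \<times> real \<Rightarrow> complex) \<Rightarrow> real \<Rightarrow> bool" where
  "bd y b \<longleftrightarrow> y \<in> L2 M2 \<and> 0 \<le> b \<and> L2.nrm M2 y \<le> b"

lemma bd_add: "bd y b \<Longrightarrow> bd y' b' \<Longrightarrow> bd (\<lambda>x. y x + y' x) (b + b')"
  unfolding bd_def using L2.nrm_add[of y M2 y'] L2_add[of y M2 y'] by (auto simp: plus_fun_def)

lemma bd_diff: "bd y b \<Longrightarrow> bd y' b' \<Longrightarrow> bd (\<lambda>x. y x - y' x) (b + b')"
  unfolding bd_def using L2.nrm_diff[of y M2 y'] L2_diff[of y M2 y'] by (auto simp: fun_diff_def)

lemma bd_mult:
  assumes m: "pbd m \<beta>" and y: "bd y b" shows "bd (\<lambda>x. m x * y x) (\<beta> * b)"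
proof -
  have yL: "y \<in> L2 M2" and b: "0 \<le> b" "L2.nrm M2 y \<le> b" and \<beta>: "0 \<le> \<beta>" using y m by (auto simp: bd_def pbd_def)
  have mm: "(\<lambda>x. m x * y x) \<in> borel_measurable M2" using m L2_measurable[OF yL] unfolding pbd_def by auto
  have ae: "AE x in M2. cmod (m x * y x) \<le> \<beta> * cmod (y x)"
    using m by (intro AE_I2) (auto simp: pbd_def norm_mult intro: mult_right_mono)
  have L: "(\<lambda>x. m x * y x) \<in> L2 M2" by (rule L2_dominated[OF yL mm ae])
  have "L2.nrm M2 (\<lambda>x. m x * y x) \<le> L2.nrm M2 (\<lambda>x. \<beta> *\<^sub>R y x)"
    by (rule L2_nrm_mono[OF L2_scale[OF yL] L]) (use ae \<beta> in simp)
  also have "\<dots> = \<beta> * L2.nrm M2 y" using L2.nrm_scale[OF yL, of \<beta>] \<beta> by (simp add: scaleR_fun_def)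
  also have "\<dots> \<le> \<beta> * b" using b \<beta> by (intro mult_left_mono)
  finally show ?thesis using L b \<beta> unfolding bd_def by auto
qed

lemma bd_mono: "bd y b \<Longrightarrow> b \<le> b' \<Longrightarrow> bd y b'"
  unfolding bd_def by auto

lemma bd_sum: "(\<And>i. i < n \<Longrightarrow> bd (y i) b) \<Longrightarrow> 0 \<le> b \<Longrightarrow> bd (\<lambda>x. \<Sum>i<n. y i x) (real n * b)"
proof (induction n)
  case 0
  then show ?case unfolding bd_def using L2_zero by (simp add: L2_nrm)
next
  case (Suc n)
  have "bd (\<lambda>x. (\<Sum>i<n. y i x) + y n x) (real n * b + b)" using Suc by (intro bd_add) auto
  then show ?case by (simp add: algebra_simps)
qed

lemma pbd_const: "pbd (\<lambda>x. k) (cmod k)"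
  unfolding pbd_def by simp

lemma pbd_k: "pbd (\<lambda>x. complex_of_real (fst x)) ku"
  unfolding pbd_def space_M2 using kl kk measurable_compose[OF measurable_fst measurable_ident_mI] by auto

text \<open>The L^2 norm of the constant 1 on the rectangle, by which sup bounds become L^2
  bounds.\<close>

definition vol :: real where "vol = sqrt (measure M2 (space M2))"

lemma bd_pbd: assumes m: "pbd m \<beta>" shows "bd m (vol * \<beta>)"
proof -
  interpret F: finite_measure M2 by (rule finite_measure_mI2)
  have one: "(\<lambda>x. 1) \<in> L2 M2" unfolding L2_def by simp
  have "bd (\<lambda>x. 1) vol" unfolding bd_def using one by (simp add: L2_nrm vol_def)
  from bd_mult[OF m this] show ?thesis by (simp add: mult.commute)
qed

lemma vol_nonneg: "0 \<le> vol" unfolding vol_def by simp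

lemma bd_D: "Hk G 2 f \<Longrightarrow> j \<le> gN G \<Longrightarrow> s \<le> gN G \<Longrightarrow> r \<le> 2 \<Longrightarrow> bd (D f j s r) (hk_norm G 2 f / gh G)"
  unfolding bd_def using Hk_D nrm_D_le X.nrm_ge0[of f] h by (auto simp: X_nrm)

section \<open>Pointwise bounds for gradients and their k-integrals\<close>

text \<open>The H^2 norm of the slice at k. It is square integrable in k but in general unbounded,
  and it measures how far pointwise bounds for f can depend on k.\<close>

definition eta :: "sdk \<Rightarrow> real \<Rightarrow> real" where "eta f k = sqrt (sd_nsq G 2 (f k))"

lemma sd_nsq_nonneg: "0 \<le> sd_nsq G n u"
  unfolding sd_nsq_eq by (intro sum_nonneg) (auto intro!: mult_nonneg_nonneg Bochner_Integration.integral_nonneg)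

lemma eta_nonneg: "0 \<le> eta f k"
  unfolding eta_def using sd_nsq_nonneg by simp

lemma slice_nrm_le:
  assumes f: "Hk G 2 f" and k: "k \<in> {kl..ku}" and j: "j \<le> gN G" "s \<le> gN G" and r: "r \<le> 2"
  shows "L2.nrm MZ (dz G (f k j s) r) \<le> eta f k / gh G"
proof -
  have "(case (j,s,r) of (j,s,r) \<Rightarrow> (gh G)\<^sup>2 * (\<integral>z. (cmod (dz G (f k j s) r z))\<^sup>2 \<partial>MZ)) \<le> sd_nsq G 2 (f k)"
    unfolding sd_nsq_eq using j r
    by (intro member_le_sum) (auto simp: idx_def intro!: mult_nonneg_nonneg Bochner_Integration.integral_nonneg)
  then have "(gh G * L2.nrm MZ (dz G (f k j s) r))\<^sup>2 \<le> sd_nsq G 2 (f k)"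
    using L2.nrm_sq[OF Hsd_L2[OF Hk_Hsd[OF f k] j r]] by (simp add: power_mult_distrib ip2_self)
  then have "gh G * L2.nrm MZ (dz G (f k j s) r) \<le> eta f k" unfolding eta_def by (rule real_le_rsqrt)
  then show ?thesis using h by (simp add: field_simps)
qed

definition Cs :: real where "Cs = 2 * sobolev_const a c / gh G"

lemma Cs_nonneg: "0 \<le> Cs" unfolding Cs_def using sobolev_const_nonneg[OF ac] h by simp

lemma D_pointwise:
  assumes f: "Hk G 2 f" and j: "j \<le> gN G" "s \<le> gN G" and r: "r < 2" and x: "x \<in> space M2"
  shows "cmod (D f j s r x) \<le> Cs * eta f (fst x)"
proof -
  have k: "fst x \<in> {kl..ku}" and z: "snd x \<in> {a..c}" using x by (auto simp: space_M2)
  have H: "Hn1 a c 2 (f (fst x) j s)" using Hk_Hn1[OF f k j] .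
  have "cmod (zd a c (f (fst x) j s) r (snd x)) \<le> sobolev_const a c * (L2.nrm MZ (zd a c (f (fst x) j s) r) + L2.nrm MZ (zd a c (f (fst x) j s) (Suc r)))"
    using sobolev[OF ac Hn1_wd[OF H r] Hn1_L2[OF H] z] r by simp
  also have "\<dots> \<le> sobolev_const a c * (eta f (fst x) / gh G + eta f (fst x) / gh G)"
    using slice_nrm_le[OF f k j, of r] slice_nrm_le[OF f k j, of "Suc r"] r sobolev_const_nonneg[OF ac]
    by (intro mult_left_mono add_mono) (auto simp: dz_def simp del: zd.simps)
  finally show ?thesis unfolding D_def dz_def Cs_def by (simp add: field_simps)
qed

lemma eta_integrable:
  assumes f: "Hk G 2 f"
  shows "integrable MK (eta f)" "(\<integral>k. eta f k \<partial>MK) \<le> sqrt (ku - kl) * hk_norm G 2 f"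
proof -
  have i: "integrable MK (\<lambda>k. sd_nsq G 2 (f k))" using f unfolding Hk_def integrable_mI by blast
  have m: "eta f \<in> borel_measurable MK" unfolding eta_def using borel_measurable_integrable[OF i] by measurable
  have L: "(\<lambda>k. complex_of_real (eta f k)) \<in> L2 MK"
    unfolding L2_def using m i sd_nsq_nonneg by (simp add: eta_def)
  from L2_integrable[OF L] have "integrable MK (\<lambda>k. Re (complex_of_real (eta f k)))" by (rule integrable_Re)
  then show "integrable MK (eta f)" by simp
  have n: "L2.nrm MK (\<lambda>k. complex_of_real (eta f k)) = hk_norm G 2 f"
    unfolding L2_nrm hk_norm_def integral_mI by (simp add: eta_def sd_nsq_nonneg)
  show "(\<integral>k. eta f k \<partial>MK) \<le> sqrt (ku - kl) * hk_norm G 2 f"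
    using L1_le_L2[OF L] kk eta_nonneg unfolding n by simp
qed

text \<open>The points where difference operators are evaluated. Here j and s are at least 1, so the
  truncated subtraction in j - 1 and s - 1 yields the true neighbours.\<close>

definition int_pt :: "nat \<Rightarrow> nat \<Rightarrow> bool" where
  "int_pt j s \<longleftrightarrow> j \<in> {1..<gN G} \<and> s \<in> {1..<gN G}"

lemma int_pt_D: "int_pt j s \<Longrightarrow> j \<le> gN G" "int_pt j s \<Longrightarrow> s \<le> gN G" "int_pt j s \<Longrightarrow> j + 1 \<le> gN G" "int_pt j s \<Longrightarrow> s + 1 \<le> gN G"
  "int_pt j s \<Longrightarrow> j - 1 \<le> gN G" "int_pt j s \<Longrightarrow> s - 1 \<le> gN G"
  by (auto simp: int_pt_def)

definition gr :: "sdk \<Rightarrow> nat \<Rightarrow> nat \<Rightarrow> nat \<Rightarrow> real \<times> real \<Rightarrow> complex" where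
  "gr f i j s x = gradc G (f (fst x)) i j s (snd x)"

lemma gr_D: "gr f i j s x = (if i = 0 then (D f (j + 1) s 0 x - D f (j - 1) s 0 x) / complex_of_real (2 * gh G)
    else if i = 1 then (D f j (s + 1) 0 x - D f j (s - 1) 0 x) / complex_of_real (2 * gh G) else D f j s 1 x)"
  unfolding gr_def gradc_def dx_def dy_def D_def dz_def by simp

lemma gr_measurable: assumes f: "Hk G 2 f" and p: "int_pt j s" shows "gr f i j s \<in> borel_measurable M2"
proof -
  note m = Hk_measurable[OF f]
  note [measurable] = m[OF int_pt_D(3,2)[OF p], of 0] m[OF int_pt_D(5,2)[OF p], of 0] m[OF int_pt_D(1,4)[OF p], of 0]
     m[OF int_pt_D(1,6)[OF p], of 0] m[OF int_pt_D(1,2)[OF p], of 1]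
  have "(\<lambda>x. gr f i j s x) \<in> borel_measurable M2"
    unfolding gr_D by measurable
  then show ?thesis by simp
qed

text \<open>The summand 1 serves the z-derivative, 1/h the central differences.\<close>

definition Cg :: real where "Cg = Cs * (1 + 1 / gh G)"

lemma Cg_nonneg: "0 \<le> Cg" unfolding Cg_def using Cs_nonneg h by simp

lemma gr_pointwise:
  assumes f: "Hk G 2 f" and p: "int_pt j s" and x: "x \<in> space M2"
  shows "cmod (gr f i j s x) \<le> Cg * eta f (fst x)"
proof -
  note b = D_pointwise[OF f _ _ _ x]
  have ce: "0 \<le> Cs * eta f (fst x)" using Cs_nonneg eta_nonneg by simp
  have q: "cmod ((u - v) / complex_of_real (2 * gh G)) \<le> Cg * eta f (fst x)"
    if "cmod u \<le> Cs * eta f (fst x)" "cmod v \<le> Cs * eta f (fst x)" for u v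
  proof -
    have "cmod ((u - v) / complex_of_real (2 * gh G)) = cmod (u - v) / (2 * gh G)" using h by (simp add: norm_divide)
    also have "\<dots> \<le> (2 * (Cs * eta f (fst x))) / (2 * gh G)"
      using norm_triangle_ineq4[of u v] that h by (intro divide_right_mono) auto
    also have "\<dots> \<le> Cg * eta f (fst x)" unfolding Cg_def using ce h by (simp add: field_simps)
    finally show ?thesis .
  qed
  have "cmod (D f j s 1 x) \<le> Cg * eta f (fst x)"
  proof -
    have "0 \<le> Cs * eta f (fst x) * (1 / gh G)" using ce h by simp
    then show ?thesis using b[OF int_pt_D(1,2)[OF p], of 1] unfolding Cg_def by (simp add: algebra_simps)
  qed
  then show ?thesis
    unfolding gr_D using q[OF b[OF int_pt_D(3,2)[OF p], of 0] b[OF int_pt_D(5,2)[OF p], of 0]]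
      q[OF b[OF int_pt_D(1,4)[OF p], of 0] b[OF int_pt_D(1,6)[OF p], of 0]] by auto
qed

lemma gr_lin_comb:
  assumes f: "Hk G 2 f" and g: "Hk G 2 g" and p: "int_pt j s" and x: "x \<in> space M2"
  shows "gr (f + t *\<^sub>R g) i j s x = gr f i j s x + t *\<^sub>R gr g i j s x"
  using D_lin_comb[OF f g int_pt_D(3,2)[OF p] _ x, of 0 t] D_lin_comb[OF f g int_pt_D(5,2)[OF p] _ x, of 0 t]
    D_lin_comb[OF f g int_pt_D(1,4)[OF p] _ x, of 0 t] D_lin_comb[OF f g int_pt_D(1,6)[OF p] _ x, of 0 t]
    D_lin_comb[OF f g int_pt_D(1,2)[OF p] _ x, of 1 t]
  unfolding gr_D by (simp add: diff_divide_distrib add_divide_distrib scaleR_conv_of_real right_diff_distrib)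

definition Cl :: real where "Cl = (1 + 1 / gh G) / gh G"

lemma Cl_nonneg: "0 \<le> Cl" unfolding Cl_def using h by simp

lemma hk_nonneg: "Hk G 2 f \<Longrightarrow> 0 \<le> hk_norm G 2 f"
  using X.nrm_ge0[of f] by (simp add: X_nrm)

lemma bd_gr: assumes f: "Hk G 2 f" and p: "int_pt j s" shows "bd (gr f i j s) (Cl * hk_norm G 2 f)"
proof -
  note b = bd_D[OF f]
  let ?n = "hk_norm G 2 f"
  have n: "0 \<le> ?n" using hk_nonneg[OF f] .
  have q: "bd (\<lambda>x. (u x - v x) / complex_of_real (2 * gh G)) (Cl * ?n)" if "bd u (?n / gh G)" "bd v (?n / gh G)" for u v
  proof -
    have "bd (\<lambda>x. (1 / complex_of_real (2 * gh G)) * (u x - v x)) (cmod (1 / complex_of_real (2 * gh G)) * (?n / gh G + ?n / gh G))"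
      by (intro bd_mult pbd_const bd_diff that)
    moreover have "cmod (1 / complex_of_real (2 * gh G)) * (?n / gh G + ?n / gh G) \<le> Cl * ?n"
      using n h by (simp add: norm_divide Cl_def field_simps)
    ultimately have "bd (\<lambda>x. (1 / complex_of_real (2 * gh G)) * (u x - v x)) (Cl * ?n)" by (rule bd_mono)
    then show ?thesis by simp
  qed
  have "bd (D f j s 1) (Cl * ?n)"
    by (rule bd_mono[OF b[OF int_pt_D(1,2)[OF p]]]) (use n h in \<open>simp_all add: Cl_def field_simps\<close>)
  moreover have "bd (\<lambda>x. (D f (j + 1) s 0 x - D f (j - 1) s 0 x) / complex_of_real (2 * gh G)) (Cl * ?n)"
    using int_pt_D[OF p] by (intro q b) auto
  moreover have "bd (\<lambda>x. (D f j (s + 1) 0 x - D f j (s - 1) 0 x) / complex_of_real (2 * gh G)) (Cl * ?n)"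
    using int_pt_D[OF p] by (intro q b) auto
  ultimately have "bd (\<lambda>x. gr f i j s x) (Cl * ?n)"
    unfolding gr_D by (cases "i = 0"; cases "i = 1") simp_all
  then show ?thesis by simp
qed

definition ig :: "sdk \<Rightarrow> nat \<Rightarrow> nat \<Rightarrow> nat \<Rightarrow> real \<times> real \<Rightarrow> complex" where
  "ig f i j s x = intgrad G f i (fst x) j s (snd x)"

lemma gr_slice_integrable:
  assumes f: "Hk G 2 f" and p: "int_pt j s" and z: "z \<in> {a..c}"
  shows "integrable MK (\<lambda>\<kappa>. gr f i j s (\<kappa>, z))"
proof (rule Bochner_Integration.integrable_bound)
  show "integrable MK (\<lambda>\<kappa>. Cg * eta f \<kappa>)" using eta_integrable(1)[OF f] by simp
  have "(\<lambda>\<kappa>. (\<kappa>, z)) \<in> measurable MK M2" using z by (intro measurable_Pair measurable_ident measurable_const) auto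
  from measurable_compose[OF this gr_measurable[OF f p]] show "(\<lambda>\<kappa>. gr f i j s (\<kappa>, z)) \<in> borel_measurable MK" .
  show "AE \<kappa> in MK. norm (gr f i j s (\<kappa>, z)) \<le> norm (Cg * eta f \<kappa>)"
    using gr_pointwise[OF f p, of "(\<kappa>, z)" i for \<kappa>] z Cg_nonneg eta_nonneg by (intro AE_I2) (auto simp: space_M2)
qed

lemma gr_slice_integrable':
  assumes f: "Hk G 2 f" and p: "int_pt j s" and z: "z \<in> {a..c}"
  shows "integrable MK (\<lambda>\<kappa>. (if k \<le> \<kappa> then 1 else 0) *\<^sub>R gr f i j s (\<kappa>, z))"
proof (rule Bochner_Integration.integrable_bound[OF gr_slice_integrable[OF f p z, of i]])
  show "(\<lambda>\<kappa>. (if k \<le> \<kappa> then 1 else 0) *\<^sub>R gr f i j s (\<kappa>, z)) \<in> borel_measurable MK"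
    using borel_measurable_integrable[OF gr_slice_integrable[OF f p z, of i]] by measurable
qed auto

lemma ig_eq:
  assumes x: "x \<in> space M2"
  shows "ig f i j s x = (\<integral>\<kappa>. (if fst x \<le> \<kappa> then 1 else 0) *\<^sub>R gr f i j s (\<kappa>, snd x) \<partial>MK)"
  using x unfolding ig_def intgrad_def integral_mI[symmetric] set_lebesgue_integral_def gr_def space_M2
  by (intro Bochner_Integration.integral_cong) (auto simp: indicator_def)

lemma ig_measurable:
  assumes f: "Hk G 2 f" and p: "int_pt j s" shows "ig f i j s \<in> borel_measurable M2"
proof -
  have [measurable]: "(\<lambda>y. fst (fst y)) \<in> borel_measurable (M2 \<Otimes>\<^sub>M MK)" "snd \<in> borel_measurable (M2 \<Otimes>\<^sub>M MK)"
    using measurable_compose[OF measurable_fst measurable_compose[OF measurable_fst measurable_ident_mI]]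
      measurable_compose[OF measurable_snd measurable_ident_mI] by simp_all
  have "(\<lambda>y. (snd y, snd (fst y))) \<in> measurable (M2 \<Otimes>\<^sub>M MK) M2"
    by (intro measurable_Pair measurable_compose[OF measurable_fst measurable_snd] measurable_snd)
  from measurable_compose[OF this gr_measurable[OF f p]]
  have [measurable]: "(\<lambda>y. gr f i j s (snd y, snd (fst y))) \<in> borel_measurable (M2 \<Otimes>\<^sub>M MK)" .
  have "(\<lambda>(x, \<kappa>). (if fst x \<le> \<kappa> then 1 else 0) *\<^sub>R gr f i j s (\<kappa>, snd x)) \<in> borel_measurable (M2 \<Otimes>\<^sub>M MK)"
    unfolding case_prod_unfold by measurable
  then have m: "(\<lambda>x. \<integral>\<kappa>. (if fst x \<le> \<kappa> then 1 else 0) *\<^sub>R gr f i j s (\<kappa>, snd x) \<partial>MK) \<in> borel_measurable M2"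
    by (rule mI.borel_measurable_lebesgue_integral)
  have "ig f i j s \<in> borel_measurable M2 \<longleftrightarrow> (\<lambda>x. \<integral>\<kappa>. (if fst x \<le> \<kappa> then 1 else 0) *\<^sub>R gr f i j s (\<kappa>, snd x) \<partial>MK) \<in> borel_measurable M2"
    by (rule measurable_cong) (rule ig_eq)
  then show ?thesis using m by blast
qed

definition Ci :: real where "Ci = Cg * sqrt (ku - kl)"

lemma Ci_nonneg: "0 \<le> Ci" unfolding Ci_def using Cg_nonneg kk by simp

text \<open>The k-integral turns the slice bound \<open>eta\<close>, which is merely integrable in
  k, into a bound uniform on the rectangle. This makes the products of \<open>ig\<close> with
  gradients square integrable.\<close>

lemma pbd_ig:
  assumes f: "Hk G 2 f" and p: "int_pt j s"
  shows "pbd (ig f i j s) (Ci * hk_norm G 2 f)"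
  unfolding pbd_def
proof (intro conjI ballI ig_measurable[OF f p])
  show "0 \<le> Ci * hk_norm G 2 f" using Ci_nonneg hk_nonneg[OF f] by simp
  fix x assume x: "x \<in> space M2"
  then have z: "snd x \<in> {a..c}" by (auto simp: space_M2)
  have "cmod (ig f i j s x) \<le> (\<integral>\<kappa>. cmod ((if fst x \<le> \<kappa> then 1 else 0) *\<^sub>R gr f i j s (\<kappa>, snd x)) \<partial>MK)"
    unfolding ig_eq[OF x] by (rule integral_norm_bound)
  also have "\<dots> \<le> (\<integral>\<kappa>. Cg * eta f \<kappa> \<partial>MK)"
  proof (rule integral_mono)
    show "integrable MK (\<lambda>\<kappa>. cmod ((if fst x \<le> \<kappa> then 1 else 0) *\<^sub>R gr f i j s (\<kappa>, snd x)))"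
      by (rule integrable_norm[OF gr_slice_integrable'[OF f p z]])
    show "integrable MK (\<lambda>\<kappa>. Cg * eta f \<kappa>)" using eta_integrable(1)[OF f] by simp
    fix \<kappa> assume "\<kappa> \<in> space MK"
    then have "cmod (gr f i j s (\<kappa>, snd x)) \<le> Cg * eta f \<kappa>" using gr_pointwise[OF f p, of "(\<kappa>, snd x)" i] z by (auto simp: space_M2)
    then show "cmod ((if fst x \<le> \<kappa> then 1 else 0) *\<^sub>R gr f i j s (\<kappa>, snd x)) \<le> Cg * eta f \<kappa>"
      using Cg_nonneg eta_nonneg by auto
  qed
  also have "\<dots> = Cg * (\<integral>\<kappa>. eta f \<kappa> \<partial>MK)" by simp
  also have "\<dots> \<le> Cg * (sqrt (ku - kl) * hk_norm G 2 f)" using eta_integrable(2)[OF f] Cg_nonneg by (intro mult_left_mono)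
  finally show "cmod (ig f i j s x) \<le> Ci * hk_norm G 2 f" unfolding Ci_def by (simp add: mult.assoc)
qed

lemma ig_lin_comb:
  assumes f: "Hk G 2 f" and g: "Hk G 2 g" and p: "int_pt j s" and x: "x \<in> space M2"
  shows "ig (f + t *\<^sub>R g) i j s x = ig f i j s x + t *\<^sub>R ig g i j s x"
proof -
  have z: "snd x \<in> {a..c}" using x by (auto simp: space_M2)
  have "ig (f + t *\<^sub>R g) i j s x = (\<integral>\<kappa>. (if fst x \<le> \<kappa> then 1 else 0) *\<^sub>R gr f i j s (\<kappa>, snd x) + t *\<^sub>R ((if fst x \<le> \<kappa> then 1 else 0) *\<^sub>R gr g i j s (\<kappa>, snd x)) \<partial>MK)"
    unfolding ig_eq[OF x]
    by (intro Bochner_Integration.integral_cong refl) (use z in \<open>auto simp: gr_lin_comb[OF f g p] space_M2\<close>)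
  also have "\<dots> = ig f i j s x + t *\<^sub>R ig g i j s x"
    unfolding ig_eq[OF x] integral_scaleR_right[symmetric]
    by (intro Bochner_Integration.integral_add integrable_scaleR_right gr_slice_integrable' f g p z)
  finally show ?thesis .
qed

section \<open>The discrete Laplacian\<close>

definition lp :: "sdk \<Rightarrow> nat \<Rightarrow> nat \<Rightarrow> real \<times> real \<Rightarrow> complex" where
  "lp f j s x = lap G (f (fst x)) j s (snd x)"

lemma lp_D: "lp f j s x = D f j s 2 x
    + (1 / complex_of_real ((gh G)\<^sup>2)) * ((D f (j - 1) s 0 x - 2 * D f j s 0 x) + D f (j + 1) s 0 x)
    + (1 / complex_of_real ((gh G)\<^sup>2)) * ((D f j (s - 1) 0 x - 2 * D f j s 0 x) + D f j (s + 1) 0 x)"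
  unfolding lp_def lap_def dxx_def dyy_def D_def dz_def by simp

text \<open>The 1 accounts for f_zz and the 8 for the two second differences, whose coefficients 1,
  2, 1 sum to 4 each.\<close>

definition Cp :: real where "Cp = (1 + 8 / (gh G)\<^sup>2) / gh G"

lemma Cp_nonneg: "0 \<le> Cp" unfolding Cp_def using h by simp

lemma bd_lp: assumes f: "Hk G 2 f" and p: "int_pt j s" shows "bd (lp f j s) (Cp * hk_norm G 2 f)"
proof -
  note b = bd_D[OF f]
  let ?n = "hk_norm G 2 f / gh G"
  let ?q = "1 / complex_of_real ((gh G)\<^sup>2)"
  have "bd (\<lambda>x. lp f j s x) ((?n + cmod ?q * ((?n + cmod 2 * ?n) + ?n)) + cmod ?q * ((?n + cmod 2 * ?n) + ?n))"
    unfolding lp_D using int_pt_D[OF p] by (intro bd_add bd_mult bd_diff pbd_const b) auto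
  moreover have "cmod ?q = 1 / (gh G)\<^sup>2" by (simp add: norm_divide norm_power)
  then have "(?n + cmod ?q * ((?n + cmod 2 * ?n) + ?n)) + cmod ?q * ((?n + cmod 2 * ?n) + ?n) = Cp * hk_norm G 2 f"
    unfolding Cp_def using h by (simp add: field_simps)
  ultimately show ?thesis by simp
qed

lemma lp_lin_comb:
  assumes f: "Hk G 2 f" and g: "Hk G 2 g" and p: "int_pt j s"
  shows "AE x in M2. lp (f + t *\<^sub>R g) j s x = lp f j s x + t *\<^sub>R lp g j s x"
proof -
  have "AE x in M2. x \<in> space M2" by (rule AE_I2)
  with D_lin_comb_AE[OF f g int_pt_D(1,2)[OF p] order_refl, of t] show ?thesis
  proof eventually_elim
    case (elim x)
    note e = D_lin_comb[OF f g _ _ _ elim(2), of _ _ 0 t]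
    show ?case
      unfolding lp_D elim(1) e[OF int_pt_D(5,2)[OF p] zero_less_numeral] e[OF int_pt_D(1,2)[OF p] zero_less_numeral] e[OF int_pt_D(3,2)[OF p] zero_less_numeral]
        e[OF int_pt_D(1,6)[OF p] zero_less_numeral] e[OF int_pt_D(1,4)[OF p] zero_less_numeral]
      by (simp add: algebra_simps scaleR_conv_of_real)
  qed
qed

end

section \<open>The operator and the weighted space\<close>

context geometry
begin

section \<open>Splitting the operator by its degree in q\<close>

definition kf :: "real \<times> real \<Rightarrow> complex" where "kf x = complex_of_real (fst x)"

definition Lc :: "sdk \<Rightarrow> nat \<Rightarrow> nat \<Rightarrow> real \<times> real \<Rightarrow> complex" where
  "Lc w j s x = 2 * (kf x * (\<Sum>i<3. gr w i j s x * (kf x * gr w i j s x))) + 2 * \<i> * gr w 2 j s x"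

definition Ll :: "sdk \<Rightarrow> sdk \<Rightarrow> nat \<Rightarrow> nat \<Rightarrow> real \<times> real \<Rightarrow> complex" where
  "Ll w q j s x = (lp q j s x + 2 * (kf x * (\<Sum>i<3. gr w i j s x * (kf x * gr q i j s x - ig q i j s x)
       - ig q i j s x * (kf x * gr w i j s x)))) + 2 * \<i> * (kf x * gr q 2 j s x - ig q 2 j s x)"

text \<open>The part of degree two in q, written as a bilinear map; it is not symmetric. Each term
  starts with a factor \<open>ig\<close>, so its second factor need only be square
  integrable.\<close>

definition LB :: "sdk \<Rightarrow> sdk \<Rightarrow> nat \<Rightarrow> nat \<Rightarrow> real \<times> real \<Rightarrow> complex" where
  "LB q p j s x = 2 * (kf x * (\<Sum>i<3. ig q i j s x * (ig p i j s x - kf x * gr p i j s x)))"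

text \<open>Only first-order differences and derivatives are expanded, which are linear at every
  point; the Laplacian acts on q(k) alone. Hence the identity holds everywhere, not just almost
  everywhere.\<close>

lemma Lop_split:
  assumes q: "Hk G 2 q" and V: "Hsd G 2 V" and p: "int_pt j s" and x: "x \<in> space M2"
  shows "Lop G V q (fst x) j s (snd x) = Lc (cst V) j s x + Ll (cst V) q j s x + LB q q j s x"
proof -
  have g: "gradc G (sd_add (q (fst x)) V) i j s (snd x) = gr q i j s x + gr (cst V) i j s x" for i
    using gr_lin_comb[OF q Hk_cst[OF V] p x, of 1 i] by (simp add: gr_def cst_def sd_add_def plus_fun_def)
  have v: "gradc G V i j s (snd x) = gr (cst V) i j s x" for i by (simp add: gr_def cst_def)
  have z: "dz G (q (fst x) j s) 1 (snd x) = gr q 2 j s x" "dz G (V j s) 1 (snd x) = gr (cst V) 2 j s x"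
    by (simp_all add: gr_def gradc_def cst_def)
  have "Lop G V q (fst x) j s (snd x) = lp q j s x + 2 * kf x *
         (\<Sum>i<3. (gr (cst V) i j s x - ig q i j s x) * (kf x * (gr q i j s x + gr (cst V) i j s x) - ig q i j s x))
     + 2 * \<i> * (kf x * gr q 2 j s x + gr (cst V) 2 j s x - ig q 2 j s x)"
    unfolding Lop_def g v z by (simp add: lp_def ig_def kf_def)
  also have "\<dots> = Lc (cst V) j s x + Ll (cst V) q j s x + LB q q j s x"
    unfolding Lc_def Ll_def LB_def
    by (simp add: eval_nat_numeral algebra_simps)
  finally show ?thesis .
qed

text \<open>The Carleman weight is moved into the functions, so that the weighted space is again a family of
copies of the unweighted one.\<close>

definition yw :: "real \<Rightarrow> nat \<times> nat \<Rightarrow> (nat \<Rightarrow> nat \<Rightarrow> real \<times> real \<Rightarrow> complex) \<Rightarrow> real \<times> real \<Rightarrow> complex" where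
  "yw lam = (\<lambda>(j,s) y x. exp (- lam * snd x) *\<^sub>R y j s x)"

definition JJ :: "(nat \<times> nat) set" where "JJ = {1..<gN G} \<times> {1..<gN G}"

definition SY :: "(nat \<Rightarrow> nat \<Rightarrow> real \<times> real \<Rightarrow> complex) set" where
  "SY = {y. \<forall>j s. int_pt j s \<longrightarrow> y j s \<in> L2 M2}"

definition wt :: "real \<Rightarrow> real" where "wt lam = exp (2 * lam * c) * (gh G)\<^sup>2"

definition ipY :: "real \<Rightarrow> (nat \<Rightarrow> nat \<Rightarrow> real \<times> real \<Rightarrow> complex) \<Rightarrow> (nat \<Rightarrow> nat \<Rightarrow> real \<times> real \<Rightarrow> complex) \<Rightarrow> real" where
  "ipY lam y y' = (\<Sum>i\<in>JJ. wt lam * ip2 M2 (yw lam i y) (yw lam i y'))"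

lemma JJ_iff: "(j, s) \<in> JJ \<longleftrightarrow> int_pt j s" by (simp add: JJ_def int_pt_def)

lemma wt_pos: "0 < wt lam" unfolding wt_def using h by simp

lemma weight_bound:
  assumes "x \<in> space M2" "0 \<le> lam" shows "exp (- lam * c) \<le> exp (- lam * snd x)" "exp (- lam * snd x) \<le> exp (lam * gxi G)"
proof -
  have "snd x \<le> c" "- snd x \<le> gxi G" using assms(1) by (auto simp: space_M2)
  from mult_left_mono[OF this(1) assms(2)] mult_left_mono[OF this(2) assms(2)]
  show "exp (- lam * c) \<le> exp (- lam * snd x)" "exp (- lam * snd x) \<le> exp (lam * gxi G)" by auto
qed

lemma bd_yw:
  assumes lam: "0 \<le> lam" and y: "bd (y j s) b" shows "bd (yw lam (j,s) y) (exp (lam * gxi G) * b)"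
proof -
  have [measurable]: "snd \<in> borel_measurable M2"
    using measurable_compose[OF measurable_snd measurable_ident_mI] by simp
  have "pbd (\<lambda>x. complex_of_real (exp (- lam * snd x))) (exp (lam * gxi G))"
    unfolding pbd_def using weight_bound(2)[OF _ lam] by auto
  from bd_mult[OF this y] show ?thesis by (simp add: yw_def scaleR_conv_of_real)
qed

lemma yw_L2: assumes lam: "0 \<le> lam" and y: "y \<in> SY" and i: "i \<in> JJ" shows "yw lam i y \<in> L2 M2"
proof -
  obtain j s where e: "i = (j,s)" and p: "int_pt j s" using i by (cases i) (auto simp: JJ_iff)
  have L: "y j s \<in> L2 M2" using y p by (simp add: SY_def)
  have "bd (y j s) (L2.nrm M2 (y j s))" using L L2.nrm_ge0[OF L] by (simp add: bd_def)
  from bd_yw[where y = y and j = j and s = s, OF lam this] show ?thesis unfolding e bd_def by simp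
qed

lemma subspace_SY: "subspace SY"
  unfolding subspace_def SY_def
  by (auto simp: plus_fun_def scaleR_fun_def zero_fun_def intro!: L2_add L2_scale L2_zero)

lemma semi_inner_Y: assumes lam: "0 \<le> lam" shows "semi_inner SY (ipY lam)"
  unfolding ipY_def
proof (rule semi_inner_family[OF subspace_SY])
  show "0 \<le> wt lam" using wt_pos[of lam] by simp
  show "yw lam i f \<in> L2 M2" if "i \<in> JJ" "f \<in> SY" for i f using yw_L2[OF lam that(2,1)] .
qed (auto simp: yw_def plus_fun_def scaleR_fun_def scaleR_add_right split: prod.split)

text \<open>A name for the norm of the target space that is available outside the local
  interpretations, which require 0 \<le> lam.\<close>

definition nY :: "real \<Rightarrow> (nat \<Rightarrow> nat \<Rightarrow> real \<times> real \<Rightarrow> complex) \<Rightarrow> real" where "nY lam y = sqrt (ipY lam y y)"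

lemma nY_sq:
  assumes lam: "0 \<le> lam" and y: "y \<in> SY"
  shows "(nY lam y)\<^sup>2 = (\<Sum>i\<in>JJ. wt lam * (L2.nrm M2 (yw lam i y))\<^sup>2)"
proof -
  interpret Y: semi_inner SY "ipY lam" by (rule semi_inner_Y[OF lam])
  have "(nY lam y)\<^sup>2 = ipY lam y y" using Y.ip_nonneg[OF y] by (simp add: nY_def)
  then show ?thesis unfolding ipY_def using L2.nrm_sq[OF yw_L2[OF lam y]] by simp
qed

lemma SY_I: "(\<And>j s. int_pt j s \<Longrightarrow> bd (y j s) b) \<Longrightarrow> y \<in> SY"
  by (auto simp: SY_def bd_def)

lemma nY_le:
  assumes lam: "0 \<le> lam" and y: "\<And>j s. int_pt j s \<Longrightarrow> bd (y j s) b" and b: "0 \<le> b"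
  shows "nY lam y \<le> sqrt (real (card JJ) * wt lam) * exp (lam * gxi G) * b"
proof -
  have S: "y \<in> SY" using y by (rule SY_I)
  have "(nY lam y)\<^sup>2 \<le> (\<Sum>i\<in>JJ. wt lam * (exp (lam * gxi G) * b)\<^sup>2)"
    unfolding nY_sq[OF lam S]
  proof (intro sum_mono mult_left_mono power_mono)
    fix i assume i: "i \<in> JJ"
    obtain j s where e: "i = (j,s)" and p: "int_pt j s" using i by (cases i) (auto simp: JJ_iff)
    show "L2.nrm M2 (yw lam i y) \<le> exp (lam * gxi G) * b" using bd_yw[where y = y and j = j and s = s, OF lam y[OF p]] unfolding e bd_def by simp
    show "0 \<le> L2.nrm M2 (yw lam i y)" using L2.nrm_ge0[OF yw_L2[OF lam S i]] .
    show "0 \<le> wt lam" using wt_pos[of lam] by simp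
  qed
  also have "\<dots> = (sqrt (real (card JJ) * wt lam) * exp (lam * gxi G) * b)\<^sup>2"
    using wt_pos[of lam] by (simp add: power_mult_distrib)
  finally show ?thesis using b wt_pos[of lam] by (intro power2_le_imp_le[OF _ mult_nonneg_nonneg]) auto
qed

lemma eqvY:
  assumes lam: "0 \<le> lam" and y: "y \<in> SY" and y': "y' \<in> SY"
    and e: "\<And>j s. int_pt j s \<Longrightarrow> AE x in M2. y j s x = y' j s x"
  shows "semi_inner.eqv SY (ipY lam) y y'"
proof -
  interpret Y: semi_inner SY "ipY lam" by (rule semi_inner_Y[OF lam])
  have d: "y - y' \<in> SY" using Y.S_diff[OF y y'] .
  have "L2.nrm M2 (yw lam i (y - y')) = 0" if i: "i \<in> JJ" for i
  proof -
    obtain j s where ij: "i = (j,s)" and p: "int_pt j s" using i by (cases i) (auto simp: JJ_iff)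
    have "L2.nrm M2 (yw lam i (y - y')) = L2.nrm M2 (\<lambda>x. 0)"
      by (rule L2_nrm_cong_AE[OF L2_zero yw_L2[OF lam d i]])
         (use e[OF p] in \<open>auto simp: ij yw_def fun_diff_def elim!: eventually_mono\<close>)
    then show ?thesis by (simp add: L2_nrm)
  qed
  then have "(nY lam (y - y'))\<^sup>2 = 0" unfolding nY_sq[OF lam d] by simp
  then show ?thesis using y y' unfolding Y.eqv_def Y.nrm_def nY_def by simp
qed

section \<open>Bounds for the three parts of the operator\<close>

lemma pbd_kf: "pbd kf ku"
  using pbd_k unfolding kf_def[abs_def] .

text \<open>For a k-independent function the slice norm is the same for all k, so its gradient is
  bounded uniformly; the tail may therefore multiply gradients of q.\<close>

lemma gr_cst_pbd:
  assumes V: "Hsd G 2 V" and p: "int_pt j s"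
  shows "pbd (gr (cst V) i j s) (Cg * sd_norm G 2 V)"
  unfolding pbd_def
proof (intro conjI ballI gr_measurable[OF Hk_cst[OF V] p])
  show "0 \<le> Cg * sd_norm G 2 V" using Cg_nonneg sd_nsq_nonneg by (simp add: sd_norm_def)
  show "cmod (gr (cst V) i j s x) \<le> Cg * sd_norm G 2 V" if "x \<in> space M2" for x
    using gr_pointwise[OF Hk_cst[OF V] p that, of i] by (simp add: eta_def cst_def sd_norm_def)
qed

text \<open>\<open>Kc\<close>, \<open>Kl\<close> and \<open>KB\<close> are read off from the closure
  rules of \<open>bd\<close> and \<open>pbd\<close>. The first two are monotone in the bound W for
  the tail, so W may replace the norm of V.\<close>

definition Kc :: "real \<Rightarrow> real" where
  "Kc W = vol * (cmod 2 * (ku * (3 * ((Cg * W) * (ku * (Cg * W)))))) + vol * (cmod (2 * \<i>) * (Cg * W))"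

definition Kl :: "real \<Rightarrow> real" where
  "Kl W = (Cp + cmod 2 * (ku * (3 * ((Cg * W) * (ku * Cl + vol * Ci) + vol * (Ci * (ku * (Cg * W))))))) + cmod (2 * \<i>) * (ku * Cl + vol * Ci)"

definition KB :: real where
  "KB = cmod 2 * (ku * (3 * (Ci * (vol * Ci + ku * Cl))))"

lemma ku0: "0 \<le> ku" using kl kk by simp

lemma bd_c:
  assumes V: "Hsd G 2 V" and p: "int_pt j s"
  shows "bd (Lc (cst V) j s) (Kc (sd_norm G 2 V))"
proof -
  let ?W = "Cg * sd_norm G 2 V"
  have W: "0 \<le> ?W" using gr_cst_pbd[OF V p] by (auto simp: pbd_def)
  note g = gr_cst_pbd[OF V p]
  have i: "bd (\<lambda>x. gr (cst V) i j s x * (kf x * gr (cst V) i j s x)) (?W * (ku * (vol * ?W)))" for i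
    by (intro bd_mult g pbd_kf bd_pbd)
  have s: "bd (\<lambda>x. \<Sum>i<3. gr (cst V) i j s x * (kf x * gr (cst V) i j s x)) (real 3 * (?W * (ku * (vol * ?W))))"
    using W ku0 vol_nonneg by (intro bd_sum i) auto
  have "bd (\<lambda>x. Lc (cst V) j s x) (cmod 2 * (ku * (real 3 * (?W * (ku * (vol * ?W))))) + cmod (2 * \<i>) * (vol * ?W))"
    unfolding Lc_def by (intro bd_add bd_mult pbd_const pbd_kf s bd_pbd g)
  then show ?thesis unfolding Kc_def by (simp add: mult_ac)
qed

lemma bd_l:
  assumes V: "Hsd G 2 V" and q: "Hk G 2 q" and p: "int_pt j s"
  shows "bd (Ll (cst V) q j s) (Kl (sd_norm G 2 V) * hk_norm G 2 q)"
proof -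
  let ?W = "Cg * sd_norm G 2 V" and ?n = "hk_norm G 2 q"
  have W: "0 \<le> ?W" using gr_cst_pbd[OF V p] by (auto simp: pbd_def)
  have n: "0 \<le> ?n" using hk_nonneg[OF q] .
  note g = gr_cst_pbd[OF V p] and gq = bd_gr[OF q p] and ii = pbd_ig[OF q p]
  have i: "bd (\<lambda>x. gr (cst V) i j s x * (kf x * gr q i j s x - ig q i j s x) - ig q i j s x * (kf x * gr (cst V) i j s x))
     (?W * (ku * (Cl * ?n) + vol * (Ci * ?n)) + (Ci * ?n) * (ku * (vol * ?W)))" for i
    by (intro bd_diff bd_mult g pbd_kf bd_pbd gq ii)
  have s: "bd (\<lambda>x. \<Sum>i<3. gr (cst V) i j s x * (kf x * gr q i j s x - ig q i j s x) - ig q i j s x * (kf x * gr (cst V) i j s x))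
     (real 3 * (?W * (ku * (Cl * ?n) + vol * (Ci * ?n)) + (Ci * ?n) * (ku * (vol * ?W))))"
    using W n ku0 vol_nonneg Cl_nonneg Ci_nonneg by (intro bd_sum i) auto
  have "bd (\<lambda>x. Ll (cst V) q j s x) ((Cp * ?n + cmod 2 * (ku * (real 3 * (?W * (ku * (Cl * ?n) + vol * (Ci * ?n)) + (Ci * ?n) * (ku * (vol * ?W))))))
     + cmod (2 * \<i>) * (ku * (Cl * ?n) + vol * (Ci * ?n)))"
    unfolding Ll_def by (intro bd_add bd_mult bd_diff pbd_const pbd_kf s bd_pbd ii gq bd_lp[OF q p])
  then show ?thesis unfolding Kl_def by (simp add: algebra_simps)
qed

lemma bd_B:
  assumes q: "Hk G 2 q" and r: "Hk G 2 r" and p: "int_pt j s"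
  shows "bd (LB q r j s) (KB * hk_norm G 2 q * hk_norm G 2 r)"
proof -
  let ?m = "hk_norm G 2 q" and ?n = "hk_norm G 2 r"
  have n: "0 \<le> ?m" "0 \<le> ?n" using hk_nonneg q r by auto
  have i: "bd (\<lambda>x. ig q i j s x * (ig r i j s x - kf x * gr r i j s x)) ((Ci * ?m) * (vol * (Ci * ?n) + ku * (Cl * ?n)))" for i
    by (intro bd_diff bd_mult pbd_kf bd_pbd pbd_ig bd_gr q r p)
  have s: "bd (\<lambda>x. \<Sum>i<3. ig q i j s x * (ig r i j s x - kf x * gr r i j s x)) (real 3 * ((Ci * ?m) * (vol * (Ci * ?n) + ku * (Cl * ?n))))"
    using n ku0 vol_nonneg Cl_nonneg Ci_nonneg by (intro bd_sum i) auto
  have "bd (\<lambda>x. LB q r j s x) (cmod 2 * (ku * (real 3 * ((Ci * ?m) * (vol * (Ci * ?n) + ku * (Cl * ?n))))))"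
    unfolding LB_def by (intro bd_mult pbd_const pbd_kf s)
  then show ?thesis unfolding KB_def by (simp add: algebra_simps)
qed

lemma Kc_mono: "0 \<le> W \<Longrightarrow> W \<le> W' \<Longrightarrow> Kc W \<le> Kc W'"
  unfolding Kc_def using vol_nonneg ku0 Cg_nonneg
  by (intro add_mono mult_left_mono mult_mono) auto

lemma Kl_mono: "0 \<le> W \<Longrightarrow> W \<le> W' \<Longrightarrow> Kl W \<le> Kl W'"
  unfolding Kl_def using vol_nonneg ku0 Cg_nonneg Cl_nonneg Ci_nonneg
  by (intro add_mono mult_left_mono mult_mono order_refl) auto

lemma K_nonneg: "0 \<le> W \<Longrightarrow> 0 \<le> Kc W" "0 \<le> W \<Longrightarrow> 0 \<le> Kl W" "0 \<le> KB"
  unfolding Kc_def Kl_def KB_def using vol_nonneg ku0 Cg_nonneg Cl_nonneg Ci_nonneg Cp_nonneg by auto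

definition Kq :: "real \<Rightarrow> real \<Rightarrow> real" where
  "Kq lam W = sqrt (real (card JJ) * wt lam) * exp (lam * gxi G) * (Kc W + Kl W + KB)"

lemma Ll_lin_comb:
  assumes q: "Hk G 2 q" and r: "Hk G 2 r" and p: "int_pt j s"
  shows "AE x in M2. Ll w (q + t *\<^sub>R r) j s x = Ll w q j s x + t *\<^sub>R Ll w r j s x"
proof -
  have "AE x in M2. x \<in> space M2" by (rule AE_I2)
  with lp_lin_comb[OF q r p, of t] show ?thesis
  proof eventually_elim
    case (elim x)
    show ?case
      unfolding Ll_def elim(1) gr_lin_comb[OF q r p elim(2)] ig_lin_comb[OF q r p elim(2)]
      by (simp add: eval_nat_numeral algebra_simps scaleR_conv_of_real)
  qed
qed

lemma LB_lin_comb1: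
  assumes q: "Hk G 2 q" and r: "Hk G 2 r" and p: "int_pt j s" and x: "x \<in> space M2"
  shows "LB (q + t *\<^sub>R r) u j s x = LB q u j s x + t *\<^sub>R LB r u j s x"
  unfolding LB_def ig_lin_comb[OF q r p x] by (simp add: eval_nat_numeral algebra_simps scaleR_conv_of_real)

lemma LB_lin_comb2:
  assumes q: "Hk G 2 q" and r: "Hk G 2 r" and p: "int_pt j s" and x: "x \<in> space M2"
  shows "LB u (q + t *\<^sub>R r) j s x = LB u q j s x + t *\<^sub>R LB u r j s x"
  unfolding LB_def ig_lin_comb[OF q r p x] gr_lin_comb[OF q r p x]
  by (simp add: eval_nat_numeral algebra_simps scaleR_conv_of_real)

lemma ig_gr_zero: assumes p: "int_pt j s" and x: "x \<in> space M2" shows "ig 0 i j s x = 0" "gr 0 i j s x = 0"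
  using ig_lin_comb[OF Hk_zero Hk_zero p x, of 1 i] gr_lin_comb[OF Hk_zero Hk_zero p x, of 1 i] by simp_all

lemma lp_zero: "int_pt j s \<Longrightarrow> x \<in> space M2 \<Longrightarrow> lp 0 j s x = 0"
  unfolding lp_D using D_zero[of x] by simp

text \<open>V enters the constant only through the bound W. All data with the same tail bound thus
  share one constant, on which the uniformity of the rate rests.\<close>

lemma quadratic_map_L:
  assumes lam: "0 \<le> lam" and V: "Hsd G 2 V" and W: "sd_norm G 2 V \<le> W"
  shows "quadratic_map {f. Hk G 2 f} (hk_inner G) SY (ipY lam) (Lc (cst V)) (Ll (cst V)) LB (Kq lam W)"
proof -
  interpret Y: semi_inner SY "ipY lam" by (rule semi_inner_Y[OF lam])
  have nY: "Y.nrm = nY lam" by (simp add: fun_eq_iff Y.nrm_def nY_def)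
  have V0: "0 \<le> sd_norm G 2 V" by (simp add: sd_norm_def sd_nsq_nonneg)
  then have W0: "0 \<le> W" using W by simp
  note K = K_nonneg(1,2)[OF W0] K_nonneg(3)
  let ?C = "sqrt (real (card JJ) * wt lam) * exp (lam * gxi G)"
  have C: "0 \<le> ?C" using wt_pos[of lam] by simp
  have cS: "Lc (cst V) \<in> SY" using bd_c[OF V] by (rule SY_I)
  have lS: "Ll (cst V) q \<in> SY" if "Hk G 2 q" for q using bd_l[OF V that] by (rule SY_I)
  have BS: "LB q r \<in> SY" if "Hk G 2 q" "Hk G 2 r" for q r using bd_B[OF that] by (rule SY_I)
  have AEs: "AE x in M2. x \<in> space M2" by (rule AE_I2)
  have KW: "?C * b \<le> Kq lam W" if "b \<le> Kc W + Kl W + KB" for b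
    unfolding Kq_def using that C by (rule mult_left_mono)
  show ?thesis
  proof unfold_locales
    show "0 \<le> Kq lam W" unfolding Kq_def using K C by simp
    show "Lc (cst V) \<in> SY" by (rule cS)
    have "nY lam (Lc (cst V)) \<le> ?C * Kc W"
      using K by (intro nY_le lam bd_mono[OF bd_c[OF V] Kc_mono[OF V0 W]])
    then show "Y.nrm (Lc (cst V)) \<le> Kq lam W" unfolding nY using KW[of "Kc W"] K by simp
  next
    fix x assume "x \<in> {f. Hk G 2 f}"
    then have x: "Hk G 2 x" by simp
    show "Ll (cst V) x \<in> SY" by (rule lS[OF x])
    have n: "0 \<le> hk_norm G 2 x" using hk_nonneg[OF x] .
    have "nY lam (Ll (cst V) x) \<le> ?C * (Kl W * hk_norm G 2 x)"
      using K n by (intro nY_le lam bd_mono[OF bd_l[OF V x] mult_right_mono[OF Kl_mono[OF V0 W] n]]) auto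
    also have "\<dots> \<le> Kq lam W * hk_norm G 2 x" using mult_right_mono[OF KW[of "Kl W"] n] K by (simp add: mult.assoc)
    finally show "Y.nrm (Ll (cst V) x) \<le> Kq lam W * X.nrm x" unfolding nY X_nrm .
    fix t :: real
    show "Y.eqv (Ll (cst V) (t *\<^sub>R x)) (t *\<^sub>R Ll (cst V) x)"
    proof (rule eqvY[OF lam lS[OF Hk_scale[OF x]] Y.S_scale[OF lS[OF x]]])
      fix j s assume p: "int_pt j s"
      show "AE z in M2. Ll (cst V) (t *\<^sub>R x) j s z = (t *\<^sub>R Ll (cst V) x) j s z"
        using Ll_lin_comb[OF Hk_zero x p, of "cst V" t] AEs
      proof eventually_elim
        case (elim z)
        have "Ll (cst V) 0 j s z = 0" unfolding Ll_def using ig_gr_zero[OF p elim(2)] lp_zero[OF p elim(2)] by simp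
        then show ?case using elim(1) by (simp add: scaleR_fun_def)
      qed
    qed
  next
    fix x y assume "x \<in> {f. Hk G 2 f}" "y \<in> {f. Hk G 2 f}"
    then have x: "Hk G 2 x" and y: "Hk G 2 y" by auto
    show "LB x y \<in> SY" by (rule BS[OF x y])
    show "Y.eqv (Ll (cst V) (x + y)) (Ll (cst V) x + Ll (cst V) y)"
      by (rule eqvY[OF lam lS[OF Hk_add[OF x y]] Y.S_add[OF lS[OF x] lS[OF y]]])
         (use Ll_lin_comb[OF x y, of _ _ "cst V" 1] in \<open>simp add: plus_fun_def\<close>)
    have n: "0 \<le> hk_norm G 2 x * hk_norm G 2 y" using hk_nonneg x y by simp
    have "nY lam (LB x y) \<le> ?C * (KB * hk_norm G 2 x * hk_norm G 2 y)"
      using K hk_nonneg[OF x] hk_nonneg[OF y] by (intro nY_le lam bd_B x y) auto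
    also have "\<dots> \<le> Kq lam W * hk_norm G 2 x * hk_norm G 2 y" using mult_right_mono[OF KW[of "KB"] n] K by (simp add: mult.assoc)
    finally show "Y.nrm (LB x y) \<le> Kq lam W * X.nrm x * X.nrm y" unfolding nY X_nrm .
  next
    fix x y z assume "x \<in> {f. Hk G 2 f}" "y \<in> {f. Hk G 2 f}" "z \<in> {f. Hk G 2 f}"
    then have x: "Hk G 2 x" and y: "Hk G 2 y" and z: "Hk G 2 z" by auto
    show "Y.eqv (LB (x + y) z) (LB x z + LB y z)"
      by (rule eqvY[OF lam BS[OF Hk_add[OF x y] z] Y.S_add[OF BS[OF x z] BS[OF y z]]])
         (use LB_lin_comb1[OF x y, of _ _ _ 1 z] in \<open>auto intro!: AE_I2 simp: plus_fun_def\<close>)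
    show "Y.eqv (LB z (x + y)) (LB z x + LB z y)"
      by (rule eqvY[OF lam BS[OF z Hk_add[OF x y]] Y.S_add[OF BS[OF z x] BS[OF z y]]])
         (use LB_lin_comb2[OF x y, of _ _ _ z 1] in \<open>auto intro!: AE_I2 simp: plus_fun_def\<close>)
  next
    fix t :: real and x z assume "x \<in> {f. Hk G 2 f}" "z \<in> {f. Hk G 2 f}"
    then have x: "Hk G 2 x" and z: "Hk G 2 z" by auto
    have l1: "LB (t *\<^sub>R x) z j s w = t *\<^sub>R LB x z j s w" if "int_pt j s" "w \<in> space M2" for j s w
      using LB_lin_comb1[OF Hk_zero x that, of t z] ig_gr_zero[OF that] by (simp add: LB_def)
    have l2: "LB z (t *\<^sub>R x) j s w = t *\<^sub>R LB z x j s w" if "int_pt j s" "w \<in> space M2" for j s w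
      using LB_lin_comb2[OF Hk_zero x that, of z t] ig_gr_zero[OF that] by (simp add: LB_def)
    show "Y.eqv (LB (t *\<^sub>R x) z) (t *\<^sub>R LB x z)"
      by (rule eqvY[OF lam BS[OF Hk_scale[OF x] z] Y.S_scale[OF BS[OF x z]]])
         (auto intro!: AE_I2 simp: scaleR_fun_def[abs_def] l1[unfolded scaleR_fun_def])
    show "Y.eqv (LB z (t *\<^sub>R x)) (t *\<^sub>R LB z x)"
      by (rule eqvY[OF lam BS[OF z Hk_scale[OF x]] Y.S_scale[OF BS[OF z x]]])
         (auto intro!: AE_I2 simp: scaleR_fun_def[abs_def] l2[unfolded scaleR_fun_def])
  qed
qed

text \<open>The weight exp(-lam z) put into the functions is squared by the norm and becomes the
  Carleman weight; the right-hand side is the shape of \<open>Jfun\<close>.\<close>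

lemma nY_integral:
  assumes lam: "0 \<le> lam" and y: "y \<in> SY"
  shows "(nY lam y)\<^sup>2 = exp (2 * lam * c) * (\<Sum>j\<in>{1..<gN G}. \<Sum>s\<in>{1..<gN G}. (gh G)\<^sup>2 *
        (LINT \<kappa>:{kl..ku}|lborel. LINT z:{a..c}|lborel. (cmod (y j s (\<kappa>, z)))\<^sup>2 * exp (- 2 * lam * z)))"
proof -
  have e: "(L2.nrm M2 (yw lam (j,s) y))\<^sup>2 = (LINT \<kappa>:{kl..ku}|lborel. LINT z:{a..c}|lborel. (cmod (y j s (\<kappa>, z)))\<^sup>2 * exp (- 2 * lam * z))"
    if "(j,s) \<in> JJ" for j s
  proof -
    have "(cmod (yw lam (j,s) y x))\<^sup>2 = (cmod (y j s x))\<^sup>2 * exp (- 2 * lam * snd x)" for x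
      unfolding yw_def by (simp add: power_mult_distrib flip: exp_of_nat_mult)
    then show ?thesis
      using integrable_slices(2)[OF yw_L2[OF lam y that]] unfolding integral_mI by simp
  qed
  have "(nY lam y)\<^sup>2 = (\<Sum>(j,s)\<in>JJ. wt lam * (L2.nrm M2 (yw lam (j,s) y))\<^sup>2)"
    unfolding nY_sq[OF lam y] by (simp add: case_prod_unfold)
  also have "\<dots> = (\<Sum>(j,s)\<in>JJ. wt lam * (LINT \<kappa>:{kl..ku}|lborel. LINT z:{a..c}|lborel. (cmod (y j s (\<kappa>, z)))\<^sup>2 * exp (- 2 * lam * z)))"
    by (intro sum.cong refl) (auto simp: e)
  finally show ?thesis
    unfolding JJ_def sum.cartesian_product[symmetric] wt_def sum_distrib_left by (simp only: mult.assoc)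
qed

end

section \<open>The tail and the objective functional\<close>

context geometry
begin

lemma lp_SY: "Hk G 2 f \<Longrightarrow> lp f \<in> SY"
  using bd_lp by (rule SY_I)

lemma lp_eqv:
  assumes lam: "0 \<le> lam" and f: "Hk G 2 f" and g: "Hk G 2 g"
  shows "semi_inner.eqv SY (ipY lam) (lp (f + t *\<^sub>R g)) (lp f + t *\<^sub>R lp g)"
proof -
  interpret Y: semi_inner SY "ipY lam" by (rule semi_inner_Y[OF lam])
  show ?thesis
    by (rule eqvY[OF lam lp_SY[OF Hk_lin_comb[OF f g]] Y.S_add[OF lp_SY[OF f] Y.S_scale[OF lp_SY[OF g]]]])
       (use lp_lin_comb[OF f g, of _ _ t] in \<open>simp add: plus_fun_def scaleR_fun_def\<close>)
qed

lemma lp_eqv_scale: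
  assumes lam: "0 \<le> lam" and f: "Hk G 2 f"
  shows "semi_inner.eqv SY (ipY lam) (lp (t *\<^sub>R f)) (t *\<^sub>R lp f)"
proof -
  interpret Y: semi_inner SY "ipY lam" by (rule semi_inner_Y[OF lam])
  have "Y.eqv (lp (t *\<^sub>R f)) (lp 0 + t *\<^sub>R lp f)" using lp_eqv[OF lam Hk_zero f, of t] by simp
  also have "Y.eqv (lp 0 + t *\<^sub>R lp f) (t *\<^sub>R lp f)"
    by (rule eqvY[OF lam Y.S_add[OF lp_SY[OF Hk_zero] Y.S_scale[OF lp_SY[OF f]]] Y.S_scale[OF lp_SY[OF f]]])
       (auto intro!: AE_I2 simp: lp_zero)
  finally show ?thesis .
qed

lemma nY_lp_le:
  assumes lam: "0 \<le> lam" and f: "Hk G 2 f"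
  shows "nY lam (lp f) \<le> sqrt (real (card JJ) * wt lam) * exp (lam * gxi G) * (Cp * hk_norm G 2 f)"
  using Cp_nonneg hk_nonneg[OF f] by (intro nY_le lam bd_lp f) auto

lemma nY_lap:
  assumes lam: "0 \<le> lam" and W: "Hsd G 2 W" and Q: "Hsd G 2 Q"
  shows "(nY lam (lp (cst W) + lp (cst Q)))\<^sup>2 = (ku - kl) * Wfun G lam Q W"
proof -
  interpret Y: semi_inner SY "ipY lam" by (rule semi_inner_Y[OF lam])
  have S: "lp (cst W) + lp (cst Q) \<in> SY" by (intro Y.S_add lp_SY Hk_cst W Q)
  have e: "(lp (cst W) + lp (cst Q)) j s (\<kappa>, z) = lap G W j s z + lap G Q j s z" for j s \<kappa> z
    by (simp add: lp_def cst_def)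
  have k: "(LINT \<kappa>:{kl..ku}|lborel. (b::real)) = (ku - kl) * b" for b
    unfolding integral_mI using kk integral_mI_const[of kl ku b] by simp
  show ?thesis
    unfolding nY_integral[OF lam S] e k Wfun_def
    by (simp add: sum_distrib_left mult_ac)
qed

lemma nY_lap0:
  assumes lam: "0 \<le> lam" and u: "Hsd G 2 u"
  shows "(nY lam (lp (cst u)))\<^sup>2 = (ku - kl) * (exp (2 * lam * c) * (\<Sum>j\<in>{1..<gN G}. \<Sum>s\<in>{1..<gN G}. (gh G)\<^sup>2 *
        (LINT z:{a..c}|lborel. (cmod (lap G u j s z))\<^sup>2 * exp (- 2 * lam * z))))"
proof -
  have e: "lp (cst u) j s (\<kappa>, z) = lap G u j s z" for j s \<kappa> z
    by (simp add: lp_def cst_def)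
  have k: "(LINT \<kappa>:{kl..ku}|lborel. (b::real)) = (ku - kl) * b" for b
    unfolding integral_mI using kk integral_mI_const[of kl ku b] by simp
  show ?thesis
    unfolding nY_integral[OF lam lp_SY[OF Hk_cst[OF u]]] e k
    by (simp add: sum_distrib_left mult_ac)
qed

section \<open>The Carleman estimate as coercivity\<close>

text \<open>Functions vanishing at lateral points contribute there with all their derivatives zero.
  This matches the norm with the Carleman estimate, whose sums run over interior points.\<close>

lemma sd_nsq_interior:
  assumes u: "H0sd G u"
  shows "sd_nsq G 2 u = (\<Sum>j\<in>{1..<gN G}. \<Sum>s\<in>{1..<gN G}. (gh G)\<^sup>2 *
     ((\<integral>z. (cmod (dz G (u j s) 2 z))\<^sup>2 \<partial>MZ) + (\<integral>z. (cmod (dz G (u j s) 1 z))\<^sup>2 \<partial>MZ) + (\<integral>z. (cmod (u j s z))\<^sup>2 \<partial>MZ)))"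
proof -
  have r: "(\<Sum>r\<le>(2::nat). F r) = F 2 + F 1 + F 0" for F :: "nat \<Rightarrow> real" by (simp add: eval_nat_numeral)
  define E where "E j s = (gh G)\<^sup>2 *
     ((\<integral>z. (cmod (dz G (u j s) 2 z))\<^sup>2 \<partial>MZ) + (\<integral>z. (cmod (dz G (u j s) 1 z))\<^sup>2 \<partial>MZ) + (\<integral>z. (cmod (u j s z))\<^sup>2 \<partial>MZ))" for j s
  have z: "E j s = 0" if "(j, s) \<in> {..gN G} \<times> {..gN G} - JJ" for j s
  proof -
    have l: "lateral_pt G j s" using that by (auto simp: lateral_pt_def in_grid_def interior_pt_def JJ_def)
    have "dz G (u j s) q z = 0" if "z \<in> {a..c}" for q z
    proof -
      have "zd a c (u j s) q z = zd a c (\<lambda>z. 0) q z"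
        using u l by (intro zd_cong[OF _ that]) (auto simp: H0sd_def bc0_def)
      then show ?thesis unfolding dz_def using zd_zero[OF ac that] by simp
    qed
    from this[where q = 0] this have "\<And>q. (\<integral>z. (cmod (dz G (u j s) q z))\<^sup>2 \<partial>MZ) = 0" "(\<integral>z. (cmod (u j s z))\<^sup>2 \<partial>MZ) = 0"
      by (auto intro!: integral_eq_zero_AE AE_I2 simp: dz_def)
    then show ?thesis by (simp add: E_def)
  qed
  have "sd_nsq G 2 u = (\<Sum>j\<le>gN G. \<Sum>s\<le>gN G. E j s)"
    unfolding sd_nsq_def r integral_mI E_def by (simp add: distrib_left dz_def)
  also have "\<dots> = (\<Sum>(j,s)\<in>{..gN G} \<times> {..gN G}. E j s)" by (simp add: sum.cartesian_product)
  also have "\<dots> = (\<Sum>(j,s)\<in>JJ. E j s)"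
  proof (rule sum.mono_neutral_right)
    show "\<forall>i\<in>{..gN G} \<times> {..gN G} - JJ. (case i of (j, s) \<Rightarrow> E j s) = 0"
    proof
      fix i assume i: "i \<in> {..gN G} \<times> {..gN G} - JJ"
      obtain j s where "i = (j, s)" by (cases i)
      then show "(case i of (j, s) \<Rightarrow> E j s) = 0" using z[of j s] i by simp
    qed
  qed (auto simp: JJ_def)
  also have "\<dots> = (\<Sum>j\<in>{1..<gN G}. \<Sum>s\<in>{1..<gN G}. E j s)" unfolding JJ_def by (simp add: sum.cartesian_product)
  finally show ?thesis unfolding E_def .
qed

text \<open>The factor exp(2 lam d) in front of the functional makes the normalized weight at least
  1 on the interval, and lam and lam^3 are at least 1; all dependence on lam can then be dropped
  from below.\<close>

lemma carleman_slice:
  assumes lam: "1 \<le> lam" and g: "Hn1 a c 2 g"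
  shows "exp (2 * lam * c) * (LINT z:{a..c}|lborel. ((cmod (dz G g 2 z))\<^sup>2 + lam * (cmod (dz G g 1 z))\<^sup>2 + lam ^ 3 * (cmod (g z))\<^sup>2) * exp (- 2 * lam * z))
    \<ge> (\<integral>z. (cmod (dz G g 2 z))\<^sup>2 \<partial>MZ) + (\<integral>z. (cmod (dz G g 1 z))\<^sup>2 \<partial>MZ) + (\<integral>z. (cmod (g z))\<^sup>2 \<partial>MZ)"
proof -
  have L: "dz G g 2 \<in> L2 MZ" "dz G g 1 \<in> L2 MZ" "g \<in> L2 MZ"
    using Hn1_L2[OF g, of 2] Hn1_L2[OF g, of 1] Hn1_L2[OF g, of 0] by (simp_all add: dz_def del: zd.simps(2) One_nat_def)
  note i = L2_sq[OF L(1)] L2_sq[OF L(2)] L2_sq[OF L(3)]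
  define F where "F z = (cmod (dz G g 2 z))\<^sup>2 + lam * (cmod (dz G g 1 z))\<^sup>2 + lam ^ 3 * (cmod (g z))\<^sup>2" for z
  have Fi: "integrable MZ F" unfolding F_def using i by simp
  have F0: "0 \<le> F z" for z unfolding F_def using lam by simp
  have w: "exp (- 2 * lam * z) \<le> exp (2 * lam * gxi G)" "exp (- 2 * lam * c) \<le> exp (- 2 * lam * z)" if "z \<in> {a..c}" for z
  proof -
    have "- z \<le> gxi G" "z \<le> c" "0 \<le> lam" using that lam by auto
    then have "lam * (- z) \<le> lam * gxi G" "lam * z \<le> lam * c" by (blast intro: mult_left_mono)+
    then show "exp (- 2 * lam * z) \<le> exp (2 * lam * gxi G)" "exp (- 2 * lam * c) \<le> exp (- 2 * lam * z)" by auto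
  qed
  have wi: "integrable MZ (\<lambda>z. F z * exp (- 2 * lam * z))"
  proof (rule Bochner_Integration.integrable_bound)
    show "integrable MZ (\<lambda>z. F z * exp (2 * lam * gxi G))" using Fi by simp
    show "(\<lambda>z. F z * exp (- 2 * lam * z)) \<in> borel_measurable MZ"
      using borel_measurable_integrable[OF Fi] by measurable
    show "AE z in MZ. norm (F z * exp (- 2 * lam * z)) \<le> norm (F z * exp (2 * lam * gxi G))"
      using F0 w(1) by (intro AE_I2) (auto simp: abs_mult intro!: mult_left_mono)
  qed
  have "(\<integral>z. (cmod (dz G g 2 z))\<^sup>2 \<partial>MZ) + (\<integral>z. (cmod (dz G g 1 z))\<^sup>2 \<partial>MZ) + (\<integral>z. (cmod (g z))\<^sup>2 \<partial>MZ)
     = (\<integral>z. (cmod (dz G g 2 z))\<^sup>2 + (cmod (dz G g 1 z))\<^sup>2 + (cmod (g z))\<^sup>2 \<partial>MZ)"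
    using i by simp
  also have "\<dots> \<le> (\<integral>z. exp (2 * lam * c) * (F z * exp (- 2 * lam * z)) \<partial>MZ)"
  proof (rule integral_mono)
    show "integrable MZ (\<lambda>z. (cmod (dz G g 2 z))\<^sup>2 + (cmod (dz G g 1 z))\<^sup>2 + (cmod (g z))\<^sup>2)" using i by simp
    show "integrable MZ (\<lambda>z. exp (2 * lam * c) * (F z * exp (- 2 * lam * z)))" using wi by simp
    fix z assume "z \<in> space MZ"
    then have z: "z \<in> {a..c}" by simp
    have "(cmod (dz G g 2 z))\<^sup>2 + 1 * (cmod (dz G g 1 z))\<^sup>2 + 1 * (cmod (g z))\<^sup>2 \<le> F z"
      unfolding F_def using lam one_le_power[OF lam, of 3] by (intro add_mono mult_right_mono) auto
    also have "F z = exp (2 * lam * c) * (F z * exp (- 2 * lam * c))" by (simp flip: exp_add)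
    also have "\<dots> \<le> exp (2 * lam * c) * (F z * exp (- 2 * lam * z))"
      using w(2)[OF z] F0 by (intro mult_left_mono) auto
    finally show "(cmod (dz G g 2 z))\<^sup>2 + (cmod (dz G g 1 z))\<^sup>2 + (cmod (g z))\<^sup>2 \<le> exp (2 * lam * c) * (F z * exp (- 2 * lam * z))" by simp
  qed
  finally show ?thesis unfolding integral_mI F_def by simp
qed

text \<open>C is the same for all large lam. This matters because \<mu>(\<delta>) grows without
  bound as \<delta> tends to 0.\<close>

lemma carleman_coercive:
  assumes car: "carleman G lamz"
  shows "\<exists>C>0. \<forall>lam\<ge>lamz. \<forall>u. H0sd G u \<longrightarrow> C * (hk_norm G 2 (cst u))\<^sup>2 \<le> (nY lam (lp (cst u)))\<^sup>2"
proof -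
  obtain C where C: "0 < C" and lamz: "1 < lamz" and E: "\<And>lam u. lam \<ge> lamz \<Longrightarrow> H0sd G u \<Longrightarrow>
     C * (\<Sum>j\<in>{1..<gN G}. \<Sum>s\<in>{1..<gN G}. (gh G)\<^sup>2 *
        (LINT z:{a..c}|lborel. ((cmod (dz G (u j s) 2 z))\<^sup>2 + lam * (cmod (dz G (u j s) 1 z))\<^sup>2
             + lam ^ 3 * (cmod (u j s z))\<^sup>2) * exp (- 2 * lam * z)))
     \<le> (\<Sum>j\<in>{1..<gN G}. \<Sum>s\<in>{1..<gN G}. (gh G)\<^sup>2 *
        (LINT z:{a..c}|lborel. (cmod (lap G u j s z))\<^sup>2 * exp (- 2 * lam * z)))"
    using car unfolding carleman_def by meson
  have "C * (hk_norm G 2 (cst u))\<^sup>2 \<le> (nY lam (lp (cst u)))\<^sup>2" if lam: "lam \<ge> lamz" and u: "H0sd G u" for lam u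
  proof -
    have uH: "Hsd G 2 u" using u by (simp add: H0sd_def)
    define I where "I j s = (LINT z:{a..c}|lborel. ((cmod (dz G (u j s) 2 z))\<^sup>2 + lam * (cmod (dz G (u j s) 1 z))\<^sup>2
             + lam ^ 3 * (cmod (u j s z))\<^sup>2) * exp (- 2 * lam * z))" for j s
    have l1: "1 \<le> lam" and l0: "0 \<le> lam" using lam lamz by auto
    have "sd_nsq G 2 u \<le> (\<Sum>j\<in>{1..<gN G}. \<Sum>s\<in>{1..<gN G}. (gh G)\<^sup>2 * (exp (2 * lam * c) * I j s))"
      unfolding sd_nsq_interior[OF u]
    proof (intro sum_mono mult_left_mono)
      fix j s assume "j \<in> {1..<gN G}" "s \<in> {1..<gN G}"
      then have "Hn1 a c 2 (u j s)" using uH unfolding Hsd_def by auto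
      then show "(\<integral>z. (cmod (dz G (u j s) 2 z))\<^sup>2 \<partial>MZ) + (\<integral>z. (cmod (dz G (u j s) 1 z))\<^sup>2 \<partial>MZ) + (\<integral>z. (cmod (u j s z))\<^sup>2 \<partial>MZ)
        \<le> exp (2 * lam * c) * I j s" unfolding I_def by (rule carleman_slice[OF l1])
    qed simp
    also have "\<dots> = exp (2 * lam * c) * (\<Sum>j\<in>{1..<gN G}. \<Sum>s\<in>{1..<gN G}. (gh G)\<^sup>2 * I j s)"
      by (simp add: sum_distrib_left mult_ac)
    finally have "C * sd_nsq G 2 u \<le> exp (2 * lam * c) * (C * (\<Sum>j\<in>{1..<gN G}. \<Sum>s\<in>{1..<gN G}. (gh G)\<^sup>2 * I j s))"
      using C by (simp add: mult_left_mono mult.left_commute)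
    also have "\<dots> \<le> exp (2 * lam * c) * (\<Sum>j\<in>{1..<gN G}. \<Sum>s\<in>{1..<gN G}. (gh G)\<^sup>2 *
        (LINT z:{a..c}|lborel. (cmod (lap G u j s z))\<^sup>2 * exp (- 2 * lam * z)))"
      using E[OF lam u] unfolding I_def by (intro mult_left_mono) auto
    finally have "(ku - kl) * (C * sd_nsq G 2 u) \<le> (nY lam (lp (cst u)))\<^sup>2"
      unfolding nY_lap0[OF l0 uH] using kk by (intro mult_left_mono) auto
    moreover have "(hk_norm G 2 (cst u))\<^sup>2 = (ku - kl) * sd_nsq G 2 u"
      unfolding hk_norm_cst sd_norm_def using kk sd_nsq_nonneg by (simp add: power_mult_distrib)
    ultimately show ?thesis by (simp add: mult.left_commute)
  qed
  then show ?thesis using C by blast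
qed

text \<open>The functional is, up to the factor ku - kl, a squared norm of an affine map; the
  parallelogram law and coercivity of its linear part give convexity with constant C/4. Since
  \<open>Wmu\<close> is a choice, existence gives access to its minimality.\<close>

lemma exists_Wmu:
  assumes lam: "0 \<le> lam" and C: "0 < C" and Q: "Hsd G 2 Q"
    and coer: "\<And>u. H0sd G u \<Longrightarrow> C * (hk_norm G 2 (cst u))\<^sup>2 \<le> (nY lam (lp (cst u)))\<^sup>2"
  shows "\<exists>W. H0sd G W \<and> (\<forall>W'. H0sd G W' \<longrightarrow> Wfun G lam Q W \<le> Wfun G lam Q W')"
proof -
  interpret Y: semi_inner SY "ipY lam" by (rule semi_inner_Y[OF lam])
  have nY: "Y.nrm = nY lam" by (simp add: fun_eq_iff Y.nrm_def nY_def)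
  define q where "q = lp (cst Q)"
  have qS: "q \<in> SY" unfolding q_def by (rule lp_SY[OF Hk_cst[OF Q]])
  have H: "Hk G 2 (cst u)" if "H0sd G u" for u using that Hk_cst by (simp add: H0sd_def)
  note lS = lp_SY[OF H]
  define J where "J W = (nY lam (lp (cst W) + q))\<^sup>2" for W
  have df: "nY lam ((lp (cst u) + q) - (lp (cst v) + q)) = nY lam (lp (cst (u - v)))" if u: "H0sd G u" and v: "H0sd G v" for u v
  proof -
    have "Y.eqv (lp (cst u + (-1) *\<^sub>R cst v)) (lp (cst u) + (-1) *\<^sub>R lp (cst v))" by (rule lp_eqv[OF lam H[OF u] H[OF v]])
    from Y.nrm_eqv[OF this] show ?thesis unfolding nY by (simp add: cst_diff)
  qed
  have "\<exists>W\<in>{u. H0sd G u}. \<forall>W'\<in>{u. H0sd G u}. J W \<le> J W'"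
  proof (rule Z.exists_minimizer[where c = "C/4" and B = 0])
    show "0 < C/4" using C by simp
  next
    fix x y assume "x \<in> {u. H0sd G u}" "y \<in> {u. H0sd G u}"
    then have x: "H0sd G x" and y: "H0sd G y" by auto
    show "(1/2) *\<^sub>R (x + y) \<in> {u. H0sd G u}" using Z.S_scale[OF Z.S_add, of x y] x y by simp
    have xy: "x - y \<in> {u. H0sd G u}" using Z.S_diff[of x y] x y by simp
    have "Y.eqv (lp (cst ((1/2) *\<^sub>R (x + y)))) ((1/2) *\<^sub>R lp (cst x + cst y))"
      unfolding cst_scale cst_add by (rule lp_eqv_scale[OF lam Hk_add[OF H[OF x] H[OF y]]])
    also have "Y.eqv ((1/2) *\<^sub>R lp (cst x + cst y)) ((1/2) *\<^sub>R (lp (cst x) + lp (cst y)))"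
      using lp_eqv[OF lam H[OF x] H[OF y], of 1] by (intro Y.eqv_scale) simp
    finally have "Y.eqv (lp (cst ((1/2) *\<^sub>R (x + y))) + q) ((1/2) *\<^sub>R (lp (cst x) + lp (cst y)) + q)"
      by (rule Y.eqv_add[OF _ Y.eqv_refl[OF qS]])
    moreover have "(1/2) *\<^sub>R (lp (cst x) + lp (cst y)) + q = (1/2) *\<^sub>R ((lp (cst x) + q) + (lp (cst y) + q))"
    proof -
      have "(lp (cst x) + q) + (lp (cst y) + q) = (lp (cst x) + lp (cst y)) + (q + q)" by (simp add: algebra_simps)
      then show ?thesis by (simp only: scaleR_right_distrib[of _ "lp (cst x) + lp (cst y)"] scaleR_half_double)
    qed
    ultimately have "J ((1/2) *\<^sub>R (x + y)) = (nY lam ((1/2) *\<^sub>R ((lp (cst x) + q) + (lp (cst y) + q))))\<^sup>2"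
      unfolding J_def using Y.nrm_eqv unfolding nY by metis
    also have "\<dots> = J x / 2 + J y / 2 - (nY lam (lp (cst (x - y))))\<^sup>2 / 4"
      using Y.parallelogram[OF Y.S_add[OF lS[OF x] qS] Y.S_add[OF lS[OF y] qS]] unfolding nY df[OF x y] J_def .
    also have "\<dots> \<le> J x / 2 + J y / 2 - C / 4 * (Z.nrm (x - y))\<^sup>2"
      using coer[of "x - y"] xy unfolding Z_nrm by simp
    finally show "J ((1/2) *\<^sub>R (x + y)) \<le> J x / 2 + J y / 2 - C / 4 * (Z.nrm (x - y))\<^sup>2" .
  next
    fix f l assume f: "\<And>n::nat. f n \<in> {u. H0sd G u}" and l: "l \<in> {u. H0sd G u}" and lim: "(\<lambda>n. Z.nrm (f n - l)) \<longlonglongrightarrow> 0"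
    have d: "f n - l \<in> {u. H0sd G u}" for n using Z.S_diff[OF f l] .
    let ?K = "sqrt (real (card JJ) * wt lam) * exp (lam * gxi G)"
    have "(\<lambda>n. Y.nrm (lp (cst (f n)) + q)) \<longlonglongrightarrow> Y.nrm (lp (cst l) + q)"
    proof (rule Y.convergent_nrm)
      show "lp (cst (f n)) + q \<in> SY" for n using Y.S_add[OF lS qS] f by simp
      show "lp (cst l) + q \<in> SY" using Y.S_add[OF lS qS] l by simp
      show "(\<lambda>n. Y.nrm (lp (cst (f n)) + q - (lp (cst l) + q))) \<longlonglongrightarrow> 0"
      proof (rule tendsto_sandwich[OF _ _ tendsto_const])
        show "\<forall>\<^sub>F n in sequentially. 0 \<le> Y.nrm (lp (cst (f n)) + q - (lp (cst l) + q))"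
          using Y.nrm_ge0[OF Y.S_diff[OF Y.S_add[OF lS qS] Y.S_add[OF lS qS]]] f l by simp
        show "\<forall>\<^sub>F n in sequentially. Y.nrm (lp (cst (f n)) + q - (lp (cst l) + q)) \<le> ?K * (Cp * Z.nrm (f n - l))"
          using nY_lp_le[OF lam H] d f l df unfolding nY Z_nrm by simp
        show "(\<lambda>n. ?K * (Cp * Z.nrm (f n - l))) \<longlonglongrightarrow> 0"
          using tendsto_mult[OF tendsto_const tendsto_mult[OF tendsto_const lim], of ?K Cp] by simp
      qed
    qed
    then show "(\<lambda>n. J (f n)) \<longlonglongrightarrow> J l" unfolding J_def nY by (intro tendsto_power)
  next
    show "{u. H0sd G u} \<noteq> {}" using Z.S_zero by blast
  qed (auto simp: J_def)
  then obtain W where W: "H0sd G W" "\<And>W'. H0sd G W' \<Longrightarrow> J W \<le> J W'" by blast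
  have "Wfun G lam Q W \<le> Wfun G lam Q W'" if W': "H0sd G W'" for W'
  proof -
    have "Hsd G 2 W" "Hsd G 2 W'" using W(1) W' by (auto simp: H0sd_def)
    then have "(ku - kl) * Wfun G lam Q W \<le> (ku - kl) * Wfun G lam Q W'"
      using W(2)[OF W'] nY_lap[OF lam _ Q] unfolding J_def q_def by simp
    then show ?thesis using kk by simp
  qed
  then show ?thesis using W(1) by blast
qed

text \<open>With \<open>W' = Vs - Qs\<close> the function \<open>W' + Q\<close> has the same Laplacian as \<open>Q - Qs\<close>, and the weight costs a factor
\<open>exp (2 * \<mu> * (d + \<xi>)) = 1 / \<delta>\<close>, which the squared noise level absorbs.\<close>

lemma tail_bound:
  assumes car: "carleman G lamz" and dz0: "dz0 < exp (- 2 * (gd G + gxi G) * lamz)"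
  shows "\<exists>Wb. \<forall>dt. admissible G dz0 dz1 nF nV dt \<longrightarrow>
     Hsd G 2 (Vmu G (d_Q dt) (d_delta dt)) \<and> sd_norm G 2 (Vmu G (d_Q dt) (d_delta dt)) \<le> Wb"
proof -
  obtain C where C: "0 < C" and coer: "\<And>lam u. lam \<ge> lamz \<Longrightarrow> H0sd G u \<Longrightarrow> C * (hk_norm G 2 (cst u))\<^sup>2 \<le> (nY lam (lp (cst u)))\<^sup>2"
    using carleman_coercive[OF car] by blast
  have lamz: "1 < lamz" using car by (simp add: carleman_def)
  define sK where "sK = sqrt (ku - kl)"
  have sK: "0 < sK" unfolding sK_def using kk by simp
  \<comment> \<open>Bound for the squared weighted norm of the Laplacian of Q - Qs: the weight
    contributes h^2/\<delta>, the data \<delta>^2, and the remaining factor \<delta> is below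
    1.\<close>
  define B2 where "B2 = real (card JJ) * (gh G)\<^sup>2 * (Cp * sK)\<^sup>2"
  have B2: "0 \<le> B2" unfolding B2_def by simp
  \<comment> \<open>One summand for each part of V = (W - W') + Vs + (Q - Qs); dividing by
    \<open>sK\<close> undoes the passage to functions constant in k.\<close>
  define Wb where "Wb = sqrt (4 * B2 / C) / sK + \<bar>nV\<bar> + 1"
  have main: "Hsd G 2 (Vmu G (d_Q dt) (d_delta dt)) \<and> sd_norm G 2 (Vmu G (d_Q dt) (d_delta dt)) \<le> Wb"
    if adm: "admissible G dz0 dz1 nF nV dt" for dt
  proof -
    define \<delta> where "\<delta> = d_delta dt"
    define \<mu> where "\<mu> = mu G \<delta>"
    define Q where "Q = d_Q dt"
    define Qs where "Qs = d_Qs dt"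
    define Vs where "Vs = d_Vs dt"
    have \<delta>: "0 < \<delta>" "\<delta> < dz0" and Q: "Hsd G 2 Q" and Qs: "Hsd G 2 Qs" "tail_bc G Qs (d_psi0s dt) (d_psi1s dt)"
      and Vs: "Hsd G 2 Vs" "tail_bc G Vs (d_psi0s dt) (d_psi1s dt)"
      and harm: "\<And>j s. interior_pt G j s \<Longrightarrow> AE z in lborel. z \<in> {a<..<c} \<longrightarrow> lap G Vs j s z = 0"
      and QQ: "sd_norm G 2 (sd_sub Q Qs) < \<delta>" and nV: "sd_norm G 2 Vs = nV"
      using adm unfolding admissible_def \<delta>_def Q_def Qs_def Vs_def by auto
    have cg: "0 < c + gxi G" using ac by simp
    have mu: "\<mu> = - ln \<delta> / (2 * (c + gxi G))" unfolding \<mu>_def mu_def using \<delta> by (simp add: ln_powr)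
    have ex: "exp (2 * \<mu> * (c + gxi G)) = 1 / \<delta>"
    proof -
      have "2 * \<mu> * (c + gxi G) = - ln \<delta>" unfolding mu using cg by (simp add: field_simps)
      then show ?thesis using \<delta> by (simp add: exp_minus inverse_eq_divide)
    qed
    have dl: "\<delta> < exp (- 2 * (c + gxi G) * lamz)" using \<delta> dz0 by simp
    have "ln \<delta> < - 2 * (c + gxi G) * lamz" using dl \<delta> by (metis exp_gt_zero ln_exp ln_less_cancel_iff)
    then have mul: "lamz \<le> \<mu>" unfolding mu using cg by (simp add: field_simps)
    then have mu0: "0 \<le> \<mu>" using lamz by simp
    have "0 < (c + gxi G) * lamz" using cg lamz by simp
    then have "- 2 * (c + gxi G) * lamz < 0" by (simp add: algebra_simps)
    then have "exp (- 2 * (c + gxi G) * lamz) < 1" by simp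
    then have \<delta>1: "\<delta> < 1" using dl by linarith
    interpret Y: semi_inner SY "ipY \<mu>" by (rule semi_inner_Y[OF mu0])
    have nY: "Y.nrm = nY \<mu>" by (simp add: fun_eq_iff Y.nrm_def nY_def)
    define W where "W = Wmu G Q \<mu>"
    have W: "H0sd G W" "\<And>W'. H0sd G W' \<Longrightarrow> Wfun G \<mu> Q W \<le> Wfun G \<mu> Q W'"
      using someI_ex[OF exists_Wmu[OF mu0 C Q coer[OF mul]]] unfolding W_def Wmu_def by auto
    have V: "Vmu G (d_Q dt) (d_delta dt) = W + Q"
      unfolding Vmu_def W_def \<mu>_def Q_def \<delta>_def sd_add_def by (simp add: plus_fun_def)
    define W' where "W' = Vs - Qs"
    have e: "Hk G 2 (cst W)" "Hk G 2 (cst Q)" "Hk G 2 (cst Qs)" "Hk G 2 (cst Vs)"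
      using W(1) Q Qs Vs Hk_cst by (auto simp: H0sd_def)
    have W'H: "Hk G 2 (cst W')" unfolding W'_def cst_diff using Hk_diff[OF e(4,3)] .
    \<comment> \<open>Vs and Qs carry the same noiseless Cauchy data, so their difference satisfies
      the homogeneous conditions. With Q in place of Qs the noise would remain in the data.\<close>
    have W': "H0sd G W'"
    proof -
      have "dz G (W' j s) 1 a = 0" if j: "j \<le> gN G" "s \<le> gN G" for j s
      proof -
        have a: "a \<in> {a..c}" using ac by simp
        show ?thesis
        proof (cases "interior_pt G j s")
          case True
          have "zd a c (\<lambda>z. Vs j s z + (-1) *\<^sub>R Qs j s z) 1 a = zd a c (Vs j s) 1 a + (-1) *\<^sub>R zd a c (Qs j s) 1 a"
            using zd_lin_comb[OF ac, of 2 "Vs j s" "Qs j s" 1 a "-1"] Vs(1) Qs(1) j a unfolding Hsd_def by simp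
          moreover have "zd a c (Vs j s) 1 a = zd a c (Qs j s) 1 a"
            using Vs(2) Qs(2) True unfolding tail_bc_def dz_def by simp
          ultimately show ?thesis unfolding W'_def dz_def by (simp add: fun_diff_def)
        next
          case False
          then have l: "lateral_pt G j s" using j by (simp add: lateral_pt_def in_grid_def)
          have "zd a c (W' j s) 1 a = zd a c (\<lambda>z. 0) 1 a"
            using Vs(2) Qs(2) l by (intro zd_cong[OF _ a]) (auto simp: tail_bc_def W'_def)
          then show ?thesis unfolding dz_def using zd_zero[OF ac a, of 1] by simp
        qed
      qed
      moreover have "W' j s a = 0" if j: "j \<le> gN G" "s \<le> gN G" for j s
        using Vs(2) Qs(2) j ac unfolding tail_bc_def W'_def lateral_pt_def in_grid_def by (cases "interior_pt G j s") auto
      ultimately have "bc0 G W'"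
        using Vs(2) Qs(2) unfolding bc0_def tail_bc_def by (auto simp: W'_def)
      then show ?thesis using Hsd_cst[OF W'H] by (simp add: H0sd_def)
    qed
    define E where "E = cst (Q - Qs)"
    have EH: "Hk G 2 E" unfolding E_def cst_diff using Hk_diff[OF e(2,3)] .
    have En: "hk_norm G 2 E \<le> sK * \<delta>"
      using QQ sK unfolding E_def hk_norm_cst sK_def sd_sub_def by (simp add: fun_diff_def)
    \<comment> \<open>Harmonicity is given on the open interval; its two endpoints are null
      sets.\<close>
    have lV: "Y.eqv (lp (cst Vs)) (lp 0)"
    proof (rule eqvY[OF mu0 lp_SY[OF e(4)] lp_SY[OF Hk_zero]])
      fix j s assume p: "int_pt j s"
      have m: "lp f j s \<in> borel_measurable M2" if "Hk G 2 f" for f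
        using bd_lp[OF that p] L2_measurable by (auto simp: bd_def)
      show "AE x in M2. lp (cst Vs) j s x = lp 0 j s x"
      proof (rule AE_M2)
        note [measurable] = m[OF e(4)] m[OF Hk_zero]
        show "Measurable.pred M2 (\<lambda>x. lp (cst Vs) j s x = lp 0 j s x)" by measurable
        fix k assume k: "k \<in> {kl..ku}"
        have "interior_pt G j s" using p by (auto simp: int_pt_def interior_pt_def)
        from harm[OF this] AE_lborel_singleton[of a] AE_lborel_singleton[of c]
        show "AE z in MZ. lp (cst Vs) j s (k, z) = lp 0 j s (k, z)"
          unfolding AE_mI
        proof eventually_elim
          case (elim z)
          have cst_eq: "lp (cst Vs) j s (k, z) = lap G Vs j s z" by (simp add: lp_def cst_def)
          show ?case
          proof
            assume z: "z \<in> {a..c}"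
            then have "lap G Vs j s z = 0" using elim by auto
            moreover have "lp 0 j s (k, z) = 0" using z k by (intro lp_zero p) (simp add: space_M2)
            ultimately show "lp (cst Vs) j s (k, z) = lp 0 j s (k, z)" by (simp add: cst_eq)
          qed
        qed
      qed
    qed
    have S: "lp (cst W) \<in> SY" "lp (cst W') \<in> SY" "lp (cst Q) \<in> SY" using lp_SY e W'H by auto
    have yy: "Y.eqv (lp (cst W') + lp (cst Q)) (lp E)"
    proof -
      have "Y.eqv (lp (cst W') + lp (cst Q)) (lp (cst W' + cst Q))"
        using Y.eqv_sym[OF lp_eqv[OF mu0 W'H e(2), of 1]] by simp
      also have "cst W' + cst Q = cst Vs + 1 *\<^sub>R E" unfolding W'_def E_def cst_diff by simp
      also have "Y.eqv (lp (cst Vs + 1 *\<^sub>R E)) (lp (cst Vs) + 1 *\<^sub>R lp E)" by (rule lp_eqv[OF mu0 e(4) EH])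
      also have "Y.eqv (lp (cst Vs) + 1 *\<^sub>R lp E) (lp 0 + 1 *\<^sub>R lp E)"
        using Y.eqv_add[OF lV Y.eqv_refl[OF lp_SY[OF EH]]] by simp
      also have "Y.eqv (lp 0 + 1 *\<^sub>R lp E) (lp (0 + 1 *\<^sub>R E))" by (rule Y.eqv_sym[OF lp_eqv[OF mu0 Hk_zero EH]])
      finally show ?thesis by (simp only: scaleR_one add_0_left)
    qed
    have nE: "(nY \<mu> (lp E))\<^sup>2 \<le> B2"
    proof -
      have n0: "0 \<le> nY \<mu> (lp E)" using Y.nrm_ge0[OF lp_SY[OF EH]] unfolding nY .
      have "nY \<mu> (lp E) \<le> sqrt (real (card JJ) * wt \<mu>) * exp (\<mu> * gxi G) * (Cp * hk_norm G 2 E)"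
        by (rule nY_lp_le[OF mu0 EH])
      also have "\<dots> \<le> sqrt (real (card JJ) * wt \<mu>) * exp (\<mu> * gxi G) * (Cp * (sK * \<delta>))"
        using En Cp_nonneg wt_pos[of \<mu>] by (intro mult_left_mono) auto
      finally have "(nY \<mu> (lp E))\<^sup>2 \<le> (sqrt (real (card JJ) * wt \<mu>) * exp (\<mu> * gxi G) * (Cp * (sK * \<delta>)))\<^sup>2"
        using n0 by (intro power_mono)
      also have "\<dots> = real (card JJ) * wt \<mu> * (exp (\<mu> * gxi G))\<^sup>2 * (Cp * (sK * \<delta>))\<^sup>2"
        using wt_pos[of \<mu>] by (simp add: power_mult_distrib)
      also have "wt \<mu> * (exp (\<mu> * gxi G))\<^sup>2 = (gh G)\<^sup>2 * (1 / \<delta>)"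
        unfolding wt_def ex[symmetric] by (simp add: algebra_simps power2_eq_square flip: exp_add)
      then have "real (card JJ) * wt \<mu> * (exp (\<mu> * gxi G))\<^sup>2 * (Cp * (sK * \<delta>))\<^sup>2 = real (card JJ) * ((gh G)\<^sup>2 * (1 / \<delta>)) * (Cp * (sK * \<delta>))\<^sup>2"
        by (simp only: mult.assoc)
      also have "\<dots> = B2 * \<delta>" unfolding B2_def using \<delta> by (simp add: power_mult_distrib power2_eq_square)
      also have "\<dots> \<le> B2" using B2 \<delta>1 \<delta> by (simp add: mult_left_le)
      finally show ?thesis .
    qed
    have n': "nY \<mu> (lp (cst W') + lp (cst Q)) \<le> sqrt B2"
      using nE Y.nrm_eqv[OF yy] unfolding nY by (simp add: real_le_rsqrt)
    have "(nY \<mu> (lp (cst W) + lp (cst Q)))\<^sup>2 \<le> (nY \<mu> (lp (cst W') + lp (cst Q)))\<^sup>2"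
      unfolding nY_lap[OF mu0 Hsd_cst[OF e(1)] Q] nY_lap[OF mu0 Hsd_cst[OF W'H] Q]
      using W(2)[OF W'] kk by (intro mult_left_mono) auto
    also have "\<dots> \<le> B2" using nE Y.nrm_eqv[OF yy] unfolding nY by simp
    finally have n: "nY \<mu> (lp (cst W) + lp (cst Q)) \<le> sqrt B2" by (simp add: real_le_rsqrt)
    have WW: "H0sd G (W - W')" using Z.S_diff[of W W'] W(1) W' by simp
    \<comment> \<open>The Laplacian of W - W' is a difference of two residuals, each of norm at most
      sqrt B2: that of W' by the noise estimate, that of W by minimality. Coercivity turns this into
      an H^2 bound.\<close>
    have d: "lp (cst W) + (-1) *\<^sub>R lp (cst W') = (lp (cst W) + lp (cst Q)) - (lp (cst W') + lp (cst Q))" by simp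
    have "nY \<mu> (lp (cst (W - W'))) = nY \<mu> (lp (cst W) + (-1) *\<^sub>R lp (cst W'))"
      using Y.nrm_eqv[OF lp_eqv[OF mu0 e(1) W'H, of "-1"]] unfolding nY by (simp add: cst_diff)
    moreover have "nY \<mu> ((lp (cst W) + lp (cst Q)) - (lp (cst W') + lp (cst Q))) \<le> sqrt B2 + sqrt B2"
      using Y.nrm_diff[OF Y.S_add[OF S(1,3)] Y.S_add[OF S(2,3)]] n n' unfolding nY by linarith
    ultimately have dB: "nY \<mu> (lp (cst (W - W'))) \<le> sqrt B2 + sqrt B2" unfolding d by (simp only:)
    have "Hk G 2 (cst (W - W'))" using WW Hk_cst by (simp add: H0sd_def)
    from Y.nrm_ge0[OF lp_SY[OF this]] have "(nY \<mu> (lp (cst (W - W'))))\<^sup>2 \<le> (sqrt B2 + sqrt B2)\<^sup>2"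
      unfolding nY by (rule power_mono[OF dB])
    also have "\<dots> = 4 * B2" using B2 by (simp add: power2_eq_square algebra_simps)
    finally have "C * (hk_norm G 2 (cst (W - W')))\<^sup>2 \<le> 4 * B2" using coer[OF mul WW] by simp
    then have "(hk_norm G 2 (cst (W - W')))\<^sup>2 \<le> 4 * B2 / C" using C by (simp add: field_simps)
    then have w1: "hk_norm G 2 (cst (W - W')) \<le> sqrt (4 * B2 / C)" by (rule real_le_rsqrt)
    have VV: "cst (W + Q) = cst (W - W') + (cst Vs + E)" unfolding W'_def E_def cst_diff cst_add by simp
    have WH: "Hk G 2 (cst (W - W'))" using WW Hk_cst by (simp add: H0sd_def)
    have "hk_norm G 2 (cst (W + Q)) \<le> hk_norm G 2 (cst (W - W')) + (hk_norm G 2 (cst Vs) + hk_norm G 2 E)"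
      unfolding VV using X.nrm_add[of "cst (W - W')" "cst Vs + E"] X.nrm_add[of "cst Vs" E] WH e(4) EH Hk_add[OF e(4) EH]
      unfolding X_nrm by simp
    also have "\<dots> \<le> sqrt (4 * B2 / C) + (sK * \<bar>nV\<bar> + sK * 1)"
    proof -
      have "sK * \<delta> \<le> sK * 1" using sK \<delta>1 by (intro mult_left_mono) auto
      moreover have "hk_norm G 2 (cst Vs) \<le> sK * \<bar>nV\<bar>" unfolding hk_norm_cst nV sK_def using kk by (simp add: mult_left_mono)
      ultimately show ?thesis using w1 En by linarith
    qed
    also have "\<dots> = sK * Wb" unfolding Wb_def using sK by (simp add: field_simps)
    finally have "sd_norm G 2 (W + Q) \<le> Wb" unfolding hk_norm_cst sK_def[symmetric] using sK by simp
    moreover have "Hsd G 2 (W + Q)" by (rule Hsd_cst) (unfold cst_add, rule Hk_add[OF e(1,2)])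
    ultimately show ?thesis unfolding V by simp
  qed
  then show ?thesis by blast
qed

section \<open>The objective functional\<close>

text \<open>Stated outside the interpretation of \<open>quadratic_map\<close>, so that it visibly
  depends on lam, the tail bound and the radius only. The absolute value supplies the nonnegative
  bound that \<open>Kq\<close> expects.\<close>

definition LipM :: "real \<Rightarrow> real \<Rightarrow> real \<Rightarrow> real" where
  "LipM lam Wb \<rho> = quadratic_map.lipc (Kq lam \<bar>Wb\<bar>) \<rho>"

lemma is_frechet_iff: "is_frechet G J p g \<longleftrightarrow> X0.has_grad J p g"
  unfolding is_frechet_def X0.has_grad_def X0_nrm by (simp add: hk_add_def plus_fun_def)

lemma cballH_eq: "cballH G R = X0.cb R"
  unfolding cballH_def X0.cb_def X0_nrm by auto

lemma hk_sub_eq: "hk_sub f g = f - g"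
  by (simp add: hk_sub_def fun_diff_def)

text \<open>J is the squared norm of the quadratic map at p + F. Riesz representation in
  \<open>Hk0\<close> turns its derivative into a gradient.\<close>

lemma objective_grad:
  assumes lam: "0 \<le> lam" and V: "Hsd G 2 V" "sd_norm G 2 V \<le> Wb" and F: "Hk G 2 F" "hk_norm G 2 F \<le> Fb" and R: "0 \<le> R"
  defines "J \<equiv> Jfun G lam V F"
  shows "\<And>p. Hk0 G p \<Longrightarrow> X0.has_grad J p (Jder G J p)"
    and "\<And>p. Hk0 G p \<Longrightarrow> 0 \<le> J p"
    and "\<And>p q r. p \<in> X0.cb R \<Longrightarrow> q \<in> X0.cb R \<Longrightarrow> Hk0 G r \<Longrightarrow>
       \<bar>hk_inner G (Jder G J p) r - hk_inner G (Jder G J q) r\<bar> \<le> LipM lam Wb (R + Fb) * hk_norm G 2 (p - q) * hk_norm G 2 r"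
    and "0 \<le> LipM lam Wb (R + Fb)"
proof -
  interpret Q: quadratic_map "{f. Hk G 2 f}" "hk_inner G" SY "ipY lam" "Lc (cst V)" "Ll (cst V)" LB "Kq lam \<bar>Wb\<bar>"
    using V(2) by (intro quadratic_map_L[OF lam V(1)]) simp
  have nY: "Q.Y.nrm = nY lam" by (simp add: fun_eq_iff Q.Y.nrm_def nY_def)
  have Jeq: "J p = (nY lam (Q.L (p + F)))\<^sup>2" if p: "Hk G 2 p" for p
  proof -
    have H: "Hk G 2 (p + F)" using Hk_add[OF p F(1)] .
    have S: "Q.L (p + F) \<in> SY" using Q.L_S[of "p + F"] H by simp
    have e: "Q.L (p + F) j s (\<kappa>, z) = Lop G V (hk_add p F) \<kappa> j s z"
      if "j \<in> {1..<gN G}" "s \<in> {1..<gN G}" "\<kappa> \<in> {kl..ku}" "z \<in> {a..c}" for j s \<kappa> z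
    proof -
      have i: "int_pt j s" using that by (simp add: int_pt_def)
      have x: "(\<kappa>, z) \<in> space M2" using that by (simp add: space_M2)
      show ?thesis using Lop_split[OF H V(1) i x] by (simp add: Q.L_def hk_add_def plus_fun_def)
    qed
    have "J p = exp (2 * lam * c) * (\<Sum>j\<in>{1..<gN G}. \<Sum>s\<in>{1..<gN G}. (gh G)\<^sup>2 *
        (LINT \<kappa>:{kl..ku}|lborel. LINT z:{a..c}|lborel. (cmod (Q.L (p + F) j s (\<kappa>, z)))\<^sup>2 * exp (- 2 * lam * z)))"
      unfolding J_def Jfun_def
      by (intro arg_cong2[where f = "(*)"] sum.cong refl set_lebesgue_integral_cong) (auto simp: e intro!: set_lebesgue_integral_cong)
    then show ?thesis unfolding nY_integral[OF lam S] .
  qed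
  show nonneg: "0 \<le> J p" if "Hk0 G p" for p unfolding Jeq[OF Hk0_Hk[OF that]] by simp
  have g: "\<exists>g. X0.has_grad J p g \<and> (\<forall>r. Hk0 G r \<longrightarrow> hk_inner G g r = Q.dJ (p + F) r)" if p: "Hk0 G p" for p
  proof -
    have x: "p + F \<in> {f. Hk G 2 f}" using Hk_add[OF Hk0_Hk[OF p] F(1)] by simp
    have "\<exists>g\<in>{f. Hk0 G f}. \<forall>r\<in>{f. Hk0 G f}. hk_inner G g r = Q.dJ (p + F) r"
    proof (rule X0.riesz)
      show "Q.dJ (p + F) (r + s) = Q.dJ (p + F) r + Q.dJ (p + F) s" if "r \<in> {f. Hk0 G f}" "s \<in> {f. Hk0 G f}" for r s
        using Q.dJ_add[OF x, of r s] that Hk0_Hk by simp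
      show "Q.dJ (p + F) (t *\<^sub>R r) = t * Q.dJ (p + F) r" if "r \<in> {f. Hk0 G f}" for t r
        using Q.dJ_scale[OF x, of r t] that Hk0_Hk by simp
      show "\<bar>Q.dJ (p + F) r\<bar> \<le> (2 * Q.Y.nrm (Q.L (p + F)) * (Kq lam \<bar>Wb\<bar> * (1 + 2 * X.nrm (p + F)))) * X0.nrm r"
        if "r \<in> {f. Hk0 G f}" for r
        using Q.dJ_bd[OF x, of r] that Hk0_Hk unfolding X0_nrm X_nrm by simp
    qed
    then obtain g where gH: "Hk0 G g" and gr: "\<And>r. Hk0 G r \<Longrightarrow> hk_inner G g r = Q.dJ (p + F) r" by auto
    \<comment> \<open>The coefficient of the quadratic remainder in \<open>Q.expansion\<close>. The
      radius min 1 (\<epsilon> / (Cx + 1)) respects the restriction to norm at most 1 there and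
      keeps the remainder below \<epsilon> times the norm.\<close>
    define Cx where "Cx = 2 * Q.Y.nrm (Q.L (p + F)) * Kq lam \<bar>Wb\<bar> + (Kq lam \<bar>Wb\<bar> * (1 + 2 * X.nrm (p + F)) + Kq lam \<bar>Wb\<bar>)\<^sup>2"
    have Cx: "0 \<le> Cx" unfolding Cx_def using Q.K0 Q.Y.nrm_ge0[OF Q.L_S[OF x]] by simp
    have "X0.has_grad J p g"
      unfolding X0.has_grad_def
    proof (intro conjI allI impI)
      show "g \<in> {f. Hk0 G f}" using gH by simp
      fix \<epsilon> :: real assume \<epsilon>: "0 < \<epsilon>"
      show "\<exists>\<eta>>0. \<forall>r. r \<in> {f. Hk0 G f} \<and> X0.nrm r < \<eta> \<longrightarrow> \<bar>J (p + r) - J p - hk_inner G g r\<bar> \<le> \<epsilon> * X0.nrm r"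
      proof (intro exI[of _ "min 1 (\<epsilon> / (Cx + 1))"] conjI allI impI)
        show "0 < min 1 (\<epsilon> / (Cx + 1))" using \<epsilon> Cx by simp
        fix r assume r': "r \<in> {f. Hk0 G f} \<and> X0.nrm r < min 1 (\<epsilon> / (Cx + 1))"
        then have r: "Hk0 G r" and n1: "hk_norm G 2 r \<le> 1" and n2: "hk_norm G 2 r \<le> \<epsilon> / (Cx + 1)" unfolding X0_nrm by auto
        have n0: "0 \<le> hk_norm G 2 r" using hk_nonneg[OF Hk0_Hk[OF r]] .
        have rX: "r \<in> {f. Hk G 2 f}" using Hk0_Hk[OF r] by simp
        have "J (p + r) = (nY lam (Q.L ((p + F) + r)))\<^sup>2"
          using Jeq[OF Hk_add[OF Hk0_Hk[OF p] Hk0_Hk[OF r]]] by (simp add: add_ac)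
        then have "\<bar>J (p + r) - J p - hk_inner G g r\<bar> \<le> Cx * (hk_norm G 2 r)\<^sup>2"
          using Q.expansion[OF x rX] n1 unfolding Jeq[OF Hk0_Hk[OF p]] gr[OF r] Cx_def nY X_nrm by simp
        also have "\<dots> = (Cx * hk_norm G 2 r) * hk_norm G 2 r" by (simp add: power2_eq_square)
        also have "\<dots> \<le> \<epsilon> * hk_norm G 2 r"
        proof (rule mult_right_mono[OF _ n0])
          have "Cx * hk_norm G 2 r \<le> Cx * (\<epsilon> / (Cx + 1))" using n2 Cx by (rule mult_left_mono)
          also have "\<dots> \<le> \<epsilon>" using Cx \<epsilon> by (simp add: field_simps)
          finally show "Cx * hk_norm G 2 r \<le> \<epsilon>" .
        qed
        finally show "\<bar>J (p + r) - J p - hk_inner G g r\<bar> \<le> \<epsilon> * X0.nrm r" unfolding X0_nrm .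
      qed
    qed
    then show ?thesis using gr by blast
  qed
  show grad: "X0.has_grad J p (Jder G J p)" if p: "Hk0 G p" for p
    using someI_ex[of "is_frechet G J p"] g[OF p] unfolding Jder_def is_frechet_iff by blast
  \<comment> \<open>\<open>Jder\<close> need not be the gradient constructed above, but all
    gradients have the same pairings.\<close>
  have dJ: "hk_inner G (Jder G J p) r = Q.dJ (p + F) r" if p: "Hk0 G p" and r: "Hk0 G r" for p r
    using g[OF p] X0.has_grad_unique[OF grad[OF p], of _ r] r by auto
  have Fb: "0 \<le> Fb" using hk_nonneg[OF F(1)] F(2) by simp
  have lip: "LipM lam Wb (R + Fb) = Q.lipc (R + Fb)" unfolding LipM_def ..
  show "0 \<le> LipM lam Wb (R + Fb)" unfolding lip Q.lipc_def Q.a0_def using Q.K0 R Fb by simp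
  fix p q r assume p: "p \<in> X0.cb R" and q: "q \<in> X0.cb R" and r: "Hk0 G r"
  \<comment> \<open>The shift by F enlarges the ball on which the Lipschitz bound is taken to radius
    R + Fb.\<close>
  have x: "u + F \<in> {f. Hk G 2 f} \<and> X.nrm (u + F) \<le> R + Fb" if "u \<in> X0.cb R" for u
    using that X.nrm_add[of u F] F Hk_add[of 2 u F] Hk0_Hk[of u] unfolding X0.cb_def X0_nrm X_nrm by auto
  have H: "Hk0 G p" "Hk0 G q" using p q unfolding X0.cb_def by auto
  show "\<bar>hk_inner G (Jder G J p) r - hk_inner G (Jder G J q) r\<bar> \<le> LipM lam Wb (R + Fb) * hk_norm G 2 (p - q) * hk_norm G 2 r"
    using Q.dJ_lipschitz[of "p + F" "R + Fb" "q + F" r] x[OF p] x[OF q] Hk0_Hk[OF r] unfolding dJ[OF H(1) r] dJ[OF H(2) r] lip X_nrm by simp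
qed

lemma objective_minimizer:
  assumes R: "0 < R" and C1: "0 < C1" and grad: "\<And>p. Hk0 G p \<Longrightarrow> X0.has_grad J p (Jder G J p)"
    and nonneg: "\<And>p. Hk0 G p \<Longrightarrow> 0 \<le> J p"
    and conv: "\<forall>p\<in>cballH G R. \<forall>q\<in>cballH G R.
            J q - J p - hk_inner G (Jder G J p) (hk_sub q p) \<ge> C1 * (hk_norm G 2 (hk_sub q p))\<^sup>2"
  shows "\<exists>pm\<in>cballH G R.
               (\<forall>y\<in>cballH G R. J pm \<le> J y) \<and>
               (\<forall>q\<in>cballH G R. (\<forall>y\<in>cballH G R. J q \<le> J y) \<longrightarrow> hk_norm G 2 (hk_sub q pm) = 0) \<and>
               (\<forall>y\<in>cballH G R. hk_inner G (Jder G J pm) (hk_sub y pm) \<ge> 0)"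
proof -
  have cv: "J q - J p - hk_inner G (Jder G J p) (q - p) \<ge> C1 * (X0.nrm (q - p))\<^sup>2" if "p \<in> X0.cb R" "q \<in> X0.cb R" for p q
    using conv that unfolding cballH_eq hk_sub_eq X0_nrm by blast
  have gd: "X0.has_grad J p (Jder G J p)" if "p \<in> X0.cb R" for p using grad that unfolding X0.cb_def by simp
  have DS: "Jder G J p \<in> {f. Hk0 G f}" if "p \<in> X0.cb R" for p using gd[OF that] unfolding X0.has_grad_def by simp
  obtain pm where pm: "pm \<in> X0.cb R" "\<And>y. y \<in> X0.cb R \<Longrightarrow> J pm \<le> J y"
    using X0.strongly_convex_minimizer[where D = "Jder G J" and J = J and R = R and c = C1] R C1 gd cv nonneg
    unfolding X0.cb_def by auto
  show ?thesis
    unfolding cballH_eq hk_sub_eq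
  proof (intro bexI[OF _ pm(1)] conjI ballI impI)
    show "J pm \<le> J y" if "y \<in> X0.cb R" for y using pm(2)[OF that] .
    show "hk_norm G 2 (q - pm) = 0" if q: "q \<in> X0.cb R" "\<forall>y\<in>X0.cb R. J q \<le> J y" for q
      using X0.strongly_convex_unique[where D = "Jder G J" and J = J and R = R and c = C1, OF C1 DS cv q(1) _ pm] q(2) unfolding X0_nrm by blast
    show "0 \<le> hk_inner G (Jder G J pm) (y - pm)" if "y \<in> X0.cb R" for y
      using X0.variational_inequality[OF pm gd[OF pm(1)] that] .
  qed
qed

text \<open>Here pm is an arbitrary minimizer; the variational inequality, derived from minimality,
  is what makes it a fixed point of the projected step.\<close>

lemma objective_descent:
  assumes R: "0 < R" and C1: "0 < C1" and grad: "\<And>p. Hk0 G p \<Longrightarrow> X0.has_grad J p (Jder G J p)"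
    and conv: "\<forall>p\<in>cballH G R. \<forall>q\<in>cballH G R.
            J q - J p - hk_inner G (Jder G J p) (hk_sub q p) \<ge> C1 * (hk_norm G 2 (hk_sub q p))\<^sup>2"
    and lip: "\<And>p q r. p \<in> X0.cb R \<Longrightarrow> q \<in> X0.cb R \<Longrightarrow> Hk0 G r \<Longrightarrow>
       \<bar>hk_inner G (Jder G J p) r - hk_inner G (Jder G J q) r\<bar> \<le> M * hk_norm G 2 (p - q) * hk_norm G 2 r"
    and M: "0 \<le> M" and \<gamma>: "0 < \<gamma>" and \<theta>: "0 \<le> \<theta>" "1 - 4 * \<gamma> * C1 + \<gamma>\<^sup>2 * M\<^sup>2 \<le> \<theta>\<^sup>2"
    and pm: "pm \<in> cballH G R" "\<forall>y\<in>cballH G R. J pm \<le> J y" and p0: "p0 \<in> ballH G R"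
  shows "hk_norm G 2 (hk_sub pm (gd_iter G R J \<gamma> p0 n)) \<le> \<theta> ^ n * hk_norm G 2 (hk_sub pm p0)"
proof -
  have cv: "J q - J p - hk_inner G (Jder G J p) (q - p) \<ge> C1 * (X0.nrm (q - p))\<^sup>2" if "p \<in> X0.cb R" "q \<in> X0.cb R" for p q
    using conv that unfolding cballH_eq hk_sub_eq X0_nrm by blast
  have gd: "X0.has_grad J p (Jder G J p)" if "p \<in> X0.cb R" for p using grad that unfolding X0.cb_def by simp
  have DS: "Jder G J p \<in> {f. Hk0 G f}" if "p \<in> X0.cb R" for p using gd[OF that] unfolding X0.has_grad_def by simp
  have pm': "pm \<in> X0.cb R" "\<And>y. y \<in> X0.cb R \<Longrightarrow> J pm \<le> J y" using pm unfolding cballH_eq by auto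
  have var: "0 \<le> hk_inner G (Jder G J pm) (y - pm)" if "y \<in> X0.cb R" for y
    using X0.variational_inequality[OF pm' gd[OF pm'(1)] that] .
  have p0': "p0 \<in> X0.cb R" using p0 unfolding ballH_def X0.cb_def X0_nrm by auto
  \<comment> \<open>\<open>projB\<close> is a choice as well; once a nearest point exists, the
    chosen one satisfies \<open>X0.is_proj\<close>.\<close>
  define T where "T p = projB G R (p - \<gamma> *\<^sub>R Jder G J p)" for p
  have Tp: "X0.is_proj R (p - \<gamma> *\<^sub>R Jder G J p) (T p)" if p: "p \<in> X0.cb R" for p
  proof -
    have "p - \<gamma> *\<^sub>R Jder G J p \<in> {f. Hk0 G f}" using p DS[OF p] unfolding X0.cb_def by (intro X0.S_diff X0.S_scale) auto
    then have "\<exists>g. X0.is_proj R (p - \<gamma> *\<^sub>R Jder G J p) g" using R by (intro X0.exists_proj) auto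
    then show ?thesis
      unfolding T_def projB_def cballH_eq hk_sub_eq X0.is_proj_def X0_nrm by (rule someI_ex)
  qed
  have lip': "\<bar>hk_inner G (Jder G J p) r - hk_inner G (Jder G J q) r\<bar> \<le> M * X0.nrm (p - q) * X0.nrm r"
    if "p \<in> X0.cb R" "q \<in> X0.cb R" "r \<in> {f. Hk0 G f}" for p q r
    using lip that unfolding X0_nrm by simp
  have it: "gd_iter G R J \<gamma> p0 n = (T ^^ n) p0"
    unfolding gd_iter_def T_def by (simp add: fun_diff_def scaleR_fun_def scaleR_conv_of_real)
  show ?thesis
    using X0.projected_gradient_iterates[where D = "Jder G J" and J = J and M = M and T = T and R = R and c = C1, OF C1 DS cv lip' var pm'(1) p0' Tp \<gamma> M \<theta>]
    unfolding it hk_sub_eq X0_nrm by blast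
qed

end

text \<open>For \<gamma> (M^2 + 1) \<le> 2 C1 the quadratic term consumes at most half of the
  decrease 4 \<gamma> C1, leaving 1 - 2 \<gamma> C1. The maximum with 1/2 keeps the square root
  positive, and M^2 + 1 avoids division by zero.\<close>

lemma projected_gradient_rate:
  fixes C1 M :: real
  assumes C1: "0 < C1" and M: "0 \<le> M" and \<gamma>: "0 < \<gamma>" "\<gamma> < min (1/2) (2 * C1 / (M\<^sup>2 + 1))"
  shows "\<exists>\<theta>. 0 < \<theta> \<and> \<theta> < 1 \<and> 1 - 4 * \<gamma> * C1 + \<gamma>\<^sup>2 * M\<^sup>2 \<le> \<theta>\<^sup>2"
proof (intro exI conjI)
  let ?t = "max (1/2) (1 - 2 * \<gamma> * C1)"
  have g: "\<gamma> * (M\<^sup>2 + 1) \<le> 2 * C1" using \<gamma>(2) by (simp add: pos_less_divide_eq add_nonneg_pos)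
  have "\<gamma>\<^sup>2 * M\<^sup>2 \<le> \<gamma> * (\<gamma> * (M\<^sup>2 + 1))" using \<gamma>(1) by (simp add: power2_eq_square algebra_simps)
  also have "\<dots> \<le> \<gamma> * (2 * C1)" using g \<gamma>(1) by (intro mult_left_mono) auto
  finally have "1 - 4 * \<gamma> * C1 + \<gamma>\<^sup>2 * M\<^sup>2 \<le> 1 - 2 * \<gamma> * C1" by (simp add: algebra_simps)
  also have "\<dots> \<le> (sqrt ?t)\<^sup>2" by simp
  finally show "1 - 4 * \<gamma> * C1 + \<gamma>\<^sup>2 * M\<^sup>2 \<le> (sqrt ?t)\<^sup>2" .
  show "0 < sqrt ?t" by simp
  have "0 < C1 * \<gamma>" using \<gamma>(1) C1 by simp
  then show "sqrt ?t < 1" by simp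
qed

text \<open>Placing \<theta> and \<open>gamz\<close> before the data D expresses that they depend on
  the listed parameters only. Uniqueness reads as norm zero of the difference because functions are
  not identified up to null sets.\<close>

theorem theorem7p5:
  fixes G :: geom and R lamz lamo dz0 dz1 lam nF nV :: real
  assumes geom: "geom_ok G"
    and lam0: "carleman G lamz"
    and delta0: "0 < dz0" "dz0 < exp (- 2 * (gd G + gxi G) * lamz)"
    and lam1_ge: "lamz \<le> lamo"
    and delta1: "0 < dz1" "dz1 < exp (- 2 * (gd G + gxi G) * lamo)"
    and R: "0 < R"
    and lam1_convex: "\<exists>C1>0. \<forall>lam'\<ge>lamo. \<forall>D. admissible G dz0 dz1 nF nV D \<longrightarrow>
         (\<forall>p\<in>cballH G R. \<forall>q\<in>cballH G R.
            Jd G lam' D q - Jd G lam' D p - hk_inner G (Jder G (Jd G lam' D) p) (hk_sub q p)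
              \<ge> C1 * (hk_norm G 2 (hk_sub q p))\<^sup>2)"
    and lam: "lamo \<le> lam"
  shows "(\<forall>D. admissible G dz0 dz1 nF nV D \<longrightarrow>
            (\<exists>pm\<in>cballH G R.
               (\<forall>y\<in>cballH G R. Jd G lam D pm \<le> Jd G lam D y) \<and>
               (\<forall>q\<in>cballH G R. (\<forall>y\<in>cballH G R. Jd G lam D q \<le> Jd G lam D y) \<longrightarrow>
                   hk_norm G 2 (hk_sub q pm) = 0) \<and>
               (\<forall>y\<in>cballH G R. hk_inner G (Jder G (Jd G lam D) pm) (hk_sub y pm) \<ge> 0)))
       \<and> (\<exists>gamz. 0 < gamz \<and> gamz < 1 \<and>
            (\<forall>\<gamma>. 0 < \<gamma> \<and> \<gamma> < gamz \<longrightarrow>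
              (\<exists>\<theta>. 0 < \<theta> \<and> \<theta> < 1 \<and>
                (\<forall>D. admissible G dz0 dz1 nF nV D \<longrightarrow>
                  (\<forall>pm\<in>cballH G R. (\<forall>y\<in>cballH G R. Jd G lam D pm \<le> Jd G lam D y) \<longrightarrow>
                    (\<forall>p0\<in>ballH G R. \<forall>n\<ge>1.
                       hk_norm G 2 (hk_sub pm (gd_iter G R (Jd G lam D) \<gamma> p0 n))
                         \<le> \<theta> ^ n * hk_norm G 2 (hk_sub pm p0)))))))"
proof -
  interpret geo: geometry G using geom by unfold_locales
  have lam_pos: "0 \<le> lam" using lam0 lam1_ge lam unfolding carleman_def by linarith
  obtain C1 where C1: "0 < C1" and conv: "\<And>D. admissible G dz0 dz1 nF nV D \<Longrightarrow>
      \<forall>p\<in>cballH G R. \<forall>q\<in>cballH G R.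
            Jd G lam D q - Jd G lam D p - hk_inner G (Jder G (Jd G lam D) p) (hk_sub q p)
              \<ge> C1 * (hk_norm G 2 (hk_sub q p))\<^sup>2"
    using lam1_convex lam by blast
  obtain Wb where Wb: "\<And>D. admissible G dz0 dz1 nF nV D \<Longrightarrow>
      Hsd G 2 (Vmu G (d_Q D) (d_delta D)) \<and> sd_norm G 2 (Vmu G (d_Q D) (d_delta D)) \<le> Wb"
    using geo.tail_bound[OF lam0 delta0(2)] by blast
  \<comment> \<open>F differs from Fs by less than \<delta> < 1 in the H^3 norm, and the H^2 norm is
    dominated by the H^3 norm.\<close>
  define Fb where "Fb = \<bar>nF\<bar> + 1"
  have "1 < lamz" using lam0 unfolding carleman_def by simp
  then have "0 < (gd G + gxi G) * lamz" using geo.ac by simp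
  then have "exp (- 2 * (gd G + gxi G) * lamz) < 1" by (simp add: algebra_simps)
  then have dz0_1: "dz0 < 1" using delta0(2) by linarith
  have Fb: "Hk G 2 (d_F D) \<and> hk_norm G 2 (d_F D) \<le> Fb" if adm: "admissible G dz0 dz1 nF nV D" for D
  proof -
    have F: "Hk G 3 (d_F D)" "Hk G 3 (d_Fs D)" "hk_norm G 3 (d_F D - d_Fs D) < 1" "hk_norm G 3 (d_Fs D) = nF"
      using adm dz0_1 unfolding admissible_def geo.hk_sub_eq by auto
    have "hk_norm G 2 (d_F D) \<le> hk_norm G 3 (d_F D)" using geo.hk_norm_mono[OF F(1)] by simp
    also have "\<dots> \<le> hk_norm G 3 (d_F D - d_Fs D) + hk_norm G 3 (d_Fs D)" by (rule geo.hk_norm_triangle[OF F(1,2)])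
    finally have "hk_norm G 2 (d_F D) \<le> Fb" using F(3,4) unfolding Fb_def by linarith
    then show ?thesis using geo.Hk_mono[OF F(1)] by simp
  qed
  define M where "M = geo.LipM lam Wb (R + Fb)"
  have grad: "\<And>p. Hk0 G p \<Longrightarrow> geo.X0.has_grad (Jd G lam D) p (Jder G (Jd G lam D) p)"
    and nonneg: "\<And>p. Hk0 G p \<Longrightarrow> 0 \<le> Jd G lam D p"
    and lip: "\<And>p q r. p \<in> geo.X0.cb R \<Longrightarrow> q \<in> geo.X0.cb R \<Longrightarrow> Hk0 G r \<Longrightarrow>
       \<bar>hk_inner G (Jder G (Jd G lam D) p) r - hk_inner G (Jder G (Jd G lam D) q) r\<bar> \<le> M * hk_norm G 2 (p - q) * hk_norm G 2 r"
    and M: "0 \<le> M" if adm: "admissible G dz0 dz1 nF nV D" for D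
  proof -
    have "Jd G lam D = Jfun G lam (Vmu G (d_Q D) (d_delta D)) (d_F D)" by (simp add: Jd_def fun_eq_iff)
    then show "\<And>p. Hk0 G p \<Longrightarrow> geo.X0.has_grad (Jd G lam D) p (Jder G (Jd G lam D) p)"
      "\<And>p. Hk0 G p \<Longrightarrow> 0 \<le> Jd G lam D p"
      "\<And>p q r. p \<in> geo.X0.cb R \<Longrightarrow> q \<in> geo.X0.cb R \<Longrightarrow> Hk0 G r \<Longrightarrow>
       \<bar>hk_inner G (Jder G (Jd G lam D) p) r - hk_inner G (Jder G (Jd G lam D) q) r\<bar> \<le> M * hk_norm G 2 (p - q) * hk_norm G 2 r"
      "0 \<le> M"
      using geo.objective_grad[OF lam_pos conjunct1[OF Wb[OF adm]] conjunct2[OF Wb[OF adm]] conjunct1[OF Fb[OF adm]] conjunct2[OF Fb[OF adm]] less_imp_le[OF R]]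
      unfolding M_def by metis+
  qed
  define gamz where "gamz = min (1/2) (2 * C1 / (M\<^sup>2 + 1))"
  show ?thesis
  proof (rule conjI)
    show "\<forall>D. admissible G dz0 dz1 nF nV D \<longrightarrow>
            (\<exists>pm\<in>cballH G R.
               (\<forall>y\<in>cballH G R. Jd G lam D pm \<le> Jd G lam D y) \<and>
               (\<forall>q\<in>cballH G R. (\<forall>y\<in>cballH G R. Jd G lam D q \<le> Jd G lam D y) \<longrightarrow>
                   hk_norm G 2 (hk_sub q pm) = 0) \<and>
               (\<forall>y\<in>cballH G R. hk_inner G (Jder G (Jd G lam D) pm) (hk_sub y pm) \<ge> 0))"
      using geo.objective_minimizer[OF R C1 grad nonneg conv] by blast
  next
    have g0: "0 < gamz" unfolding gamz_def using C1 by (simp add: add_nonneg_pos)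
    have g1: "gamz < 1" unfolding gamz_def by simp
    have rate: "\<exists>\<theta>. 0 < \<theta> \<and> \<theta> < 1 \<and>
                (\<forall>D. admissible G dz0 dz1 nF nV D \<longrightarrow>
                  (\<forall>pm\<in>cballH G R. (\<forall>y\<in>cballH G R. Jd G lam D pm \<le> Jd G lam D y) \<longrightarrow>
                    (\<forall>p0\<in>ballH G R. \<forall>n\<ge>1.
                       hk_norm G 2 (hk_sub pm (gd_iter G R (Jd G lam D) \<gamma> p0 n))
                         \<le> \<theta> ^ n * hk_norm G 2 (hk_sub pm p0))))"
      if \<gamma>: "0 < \<gamma> \<and> \<gamma> < gamz" for \<gamma>
    proof (cases "\<exists>D. admissible G dz0 dz1 nF nV D")
      case True
      \<comment> \<open>The facts about M are stated for admissible data, so one such D0 is used to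
        obtain 0 \<le> M; the resulting \<theta> depends only on C1, M and \<gamma>.\<close>
      then obtain D0 where "admissible G dz0 dz1 nF nV D0" ..
      from M[OF this] obtain \<theta> where \<theta>: "0 < \<theta>" "\<theta> < 1" "1 - 4 * \<gamma> * C1 + \<gamma>\<^sup>2 * M\<^sup>2 \<le> \<theta>\<^sup>2"
        using projected_gradient_rate[OF C1, of M \<gamma>] \<gamma> unfolding gamz_def by blast
      show ?thesis
      proof (intro exI[of _ \<theta>] conjI \<theta> allI impI ballI)
        fix D pm p0 and n :: nat
        assume adm: "admissible G dz0 dz1 nF nV D" and pm: "pm \<in> cballH G R" "\<forall>y\<in>cballH G R. Jd G lam D pm \<le> Jd G lam D y"
          and p0: "p0 \<in> ballH G R"
        show "hk_norm G 2 (hk_sub pm (gd_iter G R (Jd G lam D) \<gamma> p0 n)) \<le> \<theta> ^ n * hk_norm G 2 (hk_sub pm p0)"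
          using geo.objective_descent[OF R C1 grad[OF adm] conv[OF adm] lip[OF adm] M[OF adm] _ less_imp_le[OF \<theta>(1)] \<theta>(3) pm p0] \<gamma> by blast
      qed
    next
      case False
      then show ?thesis by (intro exI[of _ "1/2"]) simp
    qed
    then show "\<exists>gamz. 0 < gamz \<and> gamz < 1 \<and>
            (\<forall>\<gamma>. 0 < \<gamma> \<and> \<gamma> < gamz \<longrightarrow>
              (\<exists>\<theta>. 0 < \<theta> \<and> \<theta> < 1 \<and>
                (\<forall>D. admissible G dz0 dz1 nF nV D \<longrightarrow>
                  (\<forall>pm\<in>cballH G R. (\<forall>y\<in>cballH G R. Jd G lam D pm \<le> Jd G lam D y) \<longrightarrow>
                    (\<forall>p0\<in>ballH G R. \<forall>n\<ge>1.
                       hk_norm G 2 (hk_sub pm (gd_iter G R (Jd G lam D) \<gamma> p0 n))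
                         \<le> \<theta> ^ n * hk_norm G 2 (hk_sub pm p0))))))"
      using g0 g1 by blast
  qed
qed

end
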